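(* Let $m,n\in\mathbb{N}$, let $\Omega\subset\mathbb{R}^n$ be an open set, and let $X$ be a rearrangement invariant Banach function space whose upper Boyd index satisfies $\beta_X<1$. Let $f,g\colon\Omega\to\mathbb{R}$ be locally Lipschitz mappings such that $f,g\in W^mX_{\mathrm{loc}}(\Omega,\mathbb{R})$. Then $fg\in W^mX_{\mathrm{loc}}(\Omega,\mathbb{R})$ and $fg$ is a locally Lipschitz mapping.
   Context: Rearrangement invariant (r.i.) Banach function spaces (BFS) over sets with Lebesgue measure are understood in the sense of Bennett–Sharpley. $|E|$ denotes the Lebesgue measure of a set $E$, and $|\cdot|$ of a (multi-)linear map is its operator norm. The non-increasing rearrangement of a measurable $u$ is $u^*(s)=\inf\{\lambda: |\{|u|>\lambda\}|\le s\}$. For an r.i. BFS $X(G)$ over an open set $G$, its representation space is the r.i. BFS $\overline{X}(0,|G|)$ with $\|f\|_{X(G)}=\|f^*\|_{\overline{X}(0,|G|)}$ (Luxemburg representation theorem). Dilation operator: for $s>0$ and $f$ measurable on $(0,a)$, $E_sf(x)=f(sx)$ if $sx<a$ and $E_sf(x)=0$ otherwise. Same space on different domains: for open sets $G,G'$ of finite measure, put $\eta=|G'|/|G|$; r.i. BFS $X(G)$ and $Y(G')$ are called similar if $\eta\|f\|_{X(G)}=\|g\|_{Y(G')}$ whenever $E_\eta(g^* )=f^*$. All spaces similar to each other are denoted by the same letter, i.e. $X(G')$ denotes the space over $G'$ similar to $X(G)$; so a single symbol $X$ stands for the whole family. Upper Boyd index: $\beta_X=\lim_{t\to\infty}\dfrac{\log\|E_{1/t}\|_{\overline{X}\to\overline{X}}}{\log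 t}$. Sobolev spaces: $W^kX(G)$ is the set of $k$-times weakly differentiable functions $u$ on $G$ with $\sum_{i=0}^k\|D^iu\|_{X(G)}<\infty$, where $\|D^iu\|_{X(G)}$ is the norm of $|D^iu|$. $W^kX_{\mathrm{loc}}(\Omega)$ is the set of $u$ with $u\in W^kX(G)$ for all open $G\Subset\Omega$ (i.e. the closure of $G$ is a compact subset of $\Omega$). $W^kX_{\mathrm{loc}}(\Omega,\mathbb{R})$ indicates the target. *)

theory Defs
  imports "HOL-Analysis.Analysis"
begin

section \<open>Rearrangement invariant Banach function norms\<close>

text \<open>
  A function norm in the sense of Bennett and Sharpley acts on the cone of measurable functions
  with values in \<open>[0,\<infinity>]\<close>; the function space it generates consists of the measurable \<open>u\<close> for
  which the norm of \<open>\<bar>u\<bar>\<close> is finite. The values of a function norm on non-measurable functions are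
  irrelevant, and so (by axiom P2) are the values of the arguments outside the space of \<open>M\<close>.
\<close>

definition banach_function_norm :: "'a measure \<Rightarrow> (('a \<Rightarrow> ennreal) \<Rightarrow> ennreal) \<Rightarrow> bool" where
  "banach_function_norm M \<rho> \<longleftrightarrow>
     \<comment> \<open>(P1)\<close>
     (\<forall>f\<in>borel_measurable M. \<rho> f = 0 \<longleftrightarrow> (AE x in M. f x = 0)) \<and>
     (\<forall>f\<in>borel_measurable M. \<forall>c::real. c \<ge> 0 \<longrightarrow> \<rho> (\<lambda>x. ennreal c * f x) = ennreal c * \<rho> f) \<and>
     (\<forall>f\<in>borel_measurable M. \<forall>g\<in>borel_measurable M. \<rho> (\<lambda>x. f x + g x) \<le> \<rho> f + \<rho> g) \<and>
     \<comment> \<open>(P2)\<close>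
     (\<forall>f\<in>borel_measurable M. \<forall>g\<in>borel_measurable M.
        (AE x in M. g x \<le> f x) \<longrightarrow> \<rho> g \<le> \<rho> f) \<and>
     \<comment> \<open>(P3); that the norms increase is part of (P2)\<close>
     (\<forall>F f. (\<forall>i::nat. F i \<in> borel_measurable M) \<and> f \<in> borel_measurable M \<and>
        (AE x in M. incseq (\<lambda>i. F i x) \<and> (\<lambda>i. F i x) \<longlonglongrightarrow> f x) \<longrightarrow> (\<lambda>i. \<rho> (F i)) \<longlonglongrightarrow> \<rho> f) \<and>
     \<comment> \<open>(P4)\<close>
     (\<forall>E\<in>sets M. emeasure M E < \<infinity> \<longrightarrow> \<rho> (indicator E) < \<infinity>) \<and>
     \<comment> \<open>(P5)\<close>
     (\<forall>E\<in>sets M. emeasure M E < \<infinity> \<longrightarrow>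
        (\<exists>C::real. C > 0 \<and> (\<forall>f\<in>borel_measurable M. (\<integral>\<^sup>+x\<in>E. f x \<partial>M) \<le> ennreal C * \<rho> f)))"

definition equimeasurable :: "'a measure \<Rightarrow> ('a \<Rightarrow> ennreal) \<Rightarrow> ('a \<Rightarrow> ennreal) \<Rightarrow> bool" where
  "equimeasurable M f g \<longleftrightarrow>
     (\<forall>t. emeasure M {x \<in> space M. f x > t} = emeasure M {x \<in> space M. g x > t})"

definition ri_function_norm :: "'a measure \<Rightarrow> (('a \<Rightarrow> ennreal) \<Rightarrow> ennreal) \<Rightarrow> bool" where
  "ri_function_norm M \<rho> \<longleftrightarrow> banach_function_norm M \<rho> \<and>
     (\<forall>f\<in>borel_measurable M. \<forall>g\<in>borel_measurable M.
        (AE x in M. f x < \<infinity>) \<and> (AE x in M. g x < \<infinity>) \<and> equimeasurable M f g \<longrightarrow> \<rho> f = \<rho> g)"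

definition rearrangement :: "'a measure \<Rightarrow> ('a \<Rightarrow> ennreal) \<Rightarrow> real \<Rightarrow> ennreal" where
  "rearrangement M u s = Inf {t. emeasure M {x \<in> space M. u x > t} \<le> ennreal s}"

definition dilation :: "real \<Rightarrow> real \<Rightarrow> (real \<Rightarrow> 'b::zero) \<Rightarrow> real \<Rightarrow> 'b" where
  "dilation a s f x = (if s * x < a then f (s * x) else 0)"

text \<open>\<open>\<rho>'\<close> is the norm of the representation space, over \<open>(0,\<bar>G\<bar>)\<close>, of the space over \<open>G\<close> with
  norm \<open>\<rho>\<close>; only sets of finite measure occur.\<close>

definition representation_norm ::
    "'a::euclidean_space set \<Rightarrow> (('a \<Rightarrow> ennreal) \<Rightarrow> ennreal) \<Rightarrow> ((real \<Rightarrow> ennreal) \<Rightarrow> ennreal) \<Rightarrow> bool" where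
  "representation_norm G \<rho> \<rho>' \<longleftrightarrow>
     ri_function_norm (lebesgue_on {0<..<measure lebesgue G}) \<rho>' \<and>
     (\<forall>f\<in>borel_measurable (lebesgue_on G). \<rho> f = \<rho>' (rearrangement (lebesgue_on G) f))"

definition similar_norms ::
    "'a::euclidean_space set \<Rightarrow> (('a \<Rightarrow> ennreal) \<Rightarrow> ennreal) \<Rightarrow>
     'b::euclidean_space set \<Rightarrow> (('b \<Rightarrow> ennreal) \<Rightarrow> ennreal) \<Rightarrow> bool" where
  "similar_norms G \<rho> G' \<rho>' \<longleftrightarrow>
     (let \<eta> = measure lebesgue G' / measure lebesgue G in
      \<forall>f\<in>borel_measurable (lebesgue_on G). \<forall>g\<in>borel_measurable (lebesgue_on G').
        (\<forall>x\<in>{0<..<measure lebesgue G}.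
           dilation (measure lebesgue G') \<eta> (rearrangement (lebesgue_on G') g) x
             = rearrangement (lebesgue_on G) f x) \<longrightarrow>
        ennreal \<eta> * \<rho> f = \<rho>' g)"

text \<open>The family denoted by a single letter \<open>X\<close>: one space over every open set of finite measure,
  any two of them being similar. Over the empty set all norms vanish by (P1).\<close>

definition ri_family :: "('a::euclidean_space set \<Rightarrow> ('a \<Rightarrow> ennreal) \<Rightarrow> ennreal) \<Rightarrow> bool" where
  "ri_family X \<longleftrightarrow>
     (\<forall>G. open G \<and> emeasure lebesgue G < \<infinity> \<longrightarrow> ri_function_norm (lebesgue_on G) (X G)) \<and>
     (\<forall>G G'. open G \<and> G \<noteq> {} \<and> emeasure lebesgue G < \<infinity> \<and>
             open G' \<and> G' \<noteq> {} \<and> emeasure lebesgue G' < \<infinity> \<longrightarrow>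
             similar_norms G (X G) G' (X G'))"

definition operator_norm ::
    "'a measure \<Rightarrow> (('a \<Rightarrow> ennreal) \<Rightarrow> ennreal) \<Rightarrow> (('a \<Rightarrow> real) \<Rightarrow> 'a \<Rightarrow> real) \<Rightarrow> ennreal" where
  "operator_norm M \<rho> T =
     (SUP u\<in>{u \<in> borel_measurable M. \<rho> (\<lambda>x. ennreal \<bar>u x\<bar>) \<le> 1}. \<rho> (\<lambda>x. ennreal \<bar>T u x\<bar>))"

text \<open>Upper Boyd index of the norm \<open>\<rho>\<close> over \<open>(0,a)\<close>. For an r.i. norm the operator norms below are
  positive and finite, and the limit exists.\<close>

definition upper_boyd_index :: "real \<Rightarrow> ((real \<Rightarrow> ennreal) \<Rightarrow> ennreal) \<Rightarrow> real" where
  "upper_boyd_index a \<rho> =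
     Lim at_top (\<lambda>t. ln (enn2real (operator_norm (lebesgue_on {0<..<a}) \<rho> (dilation a (1 / t)))) / ln t)"


section \<open>Weak derivatives and Sobolev spaces\<close>

text \<open>\<open>D\<^sup>i\<phi>(x)[h\<^sub>1,\<dots>,h\<^sub>i]\<close> as an iterated directional derivative.\<close>

primrec iterated_deriv ::
    "'a::real_normed_vector list \<Rightarrow> ('a \<Rightarrow> real) \<Rightarrow> 'a \<Rightarrow> real" where
  "iterated_deriv [] \<phi> = \<phi>"
| "iterated_deriv (h # hs) \<phi> = (\<lambda>x. frechet_derivative (iterated_deriv hs \<phi>) (at x) h)"

definition test_function :: "'a::euclidean_space set \<Rightarrow> ('a \<Rightarrow> real) \<Rightarrow> bool" where
  "test_function G \<phi> \<longleftrightarrow>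
     (\<forall>hs x. iterated_deriv hs \<phi> differentiable (at x)) \<and>
     compact (closure {x. \<phi> x \<noteq> 0}) \<and> closure {x. \<phi> x \<noteq> 0} \<subseteq> G"

definition locally_integrable_on :: "('a::euclidean_space \<Rightarrow> real) \<Rightarrow> 'a set \<Rightarrow> bool" where
  "locally_integrable_on u G \<longleftrightarrow> (\<forall>K. compact K \<and> K \<subseteq> G \<longrightarrow> u absolutely_integrable_on K)"

text \<open>An \<open>i\<close>-linear form on \<open>'a\<close> is a function on lists of vectors, evaluated only at lists of
  length \<open>i\<close>.\<close>

definition multilinear_form :: "nat \<Rightarrow> ('a::real_vector list \<Rightarrow> real) \<Rightarrow> bool" where
  "multilinear_form i T \<longleftrightarrow> (\<forall>hs j. length hs = i \<and> j < i \<longrightarrow> linear (\<lambda>h. T (hs[j := h])))"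

definition multilinear_norm :: "nat \<Rightarrow> ('a::real_normed_vector list \<Rightarrow> real) \<Rightarrow> ennreal" where
  "multilinear_norm i T =
     (SUP hs\<in>{hs. length hs = i \<and> (\<forall>h\<in>set hs. norm h \<le> 1)}. ennreal \<bar>T hs\<bar>)"

text \<open>\<open>V\<close> is an \<open>i\<close>-th order weak derivative of \<open>u\<close> on \<open>G\<close>. For \<open>i = 0\<close> this says \<open>V x [] = u x\<close>
  for almost every \<open>x\<close> in \<open>G\<close>.\<close>

definition has_weak_derivative ::
    "'a::euclidean_space set \<Rightarrow> nat \<Rightarrow> ('a \<Rightarrow> real) \<Rightarrow> ('a \<Rightarrow> 'a list \<Rightarrow> real) \<Rightarrow> bool" where
  "has_weak_derivative G i u V \<longleftrightarrow>
     locally_integrable_on u G \<and>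
     (\<forall>x\<in>G. multilinear_form i (V x)) \<and>
     (\<forall>hs. length hs = i \<longrightarrow>
        locally_integrable_on (\<lambda>x. V x hs) G \<and>
        (\<forall>\<phi>. test_function G \<phi> \<longrightarrow>
           (LINT x|lebesgue_on G. u x * iterated_deriv hs \<phi> x)
             = (-1) ^ i * (LINT x|lebesgue_on G. V x hs * \<phi> x)))"

text \<open>Membership in \<open>W\<^sup>kX(G)\<close> and \<open>W\<^sup>kX\<^sub>l\<^sub>o\<^sub>c(\<Omega>)\<close> for real-valued functions. Weak derivatives are
  unique almost everywhere, so the choice of \<open>V\<close> does not matter.\<close>

definition sobolev ::
    "nat \<Rightarrow> ('a::euclidean_space set \<Rightarrow> ('a \<Rightarrow> ennreal) \<Rightarrow> ennreal) \<Rightarrow> 'a set \<Rightarrow> ('a \<Rightarrow> real) set" where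
  "sobolev k X G = {u. \<exists>V. (\<forall>i\<le>k. has_weak_derivative G i u (V i)) \<and>
     (\<Sum>i\<le>k. X G (\<lambda>x. multilinear_norm i (V i x))) < \<infinity>}"

definition sobolev_loc ::
    "nat \<Rightarrow> ('a::euclidean_space set \<Rightarrow> ('a \<Rightarrow> ennreal) \<Rightarrow> ennreal) \<Rightarrow> 'a set \<Rightarrow> ('a \<Rightarrow> real) set" where
  "sobolev_loc k X \<Omega> =
     {u. \<forall>G. open G \<and> compact (closure G) \<and> closure G \<subseteq> \<Omega> \<longrightarrow> u \<in> sobolev k X G}"

definition locally_lipschitz_on ::
    "'a::metric_space set \<Rightarrow> ('a \<Rightarrow> 'b::metric_space) \<Rightarrow> bool" where
  "locally_lipschitz_on \<Omega> f \<longleftrightarrow> (\<forall>x\<in>\<Omega>. \<exists>r>0. \<exists>L. L-lipschitz_on (ball x r \<inter> \<Omega>) f)"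

end

theory Submission
  imports Defs
begin

text \<open>
  Mollify \<open>f\<close> and \<open>g\<close> at scale \<open>t\<close> and apply the Leibniz rule to \<open>f\<^sub>t g\<^sub>t\<close>; the task is to pass to the
  limit \<open>t \<rightarrow> 0\<close> in the mixed terms \<open>D\<^sup>j f\<^sub>t D\<^sup>k\<^sup>-\<^sup>j g\<^sub>t\<close>, \<open>0 < j < k\<close>, by domination in \<open>X(G)\<close>. If the means of
  \<open>\<bar>D\<^sup>k f\<bar>\<close> over small balls around \<open>x\<close> are bounded by \<open>2\<close> to the power \<open>i(k-1)\<close>, then interpolation between
  this bound and the Lipschitz bound (a pointwise Gagliardo-Nirenberg inequality) bounds \<open>D\<^sup>j f\<^sub>t(x)\<close> by a
  multiple of \<open>2\<close> to the power \<open>i(j-1)\<close>, uniformly in \<open>t\<close>; likewise for \<open>g\<close>. The mixed terms are thus of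
  order \<open>2\<close> to the power \<open>i(k-2)\<close>, which is smaller by a factor \<open>2\<^sup>i\<close> than the height of the maximal function.
  Because of this gain the weak type estimate for the maximal function suffices: by Vitali
  covering and averaging in the rearrangement invariant norm, the norm of the indicator of a level set is
  at most a constant times the inverse of its height, and the sum over all dyadic levels converges.
\<close>

text \<open>The heights of the levels come from scaling. At scale \<open>r\<close> the Lipschitz
  condition bounds a mollified derivative of order \<open>j\<close> by a multiple of
  \<open>r^(1-j)\<close>, and means of size \<open>M\<close> of the derivatives of order
  \<open>k\<close> contribute \<open>M r^(k-j)\<close>. The two terms balance for
  \<open>M = r^(1-k)\<close>, so the height \<open>2^(i(k-1))\<close> belongs to the scale
  \<open>r = R / 2^i\<close>, and both terms are then of order \<open>2^(i(j-1))\<close>. The two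
  end terms of the Leibniz sum show no gain, but there one factor is bounded: convergence in mean of
  the other factor suffices for the limit, and a multiple of its norm for the bound. The balls over
  which means are taken leave \<open>G\<close>, so the maximal function has to be estimated by data
  on a neighbourhood \<open>G'\<close>. The norms over \<open>G\<close> and \<open>G'\<close> are
  linked only by similarity, which compares rearrangements. Applied to indicators it becomes a
  statement about measures of sets; this is one reason for arguing with level sets rather than with
  the maximal function as a whole.\<close>

section \<open>Smooth functions and their closure properties\<close>

definition smooth :: "('a::euclidean_space \<Rightarrow> real) \<Rightarrow> bool" where
  "smooth \<phi> \<longleftrightarrow> (\<forall>hs x. iterated_deriv hs \<phi> differentiable (at x))"

lemma iterated_deriv_append:
  "iterated_deriv (as @ bs) \<phi> = iterated_deriv as (iterated_deriv bs \<phi>)"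
  by (induction as) auto

lemma smooth_iterated_deriv: "smooth \<phi> \<Longrightarrow> smooth (iterated_deriv hs \<phi>)"
  unfolding smooth_def iterated_deriv_append[symmetric] by blast

lemma smooth_imp_differentiable: "smooth \<phi> \<Longrightarrow> \<phi> differentiable (at x)"
  unfolding smooth_def by (metis iterated_deriv.simps(1))

lemma smooth_has_derivative:
  "smooth \<phi> \<Longrightarrow> (\<phi> has_derivative frechet_derivative \<phi> (at x)) (at x)"
  using smooth_imp_differentiable frechet_derivative_works by blast

lemma smooth_continuous_on: "smooth \<phi> \<Longrightarrow> continuous_on S \<phi>"
  by (meson continuous_at_imp_continuous_on differentiable_imp_continuous_within smooth_imp_differentiable)

lemma smooth_borel_measurable: "smooth \<phi> \<Longrightarrow> \<phi> \<in> borel_measurable borel"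
  by (intro borel_measurable_continuous_onI smooth_continuous_on)

text \<open>Iterated derivatives never leave \<open>A\<close>, by induction on the list of
  directions. Smoothness is thus reduced to exhibiting a class of differentiable functions that is
  stable under directional derivatives.\<close>

lemma smooth_coinduct:
  assumes "\<phi> \<in> A"
    and diff: "\<And>f x. f \<in> A \<Longrightarrow> f differentiable (at x)"
    and deriv: "\<And>f h. f \<in> A \<Longrightarrow> (\<lambda>x. frechet_derivative f (at x) h) \<in> A"
  shows "smooth \<phi>"
proof -
  have "iterated_deriv hs \<phi> \<in> A" for hs
    by (induction hs) (auto simp: assms(1) deriv)
  then show ?thesis
    unfolding smooth_def using diff by blast
qed

text \<open>The algebra generated by \<open>S\<close>, without a unit and without scalars: where
  constants are wanted, they are put into \<open>S\<close>.\<close>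

inductive_set smooth_hull :: "('a::euclidean_space \<Rightarrow> real) set \<Rightarrow> ('a \<Rightarrow> real) set" for S where
  base: "f \<in> S \<Longrightarrow> f \<in> smooth_hull S"
| add: "f \<in> smooth_hull S \<Longrightarrow> g \<in> smooth_hull S \<Longrightarrow> (\<lambda>x. f x + g x) \<in> smooth_hull S"
| mult: "f \<in> smooth_hull S \<Longrightarrow> g \<in> smooth_hull S \<Longrightarrow> (\<lambda>x. f x * g x) \<in> smooth_hull S"

text \<open>Sum and product rule carry stability under derivatives from the generators to the whole
  hull. A derivative of a generator may be any polynomial in the generators, which is the form that
  the derivatives of the bump function take.\<close>

lemma smooth_hull_smooth:
  assumes S: "\<And>f x. f \<in> S \<Longrightarrow> f differentiable (at x)"
    and D: "\<And>f h. f \<in> S \<Longrightarrow> (\<lambda>x. frechet_derivative f (at x) h) \<in> smooth_hull S"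
    and "f \<in> smooth_hull S"
  shows "smooth f"
proof -
  have diff: "f differentiable (at x)" if "f \<in> smooth_hull S" for f x
    using that by (induction) (auto simp: S)
  have "(\<lambda>x. frechet_derivative f (at x) h) \<in> smooth_hull S" if "f \<in> smooth_hull S" for f h
    using that
  proof induction
    case (base f)
    then show ?case by (rule D)
  next
    case (add f g)
    have "frechet_derivative (\<lambda>x. f x + g x) (at x) h = frechet_derivative f (at x) h + frechet_derivative g (at x) h" for x
    proof -
      have "((\<lambda>x. f x + g x) has_derivative (\<lambda>h. frechet_derivative f (at x) h + frechet_derivative g (at x) h)) (at x)"
        using add diff by (intro has_derivative_add) (auto simp: frechet_derivative_works[symmetric])
      from fun_cong[OF frechet_derivative_at[OF this], of h] show ?thesis
        by simp
    qed
    then show ?case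
      using add by (simp add: smooth_hull.add)
  next
    case (mult f g)
    have "frechet_derivative (\<lambda>x. f x * g x) (at x) h = f x * frechet_derivative g (at x) h + frechet_derivative f (at x) h * g x" for x
    proof -
      have "((\<lambda>x. f x * g x) has_derivative (\<lambda>h. f x * frechet_derivative g (at x) h + frechet_derivative f (at x) h * g x)) (at x)"
        using mult diff by (intro has_derivative_mult) (auto simp: frechet_derivative_works[symmetric])
      from fun_cong[OF frechet_derivative_at[OF this], of h] show ?thesis
        by simp
    qed
    then show ?case
      using mult by (simp add: smooth_hull.add smooth_hull.mult)
  qed
  with diff \<open>f \<in> smooth_hull S\<close> show ?thesis
    by (intro smooth_coinduct[of f "smooth_hull S"])
qed

text \<open>With all smooth functions as generators, closure under products comes out without an
  iterated Leibniz rule.\<close>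

lemma smooth_hull_smooth_functions:
  "f \<in> smooth_hull {g. smooth g} \<Longrightarrow> smooth f"
proof (rule smooth_hull_smooth[of "{g. smooth g}"])
  fix f :: "'a \<Rightarrow> real" and h
  assume "f \<in> {g. smooth g}"
  then have "smooth (iterated_deriv [h] f)"
    by (intro smooth_iterated_deriv) simp
  then show "(\<lambda>x. frechet_derivative f (at x) h) \<in> smooth_hull {g. smooth g}"
    by (intro smooth_hull.base) simp
qed (auto simp: smooth_imp_differentiable)

lemma smooth_mult: "smooth f \<Longrightarrow> smooth g \<Longrightarrow> smooth (\<lambda>x. f x * g x)"
  by (rule smooth_hull_smooth_functions) (auto intro: smooth_hull.intros)

lemma smooth_const: "smooth (\<lambda>x. c)"
  by (rule smooth_coinduct[of _ "{\<lambda>x. c | c. True}"]) auto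

lemma smooth_inner: "smooth (\<lambda>x. x \<bullet> b)"
proof (rule smooth_coinduct[of _ "insert (\<lambda>x. x \<bullet> b) {\<lambda>x. c | c. True}"])
  fix f :: "'a \<Rightarrow> real" and h
  assume f: "f \<in> insert (\<lambda>x. x \<bullet> b) {\<lambda>x. c |c. True}"
  have "frechet_derivative (\<lambda>x. x \<bullet> b) (at x) h = h \<bullet> b" for x :: 'a
    using fun_cong[OF frechet_derivative_at[OF bounded_linear.has_derivative[OF bounded_linear_inner_left has_derivative_ident]], of h b x]
    by simp
  with f show "(\<lambda>x. frechet_derivative f (at x) h) \<in> insert (\<lambda>x. x \<bullet> b) {\<lambda>x. c |c. True}"
    by auto
qed (auto simp: bounded_linear_imp_differentiable bounded_linear_inner_left)

subsection \<open>A bump function\<close>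

text \<open>\<open>flat 0\<close> is the classical \<open>exp (- 1 / t)\<close> extended by
  \<open>0\<close>; the powers of \<open>inverse t\<close> make the family stable under
  differentiation, up to linear combinations.\<close>

definition flat :: "nat \<Rightarrow> real \<Rightarrow> real" where
  "flat k t = (if t > 0 then exp (- inverse t) * inverse t ^ k else 0)"

lemma flat_tendsto_0: "(flat k \<longlongrightarrow> 0) (at_right 0)"
proof -
  have "((\<lambda>t::real. (inverse t) ^ k / exp (inverse t)) \<longlongrightarrow> 0) (at_right 0)"
    by (rule filterlim_compose[OF tendsto_power_div_exp_0 filterlim_inverse_at_top_right])
  then show ?thesis
    by (rule tendsto_cong[THEN iffD1, rotated])
       (auto simp: eventually_at_filter flat_def exp_minus field_simps)
qed

lemma flat_has_derivative:
  "(flat k has_real_derivative flat (k + 2) t - real k * flat (k + 1) t) (at t)"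
proof (cases "t = 0")
  case True
  have "((\<lambda>h. (flat k h - flat k 0) / h) \<longlongrightarrow> 0) (at 0)"
  proof -
    have "((\<lambda>h. (flat k h - flat k 0) / h) \<longlongrightarrow> 0) (at_left 0)"
      by (rule tendsto_eventually) (auto simp: eventually_at_filter flat_def)
    \<comment> \<open>From the right the difference quotient at \<open>0\<close> is
      \<open>flat (Suc k)\<close>, so the behaviour at \<open>0\<close> of the next member of the
      family settles differentiability.\<close>
    moreover have "((\<lambda>h. (flat k h - flat k 0) / h) \<longlongrightarrow> 0) (at_right 0)"
      by (rule tendsto_cong[THEN iffD1, rotated, OF flat_tendsto_0[of "Suc k"]])
         (auto simp: eventually_at_filter flat_def field_simps)
    ultimately show ?thesis
      by (simp add: filterlim_split_at)
  qed
  then show ?thesis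
    using True by (simp add: has_field_derivative_iff flat_def)
next
  case False
  show ?thesis
  proof (cases "t > 0")
    case True
    have "((\<lambda>t. exp (- inverse t) * inverse t ^ k) has_real_derivative flat (k + 2) t - real k * flat (k + 1) t) (at t)"
      using True
      by (auto intro!: derivative_eq_intros simp: flat_def power2_eq_square power_add field_simps)
         (cases k; simp add: field_simps)
    then show ?thesis
      by (rule has_field_derivative_transform_within_open[of _ _ _ "{0<..}"]) (use True in \<open>auto simp: flat_def\<close>)
  next
    case neg: False
    have "((\<lambda>t. 0) has_real_derivative flat (k + 2) t - real k * flat (k + 1) t) (at t)"
      using neg by (simp add: flat_def)
    then show ?thesis
      by (rule has_field_derivative_transform_within_open[of _ _ _ "{..<0}"]) (use neg False in \<open>auto simp: flat_def\<close>)
  qed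
qed

definition bump :: "'a::euclidean_space \<Rightarrow> real" where
  "bump x = flat 0 (1 - x \<bullet> x)"

lemma smooth_bump: "smooth bump"
proof -
  \<comment> \<open>The inner derivative \<open>-2 (x \<bullet> h)\<close> is smooth, so a
    derivative of \<open>flat k (1 - x \<bullet> x)\<close> is a polynomial in members of
    \<open>S\<close>.\<close>
  define S :: "('a \<Rightarrow> real) set" where
    "S = {\<lambda>x. flat k (1 - x \<bullet> x) | k. True} \<union> {g. smooth g}"
  have der: "((\<lambda>x::'a. flat k (1 - x \<bullet> x)) has_derivative
       (\<lambda>h. (flat (k + 2) (1 - x \<bullet> x) - real k * flat (k + 1) (1 - x \<bullet> x)) * (- 2 * (x \<bullet> h)))) (at x)" for k x
  proof -
    have "((\<lambda>x::'a. 1 - x \<bullet> x) has_derivative (\<lambda>h. - 2 * (x \<bullet> h))) (at x)"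
      by (auto intro!: derivative_eq_intros simp: inner_commute)
    moreover have "(flat k has_derivative (\<lambda>z. (flat (k + 2) (1 - x \<bullet> x) - real k * flat (k + 1) (1 - x \<bullet> x)) * z)) (at (1 - x \<bullet> x))"
      using flat_has_derivative[of k "1 - x \<bullet> x"] unfolding has_field_derivative_def .
    ultimately show ?thesis
      by (rule has_derivative_compose)
  qed
  show ?thesis
  proof (rule smooth_hull_smooth[of S])
    fix f :: "'a \<Rightarrow> real" and x
    assume "f \<in> S"
    then show "f differentiable (at x)"
      unfolding S_def using der smooth_imp_differentiable by (auto simp: differentiable_def)
  next
    fix f :: "'a \<Rightarrow> real" and h
    assume "f \<in> S"
    then consider k where "f = (\<lambda>x. flat k (1 - x \<bullet> x))" | "smooth f"
      unfolding S_def by auto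
    then show "(\<lambda>x. frechet_derivative f (at x) h) \<in> smooth_hull S"
    proof cases
      case 1
      have "(\<lambda>x. frechet_derivative f (at x) h) =
        (\<lambda>x. (flat (k + 2) (1 - x \<bullet> x) + (- real k) * flat (k + 1) (1 - x \<bullet> x)) * (- 2 * (x \<bullet> h)))"
        unfolding 1 by (subst frechet_derivative_at[OF der, symmetric]) simp
      moreover have "(\<lambda>x. flat j (1 - x \<bullet> x)) \<in> smooth_hull S" "(\<lambda>x. c) \<in> smooth_hull S"
         "(\<lambda>x. x \<bullet> h) \<in> smooth_hull S" for j c
        by (auto intro!: smooth_hull.base smooth_const smooth_inner simp: S_def)
      ultimately show ?thesis
        by (simp only: smooth_hull.add smooth_hull.mult)
    next
      case 2
      then have "smooth (iterated_deriv [h] f)"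
        by (rule smooth_iterated_deriv)
      then show ?thesis
        by (intro smooth_hull.base) (simp add: S_def)
    qed
  next
    show "bump \<in> smooth_hull S"
      by (intro smooth_hull.base) (unfold S_def bump_def[abs_def], blast)
  qed
qed

lemma bump_nonneg: "bump x \<ge> 0"
  by (auto simp: bump_def flat_def)

lemma bump_pos_iff: "bump x > 0 \<longleftrightarrow> norm x < 1"
  by (simp add: bump_def flat_def dot_square_norm abs_square_less_1)

section \<open>Differentiation under the integral sign\<close>

text \<open>Dominated convergence for difference quotients along an arbitrary null sequence. The
  mean value inequality bounds the quotients of the kernel by \<open>B\<close>, uniformly in
  \<open>y\<close>, so that \<open>\<bar>V\<bar> * B\<close> is a majorant and \<open>V\<close> need
  only be integrable.\<close>

lemma has_real_derivative_integral:
  fixes V :: "'a \<Rightarrow> real" and k k' :: "real \<Rightarrow> 'a \<Rightarrow> real"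
  assumes V: "integrable M V" and "e > 0"
    and der: "\<And>t y. \<bar>t - t0\<bar> < e \<Longrightarrow> ((\<lambda>t. k t y) has_real_derivative k' t y) (at t)"
    and bnd: "\<And>t y. \<bar>t - t0\<bar> < e \<Longrightarrow> \<bar>k' t y\<bar> \<le> B"
    and k: "\<And>t. k t \<in> borel_measurable M" and k': "k' t0 \<in> borel_measurable M"
    and int: "\<And>t. \<bar>t - t0\<bar> < e \<Longrightarrow> integrable M (\<lambda>y. V y * k t y)"
  shows "((\<lambda>t. \<integral>y. V y * k t y \<partial>M) has_real_derivative (\<integral>y. V y * k' t0 y \<partial>M)) (at t0)"
  unfolding DERIV_def tendsto_at_iff_sequentially
proof (intro allI impI)
  fix X :: "nat \<Rightarrow> real"
  assume X0: "\<forall>i. X i \<in> UNIV - {0}" and X: "X \<longlonglongrightarrow> 0"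
  \<comment> \<open>Bounds are available only for parameters closer to \<open>t0\<close> than
    \<open>e\<close>. Dropping \<open>N\<close> terms puts the whole sequence there;
    \<open>LIMSEQ_offset\<close> restores them at the end.\<close>
  obtain N where N: "\<And>i. i \<ge> N \<Longrightarrow> \<bar>X i\<bar> < e"
    using LIMSEQ_D[OF X \<open>e > 0\<close>] by auto
  define Y where "Y i = X (i + N)" for i
  have Y: "Y \<longlonglongrightarrow> 0" "\<And>i. Y i \<noteq> 0" "\<And>i. \<bar>Y i\<bar> < e"
    using X0 N LIMSEQ_ignore_initial_segment[OF X, of N] by (auto simp: Y_def[abs_def])
  have quot: "(\<lambda>i. (k (t0 + Y i) y - k t0 y) / Y i) \<longlonglongrightarrow> k' t0 y" for y
  proof -
    have "((\<lambda>h. (k (t0 + h) y - k t0 y) / h) \<longlongrightarrow> k' t0 y) (at 0)"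
      using der[of t0 y] \<open>e > 0\<close> by (simp add: DERIV_def)
    then show ?thesis
      using Y by (auto simp: tendsto_at_iff_sequentially o_def)
  qed
  have quot_bnd: "\<bar>(k (t0 + Y i) y - k t0 y) / Y i\<bar> \<le> B" for i y
  proof -
    have "norm (k (t0 + Y i) y - k t0 y) \<le> B * norm (t0 + Y i - t0)"
    proof (rule field_differentiable_bound[where S = "{t. \<bar>t - t0\<bar> < e}" and f' = "\<lambda>t. k' t y"])
      have "{t. \<bar>t - t0\<bar> < e} = ball t0 e"
        by (auto simp: dist_real_def)
      then show "convex {t. \<bar>t - t0\<bar> < e}"
        by simp
    qed (use der bnd Y(3) \<open>e > 0\<close> in \<open>auto intro: has_field_derivative_at_within\<close>)
    then show ?thesis
      using Y(2)[of i] by (simp add: field_simps)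
  qed
  have "(\<lambda>i. \<integral>y. V y * ((k (t0 + Y i) y - k t0 y) / Y i) \<partial>M) \<longlonglongrightarrow> (\<integral>y. V y * k' t0 y \<partial>M)"
  proof (rule integral_dominated_convergence[where w = "\<lambda>y. \<bar>V y\<bar> * B"])
    show "AE y in M. (\<lambda>i. V y * ((k (t0 + Y i) y - k t0 y) / Y i)) \<longlonglongrightarrow> V y * k' t0 y"
      by (intro AE_I2 tendsto_mult tendsto_const quot)
    show "AE y in M. norm (V y * ((k (t0 + Y i) y - k t0 y) / Y i)) \<le> \<bar>V y\<bar> * B" for i
      using quot_bnd by (intro AE_I2) (simp only: abs_mult real_norm_def mult_left_mono abs_ge_zero)
  qed (use V k k' in auto)
  moreover have "(\<integral>y. V y * ((k (t0 + Y i) y - k t0 y) / Y i) \<partial>M) =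
      ((\<integral>y. V y * k (t0 + Y i) y \<partial>M) - (\<integral>y. V y * k t0 y \<partial>M)) / Y i" for i
  proof -
    have "(\<integral>y. V y * ((k (t0 + Y i) y - k t0 y) / Y i) \<partial>M) = (\<integral>y. (V y * k (t0 + Y i) y - V y * k t0 y) / Y i \<partial>M)"
      by (intro Bochner_Integration.integral_cong) (auto simp: field_simps)
    also have "\<dots> = ((\<integral>y. V y * k (t0 + Y i) y \<partial>M) - (\<integral>y. V y * k t0 y \<partial>M)) / Y i"
      using int[of "t0 + Y i"] int[of t0] Y(3)[of i] \<open>e > 0\<close> by simp
    finally show ?thesis .
  qed
  ultimately have "(\<lambda>i. ((\<integral>y. V y * k (t0 + Y i) y \<partial>M) - (\<integral>y. V y * k t0 y \<partial>M)) / Y i)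
      \<longlonglongrightarrow> (\<integral>y. V y * k' t0 y \<partial>M)"
    by (simp only:)
  then show "((\<lambda>h. ((\<integral>y. V y * k (t0 + h) y \<partial>M) - (\<integral>y. V y * k t0 y \<partial>M)) / h) \<circ> X)
      \<longlonglongrightarrow> (\<integral>y. V y * k' t0 y \<partial>M)"
    unfolding Y_def o_def by (rule LIMSEQ_offset)
qed

subsection \<open>Directional derivatives\<close>

text \<open>Differentiability along lines is all that integration by parts uses, and differentiating
  a mollification along one line needs only a real parameter under the integral.\<close>

definition has_dir_deriv :: "('a::real_vector \<Rightarrow> real) \<Rightarrow> 'a \<Rightarrow> ('a \<Rightarrow> real) \<Rightarrow> bool" where
  "has_dir_deriv F h D \<longleftrightarrow> (\<forall>x. ((\<lambda>t. F (x + t *\<^sub>R h)) has_real_derivative D x) (at 0))"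

lemma has_dir_deriv_at:
  assumes "has_dir_deriv F h D"
  shows "((\<lambda>t. F (x + t *\<^sub>R h)) has_real_derivative D (x + s *\<^sub>R h)) (at s)"
proof -
  have "((\<lambda>t. F ((x + s *\<^sub>R h) + t *\<^sub>R h)) has_real_derivative D (x + s *\<^sub>R h)) (at 0)"
    using assms unfolding has_dir_deriv_def by blast
  then have "((\<lambda>t. F (x + (t + s) *\<^sub>R h)) has_real_derivative D (x + s *\<^sub>R h)) (at 0)"
    by (simp add: scaleR_add_left algebra_simps)
  then show ?thesis
    using DERIV_shift[of "\<lambda>t. F (x + t *\<^sub>R h)" "D (x + s *\<^sub>R h)" 0 s] by simp
qed

lemma has_dir_deriv_mult:
  "has_dir_deriv F h F' \<Longrightarrow> has_dir_deriv G h G' \<Longrightarrow>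
    has_dir_deriv (\<lambda>x. F x * G x) h (\<lambda>x. F' x * G x + F x * G' x)"
  unfolding has_dir_deriv_def by (auto intro!: derivative_eq_intros)

lemma has_dir_deriv_add:
  "has_dir_deriv F h F' \<Longrightarrow> has_dir_deriv G h G' \<Longrightarrow>
    has_dir_deriv (\<lambda>x. F x + G x) h (\<lambda>x. F' x + G' x)"
  unfolding has_dir_deriv_def by (auto intro!: derivative_eq_intros)

lemma smooth_has_dir_deriv:
  assumes "smooth \<phi>"
  shows "has_dir_deriv \<phi> h (iterated_deriv [h] \<phi>)"
  unfolding has_dir_deriv_def
proof
  fix x
  have "((\<lambda>t. x + t *\<^sub>R h) has_derivative (\<lambda>t. t *\<^sub>R h)) (at 0)"
    by (auto intro!: derivative_eq_intros)
  moreover have \<phi>: "(\<phi> has_derivative frechet_derivative \<phi> (at x)) (at (x + 0 *\<^sub>R h))"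
    using smooth_has_derivative[OF assms, of x] by simp
  ultimately have "((\<lambda>t. \<phi> (x + t *\<^sub>R h)) has_derivative (\<lambda>t. frechet_derivative \<phi> (at x) (t *\<^sub>R h))) (at 0)"
    by (rule has_derivative_compose)
  moreover have "frechet_derivative \<phi> (at x) (t *\<^sub>R h) = iterated_deriv [h] \<phi> x * t" for t
    using linear_cmul[OF has_derivative_linear[OF \<phi>]] by simp
  ultimately show "((\<lambda>t. \<phi> (x + t *\<^sub>R h)) has_real_derivative iterated_deriv [h] \<phi> x) (at 0)"
    by (simp add: has_field_derivative_def)
qed

lemma integral_lborel_translation:
  fixes F :: "'a::euclidean_space \<Rightarrow> real"
  assumes "F \<in> borel_measurable borel"
  shows "(\<integral>x. F (x + c) \<partial>lborel) = (\<integral>x. F x \<partial>lborel)"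
proof -
  have "(\<integral>x. F x \<partial>lborel) = (\<integral>x. F x \<partial>distr lborel borel ((+) c))"
    by (simp add: lborel_distr_plus)
  also have "\<dots> = (\<integral>x. F (x + c) \<partial>lborel)"
    using assms by (subst integral_distr) (auto simp: add.commute)
  finally show ?thesis ..
qed

lemma integrable_bounded_support:
  fixes F :: "'a::euclidean_space \<Rightarrow> real"
  assumes "F \<in> borel_measurable borel" "\<And>x. \<bar>F x\<bar> \<le> B" "\<And>x. x \<notin> cball z r \<Longrightarrow> F x = 0"
  shows "integrable lborel F"
proof -
  have "set_integrable lborel (cball z r) F"
    unfolding set_integrable_def
  proof (rule Bochner_Integration.integrable_bound)
    show "integrable lborel (\<lambda>x. B * indicator (cball z r) x :: real)"
      by (intro integrable_mult_right integrable_real_indicator) (use emeasure_lborel_cball_finite in \<open>auto simp: less_top\<close>)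
    show "AE x in lborel. norm (indicator (cball z r) x *\<^sub>R F x) \<le> norm (B * indicator (cball z r) x)"
      using assms(2) by (intro AE_I2) (auto simp: indicator_def intro: order_trans[OF _ abs_ge_self])
  qed (use assms(1) in \<open>auto intro!: borel_measurable_times borel_measurable_indicator\<close>)
  moreover have "(\<lambda>x. indicator (cball z r) x *\<^sub>R F x) = F"
    using assms(3) by (auto simp: indicator_def fun_eq_iff)
  ultimately show ?thesis
    by (simp only: set_integrable_def)
qed

text \<open>Difference quotients have integral \<open>0\<close> by translation invariance, and
  dominated convergence passes to \<open>D\<close>. The step sizes are at most \<open>1\<close>, so
  for \<open>norm x > r + norm h\<close> both points of the quotient miss the support; this is the
  radius in the majorant \<open>w\<close>.\<close>

lemma integral_dir_deriv:
  fixes F D :: "'a::euclidean_space \<Rightarrow> real"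
  assumes F: "F \<in> borel_measurable borel" and D: "D \<in> borel_measurable borel"
    and der: "has_dir_deriv F h D"
    and bF: "\<And>x. \<bar>F x\<bar> \<le> A" and bD: "\<And>x. \<bar>D x\<bar> \<le> B"
    and supp: "\<And>x. x \<notin> cball 0 r \<Longrightarrow> F x = 0"
  shows "(\<integral>x. D x \<partial>lborel) = 0"
proof -
  define q where "q n x = (F (x + inverse (Suc n) *\<^sub>R h) - F x) / inverse (Suc n)" for n :: nat and x
  define w where "w x = B * indicator (cball 0 (r + norm h)) x" for x :: 'a
  have "B \<ge> 0"
    using bD[of 0] by linarith
  have [measurable]: "(\<lambda>x. F (x + c)) \<in> borel_measurable borel" for c
    using F by measurable
  have intF: "integrable lborel F"
    by (rule integrable_bounded_support[OF F bF supp])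
  have intFc: "integrable lborel (\<lambda>x. F (x + c))" for c
  proof -
    have "integrable (distr lborel borel ((+) c)) F"
      using intF by (simp add: lborel_distr_plus)
    then show ?thesis
      using F by (subst (asm) integrable_distr_eq) (auto simp: add.commute)
  qed
  have "(\<lambda>n. \<integral>x. q n x \<partial>lborel) \<longlonglongrightarrow> (\<integral>x. D x \<partial>lborel)"
  proof (rule integral_dominated_convergence[where w = w])
    show "integrable lborel w"
      unfolding w_def
      by (intro integrable_mult_right integrable_real_indicator) (use emeasure_lborel_cball_finite in \<open>auto simp: less_top\<close>)
    show "AE x in lborel. (\<lambda>n. q n x) \<longlonglongrightarrow> D x"
    proof (intro AE_I2)
      fix x
      have "((\<lambda>t. (F (x + t *\<^sub>R h) - F x) / t) \<longlongrightarrow> D x) (at 0)"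
        using der unfolding has_dir_deriv_def DERIV_def by (simp add: algebra_simps)
      then show "(\<lambda>n. q n x) \<longlonglongrightarrow> D x"
        unfolding tendsto_at_iff_sequentially
        by (drule_tac spec[of _ "\<lambda>n. inverse (real (Suc n))"])
           (use LIMSEQ_inverse_real_of_nat in \<open>simp add: q_def o_def\<close>)
    qed
    show "AE x in lborel. norm (q n x) \<le> w x" for n
    proof (intro AE_I2)
      fix x
      define s where "s = inverse (real (Suc n))"
      have s: "0 < s" "s \<le> 1"
        by (auto simp: s_def field_simps)
      show "norm (q n x) \<le> w x"
      proof (cases "x \<in> cball 0 (r + norm h)")
        case True
        have "norm (F (x + s *\<^sub>R h) - F (x + 0 *\<^sub>R h)) \<le> B * norm (s - 0)"
          by (rule field_differentiable_bound[where S = UNIV and f' = "\<lambda>t. D (x + t *\<^sub>R h)" and f = "\<lambda>t. F (x + t *\<^sub>R h)"])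
             (auto simp: bD has_dir_deriv_at[OF der])
        then show ?thesis
          using s True unfolding q_def w_def s_def[symmetric] by (simp add: divide_le_eq)
      next
        case False
        then have "norm (x + s *\<^sub>R h) > r" "norm x > r"
          using s norm_triangle_ineq4[of "x + s *\<^sub>R h" "s *\<^sub>R h"] mult_left_le_one_le[of "norm h" s]
            norm_ge_zero[of h]
          by (auto simp: not_le simp del: norm_ge_zero)
        then show ?thesis
          using supp[of x] supp[of "x + s *\<^sub>R h"] False by (simp add: q_def w_def s_def[symmetric] del: of_nat_Suc)
      qed
    qed
  qed (use F D in \<open>auto simp: q_def\<close>)
  moreover have "(\<integral>x. q n x \<partial>lborel) = 0" for n
    unfolding q_def using intF intFc integral_lborel_translation[OF F] by simp
  ultimately show ?thesis
    by (simp add: LIMSEQ_const_iff)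
qed

subsection \<open>Kernels\<close>

text \<open>Neither sign nor integral is prescribed, so that the class is stable under derivatives
  and under multiplication with coordinates. Both operations appear when a mollification is
  differentiated in its scale. Vanishing already on the unit sphere lets scaled kernels live on open
  balls.\<close>

definition kernel :: "('a::euclidean_space \<Rightarrow> real) \<Rightarrow> bool" where
  "kernel \<kappa> \<longleftrightarrow> smooth \<kappa> \<and> (\<forall>x. norm x \<ge> 1 \<longrightarrow> \<kappa> x = 0)"

lemma kernel_eq_0: "kernel \<kappa> \<Longrightarrow> norm x \<ge> 1 \<Longrightarrow> \<kappa> x = 0"
  by (simp add: kernel_def)

lemma kernel_smooth: "kernel \<kappa> \<Longrightarrow> smooth \<kappa>"
  by (simp add: kernel_def)

lemma kernel_bounded:
  fixes \<kappa> :: "'a::euclidean_space \<Rightarrow> real"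
  assumes "kernel \<kappa>"
  shows "\<exists>C>0. \<forall>x. \<bar>\<kappa> x\<bar> \<le> C"
proof -
  have "bounded (\<kappa> ` cball 0 1)"
    by (intro compact_imp_bounded compact_continuous_image smooth_continuous_on kernel_smooth assms) simp
  then obtain C where C: "C > 0" "\<And>x. x \<in> cball 0 1 \<Longrightarrow> \<bar>\<kappa> x\<bar> \<le> C"
    by (auto simp: bounded_pos)
  have "\<bar>\<kappa> x\<bar> \<le> C" for x
    using C kernel_eq_0[OF assms, of x] by (cases "norm x \<le> 1") auto
  with C(1) show ?thesis by blast
qed

lemma iterated_deriv_eq_0_on_open:
  assumes "open S" "\<And>x. x \<in> S \<Longrightarrow> \<phi> x = 0" "x \<in> S"
  shows "iterated_deriv hs \<phi> x = 0"
  using \<open>x \<in> S\<close>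
proof (induction hs arbitrary: x)
  case (Cons h hs)
  have "((\<lambda>_. 0) has_derivative (\<lambda>_. 0)) (at x)"
    by simp
  then have "(iterated_deriv hs \<phi> has_derivative (\<lambda>_. 0)) (at x)"
    by (rule has_derivative_transform_within_open[OF _ \<open>open S\<close> Cons.prems]) (simp add: Cons.IH)
  from fun_cong[OF frechet_derivative_at[OF this], of h] show ?case
    by simp
qed (use assms in auto)

lemma kernel_iterated_deriv:
  assumes "kernel \<kappa>"
  shows "kernel (iterated_deriv hs \<kappa>)"
  unfolding kernel_def
proof (intro conjI allI impI)
  show sm: "smooth (iterated_deriv hs \<kappa>)"
    using assms by (simp add: kernel_smooth smooth_iterated_deriv)
  fix x :: 'a
  assume "norm x \<ge> 1"
  have "iterated_deriv hs \<kappa> y = 0" if "y \<in> - cball 0 1" for y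
    by (rule iterated_deriv_eq_0_on_open[of "- cball 0 1"]) (use that in \<open>auto intro: kernel_eq_0[OF assms]\<close>)
  \<comment> \<open>Locality of derivatives gives zero only in the open exterior; the unit sphere is
    reached by continuity.\<close>
  moreover have "x \<in> closure (- cball 0 1)"
    using \<open>norm x \<ge> 1\<close> by (simp add: closure_complement)
  ultimately show "iterated_deriv hs \<kappa> x = 0"
    by (rule continuous_constant_on_closure[OF smooth_continuous_on[OF sm]])
qed

lemma kernel_inner_mult: "kernel \<kappa> \<Longrightarrow> kernel (\<lambda>x. (x \<bullet> b) * \<kappa> x)"
  by (simp add: kernel_def smooth_mult smooth_inner)

lemma kernel_cmult: "kernel \<kappa> \<Longrightarrow> kernel (\<lambda>x. c * \<kappa> x)"
  by (simp add: kernel_def smooth_mult smooth_const)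

lemma kernel_borel: "kernel \<kappa> \<Longrightarrow> \<kappa> \<in> borel_measurable borel"
  by (simp add: kernel_def smooth_borel_measurable)

lemma kernel_integrable:
  assumes "kernel \<kappa>"
  shows "integrable lborel \<kappa>"
proof -
  obtain C where "C > 0" and C: "\<And>x. \<bar>\<kappa> x\<bar> \<le> C"
    using kernel_bounded[OF assms] by blast
  from integrable_bounded_support[OF kernel_borel[OF assms] C, of 0 1] show ?thesis
    using kernel_eq_0[OF assms] by auto
qed

text \<open>One derivative is enough for the integral to vanish, because the integrand is then a
  directional derivative of a compactly supported function. This cancellation lets a constant be
  subtracted from \<open>f\<close> before a Lipschitz bound is used.\<close>

lemma integral_kernel_deriv:
  assumes "kernel \<kappa>" "hs \<noteq> []"
  shows "(\<integral>x. iterated_deriv hs \<kappa> x \<partial>lborel) = 0"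
proof -
  obtain h hs' where hs: "hs = h # hs'"
    using assms(2) by (cases hs) auto
  note K = kernel_iterated_deriv[OF assms(1)]
  obtain A where "A > 0" and A: "\<And>x. \<bar>iterated_deriv hs' \<kappa> x\<bar> \<le> A"
    using kernel_bounded[OF K[of hs']] by blast
  obtain B where "B > 0" and B: "\<And>x. \<bar>iterated_deriv hs \<kappa> x\<bar> \<le> B"
    using kernel_bounded[OF K[of hs]] by blast
  show ?thesis
  proof (rule integral_dir_deriv[OF kernel_borel[OF K] kernel_borel[OF K] _ A B, where r = 1])
    show "has_dir_deriv (iterated_deriv hs' \<kappa>) h (iterated_deriv hs \<kappa>)"
      using smooth_has_dir_deriv[OF kernel_smooth[OF K], of hs' h] hs by simp
  qed (use kernel_eq_0[OF K] in auto)
qed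

lemma iterated_deriv_affine:
  assumes "smooth \<phi>"
  shows "iterated_deriv hs (\<lambda>y. \<phi> (c *\<^sub>R y + z)) = (\<lambda>y. c ^ length hs * iterated_deriv hs \<phi> (c *\<^sub>R y + z))"
proof (induction hs)
  case (Cons h hs)
  have "frechet_derivative (\<lambda>y. c ^ length hs * iterated_deriv hs \<phi> (c *\<^sub>R y + z)) (at x) h =
     c ^ length (h # hs) * iterated_deriv (h # hs) \<phi> (c *\<^sub>R x + z)" for x
  proof -
    define \<psi> where "\<psi> = iterated_deriv hs \<phi>"
    have d: "(\<psi> has_derivative frechet_derivative \<psi> (at (c *\<^sub>R x + z))) (at (c *\<^sub>R x + z))"
      unfolding \<psi>_def by (intro smooth_has_derivative smooth_iterated_deriv assms)
    have "((\<lambda>y. c *\<^sub>R y + z) has_derivative (\<lambda>h. c *\<^sub>R h)) (at x)"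
      by (auto intro!: derivative_eq_intros)
    from has_derivative_compose[OF this d]
    have "((\<lambda>y. c ^ length hs * \<psi> (c *\<^sub>R y + z)) has_derivative
        (\<lambda>h. c ^ length hs * frechet_derivative \<psi> (at (c *\<^sub>R x + z)) (c *\<^sub>R h))) (at x)"
      by (rule has_derivative_mult_right)
    from fun_cong[OF frechet_derivative_at[OF this], of h] show ?thesis
      using linear_cmul[OF has_derivative_linear[OF d], of c h] unfolding \<psi>_def
      by (simp add: ac_simps)
  qed
  then show ?case
    unfolding iterated_deriv.simps(2) Cons.IH by (simp add: fun_eq_iff)
qed simp

lemma smooth_affine:
  assumes "smooth \<phi>"
  shows "smooth (\<lambda>y. \<phi> (c *\<^sub>R y + z))"
  unfolding smooth_def iterated_deriv_affine[OF assms]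
proof (intro allI)
  fix hs x
  have "(\<lambda>y. iterated_deriv hs \<phi> (c *\<^sub>R y + z)) differentiable at x"
    by (rule differentiable_compose[of "iterated_deriv hs \<phi>" "\<lambda>y. c *\<^sub>R y + z"])
       (auto intro!: smooth_imp_differentiable smooth_iterated_deriv assms)
  then show "(\<lambda>y. c ^ length hs * iterated_deriv hs \<phi> (c *\<^sub>R y + z)) differentiable at x"
    by (intro differentiable_mult differentiable_const)
qed

text \<open>The reflected and scaled kernel is the test function that turns the definition of a weak
  derivative into an identity for mollifications; the closed ball in \<open>G\<close> keeps its
  support compact inside \<open>G\<close>.\<close>

lemma scaled_kernel_test_function:
  assumes "kernel \<kappa>" "t > 0" "cball x t \<subseteq> G"
  shows "test_function G (\<lambda>y. \<kappa> ((x - y) /\<^sub>R t))"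
proof -
  have eq: "(\<lambda>y. \<kappa> ((x - y) /\<^sub>R t)) = (\<lambda>y. \<kappa> ((- inverse t) *\<^sub>R y + x /\<^sub>R t))"
    by (auto simp: scaleR_diff_right)
  have "{y. \<kappa> ((x - y) /\<^sub>R t) \<noteq> 0} \<subseteq> cball x t"
  proof (intro subsetI, rule ccontr)
    fix y
    assume "y \<in> {y. \<kappa> ((x - y) /\<^sub>R t) \<noteq> 0}" "y \<notin> cball x t"
    then show False
      using assms(2) kernel_eq_0[OF assms(1), of "(x - y) /\<^sub>R t"]
      by (simp add: dist_norm divide_inverse_commute[symmetric] le_divide_eq del: divide_inverse)
  qed
  then have "closure {y. \<kappa> ((x - y) /\<^sub>R t) \<noteq> 0} \<subseteq> cball x t"
    by (simp add: closure_minimal)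
  moreover have "smooth (\<lambda>y. \<kappa> ((x - y) /\<^sub>R t))"
    unfolding eq by (intro smooth_affine kernel_smooth assms)
  moreover from calculation have "compact (closure {y. \<kappa> ((x - y) /\<^sub>R t) \<noteq> 0})"
    by (auto simp: compact_eq_bounded_closed intro: bounded_subset[OF bounded_cball])
  ultimately show ?thesis
    using assms(3) unfolding test_function_def smooth_def by blast
qed

lemma iterated_deriv_scaled_kernel:
  assumes "kernel \<kappa>"
  shows "iterated_deriv hs (\<lambda>y. \<kappa> ((x - y) /\<^sub>R t)) =
    (\<lambda>y. (- inverse t) ^ length hs * iterated_deriv hs \<kappa> ((x - y) /\<^sub>R t))"
  using iterated_deriv_affine[OF kernel_smooth[OF assms], of hs "- inverse t" "x /\<^sub>R t"]
  by (simp add: scaleR_diff_right)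

text \<open>The bump can be divided by its integral because it is positive on the unit ball, which
  is not a null set.\<close>

lemma normalized_kernel:
  obtains \<rho> :: "'a::euclidean_space \<Rightarrow> real" where "kernel \<rho>" "(\<integral>x. \<rho> x \<partial>lborel) = 1"
proof -
  have k: "kernel (bump :: 'a \<Rightarrow> real)"
  proof -
    have "bump x = 0" if "norm x \<ge> 1" for x :: 'a
      using bump_nonneg[of x] bump_pos_iff[of x] that by linarith
    then show ?thesis
      by (simp add: kernel_def smooth_bump)
  qed
  have "(LINT x|lborel. bump (x :: 'a)) \<noteq> 0"
  proof
    assume "(LINT x|lborel. bump (x :: 'a)) = 0"
    then have "AE x in lborel. bump (x::'a) = 0"
      by (subst (asm) integral_nonneg_eq_0_iff_AE) (auto simp: bump_nonneg kernel_integrable k)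
    then have "AE x in lborel. x \<notin> ball (0::'a) 1"
      by eventually_elim (use bump_pos_iff in \<open>auto simp: less_le\<close>)
    then have "emeasure lborel (ball (0::'a) 1) = 0"
      using AE_iff_null_sets[of "ball (0::'a) 1" lborel] by auto
    then show False
      using unit_ball_vol_pos[of "real DIM('a)"] by (simp add: emeasure_ball del: unit_ball_vol_pos)
  qed
  then show thesis
    using that[OF kernel_cmult[OF k, of "1 / (LINT x|lborel. bump (x :: 'a))"]] by simp
qed

subsection \<open>Subsets of prescribed measure\<close>

text \<open>Cut \<open>A\<close> with growing balls. Between two radii the measure of the piece
  increases by at most the volume of the shell, so it depends continuously on the radius and takes
  the value \<open>t\<close>.\<close>

lemma nonatomic_subset:
  fixes A :: "'a::euclidean_space set"
  assumes A: "A \<in> lmeasurable" and t: "0 \<le> t" "t \<le> measure lebesgue A"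
  obtains B where "B \<in> lmeasurable" "B \<subseteq> A" "measure lebesgue B = t"
proof (cases "t = measure lebesgue A")
  case True
  then show thesis
    using that[of A] A by simp
next
  case False
  define m where "m r = measure lebesgue (A \<inter> cball 0 r)" for r
  have meas: "A \<inter> cball 0 r \<in> lmeasurable" for r
    using A by (simp add: fmeasurable.Int)
  have lip: "m r' - m r \<le> measure lebesgue (cball (0::'a) r') - measure lebesgue (cball (0::'a) r)" if "r \<le> r'" for r r'
  proof -
    have "measure lebesgue ((A \<inter> cball 0 r') - (A \<inter> cball 0 r)) = m r' - m r"
      unfolding m_def using meas that by (intro measurable_measure_Diff) auto
    moreover have "measure lebesgue (cball (0::'a) r' - cball 0 r) = measure lebesgue (cball (0::'a) r') - measure lebesgue (cball (0::'a) r)"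
      using that by (intro measurable_measure_Diff) auto
    moreover have "measure lebesgue ((A \<inter> cball 0 r') - (A \<inter> cball 0 r)) \<le> measure lebesgue (cball (0::'a) r' - cball 0 r)"
      using meas by (intro measure_mono_fmeasurable) (auto intro: fmeasurable_Diff)
    ultimately show ?thesis
      by simp
  qed
  have mono: "m r \<le> m r'" if "r \<le> r'" for r r'
    unfolding m_def using meas that by (intro measure_mono_fmeasurable) (auto simp: fmeasurableD)
  have cont: "continuous_on {0..R} m" for R
  proof -
    define w where "w r = measure lebesgue (cball (0::'a) r)" for r
    have w: "w r = unit_ball_vol (DIM('a)) * r ^ DIM('a)" if "r \<ge> 0" for r
      using that content_cball[of r "0::'a"] by (simp add: w_def)
    have "continuous_on {0..R} (\<lambda>r. unit_ball_vol (DIM('a)) * r ^ DIM('a))"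
      by (intro continuous_intros)
    then have cw: "continuous_on {0..R} w"
      by (rule continuous_on_eq) (simp add: w)
    have dist_le: "dist (m r) (m r') \<le> dist (w r) (w r')" for r r'
      using lip[of r r'] lip[of r' r] mono[of r r'] mono[of r' r]
      by (cases "r \<le> r'") (auto simp: dist_real_def w_def)
    show ?thesis
      unfolding continuous_on_iff
    proof (intro ballI allI impI)
      fix x and e :: real
      assume "x \<in> {0..R}" "e > 0"
      then obtain d where "d > 0" "\<forall>x'\<in>{0..R}. dist x' x < d \<longrightarrow> dist (w x') (w x) < e"
        using cw unfolding continuous_on_iff by blast
      then show "\<exists>d>0. \<forall>x'\<in>{0..R}. dist x' x < d \<longrightarrow> dist (m x') (m x) < e"
        using dist_le le_less_trans by blast
    qed
  qed
  have "(\<lambda>n. measure lebesgue (A \<inter> cball 0 (real n))) \<longlonglongrightarrow> measure lebesgue (\<Union>n. A \<inter> cball 0 (real n))"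
  proof (rule Lim_measure_incseq)
    show "incseq (\<lambda>n. A \<inter> cball 0 (real n))"
      by (auto simp: incseq_def)
    have "(\<Union>n. A \<inter> cball 0 (real n)) \<subseteq> A"
      by auto
    then show "emeasure lebesgue (\<Union>n. A \<inter> cball 0 (real n)) \<noteq> \<infinity>"
      using A by (metis emeasure_mono fmeasurableD fmeasurableD2 top.not_eq_extremum infinity_ennreal_def order_le_less_trans)
  qed (use meas fmeasurableD in blast)
  moreover have "(\<Union>n. A \<inter> cball 0 (real n)) = A"
    using real_arch_simple by (auto simp: mem_cball)
  ultimately have "(\<lambda>n. m (real n)) \<longlonglongrightarrow> measure lebesgue A"
    by (simp add: m_def)
  moreover have "t < measure lebesgue A"
    using False t by simp
  ultimately have "\<forall>\<^sub>F n in sequentially. t < m (real n)"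
    by (rule order_tendstoD)
  then obtain n :: nat where n: "t < m (real n)"
    by (auto simp: eventually_sequentially)
  have "m 0 = 0"
  proof -
    have "m 0 \<le> measure lebesgue (cball (0::'a) 0)"
      unfolding m_def by (rule measure_mono_fmeasurable[OF _ fmeasurableD[OF meas] lmeasurable_cball]) simp
    then show ?thesis
      by (intro antisym) (simp_all add: m_def)
  qed
  then obtain r where "r \<ge> 0" "m r = t"
    using IVT'[of m 0 t "real n"] cont n t by auto
  then show thesis
    using that[of "A \<inter> cball 0 r"] meas by (auto simp: m_def)
qed

text \<open>The threshold \<open>l\<close> is a quantile of \<open>u\<close> on \<open>E\<close>:
  the set \<open>u > l\<close> has measure at most \<open>t\<close>, the set
  \<open>u \<ge> l\<close> at least \<open>t\<close>. A piece of the plateau \<open>u = l\<close>,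
  of the missing measure, completes the slice.\<close>

lemma top_slice:
  fixes E :: "'a::euclidean_space set" and u :: "'a \<Rightarrow> real"
  assumes E: "E \<in> lmeasurable" and u[measurable]: "u \<in> borel_measurable lebesgue"
    and u0: "\<And>x. u x \<ge> 0" and t: "0 < t" "t \<le> measure lebesgue E"
  obtains P l where "P \<in> lmeasurable" "P \<subseteq> E" "measure lebesgue P = t" "l \<ge> 0"
    "\<And>x. x \<in> P \<Longrightarrow> l \<le> u x" "\<And>x. x \<in> E - P \<Longrightarrow> u x \<le> l"
proof (cases "t = measure lebesgue E")
  case True
  then show thesis
    using that[of E 0] E u0 by auto
next
  case False
  have Eu: "{x \<in> E. Q (u x)} \<in> lmeasurable" if "{y. Q y} \<in> sets borel" for Q
  proof -
    have "u -` {y. Q y} \<inter> space lebesgue \<in> sets lebesgue"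
      using u that by (rule measurable_sets)
    with E have "E \<inter> (u -` {y. Q y} \<inter> space lebesgue) \<in> lmeasurable"
      by (rule fmeasurable_Int_fmeasurable)
    moreover have "E \<inter> (u -` {y. Q y} \<inter> space lebesgue) = {x \<in> E. Q (u x)}"
      by auto
    ultimately show ?thesis
      by simp
  qed
  have meas_gt: "{x \<in> E. u x > l} \<in> lmeasurable" for l
    by (rule Eu) (simp add: greaterThan_def[symmetric])
  define D where "D l = measure lebesgue {x \<in> E. u x > l}" for l
  have D_mono: "D l' \<le> D l" if "l \<le> l'" for l l'
    unfolding D_def using meas_gt that by (intro measure_mono_fmeasurable) (auto simp: fmeasurableD)
  have fin: "emeasure lebesgue S \<noteq> \<infinity>" if "S \<subseteq> E" for S
    using E that by (metis emeasure_mono fmeasurableD fmeasurableD2 infinity_ennreal_def neq_top_trans)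
  define T where "T = {l. l \<ge> 0 \<and> D l \<le> t}"
  have "(\<lambda>n. D (real n)) \<longlonglongrightarrow> measure lebesgue (\<Inter>n. {x \<in> E. u x > real n})"
    unfolding D_def
  proof (rule Lim_measure_decseq)
    show "emeasure lebesgue {x \<in> E. u x > real n} \<noteq> \<infinity>" for n
      by (rule fin) auto
  qed (use meas_gt in \<open>auto simp: decseq_def fmeasurableD intro: order_le_less_trans\<close>)
  moreover have "(\<Inter>n. {x \<in> E. u x > real n}) = {}"
    using real_arch_simple not_less by fastforce
  ultimately have "(\<lambda>n. D (real n)) \<longlonglongrightarrow> 0"
    by simp
  then have "\<forall>\<^sub>F n in sequentially. D (real n) < t"
    using t(1) by (rule order_tendstoD)
  then obtain n :: nat where "D (real n) < t"
    by (auto simp: eventually_sequentially)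
  then have T_ne: "T \<noteq> {}"
    by (auto simp: T_def intro!: exI[of _ "real n"])
  have T_bdd: "bdd_below T"
    by (rule bdd_belowI[of _ 0]) (simp add: T_def)
  define l where "l = Inf T"
  have "l \<ge> 0"
    unfolding l_def by (rule cInf_greatest[OF T_ne]) (simp add: T_def)
  have "D l \<le> t"
  proof -
    have le: "D (l + inverse (real (Suc n))) \<le> t" for n
    proof -
      have "\<exists>l'\<in>T. l' < l + inverse (real (Suc n))"
        using cInf_less_iff[OF T_ne T_bdd, of "l + inverse (real (Suc n))"] by (simp add: l_def)
      then obtain l' where "l' \<in> T" "l' < l + inverse (real (Suc n))"
        by blast
      then show ?thesis
        using D_mono[of l' "l + inverse (real (Suc n))"] by (auto simp: T_def)
    qed
    have "(\<lambda>n. D (l + inverse (real (Suc n)))) \<longlonglongrightarrow> measure lebesgue (\<Union>n. {x \<in> E. u x > l + inverse (real (Suc n))})"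
      unfolding D_def
    proof (rule Lim_measure_incseq)
      have "inverse (real (Suc n)) \<le> inverse (real (Suc m))" if "m \<le> n" for m n
        using that by simp
      then show "incseq (\<lambda>n. {x \<in> E. u x > l + inverse (real (Suc n))})"
        unfolding incseq_def by (intro allI impI Collect_mono conj_mono) (simp, smt (verit))
      show "emeasure lebesgue (\<Union>n. {x \<in> E. u x > l + inverse (real (Suc n))}) \<noteq> \<infinity>"
        by (rule fin) auto
    qed (use meas_gt in \<open>auto simp: fmeasurableD\<close>)
    moreover have "(\<Union>n. {x \<in> E. u x > l + inverse (real (Suc n))}) = {x \<in> E. u x > l}"
    proof (intro equalityI subsetI)
      fix x
      assume "x \<in> {x \<in> E. u x > l}"
      then obtain n where "inverse (real (Suc n)) < u x - l"
        using reals_Archimedean[of "u x - l"] by auto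
      then show "x \<in> (\<Union>n. {x \<in> E. u x > l + inverse (real (Suc n))})"
        using \<open>x \<in> _\<close> by (auto simp: algebra_simps)
    next
      fix x
      assume "x \<in> (\<Union>n. {x \<in> E. u x > l + inverse (real (Suc n))})"
      then obtain n where "x \<in> E" "l + inverse (real (Suc n)) < u x"
        by blast
      moreover have "0 < inverse (real (Suc n))"
        by simp
      ultimately show "x \<in> {x \<in> E. u x > l}"
        by (simp del: of_nat_Suc inverse_positive_iff_positive)
    qed
    ultimately have "(\<lambda>n. D (l + inverse (real (Suc n)))) \<longlonglongrightarrow> D l"
      by (simp add: D_def)
    then show ?thesis
      using le by (intro LIMSEQ_le_const2) auto
  qed
  have meas_ge: "{x \<in> E. u x \<ge> l} \<in> lmeasurable" for l
    by (rule Eu) (simp add: atLeast_def[symmetric])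
  \<comment> \<open>For \<open>l = 0\<close> the set is all of \<open>E\<close>. Otherwise the
    thresholds approach \<open>l\<close> from below by fractions of \<open>l\<close>: they stay
    nonnegative, so they would belong to \<open>T\<close>, against \<open>l = Inf T\<close>, if
    \<open>D\<close> were at most \<open>t\<close> there.\<close>
  have "t \<le> measure lebesgue {x \<in> E. u x \<ge> l}"
  proof (cases "l = 0")
    case True
    then have "{x \<in> E. u x \<ge> l} = E"
      using u0 by auto
    then show ?thesis
      using t by simp
  next
    case False
    then have "l > 0"
      using \<open>l \<ge> 0\<close> by simp
    have ge: "t \<le> D (l - inverse (real (Suc n)) * l)" for n
    proof (rule ccontr)
      assume "\<not> t \<le> D (l - inverse (real (Suc n)) * l)"
      moreover have "inverse (real (Suc n)) * l \<le> l"
        using \<open>l > 0\<close> by (simp add: field_simps)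
      ultimately have "l - inverse (real (Suc n)) * l \<in> T"
        by (simp add: T_def)
      then have "l \<le> l - inverse (real (Suc n)) * l"
        unfolding l_def by (intro cInf_lower T_bdd) (simp add: l_def)
      then show False
        using \<open>l > 0\<close> by (simp add: field_simps)
    qed
    have "(\<lambda>n. D (l - inverse (real (Suc n)) * l)) \<longlonglongrightarrow> measure lebesgue (\<Inter>n. {x \<in> E. u x > l - inverse (real (Suc n)) * l})"
      unfolding D_def
    proof (rule Lim_measure_decseq)
      have "inverse (real (Suc n)) * l \<le> inverse (real (Suc m)) * l" if "m \<le> n" for m n
        using that \<open>l > 0\<close> by (intro mult_right_mono) simp_all
      then show "decseq (\<lambda>n. {x \<in> E. u x > l - inverse (real (Suc n)) * l})"
        unfolding decseq_def by (intro allI impI Collect_mono conj_mono) (simp, smt (verit))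
      show "emeasure lebesgue {x \<in> E. u x > l - inverse (real (Suc n)) * l} \<noteq> \<infinity>" for n
        by (rule fin) auto
    qed (use meas_gt in \<open>auto simp: fmeasurableD\<close>)
    moreover have "(\<Inter>n. {x \<in> E. u x > l - inverse (real (Suc n)) * l}) = {x \<in> E. u x \<ge> l}"
    proof (intro equalityI subsetI)
      fix x
      assume x: "x \<in> (\<Inter>n. {x \<in> E. u x > l - inverse (real (Suc n)) * l})"
      have "(\<lambda>n. l - inverse (real (Suc n)) * l) \<longlonglongrightarrow> l - 0 * l"
        by (intro tendsto_intros LIMSEQ_inverse_real_of_nat)
      then have "l \<le> u x"
        using x by (intro LIMSEQ_le_const2[of "\<lambda>n. l - inverse (real (Suc n)) * l"]) (auto intro: less_imp_le)
      then show "x \<in> {x \<in> E. u x \<ge> l}"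
        using x by auto
    next
      fix x
      assume "x \<in> {x \<in> E. u x \<ge> l}"
      moreover have "l - inverse (real (Suc n)) * l < l" for n
        using \<open>l > 0\<close> by simp
      then have "l - inverse (real (Suc n)) * l < u x" if "l \<le> u x" for n
        using that less_le_trans by blast
      ultimately show "x \<in> (\<Inter>n. {x \<in> E. u x > l - inverse (real (Suc n)) * l})"
        by blast
    qed
    ultimately show ?thesis
      using ge by (intro LIMSEQ_le_const) auto
  qed
  also have "\<dots> = D l + measure lebesgue {x \<in> E. u x = l}"
  proof -
    have eq: "{x \<in> E. u x \<ge> l} = {x \<in> E. u x > l} \<union> {x \<in> E. u x = l}"
      by auto
    show ?thesis
      unfolding D_def eq by (intro measure_Un_AE AE_I2 meas_gt Eu[of "\<lambda>y. y = l"]) auto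
  qed
  finally have "t - D l \<le> measure lebesgue {x \<in> E. u x = l}"
    by simp
  then obtain Q where Q: "Q \<in> lmeasurable" "Q \<subseteq> {x \<in> E. u x = l}" "measure lebesgue Q = t - D l"
    using nonatomic_subset[OF Eu[of "\<lambda>y. y = l"], of "t - D l"] \<open>D l \<le> t\<close> by auto
  show thesis
  proof (rule that[of "{x \<in> E. u x > l} \<union> Q" l])
    have "measure lebesgue ({x \<in> E. u x > l} \<union> Q) = D l + measure lebesgue Q"
      unfolding D_def using Q by (intro measure_Un_AE AE_I2 meas_gt) auto
    then show "measure lebesgue ({x \<in> E. u x > l} \<union> Q) = t"
      using Q by simp
  qed (use Q meas_gt \<open>l \<ge> 0\<close> in auto)
qed

text \<open>Take the top slice of measure \<open>\<delta>\<close> and repeat on the rest. The slices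
  are ordered: on the next one \<open>u\<close> does not exceed the lower bound \<open>l j\<close>
  of the previous one. This ordering later bounds the integral of \<open>u\<close> by the lower
  bounds alone, apart from the first slice.\<close>

lemma equal_slices:
  fixes E :: "'a::euclidean_space set" and u :: "'a \<Rightarrow> real"
  assumes u: "u \<in> borel_measurable lebesgue" and u0: "\<And>x. u x \<ge> 0" and "\<delta> > 0"
  shows "E \<in> lmeasurable \<Longrightarrow> measure lebesgue E = real N * \<delta> \<Longrightarrow>
    \<exists>P l. (\<forall>j<N. P j \<in> lmeasurable \<and> measure lebesgue (P j) = \<delta> \<and> 0 \<le> l j \<and> (\<forall>x\<in>P j. l j \<le> u x)) \<and>
      disjoint_family_on P {..<N} \<and> (\<Union>j<N. P j) \<subseteq> E \<and> measure lebesgue (E - (\<Union>j<N. P j)) = 0 \<and>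
      (\<forall>j. Suc j < N \<longrightarrow> (\<forall>x\<in>P (Suc j). u x \<le> l j))"
proof (induction N arbitrary: E)
  case 0
  then show ?case
    by (simp add: disjoint_family_on_def)
next
  case (Suc N)
  have "0 < \<delta>" "\<delta> \<le> measure lebesgue E"
    using Suc.prems \<open>\<delta> > 0\<close> by (auto simp: algebra_simps)
  then obtain P0 l0 where P0: "P0 \<in> lmeasurable" "P0 \<subseteq> E" "measure lebesgue P0 = \<delta>" "l0 \<ge> 0"
    "\<And>x. x \<in> P0 \<Longrightarrow> l0 \<le> u x" "\<And>x. x \<in> E - P0 \<Longrightarrow> u x \<le> l0"
    using top_slice[OF Suc.prems(1) u u0] by metis
  have "E - P0 \<in> lmeasurable"
    using Suc.prems P0 by (intro fmeasurable_Diff) (auto simp: fmeasurableD)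
  moreover have "measure lebesgue (E - P0) = real N * \<delta>"
    using Suc.prems P0 by (subst measurable_measure_Diff) (auto simp: fmeasurableD algebra_simps)
  ultimately obtain P l where
    P: "\<forall>j<N. P j \<in> lmeasurable \<and> measure lebesgue (P j) = \<delta> \<and> 0 \<le> l j \<and> (\<forall>x\<in>P j. l j \<le> u x)"
    and disj: "disjoint_family_on P {..<N}" and sub: "(\<Union>j<N. P j) \<subseteq> E - P0"
    and null: "measure lebesgue ((E - P0) - (\<Union>j<N. P j)) = 0"
    and ord: "\<forall>j. Suc j < N \<longrightarrow> (\<forall>x\<in>P (Suc j). u x \<le> l j)"
    using Suc.IH by metis
  have Un: "(\<Union>j<Suc N. case_nat P0 P j) = P0 \<union> (\<Union>j<N. P j)"
    by (simp add: lessThan_Suc_eq_insert_0)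
  have "disjoint_family_on (case_nat P0 P) {..<Suc N}"
    unfolding disjoint_family_on_def
  proof (intro ballI impI)
    fix i j
    assume "i \<in> {..<Suc N}" "j \<in> {..<Suc N}" "i \<noteq> j"
    then show "case_nat P0 P i \<inter> case_nat P0 P j = {}"
      using disj sub by (cases i; cases j) (auto simp: disjoint_family_on_def)
  qed
  moreover have "(\<Union>j<Suc N. case_nat P0 P j) \<subseteq> E"
    using sub P0(2) unfolding Un by auto
  moreover have "measure lebesgue (E - (\<Union>j<Suc N. case_nat P0 P j)) = 0"
    using null unfolding Un by (simp add: Diff_eq Int_assoc)
  moreover have "\<forall>j<Suc N. case_nat P0 P j \<in> lmeasurable \<and> measure lebesgue (case_nat P0 P j) = \<delta> \<and>
      0 \<le> case_nat l0 l j \<and> (\<forall>x\<in>case_nat P0 P j. case_nat l0 l j \<le> u x)"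
    using P P0 by (auto simp: less_Suc_eq_0_disj)
  moreover have "\<forall>j. Suc j < Suc N \<longrightarrow> (\<forall>x\<in>case_nat P0 P (Suc j). u x \<le> case_nat l0 l j)"
  proof (intro allI impI ballI)
    fix j x
    assume "Suc j < Suc N" "x \<in> case_nat P0 P (Suc j)"
    then show "u x \<le> case_nat l0 l j"
      using ord sub P0(6) by (cases j) auto
  qed
  ultimately show ?case
    by blast
qed

subsection \<open>Function norms\<close>

lemma norm_eq_0_iff:
  assumes "banach_function_norm M \<rho>"
  shows "f \<in> borel_measurable M \<Longrightarrow> \<rho> f = 0 \<longleftrightarrow> (AE x in M. f x = 0)"
  using assms[unfolded banach_function_norm_def, THEN conjunct1] by (rule bspec)

lemma norm_cmult:
  assumes "banach_function_norm M \<rho>"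
  shows "f \<in> borel_measurable M \<Longrightarrow> c \<ge> 0 \<Longrightarrow> \<rho> (\<lambda>x. ennreal c * f x) = ennreal c * \<rho> f"
  using assms[unfolded banach_function_norm_def, THEN conjunct2, THEN conjunct1] by simp

lemma norm_add:
  assumes "banach_function_norm M \<rho>"
  shows "f \<in> borel_measurable M \<Longrightarrow> g \<in> borel_measurable M \<Longrightarrow> \<rho> (\<lambda>x. f x + g x) \<le> \<rho> f + \<rho> g"
  using assms[unfolded banach_function_norm_def, THEN conjunct2, THEN conjunct2, THEN conjunct1] by simp

lemma norm_mono:
  assumes "banach_function_norm M \<rho>"
  shows "f \<in> borel_measurable M \<Longrightarrow> g \<in> borel_measurable M \<Longrightarrow> (AE x in M. g x \<le> f x) \<Longrightarrow> \<rho> g \<le> \<rho> f"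
  using assms[unfolded banach_function_norm_def, THEN conjunct2, THEN conjunct2, THEN conjunct2, THEN conjunct1] by simp

lemma norm_fatou:
  assumes "banach_function_norm M \<rho>"
  shows "(\<And>i::nat. F i \<in> borel_measurable M) \<Longrightarrow> f \<in> borel_measurable M \<Longrightarrow>
      (AE x in M. incseq (\<lambda>i. F i x) \<and> (\<lambda>i. F i x) \<longlonglongrightarrow> f x) \<Longrightarrow> (\<lambda>i. \<rho> (F i)) \<longlonglongrightarrow> \<rho> f"
  using assms[unfolded banach_function_norm_def, THEN conjunct2, THEN conjunct2, THEN conjunct2, THEN conjunct2,
      THEN conjunct1, rule_format, of F f] by simp

lemma norm_indicator_finite:
  assumes "banach_function_norm M \<rho>"
  shows "E \<in> sets M \<Longrightarrow> emeasure M E < \<infinity> \<Longrightarrow> \<rho> (indicator E) < \<infinity>"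
  using assms[unfolded banach_function_norm_def, THEN conjunct2, THEN conjunct2, THEN conjunct2, THEN conjunct2,
      THEN conjunct2, THEN conjunct1] by simp

lemma norm_L1:
  assumes "banach_function_norm M \<rho>"
  shows "E \<in> sets M \<Longrightarrow> emeasure M E < \<infinity> \<Longrightarrow>
      \<exists>C::real. C > 0 \<and> (\<forall>f\<in>borel_measurable M. (\<integral>\<^sup>+x\<in>E. f x \<partial>M) \<le> ennreal C * \<rho> f)"
  using assms[unfolded banach_function_norm_def, THEN conjunct2, THEN conjunct2, THEN conjunct2, THEN conjunct2,
      THEN conjunct2, THEN conjunct2] by simp

lemma norm_sum:
  assumes \<rho>: "banach_function_norm M \<rho>" and "finite I" and F: "\<And>i. i \<in> I \<Longrightarrow> F i \<in> borel_measurable M"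
  shows "\<rho> (\<lambda>x. \<Sum>i\<in>I. F i x) \<le> (\<Sum>i\<in>I. \<rho> (F i))"
  using \<open>finite I\<close> F
proof (induction I)
  case empty
  have "\<rho> (\<lambda>x. 0) = 0"
    by (subst norm_eq_0_iff[OF \<rho>]) auto
  then show ?case
    by simp
next
  case (insert i I)
  have "\<rho> (\<lambda>x. F i x + (\<Sum>i\<in>I. F i x)) \<le> \<rho> (F i) + \<rho> (\<lambda>x. \<Sum>i\<in>I. F i x)"
    using insert by (intro norm_add[OF \<rho>]) auto
  also have "\<dots> \<le> \<rho> (F i) + (\<Sum>i\<in>I. \<rho> (F i))"
    using insert by (intro add_left_mono) auto
  finally show ?case
    using insert by simp
qed

text \<open>Finite subadditivity combined with the Fatou property (P3) for the partial sums.\<close>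

lemma norm_suminf:
  assumes \<rho>: "banach_function_norm M \<rho>" and F: "\<And>i. F i \<in> borel_measurable M"
  shows "\<rho> (\<lambda>x. \<Sum>i. F i x) \<le> (\<Sum>i. \<rho> (F i))"
proof -
  have "(\<lambda>n. \<rho> (\<lambda>x. \<Sum>i<n. F i x)) \<longlonglongrightarrow> \<rho> (\<lambda>x. \<Sum>i. F i x)"
    using F by (intro norm_fatou[OF \<rho>])
      (auto intro!: AE_I2 incseq_sumI summable_LIMSEQ)
  moreover have "(\<lambda>n. \<Sum>i<n. \<rho> (F i)) \<longlonglongrightarrow> (\<Sum>i. \<rho> (F i))"
    by (intro summable_LIMSEQ) auto
  ultimately show ?thesis
    using F by (intro LIMSEQ_le) (auto intro!: norm_sum[OF \<rho>])
qed

lemma ri_imp_bfn: "ri_function_norm M \<rho> \<Longrightarrow> banach_function_norm M \<rho>"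
  by (simp add: ri_function_norm_def)

lemma ri_norm_eq:
  "ri_function_norm M \<rho> \<Longrightarrow> f \<in> borel_measurable M \<Longrightarrow> g \<in> borel_measurable M \<Longrightarrow>
   (\<And>x. f x < \<infinity>) \<Longrightarrow> (\<And>x. g x < \<infinity>) \<Longrightarrow> equimeasurable M f g \<Longrightarrow> \<rho> f = \<rho> g"
  unfolding ri_function_norm_def by blast

lemma bij_betw_subset_preimage:
  assumes "bij_betw f A B" "C = {x \<in> A. f x \<in> D}" "D \<subseteq> B"
  shows "bij_betw f C D"
proof (rule bij_betw_subset[OF assms(1)])
  show "C \<subseteq> A"
    using assms(2) by auto
  show "f ` C = D"
    using assms by (force simp: bij_betw_def)
qed

lemma bij_betw_add_mod:
  "bij_betw (\<lambda>j. (j + k) mod N) {..<N} {..<N :: nat}"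
proof -
  have "inj_on (\<lambda>j. (j + k) mod N) {..<N}"
  proof (intro linorder_inj_onI)
    fix i j
    assume "i < j" "i \<in> {..<N}" "j \<in> {..<N}"
    show "(i + k) mod N \<noteq> (j + k) mod N"
    proof
      assume "(i + k) mod N = (j + k) mod N"
      then have "N dvd (j + k) - (i + k)"
        using \<open>i < j\<close> by (metis add_le_cancel_right less_imp_le mod_eq_dvd_iff_nat)
      then show False
        using \<open>i < j\<close> \<open>j \<in> {..<N}\<close> by (auto dest!: dvd_imp_le)
    qed
  qed auto
  moreover have "(\<lambda>j. (j + k) mod N) ` {..<N} \<subseteq> {..<N}"
    by (cases "N = 0") auto
  ultimately show ?thesis
    by (simp add: bij_betw_def endo_inj_surj)
qed

text \<open>The average of a step function on \<open>N\<close> sets of equal measure over all cyclic permutations of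
  its values is constant, and all these permutations are equimeasurable.\<close>

lemma ri_cyclic_average:
  fixes P :: "nat \<Rightarrow> 'a set" and l :: "nat \<Rightarrow> real"
  assumes ri: "ri_function_norm M \<rho>" and "N > 0"
    and P: "\<And>j. j < N \<Longrightarrow> P j \<in> sets M" "\<And>j. j < N \<Longrightarrow> emeasure M (P j) = \<delta>"
    and disj: "disjoint_family_on P {..<N}" and l: "\<And>j. j < N \<Longrightarrow> l j \<ge> 0"
    and f: "f \<in> borel_measurable M" "\<And>j x. j < N \<Longrightarrow> x \<in> P j \<Longrightarrow> ennreal (l j) \<le> f x"
  shows "ennreal (\<Sum>j<N. l j) * \<rho> (indicator (\<Union>j<N. P j)) \<le> of_nat N * \<rho> f"
proof -
  note \<rho> = ri_imp_bfn[OF ri]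
  define S where "S k x = (\<Sum>j<N. ennreal (l ((j + k) mod N)) * indicator (P j) x)" for k x
  have S_in: "S k x = ennreal (l ((j + k) mod N))" if "x \<in> P j" "j < N" for k x j
  proof -
    have "S k x = (\<Sum>i<N. if i = j then ennreal (l ((i + k) mod N)) else 0)"
      unfolding S_def using that disj
      by (intro sum.cong) (auto simp: indicator_def disjoint_family_on_def)
    then show ?thesis
      using that by simp
  qed
  have S_out: "S k x = 0" if "x \<notin> (\<Union>j<N. P j)" for k x
    using that by (auto simp: S_def)
  have S_meas[measurable]: "S k \<in> borel_measurable M" for k
    unfolding S_def[abs_def] using P(1) by (intro borel_measurable_sum borel_measurable_times) auto
  have S_fin: "S k x < \<infinity>" for k x
    by (auto simp: S_def ennreal_mult_less_top sum_ennreal indicator_def)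
  \<comment> \<open>A superlevel set consists of the pieces with large value. Its measure depends
    only on their number, which a rotation of the values does not change.\<close>
  have level: "emeasure M {x \<in> space M. S k x > \<tau>} = of_nat (card {j \<in> {..<N}. ennreal (l j) > \<tau>}) * \<delta>" for k \<tau>
  proof -
    define J where "J = {j \<in> {..<N}. ennreal (l ((j + k) mod N)) > \<tau>}"
    have "{x \<in> space M. S k x > \<tau>} = (\<Union>j\<in>J. P j)"
    proof (intro equalityI subsetI)
      fix x
      assume x: "x \<in> {x \<in> space M. S k x > \<tau>}"
      have "x \<in> (\<Union>j<N. P j)"
        using x S_out[of x k] by (cases "x \<in> (\<Union>j<N. P j)") simp_all
      then obtain j where "j < N" "x \<in> P j"
        by auto
      then show "x \<in> (\<Union>j\<in>J. P j)"
        using x S_in[of x j k] by (auto simp: J_def)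
    next
      fix x
      assume "x \<in> (\<Union>j\<in>J. P j)"
      then obtain j where "j < N" "x \<in> P j" "ennreal (l ((j + k) mod N)) > \<tau>"
        by (auto simp: J_def)
      then show "x \<in> {x \<in> space M. S k x > \<tau>}"
        using S_in[of x j k] P(1)[of j] sets.sets_into_space by auto
    qed
    then have "emeasure M {x \<in> space M. S k x > \<tau>} = (\<Sum>j\<in>J. emeasure M (P j))"
      using P(1) disj by (simp, intro sum_emeasure[symmetric])
        (auto simp: J_def disjoint_family_on_def)
    also have "\<dots> = of_nat (card J) * \<delta>"
      using P(2) by (simp add: J_def)
    also have "card J = card {j \<in> {..<N}. ennreal (l j) > \<tau>}"
    proof (rule bij_betw_same_card)
      show "bij_betw (\<lambda>j. (j + k) mod N) J {j \<in> {..<N}. ennreal (l j) > \<tau>}"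
      proof (rule bij_betw_subset_preimage)
        show "bij_betw (\<lambda>j. (j + k) mod N) {..<N} {..<N}"
          by (rule bij_betw_add_mod)
      qed (auto simp: J_def)
    qed
    finally show ?thesis .
  qed
  have S_eq: "\<rho> (S k) = \<rho> (S 0)" for k
    by (rule ri_norm_eq[OF ri]) (auto simp: S_fin[unfolded infinity_ennreal_def] equimeasurable_def level)
  have "ennreal (\<Sum>j<N. l j) * \<rho> (indicator (\<Union>j<N. P j)) = \<rho> (\<lambda>x. ennreal (\<Sum>j<N. l j) * indicator (\<Union>j<N. P j) x)"
    using P(1) l by (intro norm_cmult[OF \<rho>, symmetric] borel_measurable_indicator sum_nonneg) auto
  \<comment> \<open>At a fixed point of \<open>P j\<close> the rotations run through all values
    once, so the sum over \<open>k\<close> is the total of the values on every piece.\<close>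
  also have "(\<lambda>x. ennreal (\<Sum>j<N. l j) * indicator (\<Union>j<N. P j) x) = (\<lambda>x. \<Sum>k<N. S k x)"
  proof
    fix x
    show "ennreal (\<Sum>j<N. l j) * indicator (\<Union>j<N. P j) x = (\<Sum>k<N. S k x)"
    proof (cases "x \<in> (\<Union>j<N. P j)")
      case True
      then obtain j where j: "j < N" "x \<in> P j"
        by auto
      have "(\<Sum>k<N. S k x) = (\<Sum>k<N. ennreal (l ((k + j) mod N)))"
        using S_in[OF j(2,1)] by (simp add: add.commute)
      also have "\<dots> = (\<Sum>k<N. ennreal (l k))"
        by (rule sum.reindex_bij_betw[OF bij_betw_add_mod])
      also have "\<dots> = ennreal (\<Sum>j<N. l j)"
        using l by (intro sum_ennreal) auto
      finally show ?thesis
        using True by simp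
    next
      case False
      then show ?thesis
        using S_out by (simp add: indicator_def)
    qed
  qed
  also have "\<rho> (\<lambda>x. \<Sum>k<N. S k x) \<le> (\<Sum>k<N. \<rho> (S k))"
    by (rule norm_sum[OF \<rho>]) auto
  also have "\<dots> = (\<Sum>k<N. \<rho> (S 0))"
    by (intro sum.cong refl S_eq)
  also have "\<dots> = of_nat N * \<rho> (S 0)"
    by simp
  also have "\<dots> \<le> of_nat N * \<rho> f"
  proof (intro mult_left_mono norm_mono[OF \<rho>] AE_I2 f)
    fix x
    show "S 0 x \<le> f x"
    proof (cases "x \<in> (\<Union>j<N. P j)")
      case True
      then obtain j where "j < N" "x \<in> P j"
        by auto
      then show ?thesis
        using S_in[of x j 0] f(2) by simp
    qed (simp add: S_out)
  qed auto
  finally show ?thesis .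
qed

section \<open>Averages over sets in a rearrangement invariant norm\<close>

lemma emeasure_lebesgue_on:
  "G \<in> sets lebesgue \<Longrightarrow> A \<subseteq> G \<Longrightarrow> emeasure (lebesgue_on G) A = emeasure lebesgue A"
  by (simp add: emeasure_restrict_space)

lemma sets_lebesgue_on_iff: "G \<in> sets lebesgue \<Longrightarrow> A \<in> sets (lebesgue_on G) \<longleftrightarrow> A \<subseteq> G \<and> A \<in> sets lebesgue"
  by (auto simp: sets_restrict_space_iff)

lemma measurable_lebesgue_on: "u \<in> measurable lebesgue N \<Longrightarrow> u \<in> measurable (lebesgue_on G) N"
  by (simp add: measurable_restrict_space1)

lemma nn_integral_lebesgue_on:
  assumes "G \<in> sets lebesgue" "A \<subseteq> G"
  shows "(\<integral>\<^sup>+x\<in>A. f x \<partial>lebesgue_on G) = (\<integral>\<^sup>+x\<in>A. f x \<partial>lebesgue)"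
  using assms by (subst nn_integral_restrict_space) (auto intro!: nn_integral_cong simp: indicator_def)

text \<open>The mean of \<open>u\<close> over \<open>E\<close>, placed on \<open>E\<close>, has no
  larger r.i. norm than \<open>u\<close>; the inequality is this fact multiplied out. With
  \<open>E\<close> cut into \<open>N\<close> ordered slices, cyclic averaging proves it for the
  lower step function of \<open>u\<close>. The integral of \<open>u\<close> exceeds that of the step
  function by at most \<open>B \<delta>\<close>, which tends to \<open>0\<close>.\<close>

lemma ri_average_bounded:
  fixes u :: "'a::euclidean_space \<Rightarrow> real"
  assumes ri: "ri_function_norm (lebesgue_on G) \<rho>" and G: "G \<in> sets lebesgue"
    and E: "E \<in> lmeasurable" "E \<subseteq> G"
    and u: "u \<in> borel_measurable lebesgue" "\<And>x. 0 \<le> u x" "\<And>x. u x \<le> B"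
  shows "\<rho> (indicator E) * (\<integral>\<^sup>+x\<in>E. ennreal (u x) \<partial>lebesgue) \<le> ennreal (measure lebesgue E) * \<rho> (\<lambda>x. ennreal (u x))"
\<comment> \<open>The degenerate cases are separated because \<open>0\<close> times infinity is
  \<open>0\<close> in \<open>ennreal\<close>; in the remaining case all quantities are real
  numbers.\<close>
proof (cases "measure lebesgue E = 0 \<or> \<rho> (\<lambda>x. ennreal (u x)) = \<infinity>")
  case True
  then show ?thesis
  proof
    assume "measure lebesgue E = 0"
    then have "E \<in> null_sets lebesgue"
      using E(1) by (metis emeasure_eq_measure2 ennreal_0 fmeasurableD null_setsI)
    then have "(\<integral>\<^sup>+x\<in>E. ennreal (u x) \<partial>lebesgue) = 0"
      by (rule nn_integral_null_set)
    then show ?thesis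
      by simp
  next
    assume inf: "\<rho> (\<lambda>x. ennreal (u x)) = \<infinity>"
    show ?thesis
    proof (cases "measure lebesgue E = 0")
      case True
      then have "E \<in> null_sets lebesgue"
        using E(1) by (metis emeasure_eq_measure2 ennreal_0 fmeasurableD null_setsI)
      then have "(\<integral>\<^sup>+x\<in>E. ennreal (u x) \<partial>lebesgue) = 0"
        by (rule nn_integral_null_set)
      then show ?thesis
        by simp
    next
      case False
      then have "measure lebesgue E > 0"
        by (simp add: zero_less_measure_iff)
      then show ?thesis
        using inf by (simp add: ennreal_mult_top)
    qed
  qed
next
  case False
  define s where "s = measure lebesgue E"
  note \<rho> = ri_imp_bfn[OF ri]
  have "s > 0"
    using False by (simp add: s_def zero_less_measure_iff)
  have "B \<ge> 0"
    using u(2,3) order_trans by blast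
  have emE: "emeasure lebesgue E = ennreal s"
    using E(1) by (simp add: s_def emeasure_eq_measure2)
  have u_on: "(\<lambda>x. ennreal (u x)) \<in> borel_measurable (lebesgue_on G)"
    using u(1) by (intro measurable_lebesgue_on) auto
  obtain b where b: "\<rho> (\<lambda>x. ennreal (u x)) = ennreal b" "b \<ge> 0"
    using False by (cases "\<rho> (\<lambda>x. ennreal (u x))") auto
  have "\<rho> (indicator E) < \<infinity>"
    using E G emE by (intro norm_indicator_finite[OF \<rho>])
      (auto simp: sets_lebesgue_on_iff fmeasurableD emeasure_lebesgue_on)
  then obtain a where a: "\<rho> (indicator E) = ennreal a" "a \<ge> 0"
    by (cases "\<rho> (indicator E)") auto
  define I where "I = (\<integral>\<^sup>+x\<in>E. ennreal (u x) \<partial>lebesgue)"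
  have "I \<le> (\<integral>\<^sup>+x\<in>E. ennreal B \<partial>lebesgue)"
    unfolding I_def using u(3) by (intro nn_integral_mono) (auto simp: indicator_def intro!: ennreal_leI)
  also have "\<dots> = ennreal (B * s)"
    using E(1) emE \<open>B \<ge> 0\<close> by (simp add: nn_integral_cmult_indicator fmeasurableD ennreal_mult')
  finally obtain J where J: "I = ennreal J" "J \<ge> 0"
    by (cases I) (auto simp: top_unique)
  \<comment> \<open>The number of slices is \<open>Suc n\<close>, and the last term is
    \<open>a\<close> times the error \<open>B \<delta>\<close> of the lower step function.\<close>
  have key: "a * J \<le> s * b + a * (B * s) * inverse (real (Suc n))" for n
  proof -
    define N where "N = Suc n"
    define \<delta> where "\<delta> = s / real N"
    have "\<delta> > 0"
      using \<open>s > 0\<close> by (simp add: \<delta>_def N_def)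
    have "measure lebesgue E = real N * \<delta>"
      by (simp add: \<delta>_def N_def s_def)
    from equal_slices[OF u(1,2) \<open>\<delta> > 0\<close> E(1) this] obtain P l where
      Pl: "\<forall>j<N. P j \<in> lmeasurable \<and> measure lebesgue (P j) = \<delta> \<and> 0 \<le> l j \<and> (\<forall>x\<in>P j. l j \<le> u x)"
      and disj: "disjoint_family_on P {..<N}" and sub: "(\<Union>j<N. P j) \<subseteq> E"
      and null: "measure lebesgue (E - (\<Union>j<N. P j)) = 0"
      and ord: "\<forall>j. Suc j < N \<longrightarrow> (\<forall>x\<in>P (Suc j). u x \<le> l j)"
      by (elim exE conjE) (rule that)
    have P: "P j \<in> lmeasurable" "measure lebesgue (P j) = \<delta>"
      and l: "0 \<le> l j" "\<And>x. x \<in> P j \<Longrightarrow> l j \<le> u x" if "j < N" for j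
      using Pl that by auto
    define Q where "Q = E - (\<Union>j<N. P j)"
    have Q: "Q \<in> null_sets lebesgue"
    proof -
      have "Q \<in> lmeasurable"
        unfolding Q_def using E(1) P(1) by (intro fmeasurable_Diff) (auto simp: fmeasurableD)
      then show ?thesis
        using null by (metis Q_def emeasure_eq_measure2 ennreal_0 fmeasurableD null_setsI)
    qed
    have emP: "emeasure lebesgue (P j) = ennreal \<delta>" if "j < N" for j
      using P[OF that] by (simp add: emeasure_eq_measure2)
    have "\<rho> (indicator E) = \<rho> (indicator (\<Union>j<N. P j))"
    proof -
      have ae: "AE x in lebesgue_on G. (indicator E x :: ennreal) = indicator (\<Union>j<N. P j) x"
      proof -
        have "AE x in lebesgue. x \<notin> Q"
          using Q by (rule AE_not_in)
        then have "AE x in lebesgue. x \<in> G \<longrightarrow> (indicator E x :: ennreal) = indicator (\<Union>j<N. P j) x"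
          by eventually_elim (use sub in \<open>auto simp: Q_def indicator_def\<close>)
        then show ?thesis
          using G by (simp add: AE_restrict_space_iff)
      qed
      have sets: "E \<in> sets (lebesgue_on G)" "(\<Union>j<N. P j) \<in> sets (lebesgue_on G)"
        using E G P(1) sub by (auto simp: sets_lebesgue_on_iff fmeasurableD)
      note m = borel_measurable_indicator[OF sets(1)] borel_measurable_indicator[OF sets(2)]
      show ?thesis
        using norm_mono[OF \<rho> m eventually_mono[OF ae]] norm_mono[OF \<rho> m(2,1) eventually_mono[OF ae]]
        by (intro antisym) simp_all
    qed
    moreover have "ennreal (\<Sum>j<N. l j) * \<rho> (indicator (\<Union>j<N. P j)) \<le> of_nat N * \<rho> (\<lambda>x. ennreal (u x))"
    proof (rule ri_cyclic_average[OF ri _ _ _ disj l(1) u_on])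
      show "P j \<in> sets (lebesgue_on G)" if "j < N" for j
        using P(1)[OF that] that sub E(2) G by (auto simp: sets_lebesgue_on_iff fmeasurableD)
      show "emeasure (lebesgue_on G) (P j) = ennreal \<delta>" if "j < N" for j
        using emP[OF that] that sub E(2) G by (subst emeasure_lebesgue_on) auto
    qed (use l in \<open>auto simp: N_def intro: ennreal_leI\<close>)
    ultimately have "ennreal (\<Sum>j<N. l j) * ennreal a \<le> of_nat N * ennreal b"
      unfolding a(1)[symmetric] b(1)[symmetric] by simp
    moreover have "0 \<le> (\<Sum>j<N. l j)"
      using l(1) by (intro sum_nonneg) auto
    ultimately have "ennreal ((\<Sum>j<N. l j) * a) \<le> ennreal (real N * b)"
      using a(2) b(2) by (simp add: ennreal_mult ennreal_of_nat_eq_real_of_nat)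
    then have la: "(\<Sum>j<N. l j) * a \<le> real N * b"
      using b by (subst (asm) ennreal_le_iff) auto
    \<comment> \<open>On slice \<open>j + 1\<close> the ordering bounds \<open>u\<close> by
      \<open>l j\<close>; only the top slice takes the crude bound \<open>B\<close>, and this is
      where boundedness of \<open>u\<close> enters.\<close>
    have "I \<le> (\<integral>\<^sup>+x. (ennreal B * indicator (P 0) x + (\<Sum>j<n. ennreal (l j) * indicator (P (Suc j)) x)) \<partial>lebesgue)"
      unfolding I_def
    proof (intro nn_integral_mono_AE)
      have "AE x in lebesgue. x \<notin> Q"
        using Q by (rule AE_not_in)
      then show "AE x in lebesgue. ennreal (u x) * indicator E x \<le>
        ennreal B * indicator (P 0) x + (\<Sum>j<n. ennreal (l j) * indicator (P (Suc j)) x)"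
      proof eventually_elim
        case (elim x)
        show ?case
        proof (cases "x \<in> E")
          case True
          then obtain j where j: "j < N" "x \<in> P j"
            using elim by (auto simp: Q_def)
          show ?thesis
          proof (cases j)
            case 0
            then show ?thesis
              using j u(3) by (auto simp: indicator_def intro!: add_increasing2 ennreal_leI)
          next
            case (Suc i)
            then have "ennreal (u x) \<le> ennreal (l i) * indicator (P (Suc i)) x"
              using j ord by (auto intro: ennreal_leI)
            also have "\<dots> \<le> (\<Sum>j<n. ennreal (l j) * indicator (P (Suc j)) x)"
              using Suc j by (intro member_le_sum) (auto simp: N_def)
            finally show ?thesis
              using True by (simp add: add_increasing)
          qed
        qed auto
      qed
    qed
    also have "\<dots> = ennreal B * ennreal \<delta> + (\<Sum>j<n. ennreal (l j) * ennreal \<delta>)"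
    proof -
      have m: "P j \<in> sets lebesgue" if "j < N" for j
        using P(1)[OF that] by (rule fmeasurableD)
      have m0: "P 0 \<in> sets lebesgue" and mS: "\<And>j. j < n \<Longrightarrow> P (Suc j) \<in> sets lebesgue"
        using m by (auto simp: N_def)
      have "(\<integral>\<^sup>+x. (ennreal B * indicator (P 0) x + (\<Sum>j<n. ennreal (l j) * indicator (P (Suc j)) x)) \<partial>lebesgue) =
         (\<integral>\<^sup>+x. ennreal B * indicator (P 0) x \<partial>lebesgue) + (\<integral>\<^sup>+x. (\<Sum>j<n. ennreal (l j) * indicator (P (Suc j)) x) \<partial>lebesgue)"
        using m0 mS by (intro nn_integral_add borel_measurable_sum borel_measurable_times borel_measurable_indicator) auto
      also have "(\<integral>\<^sup>+x. (\<Sum>j<n. ennreal (l j) * indicator (P (Suc j)) x) \<partial>lebesgue) =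
         (\<Sum>j<n. \<integral>\<^sup>+x. ennreal (l j) * indicator (P (Suc j)) x \<partial>lebesgue)"
        using mS by (intro nn_integral_sum borel_measurable_times borel_measurable_indicator) auto
      finally show ?thesis
        using m0 mS emP by (simp add: N_def nn_integral_cmult_indicator del: emeasure_completion)
    qed
    also have "\<dots> = ennreal (B * \<delta> + (\<Sum>j<n. l j * \<delta>))"
    proof -
      have "(\<Sum>j<n. ennreal (l j) * ennreal \<delta>) = (\<Sum>j<n. ennreal (l j * \<delta>))"
        using \<open>\<delta> > 0\<close> by (intro sum.cong refl) (simp add: ennreal_mult'')
      also have "\<dots> = ennreal (\<Sum>j<n. l j * \<delta>)"
        using \<open>\<delta> > 0\<close> l(1) by (intro sum_ennreal) (simp add: N_def)
      finally have eq: "(\<Sum>j<n. ennreal (l j) * ennreal \<delta>) = ennreal (\<Sum>j<n. l j * \<delta>)" .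
      have "0 \<le> (\<Sum>j<n. l j * \<delta>)"
        using \<open>\<delta> > 0\<close> l(1) by (intro sum_nonneg) (simp add: N_def)
      then show ?thesis
        unfolding eq using \<open>B \<ge> 0\<close> \<open>\<delta> > 0\<close> by (simp add: ennreal_mult ennreal_plus)
    qed
    also have "\<dots> \<le> ennreal (B * \<delta> + (\<Sum>j<N. l j) * \<delta>)"
      using \<open>\<delta> > 0\<close> l(1)[of n] by (intro ennreal_leI) (auto simp: N_def sum_distrib_right distrib_right)
    finally have "J \<le> B * \<delta> + (\<Sum>j<N. l j) * \<delta>"
      using J \<open>B \<ge> 0\<close> \<open>\<delta> > 0\<close> l(1) by (subst (asm) J, subst (asm) ennreal_le_iff) (auto intro!: add_nonneg_nonneg mult_nonneg_nonneg sum_nonneg)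
    then have "a * J \<le> a * (B * \<delta> + (\<Sum>j<N. l j) * \<delta>)"
      using a(2) by (rule mult_left_mono)
    also have "\<dots> = a * B * \<delta> + ((\<Sum>j<N. l j) * a) * \<delta>"
      by (simp add: algebra_simps)
    also have "\<dots> \<le> a * B * \<delta> + (real N * b) * \<delta>"
      using la \<open>\<delta> > 0\<close> by simp
    also have "\<dots> = a * B * \<delta> + s * b"
      by (simp add: \<delta>_def N_def)
    finally show ?thesis
      by (simp add: \<delta>_def N_def divide_inverse ac_simps)
  qed
  have "(\<lambda>n. s * b + a * (B * s) * inverse (real (Suc n))) \<longlonglongrightarrow> s * b + a * (B * s) * 0"
    by (intro tendsto_intros LIMSEQ_inverse_real_of_nat)
  then have "a * J \<le> s * b"
    using key by (intro LIMSEQ_le_const[of "\<lambda>n. s * b + a * (B * s) * inverse (real (Suc n))"]) auto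
  then have "ennreal (a * J) \<le> ennreal (s * b)"
    by (rule ennreal_leI)
  then show ?thesis
    using a b J by (simp add: ennreal_mult s_def I_def)
qed

text \<open>Truncation at \<open>n\<close> and monotone convergence on the left, monotonicity of the
  norm on the right.\<close>

lemma ri_average:
  fixes u :: "'a::euclidean_space \<Rightarrow> real"
  assumes ri: "ri_function_norm (lebesgue_on G) \<rho>" and G: "G \<in> sets lebesgue"
    and E: "E \<in> lmeasurable" "E \<subseteq> G"
    and u: "u \<in> borel_measurable lebesgue" "\<And>x. 0 \<le> u x"
  shows "\<rho> (indicator E) * (\<integral>\<^sup>+x\<in>E. ennreal (u x) \<partial>lebesgue) \<le> ennreal (measure lebesgue E) * \<rho> (\<lambda>x. ennreal (u x))"
proof -
  note \<rho> = ri_imp_bfn[OF ri]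
  have [measurable]: "u \<in> borel_measurable lebesgue" "E \<in> sets lebesgue"
    using u E by (auto simp: fmeasurableD)
  have "(\<integral>\<^sup>+x\<in>E. ennreal (u x) \<partial>lebesgue) = (SUP n. \<integral>\<^sup>+x\<in>E. ennreal (min (u x) (real n)) \<partial>lebesgue)"
  proof (subst nn_integral_monotone_convergence_SUP[symmetric])
    have "(SUP n. ennreal (min y (real n))) = ennreal y" for y
    proof (rule antisym)
      obtain n where "y \<le> real n"
        using real_arch_simple by blast
      then show "ennreal y \<le> (SUP n. ennreal (min y (real n)))"
        by (intro SUP_upper2[of n]) (auto simp: min_def)
    qed (auto intro!: SUP_least ennreal_leI)
    then show "(\<integral>\<^sup>+x\<in>E. ennreal (u x) \<partial>lebesgue) = (\<integral>\<^sup>+x. (SUP n. ennreal (min (u x) (real n)) * indicator E x) \<partial>lebesgue)"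
      by (intro nn_integral_cong) (auto simp: indicator_def)
    show "incseq (\<lambda>n x. ennreal (min (u x) (real n)) * indicator E x)"
      by (auto simp: incseq_def le_fun_def indicator_def intro!: ennreal_leI)
  qed auto
  then have "\<rho> (indicator E) * (\<integral>\<^sup>+x\<in>E. ennreal (u x) \<partial>lebesgue) =
      (SUP n. \<rho> (indicator E) * (\<integral>\<^sup>+x\<in>E. ennreal (min (u x) (real n)) \<partial>lebesgue))"
    by (simp add: SUP_mult_left_ennreal)
  also have "\<dots> \<le> ennreal (measure lebesgue E) * \<rho> (\<lambda>x. ennreal (u x))"
  proof (rule SUP_least)
    fix n
    have "\<rho> (indicator E) * (\<integral>\<^sup>+x\<in>E. ennreal (min (u x) (real n)) \<partial>lebesgue)
        \<le> ennreal (measure lebesgue E) * \<rho> (\<lambda>x. ennreal (min (u x) (real n)))"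
      using u by (intro ri_average_bounded[OF ri G E, of _ "real n"]) auto
    also have "\<dots> \<le> ennreal (measure lebesgue E) * \<rho> (\<lambda>x. ennreal (u x))"
      by (intro mult_left_mono norm_mono[OF \<rho>] AE_I2 ennreal_leI measurable_lebesgue_on) auto
    finally show "\<rho> (indicator E) * (\<integral>\<^sup>+x\<in>E. ennreal (min (u x) (real n)) \<partial>lebesgue)
        \<le> ennreal (measure lebesgue E) * \<rho> (\<lambda>x. ennreal (u x))" .
  qed
  finally show ?thesis .
qed

lemma indicator_lebesgue_on:
  "G \<in> sets lebesgue \<Longrightarrow> A \<in> lmeasurable \<Longrightarrow> A \<subseteq> G \<Longrightarrow>
   (indicator A :: _ \<Rightarrow> ennreal) \<in> borel_measurable (lebesgue_on G)"
  by (intro borel_measurable_indicator) (auto simp: sets_lebesgue_on_iff fmeasurableD)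

section \<open>Transfer of level set estimates between similar spaces\<close>

lemma rearrangement_indicator:
  assumes G: "G \<in> sets lebesgue" and A: "A \<in> lmeasurable" "A \<subseteq> G" and "s \<ge> 0"
  shows "rearrangement (lebesgue_on G) (indicator A) s = (if s < measure lebesgue A then 1 else 0)"
proof -
  have em: "emeasure (lebesgue_on G) A = ennreal (measure lebesgue A)"
    using A G by (simp add: emeasure_lebesgue_on emeasure_eq_measure2)
  have set_eq: "{x \<in> space (lebesgue_on G). indicator A x > t} = (if t < 1 then A else {})" for t :: ennreal
    using A(2) by (auto simp: indicator_def space_restrict_space)
  have "emeasure (lebesgue_on G) {x \<in> space (lebesgue_on G). indicator A x > t} \<le> ennreal s \<longleftrightarrow>
     (t < 1 \<longrightarrow> measure lebesgue A \<le> s)" for t :: ennreal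
    unfolding set_eq using em \<open>s \<ge> 0\<close> by (simp add: ennreal_le_iff)
  then have "{t :: ennreal. emeasure (lebesgue_on G) {x \<in> space (lebesgue_on G). indicator A x > t} \<le> ennreal s} =
     (if s < measure lebesgue A then {1..} else UNIV)"
    by auto
  then show ?thesis
    unfolding rearrangement_def by (simp only:) (simp add: bot_ennreal)
qed

text \<open>The rearrangement of an indicator is the indicator of an initial interval, and dilation
  by \<open>\<eta>\<close> matches two such intervals when the measures are in the ratio
  \<open>\<eta>\<close>. Similarity then relates the norms, with its factor
  \<open>\<eta>\<close>.\<close>

lemma similar_indicator:
  assumes sim: "similar_norms G \<rho> G' \<rho>'" and G: "G \<in> lmeasurable" "measure lebesgue G > 0"
    and G': "G' \<in> lmeasurable" "measure lebesgue G' > 0"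
    and A: "A \<in> lmeasurable" "A \<subseteq> G" and A': "A' \<in> lmeasurable" "A' \<subseteq> G'"
    and m: "measure lebesgue A' = measure lebesgue G' / measure lebesgue G * measure lebesgue A"
  shows "ennreal (measure lebesgue G' / measure lebesgue G) * \<rho> (indicator A) = \<rho>' (indicator A')"
proof -
  define \<eta> where "\<eta> = measure lebesgue G' / measure lebesgue G"
  have "\<eta> > 0"
    using G G' by (simp add: \<eta>_def)
  have "dilation (measure lebesgue G') \<eta> (rearrangement (lebesgue_on G') (indicator A')) x =
      rearrangement (lebesgue_on G) (indicator A) x" if "x \<in> {0<..<measure lebesgue G}" for x
  proof -
    have "\<eta> * x < measure lebesgue G'"
      using that G(2) G'(2) by (simp add: \<eta>_def field_simps)
    moreover have "\<eta> * x < measure lebesgue A' \<longleftrightarrow> x < measure lebesgue A"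
      using \<open>\<eta> > 0\<close> by (simp add: m[folded \<eta>_def])
    ultimately show ?thesis
      using that \<open>\<eta> > 0\<close> G(1) G'(1) A A' by (simp add: dilation_def rearrangement_indicator fmeasurableD)
  qed
  moreover have "(indicator A :: _ \<Rightarrow> ennreal) \<in> borel_measurable (lebesgue_on G)" "(indicator A' :: _ \<Rightarrow> ennreal) \<in> borel_measurable (lebesgue_on G')"
    using A A' G G' by (simp_all add: indicator_lebesgue_on fmeasurableD)
  ultimately show ?thesis
    using sim unfolding similar_norms_def Let_def \<eta>_def[symmetric] by blast
qed

text \<open>Turns a weak type inequality for measures into a bound for norms of indicators. The set
  \<open>A\<close> is replaced by a set \<open>A'\<close> in \<open>G'\<close> with
  \<open>\<eta>\<close> times its measure. If that measure fits into the set \<open>c L < u\<close>,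
  then \<open>A'\<close> is chosen there and \<open>indicator A' \<le> u / (c L)\<close>. Otherwise
  \<open>A'\<close> is chosen to contain that set, and averaging \<open>u\<close> over
  \<open>A'\<close>, combined with the hypothesis, cancels the measure of \<open>A\<close>.\<close>

lemma ri_family_weak_type:
  fixes u :: "'a::euclidean_space \<Rightarrow> real"
  assumes X: "ri_family X" and G: "open G" "G \<noteq> {}" "G \<in> lmeasurable"
    and G': "open G'" "G' \<noteq> {}" "G' \<in> lmeasurable"
    and u: "u \<in> borel_measurable lebesgue" "\<And>x. 0 \<le> u x" and fin: "X G' (\<lambda>x. ennreal (u x)) < \<infinity>"
    and pos: "K > 0" "c > 0"
  obtains C where "C \<ge> 0" "\<And>A L. A \<in> lmeasurable \<Longrightarrow> A \<subseteq> G \<Longrightarrow> L > 0 \<Longrightarrow>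
    ennreal (L * measure lebesgue A) \<le> ennreal K * (\<integral>\<^sup>+x\<in>{x\<in>G'. c * L < u x}. ennreal (u x) \<partial>lebesgue) \<Longrightarrow>
    X G (indicator A) \<le> ennreal (C / L)"
proof -
  define \<eta> where "\<eta> = measure lebesgue G' / measure lebesgue G"
  have Gpos: "measure lebesgue G > 0" "measure lebesgue G' > 0"
    using G G' by (metis emeasure_lborel_countable zero_less_measure_iff negligible_iff_measure open_not_negligible)+
  then have "\<eta> > 0"
    by (simp add: \<eta>_def)
  have em: "emeasure lebesgue G < \<infinity>" "emeasure lebesgue G' < \<infinity>"
    using G G' by (auto simp: emeasure_eq_measure2)
  have ri: "ri_function_norm (lebesgue_on G) (X G)" "ri_function_norm (lebesgue_on G') (X G')"
    using X G G' em unfolding ri_family_def by blast+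
  have sim: "similar_norms G (X G) G' (X G')"
    using X G G' em unfolding ri_family_def by blast
  have Gs: "G \<in> sets lebesgue" "G' \<in> sets lebesgue"
    using G G' by (auto simp: fmeasurableD)
  note \<rho> = ri_imp_bfn[OF ri(1)] and \<rho>' = ri_imp_bfn[OF ri(2)]
  obtain b where b: "X G' (\<lambda>x. ennreal (u x)) = ennreal b" "b \<ge> 0"
    using fin by (cases "X G' (\<lambda>x. ennreal (u x))") auto
  have u_on: "(\<lambda>x. ennreal (u x)) \<in> borel_measurable (lebesgue_on G')"
    using u(1) by (intro measurable_lebesgue_on) auto
  \<comment> \<open>The norm of \<open>indicator A'\<close> is at most \<open>b / (c L)\<close> in
    one case and \<open>\<eta> K b / L\<close> in the other; similarity divides both by
    \<open>\<eta>\<close>.\<close>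
  define C where "C = max (K * b) (b / (c * \<eta>))"
  have "C \<ge> 0"
    using b pos by (simp add: C_def le_max_iff_disj)
  show thesis
  proof (rule that[OF \<open>C \<ge> 0\<close>])
    fix A and L :: real
    assume A: "A \<in> lmeasurable" "A \<subseteq> G" and "L > 0"
      and le: "ennreal (L * measure lebesgue A) \<le> ennreal K * (\<integral>\<^sup>+x\<in>{x\<in>G'. c * L < u x}. ennreal (u x) \<partial>lebesgue)"
    define E where "E = {x\<in>G'. c * L < u x}"
    define q where "q = \<eta> * measure lebesgue A"
    have "q \<ge> 0"
      using \<open>\<eta> > 0\<close> by (simp add: q_def)
    have "measure lebesgue A \<le> measure lebesgue G"
      using A G(3) by (intro measure_mono_fmeasurable) (auto simp: fmeasurableD)
    then have "q \<le> measure lebesgue G'"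
      using Gpos by (simp add: q_def \<eta>_def field_simps)
    have E: "E \<in> lmeasurable" "E \<subseteq> G'"
    proof -
      have "{x \<in> space lebesgue. c * L < u x} \<in> sets lebesgue"
        using u(1) by measurable
      then have "G' \<inter> {x \<in> space lebesgue. c * L < u x} \<in> lmeasurable"
        using G'(3) by (intro fmeasurable_Int_fmeasurable)
      moreover have "G' \<inter> {x \<in> space lebesgue. c * L < u x} = E"
        by (auto simp: E_def)
      ultimately show "E \<in> lmeasurable" "E \<subseteq> G'"
        by auto
    qed
    have "\<exists>A'. A' \<in> lmeasurable \<and> A' \<subseteq> G' \<and> measure lebesgue A' = q \<and> X G' (indicator A') \<le> ennreal (\<eta> * C / L)"
    proof (cases "q \<le> measure lebesgue E")
      case True
      then obtain A' where A': "A' \<in> lmeasurable" "A' \<subseteq> E" "measure lebesgue A' = q"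
        using nonatomic_subset[OF E(1) \<open>q \<ge> 0\<close>] by blast
      have "X G' (indicator A') \<le> X G' (\<lambda>x. ennreal (1 / (c * L)) * ennreal (u x))"
      proof (intro norm_mono[OF \<rho>'] AE_I2)
        show "(indicator A' :: _ \<Rightarrow> ennreal) \<in> borel_measurable (lebesgue_on G')"
          using A' E Gs by (intro indicator_lebesgue_on) auto
        fix x
        show "(indicator A' x :: ennreal) \<le> ennreal (1 / (c * L)) * ennreal (u x)"
          using A'(2) pos \<open>L > 0\<close> u(2)[of x]
          by (auto simp: indicator_def E_def field_simps simp flip: ennreal_mult ennreal_1 intro!: ennreal_leI)
      qed (use u_on in auto)
      also have "\<dots> = ennreal (1 / (c * L) * b)"
        using b pos \<open>L > 0\<close> u_on by (subst norm_cmult[OF \<rho>']) (auto simp flip: ennreal_mult)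
      also have "\<dots> \<le> ennreal (\<eta> * C / L)"
      proof (rule ennreal_leI)
        have "b / c \<le> \<eta> * C"
          using \<open>\<eta> > 0\<close> pos b(2) by (simp add: C_def field_simps max_def)
        then show "1 / (c * L) * b \<le> \<eta> * C / L"
          using \<open>L > 0\<close> pos by (simp add: field_simps)
      qed
      finally show ?thesis
        using A' E by blast
    next
      case False
      have "measure lebesgue (G' - E) = measure lebesgue G' - measure lebesgue E"
        using G'(3) E by (intro measurable_measure_Diff) (auto simp: fmeasurableD)
      then obtain B where B: "B \<in> lmeasurable" "B \<subseteq> G' - E" "measure lebesgue B = q - measure lebesgue E"
        using nonatomic_subset[of "G' - E" "q - measure lebesgue E"] G'(3) E False \<open>q \<le> measure lebesgue G'\<close>
        by (metis diff_ge_0_iff_ge diff_right_mono fmeasurableD fmeasurable_Diff linear)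
      define A' where "A' = E \<union> B"
      have A': "A' \<in> lmeasurable" "A' \<subseteq> G'" "measure lebesgue A' = q"
      proof -
        have "measure lebesgue A' = measure lebesgue E + measure lebesgue B"
          unfolding A'_def using B E by (intro measure_Un_AE AE_I2) auto
        then show "measure lebesgue A' = q"
          using B by simp
      qed (use B E in \<open>auto simp: A'_def\<close>)
      have "q > 0"
        using False measure_nonneg[of lebesgue E] by linarith
      have "X G' (indicator A') < \<infinity>"
        using A' Gs by (intro norm_indicator_finite[OF \<rho>'])
          (auto simp: sets_lebesgue_on_iff fmeasurableD emeasure_lebesgue_on emeasure_eq_measure2)
      then obtain a where a: "X G' (indicator A') = ennreal a" "a \<ge> 0"
        by (cases "X G' (indicator A')") auto
      define I where "I = (\<integral>\<^sup>+x\<in>E. ennreal (u x) \<partial>lebesgue)"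
      \<comment> \<open>The hypothesis speaks about the integral over \<open>E\<close> only, while
        averaging is applied over the larger \<open>A'\<close>, whose measure \<open>q\<close> is a
        known multiple of that of \<open>A\<close>.\<close>
      have "ennreal a * I \<le> ennreal a * (\<integral>\<^sup>+x\<in>A'. ennreal (u x) \<partial>lebesgue)"
        unfolding I_def A'_def by (intro mult_left_mono nn_integral_mono) (auto simp: indicator_def)
      also have "\<dots> \<le> ennreal q * ennreal b"
        using ri_average[OF ri(2) Gs(2) A'(1,2) u] A'(3) a b by simp
      finally have I_le: "ennreal a * I \<le> ennreal (q * b)"
        using b \<open>q \<ge> 0\<close> by (simp add: ennreal_mult)
      have "ennreal (a * (L * measure lebesgue A)) \<le> ennreal a * (ennreal K * I)"
        using le a(2) \<open>L > 0\<close> unfolding E_def[symmetric] I_def[symmetric]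
        by (subst ennreal_mult) (auto intro: mult_left_mono)
      also have "\<dots> = ennreal K * (ennreal a * I)"
        by (simp add: ac_simps)
      also have "\<dots> \<le> ennreal K * ennreal (q * b)"
        using I_le by (rule mult_left_mono) simp
      also have "\<dots> = ennreal (K * (q * b))"
        using pos b \<open>q \<ge> 0\<close> by (simp add: ennreal_mult)
      finally have "a * (L * measure lebesgue A) \<le> K * (q * b)"
        using pos b \<open>q \<ge> 0\<close> by (subst (asm) ennreal_le_iff) auto
      moreover have "measure lebesgue A = q / \<eta>"
        using \<open>\<eta> > 0\<close> by (simp add: q_def)
      ultimately have "(a * L) * q \<le> (\<eta> * (K * b)) * q"
        using \<open>\<eta> > 0\<close> by (simp add: field_simps)
      then have "a * L \<le> \<eta> * (K * b)"
        using \<open>q > 0\<close> by (simp only: mult_le_cancel_right_pos)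
      also have "\<dots> \<le> \<eta> * C"
        using \<open>\<eta> > 0\<close> by (simp add: C_def)
      finally have "a \<le> \<eta> * C / L"
        using \<open>L > 0\<close> by (simp add: field_simps)
      then show ?thesis
        using A' a(1) by (auto intro!: exI[of _ A'] ennreal_leI)
    qed
    then obtain A' where A': "A' \<in> lmeasurable" "A' \<subseteq> G'" "measure lebesgue A' = q" "X G' (indicator A') \<le> ennreal (\<eta> * C / L)"
      by blast
    have "ennreal \<eta> * X G (indicator A) = X G' (indicator A')"
      unfolding \<eta>_def
      by (rule similar_indicator[OF sim G(3) Gpos(1) G'(3) Gpos(2) A A'(1,2)]) (simp add: A'(3) q_def \<eta>_def)
    then have "ennreal \<eta> * X G (indicator A) \<le> ennreal \<eta> * ennreal (C / L)"
      using A'(4) \<open>\<eta> > 0\<close> \<open>C \<ge> 0\<close> \<open>L > 0\<close> by (simp flip: ennreal_mult)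
    then show "X G (indicator A) \<le> ennreal (C / L)"
      using \<open>\<eta> > 0\<close> by (subst (asm) ennreal_mult_le_mult_iff) auto
  qed
qed

text \<open>The weights grow like \<open>2\<^sup>i\<^sup>l\<close> and the norms of the indicators decay like
  \<open>2\<^sup>-\<^sup>i\<^sup>(\<^sup>l\<^sup>+\<^sup>1\<^sup>)\<close>; the difference makes the series converge.\<close>

lemma norm_level_sum_finite:
  assumes \<rho>: "banach_function_norm M \<rho>" and "emeasure M (space M) < \<infinity>"
    and U: "\<And>i. U i \<in> sets M" and "C \<ge> 0"
    and le: "\<And>i. \<rho> (indicator (U i)) \<le> ennreal (C / 2 ^ (i * (l + 1)))"
  shows "\<rho> (\<lambda>x. 1 + (\<Sum>i. ennreal (2 ^ ((i + 1) * l)) * indicator (U i) x)) < \<infinity>"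
proof -
  have "\<rho> (\<lambda>x. 1 + (\<Sum>i. ennreal (2 ^ ((i + 1) * l)) * indicator (U i) x)) \<le>
     \<rho> (\<lambda>x. 1) + \<rho> (\<lambda>x. \<Sum>i. ennreal (2 ^ ((i + 1) * l)) * indicator (U i) x)"
    using U by (intro norm_add[OF \<rho>]) auto
  also have "\<dots> \<le> \<rho> (\<lambda>x. 1) + (\<Sum>i. \<rho> (\<lambda>x. ennreal (2 ^ ((i + 1) * l)) * indicator (U i) x))"
    using U by (intro add_left_mono norm_suminf[OF \<rho>]) auto
  also have "\<dots> \<le> \<rho> (\<lambda>x. 1) + (\<Sum>i. ennreal (C * 2 ^ l * (1 / 2) ^ i))"
  proof (intro add_left_mono suminf_le)
    fix i
    have "\<rho> (\<lambda>x. ennreal (2 ^ ((i + 1) * l)) * indicator (U i) x) = ennreal (2 ^ ((i + 1) * l)) * \<rho> (indicator (U i))"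
      using U by (intro norm_cmult[OF \<rho>]) auto
    also have "\<dots> \<le> ennreal (2 ^ ((i + 1) * l)) * ennreal (C / 2 ^ (i * (l + 1)))"
      by (intro mult_left_mono le) simp
    also have "\<dots> = ennreal (2 ^ ((i + 1) * l) * (C / 2 ^ (i * (l + 1))))"
      using \<open>C \<ge> 0\<close> by (simp flip: ennreal_mult)
    also have "2 ^ ((i + 1) * l) * (C / 2 ^ (i * (l + 1))) = C * 2 ^ l * (1 / 2) ^ i"
      by (simp add: field_simps power_add)
    finally show "\<rho> (\<lambda>x. ennreal (2 ^ ((i + 1) * l)) * indicator (U i) x) \<le> ennreal (C * 2 ^ l * (1 / 2) ^ i)" .
  qed auto
  also have "\<dots> < \<infinity>"
  proof -
    have "summable (\<lambda>i. C * 2 ^ l * (1 / 2 :: real) ^ i)"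
      by (intro summable_mult summable_geometric) simp
    then have "(\<Sum>i. ennreal (C * 2 ^ l * (1 / 2) ^ i)) < \<infinity>"
      using \<open>C \<ge> 0\<close> by (subst suminf_ennreal2) auto
    moreover have "\<rho> (indicator (space M)) < \<infinity>"
      using assms(2) by (intro norm_indicator_finite[OF \<rho>]) auto
    moreover have "\<rho> (\<lambda>x. 1) \<le> \<rho> (indicator (space M))"
      by (intro norm_mono[OF \<rho>]) auto
    ultimately show ?thesis
      by (auto simp: less_top[symmetric] top_unique)
  qed
  finally show ?thesis .
qed

subsection \<open>Multilinear forms\<close>

lemma multilinear_form_Cons:
  assumes "multilinear_form (Suc i) T"
  shows "multilinear_form i (\<lambda>hs. T (h # hs))"
  unfolding multilinear_form_def
proof (intro allI impI)
  fix hs :: "'a list" and j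
  assume "length hs = i \<and> j < i"
  then have "linear (\<lambda>k. T ((h # hs)[Suc j := k]))"
    using assms unfolding multilinear_form_def by (metis Suc_less_eq length_Cons)
  then show "linear (\<lambda>k. T (h # hs[j := k]))"
    by simp
qed

lemma multilinear_form_linear_hd:
  assumes "multilinear_form (Suc i) T" "length hs = i"
  shows "linear (\<lambda>h. T (h # hs))"
proof -
  have "linear (\<lambda>h. T ((undefined # hs)[0 := h]))"
    using assms unfolding multilinear_form_def by (metis length_Cons zero_less_Suc)
  then show ?thesis
    by simp
qed

definition basis_lists :: "nat \<Rightarrow> 'a::euclidean_space list set" where
  "basis_lists i = {bs. set bs \<subseteq> Basis \<and> length bs = i}"

lemma finite_basis_lists: "finite (basis_lists i)"
  unfolding basis_lists_def by (rule finite_lists_length_eq) simp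

lemma basis_lists_Suc: "basis_lists (Suc i) = (\<lambda>(b, bs). b # bs) ` (Basis \<times> basis_lists i)"
proof (intro equalityI subsetI)
  fix bs :: "'a list"
  assume "bs \<in> basis_lists (Suc i)"
  then show "bs \<in> (\<lambda>(b, bs). b # bs) ` (Basis \<times> basis_lists i)"
    by (cases bs) (auto simp: basis_lists_def)
qed (auto simp: basis_lists_def)

text \<open>Expand the first argument in the basis and use induction for the rest. The finitely many
  values on basis vectors thus control the form, which makes them a convenient substitute for its
  norm.\<close>

lemma multilinear_form_bound:
  fixes T :: "'a::euclidean_space list \<Rightarrow> real"
  shows "multilinear_form i T \<Longrightarrow> length hs = i \<Longrightarrow>
    \<bar>T hs\<bar> \<le> (\<Prod>h\<leftarrow>hs. norm h) * (\<Sum>bs\<in>basis_lists i. \<bar>T bs\<bar>)"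
proof (induction i arbitrary: T hs)
  case 0
  have "basis_lists 0 = {[] :: 'a list}"
    by (auto simp: basis_lists_def)
  with 0 show ?case
    by simp
next
  case (Suc i)
  then obtain h hs' where hs: "hs = h # hs'" "length hs' = i"
    by (cases hs) auto
  interpret linear "\<lambda>h. T (h # hs')"
    using Suc.prems(1) hs(2) by (rule multilinear_form_linear_hd)
  have "T hs = (\<Sum>b\<in>Basis. (h \<bullet> b) * T (b # hs'))"
    using sum[of "\<lambda>b. (h \<bullet> b) *\<^sub>R b" Basis] unfolding hs(1) by (simp add: euclidean_representation scale)
  then have "\<bar>T hs\<bar> \<le> (\<Sum>b\<in>Basis. \<bar>(h \<bullet> b) * T (b # hs')\<bar>)"
    by simp
  also have "\<dots> \<le> (\<Sum>b\<in>Basis. norm h * ((\<Prod>h\<leftarrow>hs'. norm h) * (\<Sum>bs\<in>basis_lists i. \<bar>T (b # bs)\<bar>)))"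
    unfolding abs_mult using Suc.prems(1) hs(2)
    by (intro sum_mono mult_mono Basis_le_norm Suc.IH multilinear_form_Cons) auto
  also have "\<dots> = (\<Prod>h\<leftarrow>hs. norm h) * (\<Sum>b\<in>Basis. \<Sum>bs\<in>basis_lists i. \<bar>T (b # bs)\<bar>)"
    by (simp add: hs(1) sum_distrib_left mult.assoc)
  also have "(\<Sum>b\<in>Basis. \<Sum>bs\<in>basis_lists i. \<bar>T (b # bs)\<bar>) = (\<Sum>bs\<in>basis_lists (Suc i). \<bar>T bs\<bar>)"
    unfolding basis_lists_Suc sum.cartesian_product
    by (subst sum.reindex) (auto simp: inj_on_def o_def case_prod_beta)
  finally show ?case .
qed

lemma multilinear_norm_le:
  fixes T :: "'a::euclidean_space list \<Rightarrow> real"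
  assumes "multilinear_form i T"
  shows "multilinear_norm i T \<le> ennreal (\<Sum>bs\<in>basis_lists i. \<bar>T bs\<bar>)"
  unfolding multilinear_norm_def
proof (rule SUP_least)
  fix hs :: "'a list"
  assume hs: "hs \<in> {hs. length hs = i \<and> (\<forall>h\<in>set hs. norm h \<le> 1)}"
  have le1: "(\<Prod>h\<leftarrow>hs. norm h) \<le> 1" if "\<forall>h\<in>set hs. norm h \<le> 1" for hs :: "'a list"
    using that by (induction hs) (auto intro!: mult_le_one prod_list_nonneg)
  have "\<bar>T hs\<bar> \<le> (\<Prod>h\<leftarrow>hs. norm h) * (\<Sum>bs\<in>basis_lists i. \<bar>T bs\<bar>)"
    using hs assms by (intro multilinear_form_bound) auto
  also have "\<dots> \<le> 1 * (\<Sum>bs\<in>basis_lists i. \<bar>T bs\<bar>)"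
    using le1[of hs] hs by (intro mult_right_mono sum_nonneg) auto
  finally show "ennreal \<bar>T hs\<bar> \<le> ennreal (\<Sum>bs\<in>basis_lists i. \<bar>T bs\<bar>)"
    by (simp add: ennreal_leI)
qed

lemma multilinear_norm_ge:
  "length hs = i \<Longrightarrow> \<forall>h\<in>set hs. norm h \<le> 1 \<Longrightarrow> ennreal \<bar>T hs\<bar> \<le> multilinear_norm i T"
  unfolding multilinear_norm_def by (rule SUP_upper) simp

lemma basis_lists_le_multilinear_norm:
  "bs \<in> basis_lists i \<Longrightarrow> ennreal \<bar>T bs\<bar> \<le> multilinear_norm i T"
  by (rule multilinear_norm_ge) (auto simp: basis_lists_def subset_iff)

text \<open>The supremum in the norm may be restricted to a countable set of lists, since a multilinear
  form is continuous in every argument.\<close>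

lemma multilinear_approx:
  fixes T :: "'a::euclidean_space list \<Rightarrow> real"
  assumes D: "cball 0 1 \<subseteq> closure D"
  shows "multilinear_form i T \<Longrightarrow> length hs = i \<Longrightarrow> \<forall>h\<in>set hs. norm h \<le> 1 \<Longrightarrow> t < \<bar>T hs\<bar> \<Longrightarrow>
    \<exists>ds. length ds = i \<and> set ds \<subseteq> D \<and> t < \<bar>T ds\<bar>"
proof (induction i arbitrary: T hs)
  case (Suc i)
  then obtain h hs' where hs: "hs = h # hs'" "length hs' = i"
    by (cases hs) auto
  have "\<exists>ds. length ds = i \<and> set ds \<subseteq> D \<and> t < \<bar>T (h # ds)\<bar>"
    using Suc.prems hs by (intro Suc.IH[of "\<lambda>hs. T (h # hs)" hs'] multilinear_form_Cons) auto
  then obtain ds where ds: "length ds = i" "set ds \<subseteq> D" "t < \<bar>T (h # ds)\<bar>"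
    by blast
  have lin: "linear (\<lambda>h. T (h # ds))"
    using Suc.prems(1) ds(1) by (rule multilinear_form_linear_hd)
  have "continuous_on UNIV (\<lambda>h. \<bar>T (h # ds)\<bar>)"
    using linear_continuous_on[OF lin[unfolded linear_conv_bounded_linear]] by (intro continuous_intros)
  then have "open {h. t < \<bar>T (h # ds)\<bar>}"
    by (intro open_Collect_less continuous_on_const)
  moreover have "h \<in> closure D"
    using D Suc.prems(3) hs(1) by auto
  ultimately obtain d where "d \<in> D" "t < \<bar>T (d # ds)\<bar>"
    using ds(3) by (auto simp: closure_iff_nhds_not_empty)
  then show ?case
    using ds by (intro exI[of _ "d # ds"]) auto
qed auto

text \<open>The axioms of a function norm speak about measurable functions only, so the norm of a
  derivative cannot be estimated before this is known. By \<open>multilinear_approx\<close> the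
  supremum is one over lists from a countable dense subset of the unit ball.\<close>

lemma borel_measurable_multilinear_norm:
  fixes V :: "'b \<Rightarrow> 'a::euclidean_space list \<Rightarrow> real"
  assumes ml: "\<And>x. x \<in> space M \<Longrightarrow> multilinear_form i (V x)"
    and meas: "\<And>hs. length hs = i \<Longrightarrow> (\<lambda>x. V x hs) \<in> borel_measurable M"
  shows "(\<lambda>x. multilinear_norm i (V x)) \<in> borel_measurable M"
proof -
  obtain D :: "'a set" where D: "countable D" "D \<subseteq> cball 0 1" "cball 0 1 \<subseteq> closure D"
    by (rule separable)
  define Q where "Q = {ds. length ds = i \<and> set ds \<subseteq> D}"
  have "Q \<subseteq> lists D"
    by (auto simp: Q_def)
  then have "countable Q"
    using D(1) countable_lists countable_subset by blast
  have "multilinear_norm i (V x) = (SUP ds\<in>Q. ennreal \<bar>V x ds\<bar>)" if x: "x \<in> space M" for x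
  proof (rule antisym)
    show "(SUP ds\<in>Q. ennreal \<bar>V x ds\<bar>) \<le> multilinear_norm i (V x)"
      using D(2) by (intro SUP_least multilinear_norm_ge) (auto simp: Q_def subset_iff)
    show "multilinear_norm i (V x) \<le> (SUP ds\<in>Q. ennreal \<bar>V x ds\<bar>)"
      unfolding multilinear_norm_def
    proof (rule SUP_least)
      fix hs :: "'a list"
      assume hs: "hs \<in> {hs. length hs = i \<and> (\<forall>h\<in>set hs. norm h \<le> 1)}"
      show "ennreal \<bar>V x hs\<bar> \<le> (SUP ds\<in>Q. ennreal \<bar>V x ds\<bar>)"
      proof (rule dense_le)
        fix y
        assume "y < ennreal \<bar>V x hs\<bar>"
        then obtain t where t: "y = ennreal t" "t \<ge> 0" "t < \<bar>V x hs\<bar>"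
          by (cases y) (auto simp: ennreal_less_iff)
        then obtain ds where "length ds = i" "set ds \<subseteq> D" "t < \<bar>V x ds\<bar>"
          using multilinear_approx[OF D(3) ml[OF x], of hs t] hs by auto
        then show "y \<le> (SUP ds\<in>Q. ennreal \<bar>V x ds\<bar>)"
          using t by (intro SUP_upper2[of ds]) (auto simp: Q_def intro: ennreal_leI)
      qed
    qed
  qed
  moreover have "(\<lambda>x. SUP ds\<in>Q. ennreal \<bar>V x ds\<bar>) \<in> borel_measurable M"
    using \<open>countable Q\<close> meas by (intro borel_measurable_SUP) (auto simp: Q_def intro!: measurable_compose[OF _ measurable_ennreal] borel_measurable_abs)
  ultimately show ?thesis
    by (simp cong: measurable_cong)
qed

subsection \<open>The Leibniz formula\<close>

text \<open>The sum over all ways to hand each direction either to \<open>V\<close> or to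
  \<open>W\<close>, in the given order; there are \<open>2 ^ length hs\<close> terms. Recording
  derivatives as functions of lists of directions replaces binomial coefficients and index
  subsets.\<close>

primrec leibniz :: "('a list \<Rightarrow> real) \<Rightarrow> ('a list \<Rightarrow> real) \<Rightarrow> 'a list \<Rightarrow> real" where
  "leibniz V W [] = V [] * W []"
| "leibniz V W (h # hs) = leibniz (\<lambda>a. V (h # a)) W hs + leibniz V (\<lambda>b. W (h # b)) hs"


lemma leibniz_cong:
  "(\<And>a. length a \<le> length hs \<Longrightarrow> V a = V' a) \<Longrightarrow> (\<And>a. length a \<le> length hs \<Longrightarrow> W a = W' a) \<Longrightarrow>
    leibniz V W hs = leibniz V' W' hs"
proof (induction hs arbitrary: V V' W W')
  case (Cons h hs)
  have "leibniz (\<lambda>a. V (h # a)) W hs = leibniz (\<lambda>a. V' (h # a)) W' hs"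
    by (rule Cons.IH) (auto simp: Cons.prems)
  moreover have "leibniz V (\<lambda>b. W (h # b)) hs = leibniz V' (\<lambda>b. W' (h # b)) hs"
    by (rule Cons.IH) (auto simp: Cons.prems)
  ultimately show ?case
    by simp
qed simp

lemma leibniz_add_left: "leibniz (\<lambda>a. V a + V' a) W hs = leibniz V W hs + leibniz V' W hs"
proof (induction hs arbitrary: V V' W)
  case (Cons h hs)
  show ?case
    by (simp only: leibniz.simps Cons.IH ac_simps)
qed (simp add: distrib_right)

lemma leibniz_add_right: "leibniz V (\<lambda>a. W a + W' a) hs = leibniz V W hs + leibniz V W' hs"
proof (induction hs arbitrary: V W W')
  case (Cons h hs)
  show ?case
    by (simp only: leibniz.simps Cons.IH ac_simps)
qed (simp add: distrib_left)

lemma leibniz_cmult_left: "leibniz (\<lambda>a. c * V a) W hs = c * leibniz V W hs"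
proof (induction hs arbitrary: V W)
  case (Cons h hs)
  show ?case
    by (simp only: leibniz.simps Cons.IH distrib_left)
qed simp

lemma leibniz_cmult_right: "leibniz V (\<lambda>a. c * W a) hs = c * leibniz V W hs"
proof (induction hs arbitrary: V W)
  case (Cons h hs)
  show ?case
    by (simp only: leibniz.simps Cons.IH distrib_left)
qed simp

text \<open>Linearity is required for all lengths up to \<open>n\<close> at once, since the Leibniz
  sum evaluates its factors at lists of all these lengths.\<close>

definition multilinear_family :: "nat \<Rightarrow> ('a::real_vector list \<Rightarrow> real) \<Rightarrow> bool" where
  "multilinear_family n V \<longleftrightarrow> (\<forall>hs j. length hs \<le> n \<and> j < length hs \<longrightarrow> linear (\<lambda>h. V (hs[j := h])))"

lemma multilinear_family_Cons:
  assumes "multilinear_family (Suc n) V"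
  shows "multilinear_family n (\<lambda>a. V (h # a))"
  unfolding multilinear_family_def
proof (intro allI impI)
  fix hs :: "'a list" and j
  assume "length hs \<le> n \<and> j < length hs"
  then have "linear (\<lambda>k. V ((h # hs)[Suc j := k]))"
    using assms unfolding multilinear_family_def by (metis Suc_le_mono Suc_less_eq length_Cons)
  then show "linear (\<lambda>k. V (h # hs[j := k]))"
    by simp
qed

lemma multilinear_family_mono: "multilinear_family n V \<Longrightarrow> m \<le> n \<Longrightarrow> multilinear_family m V"
  unfolding multilinear_family_def by (meson order_trans)

lemma multilinear_family_linear_hd:
  assumes "multilinear_family (Suc n) V" "length a \<le> n"
  shows "linear (\<lambda>h. V (h # a))"
proof -
  have "linear (\<lambda>h. V ((undefined # a)[0 := h]))"
    using assms unfolding multilinear_family_def by (metis Suc_le_mono length_Cons zero_less_Suc)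
  then show ?thesis
    by simp
qed

text \<open>For the first slot this is bilinearity of the Leibniz sum in its two factors; for later
  slots, induction.\<close>

lemma linear_leibniz:
  "multilinear_family n V \<Longrightarrow> multilinear_family n W \<Longrightarrow> length hs = n \<Longrightarrow> j < n \<Longrightarrow>
   linear (\<lambda>h. leibniz V W (hs[j := h]))"
proof (induction hs arbitrary: n j V W)
  case (Cons k hs)
  then obtain m where m: "n = Suc m" "length hs = m"
    by (cases n) auto
  note V = Cons.prems(1)[unfolded m(1)] and W = Cons.prems(2)[unfolded m(1)]
  show ?case
  proof (cases j)
    case 0
    have "linear (\<lambda>h. leibniz (\<lambda>a. V (h # a)) W hs)"
    proof (rule linearI)
      fix h h'
      have "leibniz (\<lambda>a. V ((h + h') # a)) W hs = leibniz (\<lambda>a. V (h # a) + V (h' # a)) W hs"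
        using m by (intro leibniz_cong linear_add[OF multilinear_family_linear_hd[OF V]]) auto
      then show "leibniz (\<lambda>a. V ((h + h') # a)) W hs = leibniz (\<lambda>a. V (h # a)) W hs + leibniz (\<lambda>a. V (h' # a)) W hs"
        by (simp add: leibniz_add_left)
    next
      fix c h
      have "leibniz (\<lambda>a. V ((c *\<^sub>R h) # a)) W hs = leibniz (\<lambda>a. c * V (h # a)) W hs"
        using m linear_scale[OF multilinear_family_linear_hd[OF V]] by (intro leibniz_cong) auto
      then show "leibniz (\<lambda>a. V ((c *\<^sub>R h) # a)) W hs = c *\<^sub>R leibniz (\<lambda>a. V (h # a)) W hs"
        by (simp add: leibniz_cmult_left)
    qed
    moreover have "linear (\<lambda>h. leibniz V (\<lambda>a. W (h # a)) hs)"
    proof (rule linearI)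
      fix h h'
      have "leibniz V (\<lambda>a. W ((h + h') # a)) hs = leibniz V (\<lambda>a. W (h # a) + W (h' # a)) hs"
        using m by (intro leibniz_cong linear_add[OF multilinear_family_linear_hd[OF W]]) auto
      then show "leibniz V (\<lambda>a. W ((h + h') # a)) hs = leibniz V (\<lambda>a. W (h # a)) hs + leibniz V (\<lambda>a. W (h' # a)) hs"
        by (simp add: leibniz_add_right)
    next
      fix c h
      have "leibniz V (\<lambda>a. W ((c *\<^sub>R h) # a)) hs = leibniz V (\<lambda>a. c * W (h # a)) hs"
        using m linear_scale[OF multilinear_family_linear_hd[OF W]] by (intro leibniz_cong) auto
      then show "leibniz V (\<lambda>a. W ((c *\<^sub>R h) # a)) hs = c *\<^sub>R leibniz V (\<lambda>a. W (h # a)) hs"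
        by (simp add: leibniz_cmult_right)
    qed
    ultimately show ?thesis
      using 0 by (simp add: linear_compose_add)
  next
    case (Suc i)
    have "linear (\<lambda>h. leibniz (\<lambda>a. V (k # a)) W (hs[i := h]))"
      using Cons.prems(4) m Suc multilinear_family_mono[OF W]
      by (intro Cons.IH[where n = m] multilinear_family_Cons V) auto
    moreover have "linear (\<lambda>h. leibniz V (\<lambda>b. W (k # b)) (hs[i := h]))"
      using Cons.prems(4) m Suc multilinear_family_mono[OF V]
      by (intro Cons.IH[where n = m] multilinear_family_Cons W) auto
    ultimately show ?thesis
      using Suc by (simp add: linear_compose_add)
  qed
qed simp

text \<open>Integration by parts moves the outermost direction of the test function first and puts
  later ones in front of it, so the list arrives reversed. The derivative of the product is
  therefore read off at \<open>rev hs\<close>, and linearity is checked in that form.\<close>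

lemma multilinear_form_leibniz_rev:
  assumes "multilinear_family n V" "multilinear_family n W" "i \<le> n"
  shows "multilinear_form i (\<lambda>hs. leibniz V W (rev hs))"
  unfolding multilinear_form_def
proof (intro allI impI)
  fix hs :: "'a list" and j
  assume j: "length hs = i \<and> j < i"
  then have "rev (hs[j := h]) = (rev hs)[i - 1 - j := h]" for h
    by (simp add: rev_update)
  moreover have "linear (\<lambda>h. leibniz V W ((rev hs)[i - 1 - j := h]))"
    by (rule linear_leibniz[OF multilinear_family_mono[OF assms(1,3)] multilinear_family_mono[OF assms(2,3)]])
      (use j in auto)
  ultimately show "linear (\<lambda>h. leibniz V W (rev (hs[j := h])))"
    by simp
qed

text \<open>Only entries and lengths are recorded, not that \<open>a\<close> and \<open>b\<close>
  are complementary sublists: this is what the estimates use, it is stable under prepending a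
  direction to either part, and it does not see reversal.\<close>

definition splitting :: "'a list \<Rightarrow> 'a list \<Rightarrow> 'a list \<Rightarrow> bool" where
  "splitting hs a b \<longleftrightarrow> set a \<subseteq> set hs \<and> set b \<subseteq> set hs \<and> length a + length b = length hs"

lemma splitting_Cons: "splitting hs a b \<Longrightarrow> splitting (h # hs) (h # a) b"
  "splitting hs a b \<Longrightarrow> splitting (h # hs) a (h # b)"
  by (auto simp: splitting_def)

lemma splitting_rev: "splitting (rev hs) = splitting hs"
  by (simp add: splitting_def fun_eq_iff)

lemma leibniz_bound:
  "(\<And>a b. splitting hs a b \<Longrightarrow> \<bar>V a * W b\<bar> \<le> B) \<Longrightarrow> \<bar>leibniz V W hs\<bar> \<le> 2 ^ length hs * B"
proof (induction hs arbitrary: V W)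
  case Nil
  then show ?case
    by (simp add: splitting_def)
next
  case (Cons h hs)
  have "\<bar>leibniz (\<lambda>a. V (h # a)) W hs\<bar> \<le> 2 ^ length hs * B"
    by (intro Cons.IH Cons.prems splitting_Cons)
  moreover have "\<bar>leibniz V (\<lambda>b. W (h # b)) hs\<bar> \<le> 2 ^ length hs * B"
    by (intro Cons.IH Cons.prems splitting_Cons)
  ultimately show ?case
    by simp
qed

lemma leibniz_measurable:
  "(\<And>a b. splitting hs a b \<Longrightarrow> (\<lambda>x. V a x * W b x) \<in> borel_measurable M) \<Longrightarrow>
    (\<lambda>x. leibniz (\<lambda>a. V a x) (\<lambda>b. W b x) hs) \<in> borel_measurable M"
proof (induction hs arbitrary: V W)
  case Nil
  then show ?case
    by (simp add: splitting_def)
next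
  case (Cons h hs)
  have "(\<lambda>x. leibniz (\<lambda>a. V (h # a) x) (\<lambda>b. W b x) hs) \<in> borel_measurable M"
    by (intro Cons.IH Cons.prems splitting_Cons)
  moreover have "(\<lambda>x. leibniz (\<lambda>a. V a x) (\<lambda>b. W (h # b) x) hs) \<in> borel_measurable M"
    by (intro Cons.IH Cons.prems splitting_Cons)
  ultimately show ?case
    by simp
qed

lemma leibniz_integrable:
  "(\<And>a b. splitting hs a b \<Longrightarrow> integrable M (\<lambda>x. V a x * W b x * \<phi> x)) \<Longrightarrow>
    integrable M (\<lambda>x. leibniz (\<lambda>a. V a x) (\<lambda>b. W b x) hs * \<phi> x :: real)"
proof (induction hs arbitrary: V W)
  case Nil
  then show ?case
    by (simp add: splitting_def)
next
  case (Cons h hs)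
  have "integrable M (\<lambda>x. leibniz (\<lambda>a. V (h # a) x) (\<lambda>b. W b x) hs * \<phi> x)"
    by (intro Cons.IH Cons.prems splitting_Cons)
  moreover have "integrable M (\<lambda>x. leibniz (\<lambda>a. V a x) (\<lambda>b. W (h # b) x) hs * \<phi> x)"
    by (intro Cons.IH Cons.prems splitting_Cons)
  ultimately show ?case
    by (simp add: distrib_right)
qed

text \<open>Integrability of every single product is assumed because the Bochner integral splits
  over the two halves of the sum only for integrable functions.\<close>

lemma leibniz_integral_tendsto:
  "(\<And>n a b. splitting hs a b \<Longrightarrow> integrable M (\<lambda>x. A n a x * B n b x * \<phi> x)) \<Longrightarrow>
   (\<And>a b. splitting hs a b \<Longrightarrow> integrable M (\<lambda>x. V a x * W b x * \<phi> x)) \<Longrightarrow>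
   (\<And>a b. splitting hs a b \<Longrightarrow> (\<lambda>n. \<integral>x. A n a x * B n b x * \<phi> x \<partial>M) \<longlonglongrightarrow> (\<integral>x. V a x * W b x * \<phi> x \<partial>M)) \<Longrightarrow>
    (\<lambda>n::nat. \<integral>x. leibniz (\<lambda>a. A n a x) (\<lambda>b. B n b x) hs * \<phi> x \<partial>M) \<longlonglongrightarrow>
      (\<integral>x. leibniz (\<lambda>a. V a x) (\<lambda>b. W b x) hs * \<phi> x \<partial>M :: real)"
proof (induction hs arbitrary: A B V W)
  case Nil
  then show ?case
    by (simp add: splitting_def)
next
  case (Cons h hs)
  have "(\<lambda>n::nat. \<integral>x. leibniz (\<lambda>a. A n (h # a) x) (\<lambda>b. B n b x) hs * \<phi> x \<partial>M) \<longlonglongrightarrow>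
      (\<integral>x. leibniz (\<lambda>a. V (h # a) x) (\<lambda>b. W b x) hs * \<phi> x \<partial>M)"
    by (intro Cons.IH Cons.prems splitting_Cons)
  moreover have "(\<lambda>n::nat. \<integral>x. leibniz (\<lambda>a. A n a x) (\<lambda>b. B n (h # b) x) hs * \<phi> x \<partial>M) \<longlonglongrightarrow>
      (\<integral>x. leibniz (\<lambda>a. V a x) (\<lambda>b. W (h # b) x) hs * \<phi> x \<partial>M)"
    by (intro Cons.IH Cons.prems splitting_Cons)
  moreover have "integrable M (\<lambda>x. leibniz (\<lambda>a. A n (h # a) x) (\<lambda>b. B n b x) hs * \<phi> x)" for n
    by (rule leibniz_integrable[of hs M "\<lambda>a. A n (h # a)" "B n"], rule Cons.prems(1), erule splitting_Cons)
  moreover have "integrable M (\<lambda>x. leibniz (\<lambda>a. A n a x) (\<lambda>b. B n (h # b) x) hs * \<phi> x)" for n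
    by (rule leibniz_integrable[of hs M "A n" "\<lambda>b. B n (h # b)"], rule Cons.prems(1), erule splitting_Cons)
  moreover have "integrable M (\<lambda>x. leibniz (\<lambda>a. V (h # a) x) (\<lambda>b. W b x) hs * \<phi> x)"
    by (rule leibniz_integrable[of hs M "\<lambda>a. V (h # a)" W], rule Cons.prems(2), erule splitting_Cons)
  moreover have "integrable M (\<lambda>x. leibniz (\<lambda>a. V a x) (\<lambda>b. W (h # b) x) hs * \<phi> x)"
    by (rule leibniz_integrable[of hs M V "\<lambda>b. W (h # b)"], rule Cons.prems(2), erule splitting_Cons)
  ultimately show ?case
    by (simp add: distrib_right tendsto_add)
qed

lemma leibniz_has_dir_deriv:
  "(\<And>a. has_dir_deriv (F a) h (F' a)) \<Longrightarrow> (\<And>a. has_dir_deriv (G a) h (G' a)) \<Longrightarrow>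
    has_dir_deriv (\<lambda>x. leibniz (\<lambda>a. F a x) (\<lambda>b. G b x) hs) h
      (\<lambda>x. leibniz (\<lambda>a. F' a x) (\<lambda>b. G b x) hs + leibniz (\<lambda>a. F a x) (\<lambda>b. G' b x) hs)"
proof (induction hs arbitrary: F F' G G')
  case Nil
  then show ?case
    by (simp add: has_dir_deriv_mult)
next
  case (Cons k hs)
  from has_dir_deriv_add[OF Cons.IH[of "\<lambda>a. F (k # a)" "\<lambda>a. F' (k # a)" G G'] Cons.IH[of F F' "\<lambda>a. G (k # a)" "\<lambda>a. G' (k # a)"]]
  show ?case
    using Cons.prems by (simp add: algebra_simps)
qed

subsection \<open>Integration by parts\<close>

text \<open>The directions leave \<open>\<phi>\<close> one at a time, each with a sign;
  \<open>js\<close> collects those already moved and is generalised for the induction.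
  \<open>U\<close> stands for a function together with all its iterated derivatives, indexed by
  lists of directions.\<close>

lemma integration_by_parts:
  fixes U :: "'a::euclidean_space list \<Rightarrow> 'a \<Rightarrow> real"
  assumes U: "\<And>hs h. has_dir_deriv (U hs) h (U (h # hs))"
    and U_meas: "\<And>hs. U hs \<in> borel_measurable borel"
    and U_bnd: "\<And>hs. \<exists>B. \<forall>x. \<bar>U hs x\<bar> \<le> B"
    and \<phi>: "smooth \<phi>" "\<And>x. x \<notin> cball 0 r \<Longrightarrow> \<phi> x = 0"
  shows "(\<integral>x. U js x * iterated_deriv hs \<phi> x \<partial>lborel) = (- 1) ^ length hs * (\<integral>x. U (rev hs @ js) x * \<phi> x \<partial>lborel)"
proof (induction hs arbitrary: js)
  case (Cons h hs)
  have supp: "iterated_deriv ks \<phi> x = 0" if "x \<notin> cball 0 r" for ks x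
    by (rule iterated_deriv_eq_0_on_open[of "- cball 0 r"]) (use that \<phi> in auto)
  have sm: "smooth (iterated_deriv ks \<phi>)" for ks
    using \<phi> by (simp add: smooth_iterated_deriv)
  have bnd: "\<exists>B. \<forall>x. \<bar>iterated_deriv ks \<phi> x\<bar> \<le> B" for ks
  proof -
    have "bounded (iterated_deriv ks \<phi> ` cball 0 r)"
      by (intro compact_imp_bounded compact_continuous_image smooth_continuous_on sm compact_cball)
    then obtain B where B: "B > 0" "\<And>x. x \<in> cball 0 r \<Longrightarrow> \<bar>iterated_deriv ks \<phi> x\<bar> \<le> B"
      by (auto simp: bounded_pos)
    then have "\<bar>iterated_deriv ks \<phi> x\<bar> \<le> B" for x
      using supp[of x ks] by (cases "x \<in> cball 0 r") auto
    then show ?thesis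
      by blast
  qed
  have prod_int: "integrable lborel (\<lambda>x. U ks x * iterated_deriv ls \<phi> x)"
    and prod_bnd: "\<exists>B. \<forall>x. \<bar>U ks x * iterated_deriv ls \<phi> x\<bar> \<le> B" for ks ls
  proof -
    obtain B C where B: "\<And>x. \<bar>U ks x\<bar> \<le> B" and C: "\<And>x. \<bar>iterated_deriv ls \<phi> x\<bar> \<le> C"
      using U_bnd bnd by meson
    have BC: "\<bar>U ks x * iterated_deriv ls \<phi> x\<bar> \<le> B * C" for x
      unfolding abs_mult using B[of x] C[of x] by (intro mult_mono) auto
    then show "\<exists>B. \<forall>x. \<bar>U ks x * iterated_deriv ls \<phi> x\<bar> \<le> B"
      by blast
    show "integrable lborel (\<lambda>x. U ks x * iterated_deriv ls \<phi> x)"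
      by (rule integrable_bounded_support[where z = 0 and r = r and B = "B * C"])
        (use U_meas smooth_borel_measurable[OF sm] supp BC in auto)
  qed
  have D: "has_dir_deriv (\<lambda>x. U js x * iterated_deriv hs \<phi> x) h
      (\<lambda>x. U (h # js) x * iterated_deriv hs \<phi> x + U js x * iterated_deriv (h # hs) \<phi> x)"
    using has_dir_deriv_mult[OF U smooth_has_dir_deriv[OF sm]] by simp
  obtain A where A: "\<And>x. \<bar>U js x * iterated_deriv hs \<phi> x\<bar> \<le> A"
    using prod_bnd by blast
  obtain B1 B2 where B: "\<And>x. \<bar>U (h # js) x * iterated_deriv hs \<phi> x\<bar> \<le> B1" "\<And>x. \<bar>U js x * iterated_deriv (h # hs) \<phi> x\<bar> \<le> B2"
    using prod_bnd[of "h # js" hs] prod_bnd[of js "h # hs"] by blast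
  have "(\<integral>x. U (h # js) x * iterated_deriv hs \<phi> x + U js x * iterated_deriv (h # hs) \<phi> x \<partial>lborel) = 0"
  proof (rule integral_dir_deriv[OF _ _ D A, of "B1 + B2" r])
    show "\<bar>U (h # js) x * iterated_deriv hs \<phi> x + U js x * iterated_deriv (h # hs) \<phi> x\<bar> \<le> B1 + B2" for x
      using B[of x] by linarith
    show "(\<lambda>x. U (h # js) x * iterated_deriv hs \<phi> x + U js x * iterated_deriv (h # hs) \<phi> x) \<in> borel_measurable borel"
      by (intro borel_measurable_add borel_measurable_times U_meas smooth_borel_measurable sm)
    show "(\<lambda>x. U js x * iterated_deriv hs \<phi> x) \<in> borel_measurable borel"
      by (intro borel_measurable_times U_meas smooth_borel_measurable sm)
  qed (simp add: supp)
  then have "(\<integral>x. U js x * iterated_deriv (h # hs) \<phi> x \<partial>lborel) = - (\<integral>x. U (h # js) x * iterated_deriv hs \<phi> x \<partial>lborel)"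
    by (subst (asm) Bochner_Integration.integral_add[OF prod_int prod_int]) linarith
  also have "\<dots> = (- 1) ^ length (h # hs) * (\<integral>x. U (rev (h # hs) @ js) x * \<phi> x \<partial>lborel)"
    by (simp add: Cons.IH)
  finally show ?case .
qed simp

subsection \<open>Mollification\<close>

text \<open>Convolution with the kernel dilated to scale \<open>t\<close>, for any kernel and any
  function on the whole space. A function on \<open>G\<close> enters as
  \<open>indicator G y * u y\<close>; for \<open>t > 0\<close> the cut is invisible at
  \<open>x\<close> as long as \<open>cball x t \<subseteq> G\<close>.\<close>

definition mollify :: "('a::euclidean_space \<Rightarrow> real) \<Rightarrow> real \<Rightarrow> ('a \<Rightarrow> real) \<Rightarrow> 'a \<Rightarrow> real" where
  "mollify \<kappa> t u x = (LINT y|lebesgue. u y * (\<kappa> ((x - y) /\<^sub>R t) / t ^ DIM('a)))"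

lemma borel_imp_lebesgue_measurable: "f \<in> borel_measurable borel \<Longrightarrow> f \<in> borel_measurable lebesgue"
  by (rule measurable_completion) simp

lemma kernel_scaled_measurable:
  "kernel \<kappa> \<Longrightarrow> (\<lambda>y. \<kappa> ((x - y) /\<^sub>R t)) \<in> borel_measurable borel"
  by (rule measurable_compose[OF _ kernel_borel]) auto

lemma kernel_scaled_lebesgue:
  "kernel \<kappa> \<Longrightarrow> (\<lambda>y. \<kappa> ((x - y) /\<^sub>R t)) \<in> borel_measurable lebesgue"
  by (intro borel_imp_lebesgue_measurable kernel_scaled_measurable)

lemma kernel_scaled_eq_0:
  assumes "kernel \<kappa>" "t > 0" "y \<notin> ball x t"
  shows "\<kappa> ((x - y) /\<^sub>R t) = 0"
  using assms kernel_eq_0[OF assms(1), of "(x - y) /\<^sub>R t"]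
  by (simp add: dist_norm divide_inverse_commute[symmetric] le_divide_eq)

lemma mollify_integrable:
  assumes u: "integrable lebesgue u" and \<kappa>: "kernel \<kappa>"
  shows "integrable lebesgue (\<lambda>y. u y * (\<kappa> ((x - y) /\<^sub>R t) / c))"
proof -
  obtain C where C: "\<And>x. \<bar>\<kappa> x\<bar> \<le> C"
    using kernel_bounded[OF \<kappa>] by blast
  show ?thesis
  proof (rule Bochner_Integration.integrable_bound)
    show "integrable lebesgue (\<lambda>y. C / \<bar>c\<bar> * \<bar>u y\<bar>)"
      using u by simp
    show "(\<lambda>y. u y * (\<kappa> ((x - y) /\<^sub>R t) / c)) \<in> borel_measurable lebesgue"
      using u borel_imp_lebesgue_measurable[OF kernel_scaled_measurable[OF \<kappa>]]
      by (intro borel_measurable_times borel_measurable_divide) auto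
    show "AE y in lebesgue. norm (u y * (\<kappa> ((x - y) /\<^sub>R t) / c)) \<le> norm (C / \<bar>c\<bar> * \<bar>u y\<bar>)"
    proof (intro AE_I2)
      fix y
      have "\<bar>u y\<bar> * (\<bar>\<kappa> ((x - y) /\<^sub>R t)\<bar> / \<bar>c\<bar>) \<le> \<bar>u y\<bar> * (C / \<bar>c\<bar>)"
        by (intro mult_left_mono divide_right_mono C) auto
      then show "norm (u y * (\<kappa> ((x - y) /\<^sub>R t) / c)) \<le> norm (C / \<bar>c\<bar> * \<bar>u y\<bar>)"
        using C[of 0] by (simp add: abs_mult ac_simps)
    qed
  qed
qed

lemma mollify_bound:
  fixes x :: "'a::euclidean_space"
  assumes u: "u \<in> borel_measurable lebesgue" and \<kappa>: "kernel \<kappa>" "\<And>x. \<bar>\<kappa> x\<bar> \<le> C" and "t > 0"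
    and le: "(\<integral>\<^sup>+y\<in>ball x t. ennreal \<bar>u y\<bar> \<partial>lebesgue) \<le> ennreal (M * t ^ DIM('a))" and "M \<ge> 0"
  shows "\<bar>mollify \<kappa> t u x\<bar> \<le> C * M"
proof -
  have "C \<ge> 0"
    using \<kappa>(2)[of 0] by linarith
  have "ennreal \<bar>mollify \<kappa> t u x\<bar> \<le> (\<integral>\<^sup>+y. ennreal (norm (u y * (\<kappa> ((x - y) /\<^sub>R t) / t ^ DIM('a)))) \<partial>lebesgue)"
  \<comment> \<open>Without integrability the Bochner integral is \<open>0\<close> by convention,
    and the bound is trivial.\<close>
  proof (cases "integrable lebesgue (\<lambda>y. u y * (\<kappa> ((x - y) /\<^sub>R t) / t ^ DIM('a)))")
    case True
    from integral_norm_bound_ennreal[OF this] show ?thesis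
      by (simp add: mollify_def)
  next
    case False
    have "mollify \<kappa> t u x = 0"
      unfolding mollify_def by (rule not_integrable_integral_eq[OF False])
    then show ?thesis
      by simp
  qed
  also have "\<dots> \<le> (\<integral>\<^sup>+y. ennreal (C / t ^ DIM('a)) * (ennreal \<bar>u y\<bar> * indicator (ball x t) y) \<partial>lebesgue)"
  proof (intro nn_integral_mono)
    fix y
    show "ennreal (norm (u y * (\<kappa> ((x - y) /\<^sub>R t) / t ^ DIM('a)))) \<le>
      ennreal (C / t ^ DIM('a)) * (ennreal \<bar>u y\<bar> * indicator (ball x t) y)"
    proof (cases "y \<in> ball x t")
      case True
      have "norm (u y * (\<kappa> ((x - y) /\<^sub>R t) / t ^ DIM('a))) = \<bar>u y\<bar> * (\<bar>\<kappa> ((x - y) /\<^sub>R t)\<bar> / t ^ DIM('a))"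
        using \<open>t > 0\<close> by (simp add: abs_mult)
      also have "\<dots> \<le> \<bar>u y\<bar> * (C / t ^ DIM('a))"
        using \<open>t > 0\<close> by (intro mult_left_mono divide_right_mono \<kappa>) auto
      finally have "ennreal (norm (u y * (\<kappa> ((x - y) /\<^sub>R t) / t ^ DIM('a)))) \<le> ennreal (C / t ^ DIM('a) * \<bar>u y\<bar>)"
        by (simp add: mult.commute ennreal_leI)
      then show ?thesis
        using True \<open>C \<ge> 0\<close> \<open>t > 0\<close> by (subst (asm) ennreal_mult) simp_all
    next
      case False
      then show ?thesis
        using kernel_scaled_eq_0[OF \<kappa>(1) \<open>t > 0\<close>] by simp
    qed
  qed
  also have "\<dots> = ennreal (C / t ^ DIM('a)) * (\<integral>\<^sup>+y\<in>ball x t. ennreal \<bar>u y\<bar> \<partial>lebesgue)"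
  proof (rule nn_integral_cmult)
    have [measurable]: "u \<in> borel_measurable lebesgue" "ball x t \<in> sets lebesgue"
      using u by auto
    show "(\<lambda>y. ennreal \<bar>u y\<bar> * indicator (ball x t) y) \<in> borel_measurable lebesgue"
      by measurable
  qed
  also have "\<dots> \<le> ennreal (C / t ^ DIM('a)) * ennreal (M * t ^ DIM('a))"
    by (rule mult_left_mono[OF le]) simp
  also have "\<dots> = ennreal (C / t ^ DIM('a) * (M * t ^ DIM('a)))"
    using \<open>C \<ge> 0\<close> \<open>M \<ge> 0\<close> \<open>t > 0\<close> by (simp flip: ennreal_mult)
  also have "C / t ^ DIM('a) * (M * t ^ DIM('a)) = C * M"
    using \<open>t > 0\<close> by simp
  finally show ?thesis
    using \<open>C \<ge> 0\<close> \<open>M \<ge> 0\<close> by (simp add: ennreal_le_iff)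
qed

lemma sigma_finite_lebesgue: "sigma_finite_measure (lebesgue :: 'a::euclidean_space measure)"
proof
  have "(\<Union>n. cball 0 (real n)) = (UNIV :: 'a set)"
    using real_arch_simple by (auto simp: mem_cball)
  moreover have "emeasure lebesgue (cball (0::'a) (real n)) \<noteq> \<infinity>" for n
    using emeasure_lborel_cball_finite[of "0::'a" "real n"] by auto
  ultimately show "\<exists>A::'a set set. countable A \<and> A \<subseteq> sets lebesgue \<and> \<Union> A = space lebesgue \<and> (\<forall>a\<in>A. emeasure lebesgue a \<noteq> \<infinity>)"
    by (intro exI[of _ "range (\<lambda>n. cball (0::'a) (real n))"]) auto
qed

text \<open>The map \<open>f\<close> allows the point to vary over the Borel space as well as over
  the Lebesgue space; the second case is the one for Fubini.\<close>

lemma mollify_pair_measurable: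
  assumes u: "u \<in> borel_measurable lebesgue" and \<kappa>: "kernel \<kappa>" and f: "f \<in> measurable N borel"
  shows "(\<lambda>(x, y). u y * (\<kappa> ((f x - y) /\<^sub>R t) / c)) \<in> borel_measurable (N \<Otimes>\<^sub>M lebesgue)"
proof -
  have id: "(\<lambda>x. x) \<in> measurable lebesgue borel"
    by (rule borel_imp_lebesgue_measurable) simp
  have "(\<lambda>z. (f (fst z) - snd z) /\<^sub>R t) \<in> borel_measurable (N \<Otimes>\<^sub>M lebesgue)"
    using measurable_compose[OF measurable_fst f] measurable_compose[OF measurable_snd id] by (intro borel_measurable_scaleR borel_measurable_diff) auto
  then have "(\<lambda>z. \<kappa> ((f (fst z) - snd z) /\<^sub>R t)) \<in> borel_measurable (N \<Otimes>\<^sub>M lebesgue)"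
    by (rule measurable_compose[OF _ kernel_borel[OF \<kappa>]])
  then show ?thesis
    unfolding case_prod_beta
    by (intro borel_measurable_times borel_measurable_divide measurable_compose[OF measurable_snd u] borel_measurable_const)
qed

lemma mollify_borel:
  assumes u: "u \<in> borel_measurable lebesgue" and \<kappa>: "kernel \<kappa>"
  shows "mollify \<kappa> t u \<in> borel_measurable borel"
proof -
  interpret sigma_finite_measure "lebesgue :: 'a measure"
    by (rule sigma_finite_lebesgue)
  show ?thesis
    unfolding mollify_def[abs_def]
    by (rule borel_measurable_lebesgue_integral) (rule mollify_pair_measurable[OF u \<kappa>]; simp)
qed

lemma mollify_bounded:
  assumes u: "integrable lebesgue u" and \<kappa>: "kernel \<kappa>"
  shows "\<exists>B. \<forall>x. \<bar>mollify \<kappa> t u x\<bar> \<le> B"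
proof -
  obtain C where C: "\<And>x. \<bar>\<kappa> x\<bar> \<le> C"
    using kernel_bounded[OF \<kappa>] by blast
  have "\<bar>mollify \<kappa> t u x\<bar> \<le> (\<integral>y. \<bar>u y\<bar> * (C / \<bar>t ^ DIM('a)\<bar>) \<partial>lebesgue)" for x
  proof -
    have "\<bar>mollify \<kappa> t u x\<bar> \<le> (\<integral>y. \<bar>u y * (\<kappa> ((x - y) /\<^sub>R t) / t ^ DIM('a))\<bar> \<partial>lebesgue)"
      unfolding mollify_def by (rule integral_abs_bound)
    also have "\<dots> \<le> (\<integral>y. \<bar>u y\<bar> * (C / \<bar>t ^ DIM('a)\<bar>) \<partial>lebesgue)"
    proof (rule integral_mono)
      show "\<bar>u y * (\<kappa> ((x - y) /\<^sub>R t) / t ^ DIM('a))\<bar> \<le> \<bar>u y\<bar> * (C / \<bar>t ^ DIM('a)\<bar>)" for y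
        unfolding abs_mult abs_divide by (intro mult_left_mono divide_right_mono C) auto
      show "integrable lebesgue (\<lambda>y. \<bar>u y * (\<kappa> ((x - y) /\<^sub>R t) / t ^ DIM('a))\<bar>)"
        by (intro integrable_abs mollify_integrable[OF u \<kappa>])
    qed (use u in auto)
    finally show ?thesis .
  qed
  then show ?thesis
    by blast
qed

lemma mollify_has_dir_deriv:
  fixes u :: "'a::euclidean_space \<Rightarrow> real"
  assumes u: "integrable lebesgue u" and \<kappa>: "kernel \<kappa>" and "t > 0"
  shows "has_dir_deriv (mollify \<kappa> t u) h (\<lambda>x. mollify (iterated_deriv [h] \<kappa>) t u x / t)"
  unfolding has_dir_deriv_def
proof
  fix x :: 'a
  let ?n = "t ^ DIM('a)"
  note K = kernel_iterated_deriv[OF \<kappa>, of "[h]"]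
  obtain B where "B > 0" and B: "\<And>x. \<bar>iterated_deriv [h] \<kappa> x\<bar> \<le> B"
    using kernel_bounded[OF K] by blast
  have der: "((\<lambda>s. \<kappa> ((x + s *\<^sub>R h - y) /\<^sub>R t) / ?n) has_real_derivative
      iterated_deriv [h] \<kappa> ((x + s *\<^sub>R h - y) /\<^sub>R t) / t / ?n) (at s)" for s y
  proof -
    have d: "((\<lambda>r. \<kappa> ((x - y) /\<^sub>R t + r *\<^sub>R h)) has_real_derivative
        iterated_deriv [h] \<kappa> ((x - y) /\<^sub>R t + (s / t) *\<^sub>R h)) (at (s / t))"
      by (rule has_dir_deriv_at[OF smooth_has_dir_deriv[OF kernel_smooth[OF \<kappa>]]])
    have "((\<lambda>s. s / t) has_real_derivative 1 / t) (at s)"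
      using \<open>t > 0\<close> by (auto intro!: derivative_eq_intros)
    from DERIV_cdivide[OF DERIV_chain2[OF d this], of ?n] show ?thesis
      by (simp add: scaleR_add_right scaleR_diff_right add_diff_eq divide_inverse_commute algebra_simps)
  qed
  have "((\<lambda>s. \<integral>y. u y * (\<kappa> ((x + s *\<^sub>R h - y) /\<^sub>R t) / ?n) \<partial>lebesgue) has_real_derivative
      (\<integral>y. u y * (iterated_deriv [h] \<kappa> ((x + 0 *\<^sub>R h - y) /\<^sub>R t) / t / ?n) \<partial>lebesgue)) (at 0)"
  proof (rule has_real_derivative_integral[OF u, of 1 0 _ _ "B / t / ?n"])
    show "\<bar>iterated_deriv [h] \<kappa> ((x + s *\<^sub>R h - y) /\<^sub>R t) / t / ?n\<bar> \<le> B / t / ?n" for s y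
      using B[of "(x + s *\<^sub>R h - y) /\<^sub>R t"] \<open>t > 0\<close> by (simp add: divide_right_mono)
    show "(\<lambda>y. \<kappa> ((x + s *\<^sub>R h - y) /\<^sub>R t) / ?n) \<in> borel_measurable lebesgue" for s
      by (intro borel_measurable_divide kernel_scaled_lebesgue[OF \<kappa>] borel_measurable_const)
    show "(\<lambda>y. iterated_deriv [h] \<kappa> ((x + 0 *\<^sub>R h - y) /\<^sub>R t) / t / ?n) \<in> borel_measurable lebesgue"
      by (intro borel_measurable_divide kernel_scaled_lebesgue[OF K] borel_measurable_const)
  qed (use der mollify_integrable[OF u \<kappa>] in auto)
  moreover have "(\<integral>y. u y * (iterated_deriv [h] \<kappa> ((x - y) /\<^sub>R t) / t / ?n) \<partial>lebesgue) =
     mollify (iterated_deriv [h] \<kappa>) t u x / t"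
    unfolding mollify_def by (subst integral_divide_zero[symmetric]) (auto intro!: Bochner_Integration.integral_cong)
  ultimately show "((\<lambda>s. mollify \<kappa> t u (x + s *\<^sub>R h)) has_real_derivative
      mollify (iterated_deriv [h] \<kappa>) t u x / t) (at 0)"
    unfolding mollify_def by (simp add: ac_simps)
qed

text \<open>Derivative with respect to the scale: \<open>t\<^sup>-\<^sup>n \<kappa>(z/t)\<close> satisfies
  \<open>\<partial>\<^sub>t (t\<^sup>-\<^sup>n \<kappa>(z/t)) = - div\<^sub>z (t\<^sup>-\<^sup>n (z/t) \<kappa>(z/t))\<close>.\<close>

lemma mollify_scale_derivative:
  fixes u :: "'a::euclidean_space \<Rightarrow> real"
  assumes u: "integrable lebesgue u" and \<kappa>: "kernel \<kappa>" and "t > 0"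
  shows "((\<lambda>t. mollify \<kappa> t u x) has_real_derivative
     - (\<Sum>b\<in>Basis. mollify (iterated_deriv [b] (\<lambda>z. (z \<bullet> b) * \<kappa> z)) t u x) / t) (at t)"
proof -
  define n where "n = DIM('a)"
  define \<kappa>' where "\<kappa>' b = iterated_deriv [b] (\<lambda>z. (z \<bullet> b) * \<kappa> z)" for b :: 'a
  have k': "kernel (\<kappa>' b)" for b
    unfolding \<kappa>'_def by (intro kernel_iterated_deriv kernel_inner_mult \<kappa>)
  have "\<forall>b. \<exists>B. \<forall>x. \<bar>\<kappa>' b x\<bar> \<le> B"
    using kernel_bounded[OF k'] by blast
  then obtain B where B: "\<And>b x. \<bar>\<kappa>' b x\<bar> \<le> B b"
    by metis
  \<comment> \<open>The divergence of \<open>z * \<kappa> z\<close>, which equals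
    \<open>n \<kappa>\<close> plus the derivative of \<open>\<kappa>\<close> in the radial
    direction; the two parts come from differentiating \<open>t^-n\<close> and
    \<open>\<kappa> (z / t)\<close>.\<close>
  define S where "S w = (\<Sum>b\<in>Basis. \<kappa>' b w)" for w
  have S_eq: "S w = real n * \<kappa> w + frechet_derivative \<kappa> (at w) w" for w
  proof -
    have d: "(\<kappa> has_derivative frechet_derivative \<kappa> (at w)) (at w)"
      by (intro smooth_has_derivative kernel_smooth \<kappa>)
    have "\<kappa>' b w = (b \<bullet> b) * \<kappa> w + (w \<bullet> b) * frechet_derivative \<kappa> (at w) b" for b
    proof -
      have "((\<lambda>z. (z \<bullet> b) * \<kappa> z) has_derivative (\<lambda>h. (w \<bullet> b) * frechet_derivative \<kappa> (at w) h + (h \<bullet> b) * \<kappa> w)) (at w)"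
        by (intro has_derivative_mult d) (auto intro!: derivative_eq_intros)
      from fun_cong[OF frechet_derivative_at[OF this], of b] show ?thesis
        by (simp add: \<kappa>'_def)
    qed
    moreover have "frechet_derivative \<kappa> (at w) w = (\<Sum>b\<in>Basis. (w \<bullet> b) * frechet_derivative \<kappa> (at w) b)"
    proof -
      interpret linear "frechet_derivative \<kappa> (at w)"
        using d by (rule has_derivative_linear)
      have "frechet_derivative \<kappa> (at w) (\<Sum>b\<in>Basis. (w \<bullet> b) *\<^sub>R b) = (\<Sum>b\<in>Basis. (w \<bullet> b) * frechet_derivative \<kappa> (at w) b)"
        by (simp add: sum scale)
      then show ?thesis
        by (simp add: euclidean_representation)
    qed
    ultimately show ?thesis
      by (simp add: S_def sum.distrib n_def)
  qed
  have S_bnd: "\<bar>S w\<bar> \<le> (\<Sum>b\<in>Basis. B b)" for w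
    unfolding S_def using B by (intro order_trans[OF sum_abs] sum_mono)
  have S_kernel: "(\<lambda>y. S ((x - y) /\<^sub>R s)) \<in> borel_measurable lebesgue" for s
    unfolding S_def by (intro borel_measurable_sum kernel_scaled_lebesgue[OF k'])
  have der: "((\<lambda>s. \<kappa> ((x - y) /\<^sub>R s) / s ^ n) has_real_derivative
      - S ((x - y) /\<^sub>R s) / s ^ Suc n) (at s)" if "s > 0" for s y
  proof -
    define z where "z = x - y"
    have d: "(\<kappa> has_derivative frechet_derivative \<kappa> (at (z /\<^sub>R s))) (at (z /\<^sub>R s))"
      by (intro smooth_has_derivative kernel_smooth \<kappa>)
    interpret linear "frechet_derivative \<kappa> (at (z /\<^sub>R s))"
      using d by (rule has_derivative_linear)
    have "((\<lambda>s. z /\<^sub>R s) has_derivative (\<lambda>h. (- (h / s)) *\<^sub>R (z /\<^sub>R s))) (at s)"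
    proof -
      have "((\<lambda>s. z /\<^sub>R s) has_derivative (\<lambda>h. (- (inverse s * h * inverse s)) *\<^sub>R z)) (at s)"
        using that by (intro has_derivative_scaleR_left[OF Deriv.has_derivative_inverse[OF _ has_derivative_ident]]) auto
      moreover have "(\<lambda>h. (- (inverse s * h * inverse s)) *\<^sub>R z) = (\<lambda>h. (- (h / s)) *\<^sub>R (z /\<^sub>R s))"
        by (simp add: fun_eq_iff divide_inverse ac_simps)
      ultimately show ?thesis
        by simp
    qed
    from has_derivative_compose[OF this d]
    have "((\<lambda>s. \<kappa> (z /\<^sub>R s)) has_derivative (\<lambda>h. (- frechet_derivative \<kappa> (at (z /\<^sub>R s)) (z /\<^sub>R s) / s) * h)) (at s)"
      by (rule has_derivative_eq_rhs) (simp add: scale neg fun_eq_iff)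
    then have k: "((\<lambda>s. \<kappa> (z /\<^sub>R s)) has_real_derivative - frechet_derivative \<kappa> (at (z /\<^sub>R s)) (z /\<^sub>R s) / s) (at s)"
      unfolding has_field_derivative_def .
    have "((\<lambda>s. inverse s ^ n) has_real_derivative - (real n * inverse s ^ Suc n)) (at s)"
      using that by (auto intro!: derivative_eq_intros simp: power2_eq_square) (cases n; simp add: field_simps)
    from DERIV_mult[OF k this] show ?thesis
      using that by (simp add: S_eq z_def[symmetric] divide_inverse power_inverse algebra_simps)
  qed
  \<comment> \<open>Negative powers of \<open>s\<close> stay bounded away from \<open>s = 0\<close>;
    parameters within \<open>t / 2\<close> of \<open>t\<close> give the majorant with
    \<open>(t / 2) ^ Suc n\<close>.\<close>
  have near: "t / 2 < s" if "\<bar>s - t\<bar> < t / 2" for s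
    using that by (simp add: abs_if field_simps split: if_splits)
  have "((\<lambda>s. \<integral>y. u y * (\<kappa> ((x - y) /\<^sub>R s) / s ^ n) \<partial>lebesgue) has_real_derivative
      (\<integral>y. u y * (- S ((x - y) /\<^sub>R t) / t ^ Suc n) \<partial>lebesgue)) (at t)"
  proof (rule has_real_derivative_integral[OF u, of "t / 2" t _ _ "(\<Sum>b\<in>Basis. B b) / (t / 2) ^ Suc n"])
    show "\<bar>- S ((x - y) /\<^sub>R s) / s ^ Suc n\<bar> \<le> (\<Sum>b\<in>Basis. B b) / (t / 2) ^ Suc n" if "\<bar>s - t\<bar> < t / 2" for s y
    proof -
      have "(t / 2) ^ Suc n \<le> s ^ Suc n" "0 < s ^ Suc n" "0 < (t / 2) ^ Suc n"
        using near[OF that] \<open>t > 0\<close> by (auto intro!: power_mono simp del: power_Suc)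
      moreover have "0 \<le> (\<Sum>b\<in>Basis. B b)"
        using S_bnd[of 0] by linarith
      ultimately show ?thesis
        using S_bnd[of "(x - y) /\<^sub>R s"] by (simp add: frac_le del: power_Suc)
    qed
    show "(\<lambda>y. \<kappa> ((x - y) /\<^sub>R s) / s ^ n) \<in> borel_measurable lebesgue" for s
      by (intro borel_measurable_divide kernel_scaled_lebesgue[OF \<kappa>] borel_measurable_const)
    show "(\<lambda>y. - S ((x - y) /\<^sub>R t) / t ^ Suc n) \<in> borel_measurable lebesgue"
      by (intro borel_measurable_divide borel_measurable_uminus S_kernel borel_measurable_const)
    show "((\<lambda>s. \<kappa> ((x - y) /\<^sub>R s) / s ^ n) has_real_derivative - S ((x - y) /\<^sub>R s) / s ^ Suc n) (at s)"
      if "\<bar>s - t\<bar> < t / 2" for s y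
      using der near[OF that] \<open>t > 0\<close> by simp
  qed (use mollify_integrable[OF u \<kappa>] \<open>t > 0\<close> in auto)
  moreover have "(\<integral>y. u y * (- S ((x - y) /\<^sub>R t) / t ^ Suc n) \<partial>lebesgue) = - (\<Sum>b\<in>Basis. mollify (\<kappa>' b) t u x) / t"
  proof -
    have "(\<integral>y. u y * (- S ((x - y) /\<^sub>R t) / t ^ Suc n) \<partial>lebesgue) =
       (\<integral>y. (\<Sum>b\<in>Basis. u y * (\<kappa>' b ((x - y) /\<^sub>R t) / t ^ n)) * (- 1 / t) \<partial>lebesgue)"
      by (intro Bochner_Integration.integral_cong refl) (simp add: S_def sum_distrib_left sum_distrib_right sum_divide_distrib ac_simps sum_negf)
    also have "\<dots> = (\<Sum>b\<in>Basis. mollify (\<kappa>' b) t u x) * (- 1 / t)"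
      unfolding mollify_def n_def using mollify_integrable[OF u k'] by (simp add: Bochner_Integration.integral_sum)
    finally show ?thesis
      by simp
  qed
  ultimately show ?thesis
    unfolding mollify_def \<kappa>'_def n_def by simp
qed

lemma nn_integral_affine:
  fixes f :: "'a::euclidean_space \<Rightarrow> ennreal"
  assumes "f \<in> borel_measurable borel" "c \<noteq> 0"
  shows "(\<integral>\<^sup>+y. f y \<partial>lborel) = ennreal (\<bar>c\<bar> ^ DIM('a)) * (\<integral>\<^sup>+z. f (x + c *\<^sub>R z) \<partial>lborel)"
  using assms by (subst lborel_affine[OF \<open>c \<noteq> 0\<close>, of x]) (simp add: nn_integral_density nn_integral_distr nn_integral_cmult)

lemma integral_affine:
  fixes f :: "'a::euclidean_space \<Rightarrow> real"
  assumes "f \<in> borel_measurable borel" "c \<noteq> 0"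
  shows "(\<integral>y. f y \<partial>lborel) = \<bar>c\<bar> ^ DIM('a) * (\<integral>z. f (x + c *\<^sub>R z) \<partial>lborel)"
  using assms by (subst lborel_affine[OF \<open>c \<noteq> 0\<close>, of x]) (simp add: integral_density integral_distr)

lemma nn_integral_lebesgue_borel:
  "f \<in> borel_measurable borel \<Longrightarrow> (\<integral>\<^sup>+y. f y \<partial>lebesgue) = (\<integral>\<^sup>+y. f y \<partial>lborel)"
  by (rule nn_integral_completion)

lemma nn_integral_scaled_kernel:
  fixes y :: "'a::euclidean_space"
  assumes \<kappa>: "kernel \<kappa>" and "t > 0"
  shows "(\<integral>\<^sup>+x. ennreal (\<bar>\<kappa> ((x - y) /\<^sub>R t)\<bar> / t ^ DIM('a)) \<partial>lebesgue) = (\<integral>\<^sup>+x. ennreal \<bar>\<kappa> x\<bar> \<partial>lborel)"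
proof -
  have m: "(\<lambda>x. ennreal (\<bar>\<kappa> ((x - y) /\<^sub>R t)\<bar> / t ^ DIM('a))) \<in> borel_measurable borel"
    by (intro measurable_compose[OF _ measurable_ennreal] borel_measurable_divide borel_measurable_abs
        measurable_compose[OF _ kernel_borel[OF \<kappa>]]) auto
  have "(\<integral>\<^sup>+x. ennreal (\<bar>\<kappa> ((x - y) /\<^sub>R t)\<bar> / t ^ DIM('a)) \<partial>lebesgue) =
     ennreal (\<bar>t\<bar> ^ DIM('a)) * (\<integral>\<^sup>+z. ennreal (\<bar>\<kappa> ((y + t *\<^sub>R z - y) /\<^sub>R t)\<bar> / t ^ DIM('a)) \<partial>lborel)"
    using \<open>t > 0\<close> by (subst nn_integral_lebesgue_borel[OF m], subst nn_integral_affine[OF m, of t y]) auto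
  also have "\<dots> = (\<integral>\<^sup>+z. ennreal (\<bar>t\<bar> ^ DIM('a)) * ennreal (\<bar>\<kappa> ((y + t *\<^sub>R z - y) /\<^sub>R t)\<bar> / t ^ DIM('a)) \<partial>lborel)"
    using m by (intro nn_integral_cmult[symmetric]) (rule measurable_compose[of "\<lambda>z. y + t *\<^sub>R z" _ borel], auto)
  also have "\<dots> = (\<integral>\<^sup>+x. ennreal \<bar>\<kappa> x\<bar> \<partial>lborel)"
    using \<open>t > 0\<close> by (intro nn_integral_cong) (simp flip: ennreal_mult)
  finally show ?thesis .
qed

lemma integral_scaled_kernel:
  fixes x :: "'a::euclidean_space"
  assumes \<kappa>: "kernel \<kappa>" and "t > 0"
  shows "(\<integral>y. \<kappa> ((x - y) /\<^sub>R t) / t ^ DIM('a) \<partial>lebesgue) = (\<integral>z. \<kappa> z \<partial>lborel)"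
proof -
  have m: "(\<lambda>y. \<kappa> ((x - y) /\<^sub>R t) / t ^ DIM('a)) \<in> borel_measurable borel"
    by (intro borel_measurable_divide kernel_scaled_measurable \<kappa> borel_measurable_const)
  have "(\<integral>y. \<kappa> ((x - y) /\<^sub>R t) / t ^ DIM('a) \<partial>lebesgue) = (\<integral>y. \<kappa> ((x - y) /\<^sub>R t) / t ^ DIM('a) \<partial>lborel)"
    using m by (intro integral_completion) simp
  also have "\<dots> = \<bar>- t\<bar> ^ DIM('a) * (\<integral>z. \<kappa> ((x - (x + (- t) *\<^sub>R z)) /\<^sub>R t) / t ^ DIM('a) \<partial>lborel)"
    using \<open>t > 0\<close> by (intro integral_affine[OF m]) auto
  also have "\<dots> = (\<integral>z. \<kappa> z \<partial>lborel)"
    using \<open>t > 0\<close> by simp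
  finally show ?thesis .
qed

lemma mollify_diff_const:
  fixes x :: "'a::euclidean_space"
  assumes u: "integrable lebesgue u" and \<kappa>: "kernel \<kappa>" and "t > 0"
  shows "mollify \<kappa> t (\<lambda>y. u y - c) x = mollify \<kappa> t u x - c * (\<integral>z. \<kappa> z \<partial>lborel)"
proof -
  have "integrable lebesgue (\<lambda>y. \<kappa> ((x - y) /\<^sub>R t) / t ^ DIM('a))"
  proof -
    obtain B where B: "\<And>x. \<bar>\<kappa> x\<bar> \<le> B"
      using kernel_bounded[OF \<kappa>] by blast
    have "integrable lborel (\<lambda>y. \<kappa> ((x - y) /\<^sub>R t))"
    proof (rule integrable_bounded_support[where B = B and z = x and r = t])
      show "\<kappa> ((x - y) /\<^sub>R t) = 0" if "y \<notin> cball x t" for y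
        using kernel_scaled_eq_0[OF \<kappa> \<open>t > 0\<close>, of y x] that by auto
    qed (use B kernel_scaled_measurable[OF \<kappa>] in auto)
    then have "integrable lebesgue (\<lambda>y. \<kappa> ((x - y) /\<^sub>R t))"
      using kernel_scaled_measurable[OF \<kappa>] by (subst integrable_completion) auto
    then show ?thesis
      by (rule integrable_divide)
  qed
  then have "(\<integral>y. u y * (\<kappa> ((x - y) /\<^sub>R t) / t ^ DIM('a)) - c * (\<kappa> ((x - y) /\<^sub>R t) / t ^ DIM('a)) \<partial>lebesgue) =
     mollify \<kappa> t u x - c * (\<integral>y. \<kappa> ((x - y) /\<^sub>R t) / t ^ DIM('a) \<partial>lebesgue)"
    unfolding mollify_def using mollify_integrable[OF u \<kappa>]
    by (subst Bochner_Integration.integral_diff; (intro integrable_mult_right)?; simp only: integral_mult_right_zero)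
  then show ?thesis
    unfolding integral_scaled_kernel[OF \<kappa> \<open>t > 0\<close>] unfolding mollify_def left_diff_distrib .
qed

text \<open>The constant \<open>c\<close> is subtracted before estimating. This is used with a
  kernel of integral \<open>0\<close> to exploit a Lipschitz bound, with integral \<open>1\<close>
  for uniform convergence, and with \<open>c = 0\<close> for a plain supremum bound.\<close>

lemma mollify_oscillation:
  fixes x :: "'a::euclidean_space"
  assumes u: "integrable lebesgue u" and \<kappa>: "kernel \<kappa>" "\<And>x. \<bar>\<kappa> x\<bar> \<le> C" and "t > 0" "\<eta> \<ge> 0"
    and osc: "\<And>y. y \<in> ball x t \<Longrightarrow> \<bar>u y - c\<bar> \<le> \<eta>"
  shows "\<bar>mollify \<kappa> t u x - c * (\<integral>z. \<kappa> z \<partial>lborel)\<bar> \<le> C * (unit_ball_vol DIM('a) * \<eta>)"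
  unfolding mollify_diff_const[OF u \<kappa>(1) \<open>t > 0\<close>, symmetric]
proof (rule mollify_bound[OF _ \<kappa> \<open>t > 0\<close>])
  show "(\<lambda>y. u y - c) \<in> borel_measurable lebesgue"
    using u by auto
  have "(\<integral>\<^sup>+y\<in>ball x t. ennreal \<bar>u y - c\<bar> \<partial>lebesgue) \<le> (\<integral>\<^sup>+y. ennreal \<eta> * indicator (ball x t) y \<partial>lebesgue)"
    using osc by (intro nn_integral_mono) (auto simp: indicator_def intro!: ennreal_leI)
  also have "\<dots> = ennreal \<eta> * emeasure lebesgue (ball x t)"
    by (rule nn_integral_cmult_indicator) auto
  also have "emeasure lebesgue (ball x t) = ennreal (unit_ball_vol DIM('a) * t ^ DIM('a))"
    using emeasure_ball[of t x] \<open>t > 0\<close> by simp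
  finally show "(\<integral>\<^sup>+y\<in>ball x t. ennreal \<bar>u y - c\<bar> \<partial>lebesgue) \<le> ennreal (unit_ball_vol (real DIM('a)) * \<eta> * t ^ DIM('a))"
    using \<open>\<eta> \<ge> 0\<close> \<open>t > 0\<close> by (simp add: ac_simps flip: ennreal_mult)
qed (use \<open>\<eta> \<ge> 0\<close> in auto)

subsection \<open>Convergence in mean\<close>

text \<open>Young's inequality for the convolution of two integrable functions, by exchanging the
  integrals; the dilation preserves the \<open>L^1\<close> norm of the kernel.\<close>

lemma mollify_L1_bound:
  fixes u :: "'a::euclidean_space \<Rightarrow> real"
  assumes u: "integrable lebesgue u" and \<kappa>: "kernel \<kappa>" and "t > 0"
  shows "(\<integral>\<^sup>+x. ennreal \<bar>mollify \<kappa> t u x\<bar> \<partial>lebesgue) \<le>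
     (\<integral>\<^sup>+y. ennreal \<bar>u y\<bar> \<partial>lebesgue) * (\<integral>\<^sup>+x. ennreal \<bar>\<kappa> x\<bar> \<partial>lborel)"
proof -
  let ?n = "t ^ DIM('a)"
  interpret L: sigma_finite_measure "lebesgue :: 'a measure"
    by (rule sigma_finite_lebesgue)
  interpret P: pair_sigma_finite "lebesgue :: 'a measure" "lebesgue :: 'a measure"
    by standard
  have um: "u \<in> borel_measurable lebesgue"
    using u by auto
  have "(\<integral>\<^sup>+x. ennreal \<bar>mollify \<kappa> t u x\<bar> \<partial>lebesgue) \<le>
    (\<integral>\<^sup>+x. \<integral>\<^sup>+y. ennreal \<bar>u y * (\<kappa> ((x - y) /\<^sub>R t) / ?n)\<bar> \<partial>lebesgue \<partial>lebesgue)"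
  proof (intro nn_integral_mono)
    fix x
    show "ennreal \<bar>mollify \<kappa> t u x\<bar> \<le> (\<integral>\<^sup>+y. ennreal \<bar>u y * (\<kappa> ((x - y) /\<^sub>R t) / ?n)\<bar> \<partial>lebesgue)"
      using integral_norm_bound_ennreal[OF mollify_integrable[OF u \<kappa>, where x = x and t = t and c = ?n]]
      unfolding mollify_def real_norm_def .
  qed
  also have "\<dots> = (\<integral>\<^sup>+y. \<integral>\<^sup>+x. ennreal \<bar>u y * (\<kappa> ((x - y) /\<^sub>R t) / ?n)\<bar> \<partial>lebesgue \<partial>lebesgue)"
  proof (rule P.Fubini'[symmetric])
    have "(\<lambda>x. x) \<in> measurable (lebesgue :: 'a measure) borel"
      by (rule borel_imp_lebesgue_measurable) simp
    from mollify_pair_measurable[OF um \<kappa> this, of t ?n]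
    show "(\<lambda>(x, y). ennreal \<bar>u y * (\<kappa> ((x - y) /\<^sub>R t) / ?n)\<bar>) \<in> borel_measurable (lebesgue \<Otimes>\<^sub>M lebesgue)"
      unfolding case_prod_beta by (intro measurable_compose[OF _ measurable_ennreal] borel_measurable_abs)
  qed
  also have "\<dots> = (\<integral>\<^sup>+y. ennreal \<bar>u y\<bar> * (\<integral>\<^sup>+x. ennreal \<bar>\<kappa> x\<bar> \<partial>lborel) \<partial>lebesgue)"
  proof (intro nn_integral_cong)
    fix y
    have "(\<integral>\<^sup>+x. ennreal \<bar>u y * (\<kappa> ((x - y) /\<^sub>R t) / ?n)\<bar> \<partial>lebesgue) =
      (\<integral>\<^sup>+x. ennreal \<bar>u y\<bar> * ennreal (\<bar>\<kappa> ((x - y) /\<^sub>R t)\<bar> / ?n) \<partial>lebesgue)"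
      using \<open>t > 0\<close> by (intro nn_integral_cong) (simp add: abs_mult flip: ennreal_mult)
    also have "\<dots> = ennreal \<bar>u y\<bar> * (\<integral>\<^sup>+x. ennreal (\<bar>\<kappa> ((x - y) /\<^sub>R t)\<bar> / ?n) \<partial>lebesgue)"
      by (intro nn_integral_cmult measurable_compose[OF _ measurable_ennreal] borel_measurable_divide borel_measurable_abs
          borel_imp_lebesgue_measurable measurable_compose[OF _ kernel_borel[OF \<kappa>]]) auto
    finally show "(\<integral>\<^sup>+x. ennreal \<bar>u y * (\<kappa> ((x - y) /\<^sub>R t) / ?n)\<bar> \<partial>lebesgue) = ennreal \<bar>u y\<bar> * (\<integral>\<^sup>+x. ennreal \<bar>\<kappa> x\<bar> \<partial>lborel)"
      unfolding nn_integral_scaled_kernel[OF \<kappa> \<open>t > 0\<close>] .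
  qed
  also have "\<dots> = (\<integral>\<^sup>+y. ennreal \<bar>u y\<bar> \<partial>lebesgue) * (\<integral>\<^sup>+x. ennreal \<bar>\<kappa> x\<bar> \<partial>lborel)"
    using um by (intro nn_integral_multc measurable_compose[OF _ measurable_ennreal] borel_measurable_abs)
  finally show ?thesis .
qed

lemma mollify_uniform_limit:
  fixes g :: "'a::euclidean_space \<Rightarrow> real"
  assumes g: "continuous_on UNIV g" "integrable lebesgue g"
    and \<rho>: "kernel \<rho>" "(\<integral>z. \<rho> z \<partial>lborel) = 1" and K: "compact K" and "e > 0"
  obtains d where "d > 0" "\<And>x t. x \<in> K \<Longrightarrow> 0 < t \<Longrightarrow> t < d \<Longrightarrow> \<bar>mollify \<rho> t g x - g x\<bar> \<le> e"
proof -
  obtain C where "C > 0" and C: "\<And>x. \<bar>\<rho> x\<bar> \<le> C"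
    using kernel_bounded[OF \<rho>(1)] by blast
  define \<omega> where "\<omega> = unit_ball_vol (real DIM('a))"
  have "\<omega> > 0"
    by (simp add: \<omega>_def)
  define \<eta> where "\<eta> = e / (C * \<omega>)"
  have "\<eta> > 0"
    using \<open>e > 0\<close> \<open>C > 0\<close> \<open>\<omega> > 0\<close> by (simp add: \<eta>_def)
  \<comment> \<open>The closed neighbourhood of radius \<open>1\<close> is compact, so
    \<open>g\<close> is uniformly continuous on it; the scale is kept below \<open>1\<close> so that
    all balls around points of \<open>K\<close> stay inside.\<close>
  define K' where "K' = {x + y | x y. x \<in> K \<and> y \<in> cball (0::'a) 1}"
  have "compact K'"
    unfolding K'_def by (intro compact_sums K compact_cball)
  then have "uniformly_continuous_on K' g"
    using g(1) by (intro compact_uniformly_continuous) (rule continuous_on_subset, auto)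
  then obtain d where d: "d > 0" "\<And>x y. x \<in> K' \<Longrightarrow> y \<in> K' \<Longrightarrow> dist y x < d \<Longrightarrow> dist (g y) (g x) < \<eta>"
    using \<open>\<eta> > 0\<close> unfolding uniformly_continuous_on_def by metis
  show thesis
  proof (rule that[of "min d 1"])
    fix x t
    assume x: "x \<in> K" and t: "0 < t" "t < min d 1"
    have "x \<in> K'"
      using x by (force simp: K'_def)
    have "\<bar>g y - g x\<bar> \<le> \<eta>" if y: "y \<in> ball x t" for y
    proof -
      have "y = x + (y - x)" "norm (y - x) \<le> 1"
        using y t by (auto simp: dist_norm norm_minus_commute)
      then have "y \<in> K'"
        using x unfolding K'_def by (smt (verit) mem_Collect_eq mem_cball_0)
      moreover have "dist y x < d"
        using y t by (simp add: dist_commute)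
      ultimately show ?thesis
        using d(2)[OF \<open>x \<in> K'\<close>, of y] by (simp add: dist_real_def)
    qed
    from mollify_oscillation[OF g(2) \<rho>(1) C t(1) less_imp_le[OF \<open>\<eta> > 0\<close>] this]
    have "\<bar>mollify \<rho> t g x - g x * 1\<bar> \<le> C * (\<omega> * \<eta>)"
      unfolding \<rho>(2) \<omega>_def .
    then show "\<bar>mollify \<rho> t g x - g x\<bar> \<le> e"
      using \<open>C > 0\<close> \<open>\<omega> > 0\<close> by (simp add: \<eta>_def)
  qed (use d in auto)
qed

text \<open>Density of continuous functions in \<open>L^1\<close>. For an indicator, Urysohn's lemma
  interpolates between a closed set inside and an open set outside \<open>A\<close>, each up to
  measure \<open>d\<close>; sums and dominated limits follow by the induction rule for integrable
  functions.\<close>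

lemma integrable_approximate_continuous:
  fixes u :: "'a::euclidean_space \<Rightarrow> real"
  assumes "integrable lebesgue u" "e > 0"
  shows "\<exists>g. continuous_on UNIV g \<and> integrable lebesgue g \<and> (\<integral>\<^sup>+x. ennreal \<bar>u x - g x\<bar> \<partial>lebesgue) < ennreal e"
  using assms
proof (induction arbitrary: e rule: integrable_induct)
  case (base A c)
  \<comment> \<open>The \<open>+ 1\<close> in the denominator covers \<open>c = 0\<close> and makes
    the final inequality strict.\<close>
  define d where "d = e / (2 * (\<bar>c\<bar> + 1))"
  have "d > 0"
    using base by (simp add: d_def)
  obtain T where T: "open T" "A \<subseteq> T" "T - A \<in> lmeasurable" "emeasure lebesgue (T - A) < ennreal d"
    using sets_lebesgue_outer_open[OF base(1) \<open>d > 0\<close>] by metis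
  obtain C where C: "closed C" "C \<subseteq> A" "A - C \<in> lmeasurable" "emeasure lebesgue (A - C) < ennreal d"
    using sets_lebesgue_inner_closed[OF base(1) \<open>d > 0\<close>] by metis
  have "T \<in> lmeasurable"
  proof -
    have "A \<in> lmeasurable"
      using base by (simp add: fmeasurableI)
    then have "(T - A) \<union> A \<in> lmeasurable"
      using T(3) by (rule fmeasurable.Un[rotated])
    moreover have "(T - A) \<union> A = T"
      using T(2) by auto
    ultimately show ?thesis
      by simp
  qed
  have "closed (- T)" "C \<inter> - T = {}"
    using T C by auto
  then obtain g :: "'a \<Rightarrow> real" where g: "continuous_on UNIV g" "\<And>x. g x \<in> closed_segment 1 0"
      "\<And>x. x \<in> C \<Longrightarrow> g x = 1" "\<And>x. x \<in> - T \<Longrightarrow> g x = 0"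
    using Urysohn[OF C(1)] by metis
  have g01: "0 \<le> g x" "g x \<le> 1" for x
    using g(2)[of x] by (auto simp: closed_segment_eq_real_ivl split: if_splits)
  have gint: "integrable lebesgue g"
  proof (rule Bochner_Integration.integrable_bound)
    show "integrable lebesgue (indicator T :: 'a \<Rightarrow> real)"
      using \<open>T \<in> lmeasurable\<close> by (simp add: lmeasurable_iff_integrable)
    show "g \<in> borel_measurable lebesgue"
      by (intro borel_imp_lebesgue_measurable borel_measurable_continuous_onI g)
    show "AE x in lebesgue. norm (g x) \<le> norm (indicator T x :: real)"
      using g01 g(4) by (intro AE_I2) (auto simp: indicator_def)
  qed
  have "(\<integral>\<^sup>+x. ennreal \<bar>indicator A x *\<^sub>R c - c * g x\<bar> \<partial>lebesgue) \<le>
     (\<integral>\<^sup>+x. ennreal \<bar>c\<bar> * (indicator (T - A) x + indicator (A - C) x) \<partial>lebesgue)"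
  proof (intro nn_integral_mono)
    fix x
    have "\<bar>c * g x\<bar> \<le> \<bar>c\<bar>" "\<bar>c - c * g x\<bar> \<le> \<bar>c\<bar>"
    proof -
      have "\<bar>c\<bar> * g x \<le> \<bar>c\<bar> * 1" "\<bar>c\<bar> * (1 - g x) \<le> \<bar>c\<bar> * 1"
        using g01[of x] by (intro mult_left_mono; simp)+
      moreover have "\<bar>c - c * g x\<bar> = \<bar>c\<bar> * (1 - g x)"
      proof -
        have "c - c * g x = c * (1 - g x)"
          by (simp add: right_diff_distrib)
        then show ?thesis
          using g01[of x] by (simp only: abs_mult)
      qed
      ultimately show "\<bar>c * g x\<bar> \<le> \<bar>c\<bar>" "\<bar>c - c * g x\<bar> \<le> \<bar>c\<bar>"
        using g01[of x] by (simp_all add: abs_mult)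
    qed
    then show "ennreal \<bar>indicator A x *\<^sub>R c - c * g x\<bar> \<le> ennreal \<bar>c\<bar> * (indicator (T - A) x + indicator (A - C) x)"
      using g(3)[of x] g(4)[of x] T(2) C(2) by (auto simp: indicator_def intro: ennreal_leI)
  qed
  also have "\<dots> = ennreal \<bar>c\<bar> * (emeasure lebesgue (T - A) + emeasure lebesgue (A - C))"
    using T(3) C(3) by (subst nn_integral_cmult) (auto simp: fmeasurableD nn_integral_add simp del: emeasure_completion)
  also have "\<dots> \<le> ennreal \<bar>c\<bar> * (ennreal d + ennreal d)"
    using T(4) C(4) by (intro mult_left_mono add_mono) auto
  also have "\<dots> = ennreal (\<bar>c\<bar> * (d + d))"
    using \<open>d > 0\<close> by (subst ennreal_mult, simp, simp, subst ennreal_plus, simp_all)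
  also have "\<dots> < ennreal e"
  proof (rule ennreal_lessI)
    have "\<bar>c\<bar> / (\<bar>c\<bar> + 1) < 1"
      by simp
    then have "e * (\<bar>c\<bar> / (\<bar>c\<bar> + 1)) < e * 1"
      using base(3) by (intro mult_strict_left_mono)
    moreover have "\<bar>c\<bar> * (d + d) = e * (\<bar>c\<bar> / (\<bar>c\<bar> + 1))"
    proof -
      have "d + d = e / (\<bar>c\<bar> + 1)"
        unfolding d_def by (simp add: divide_simps)
      then show ?thesis
        by (simp add: ac_simps)
    qed
    ultimately show "\<bar>c\<bar> * (d + d) < e"
      by simp
  qed (use base(3) in auto)
  finally show ?case
    using g(1) gint by (intro exI[of _ "\<lambda>x. c * g x"]) (auto intro!: continuous_intros)
next
  case (add u v)
  obtain g h where g: "continuous_on UNIV g" "integrable lebesgue g" "(\<integral>\<^sup>+x. ennreal \<bar>u x - g x\<bar> \<partial>lebesgue) < ennreal (e / 2)"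
    and h: "continuous_on UNIV h" "integrable lebesgue h" "(\<integral>\<^sup>+x. ennreal \<bar>v x - h x\<bar> \<partial>lebesgue) < ennreal (e / 2)"
    using add.IH(1)[of "e / 2"] add.IH(2)[of "e / 2"] add.prems by auto
  have "(\<integral>\<^sup>+x. ennreal \<bar>u x + v x - (g x + h x)\<bar> \<partial>lebesgue) \<le> (\<integral>\<^sup>+x. (ennreal \<bar>u x - g x\<bar> + ennreal \<bar>v x - h x\<bar>) \<partial>lebesgue)"
    by (intro nn_integral_mono) (auto simp flip: ennreal_plus intro!: ennreal_leI)
  also have "\<dots> = (\<integral>\<^sup>+x. ennreal \<bar>u x - g x\<bar> \<partial>lebesgue) + (\<integral>\<^sup>+x. ennreal \<bar>v x - h x\<bar> \<partial>lebesgue)"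
    using add.hyps g h by (intro nn_integral_add) auto
  also have "\<dots> < ennreal (e / 2) + ennreal (e / 2)"
    using g(3) h(3) by (intro add_strict_mono) auto
  also have "\<dots> = ennreal e"
    using add.prems by (simp flip: ennreal_plus)
  finally show ?case
    using g h by (intro exI[of _ "\<lambda>x. g x + h x"]) (auto intro!: continuous_intros)
next
  case (lim u s)
  have "(\<lambda>i. \<integral>\<^sup>+x. ennreal (norm (u x - s i x)) \<partial>lebesgue) \<longlonglongrightarrow> 0"
  proof (rule nn_integral_dominated_convergence_norm[where w = "\<lambda>x. 2 * norm (u x)"])
    show "(\<integral>\<^sup>+x. ennreal (2 * norm (u x)) \<partial>lebesgue) < \<infinity>"
      using lim.hyps(4) integrable_iff_bounded[of lebesgue "\<lambda>x. 2 * norm (u x)"] by simp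
  qed (use lim.hyps in auto)
  then have "\<forall>\<^sub>F i in sequentially. (\<integral>\<^sup>+x. ennreal (norm (u x - s i x)) \<partial>lebesgue) < ennreal (e / 2)"
    using lim.prems by (intro order_tendstoD) auto
  then obtain i where i: "(\<integral>\<^sup>+x. ennreal (norm (u x - s i x)) \<partial>lebesgue) < ennreal (e / 2)"
    by (auto simp: eventually_sequentially)
  obtain g where g: "continuous_on UNIV g" "integrable lebesgue g" "(\<integral>\<^sup>+x. ennreal \<bar>s i x - g x\<bar> \<partial>lebesgue) < ennreal (e / 2)"
    using lim.IH[of "e / 2" i] lim.prems by auto
  have "(\<integral>\<^sup>+x. ennreal \<bar>u x - g x\<bar> \<partial>lebesgue) \<le> (\<integral>\<^sup>+x. (ennreal (norm (u x - s i x)) + ennreal \<bar>s i x - g x\<bar>) \<partial>lebesgue)"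
    by (intro nn_integral_mono) (auto simp flip: ennreal_plus intro!: ennreal_leI)
  also have "\<dots> = (\<integral>\<^sup>+x. ennreal (norm (u x - s i x)) \<partial>lebesgue) + (\<integral>\<^sup>+x. ennreal \<bar>s i x - g x\<bar> \<partial>lebesgue)"
    using lim.hyps(1,4) g by (intro nn_integral_add) auto
  also have "\<dots> < ennreal (e / 2) + ennreal (e / 2)"
    using g(3) i by (intro add_strict_mono) auto
  also have "\<dots> = ennreal e"
    using lim.prems by (simp flip: ennreal_plus)
  finally show ?case
    using g by blast
qed

text \<open>Approximate \<open>u\<close> by a continuous \<open>g\<close> up to \<open>e\<close> in
  mean: Young's inequality gives \<open>e R\<close> for the mollified difference, uniform
  convergence on \<open>K\<close> gives \<open>e k\<close>, and the difference itself gives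
  \<open>e\<close>.\<close>

lemma mollify_tendsto_L1:
  fixes u :: "'a::euclidean_space \<Rightarrow> real"
  assumes u: "integrable lebesgue u" and \<rho>: "kernel \<rho>" "(\<integral>z. \<rho> z \<partial>lborel) = 1" and K: "compact K"
    and t: "\<And>n. t n > 0" "t \<longlonglongrightarrow> 0"
  shows "(\<lambda>n. \<integral>\<^sup>+x\<in>K. ennreal \<bar>mollify \<rho> (t n) u x - u x\<bar> \<partial>lebesgue) \<longlonglongrightarrow> 0"
proof (rule tendsto_0_if_Limsup_eq_0_ennreal)
  have um: "u \<in> borel_measurable lebesgue"
    using u by auto
  define R where "R = (\<integral>x. \<bar>\<rho> x\<bar> \<partial>lborel)"
  have R: "(\<integral>\<^sup>+x. ennreal \<bar>\<rho> x\<bar> \<partial>lborel) = ennreal R" "R \<ge> 0"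
    unfolding R_def using kernel_integrable[OF \<rho>(1)] by (auto intro!: nn_integral_eq_integral)
  define k where "k = measure lebesgue K"
  have k: "emeasure lebesgue K = ennreal k" "k \<ge> 0"
    using K by (auto simp: k_def lmeasurable_compact emeasure_eq_measure2 simp del: emeasure_completion)
  have Ks: "K \<in> sets lebesgue"
    using K by (simp add: fmeasurableD lmeasurable_compact)
  have bound: "Limsup sequentially (\<lambda>n. \<integral>\<^sup>+x\<in>K. ennreal \<bar>mollify \<rho> (t n) u x - u x\<bar> \<partial>lebesgue) \<le> ennreal (e * (R + k + 1))"
    if "e > 0" for e
  proof -
    obtain g where g: "continuous_on UNIV g" and gi: "integrable lebesgue g"
      and ug_lt: "(\<integral>\<^sup>+x. ennreal \<bar>u x - g x\<bar> \<partial>lebesgue) < ennreal e"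
      using integrable_approximate_continuous[OF u \<open>e > 0\<close>] by blast
    note ug_le = less_imp_le[OF ug_lt]
    have ug: "integrable lebesgue (\<lambda>x. u x - g x)"
      using u gi by simp
    obtain d where d: "d > 0" "\<And>x t. x \<in> K \<Longrightarrow> 0 < t \<Longrightarrow> t < d \<Longrightarrow> \<bar>mollify \<rho> t g x - g x\<bar> \<le> e"
      using mollify_uniform_limit[OF g gi \<rho> K \<open>e > 0\<close>] by metis
    have "\<forall>\<^sub>F n in sequentially. t n < d"
      using t(2) d(1) by (rule order_tendstoD)
    then have "\<forall>\<^sub>F n in sequentially. (\<integral>\<^sup>+x\<in>K. ennreal \<bar>mollify \<rho> (t n) u x - u x\<bar> \<partial>lebesgue) \<le> ennreal (e * (R + k + 1))"
    proof eventually_elim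
      case (elim n)
      have mm: "mollify \<rho> (t n) v \<in> borel_measurable lebesgue" if "v \<in> borel_measurable lebesgue" for v :: "'a \<Rightarrow> real"
        by (intro borel_imp_lebesgue_measurable mollify_borel that \<rho>)
      have [measurable]: "mollify \<rho> (t n) (\<lambda>x. u x - g x) \<in> borel_measurable lebesgue" "K \<in> sets lebesgue"
        "(\<lambda>x. u x - g x) \<in> borel_measurable lebesgue"
        using mm[of "\<lambda>x. u x - g x"] ug Ks by auto
      have lin: "mollify \<rho> (t n) (\<lambda>x. u x - g x) x = mollify \<rho> (t n) u x - mollify \<rho> (t n) g x" for x
        unfolding mollify_def left_diff_distrib
        using mollify_integrable[OF u \<rho>(1)] mollify_integrable[OF gi \<rho>(1)] by (rule Bochner_Integration.integral_diff)
      have "(\<integral>\<^sup>+x\<in>K. ennreal \<bar>mollify \<rho> (t n) u x - u x\<bar> \<partial>lebesgue) \<le>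
        (\<integral>\<^sup>+x. ((ennreal \<bar>mollify \<rho> (t n) (\<lambda>x. u x - g x) x\<bar> + ennreal e * indicator K x) + ennreal \<bar>u x - g x\<bar>) \<partial>lebesgue)"
      proof (intro nn_integral_mono)
        fix x
        show "ennreal \<bar>mollify \<rho> (t n) u x - u x\<bar> * indicator K x \<le>
          (ennreal \<bar>mollify \<rho> (t n) (\<lambda>x. u x - g x) x\<bar> + ennreal e * indicator K x) + ennreal \<bar>u x - g x\<bar>"
        proof (cases "x \<in> K")
          case True
          have "\<bar>mollify \<rho> (t n) g x - g x\<bar> \<le> e"
            using d(2)[OF True t(1) elim] .
          then have "\<bar>mollify \<rho> (t n) u x - u x\<bar> \<le> \<bar>mollify \<rho> (t n) (\<lambda>x. u x - g x) x\<bar> + e + \<bar>u x - g x\<bar>"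
            unfolding lin by linarith
          then have "ennreal \<bar>mollify \<rho> (t n) u x - u x\<bar> \<le> ennreal (\<bar>mollify \<rho> (t n) (\<lambda>x. u x - g x) x\<bar> + e + \<bar>u x - g x\<bar>)"
            by (rule ennreal_leI)
          then show ?thesis
            using True \<open>e > 0\<close> by (simp add: ennreal_plus)
        qed simp
      qed
      also have "\<dots> = (\<integral>\<^sup>+x. ennreal \<bar>mollify \<rho> (t n) (\<lambda>x. u x - g x) x\<bar> \<partial>lebesgue) + ennreal e * ennreal k
          + (\<integral>\<^sup>+x. ennreal \<bar>u x - g x\<bar> \<partial>lebesgue)"
        using k Ks by (subst nn_integral_add, measurable, subst nn_integral_add, measurable)
          (simp add: nn_integral_cmult_indicator del: emeasure_completion)
      also have "\<dots> \<le> ennreal e * ennreal R + ennreal e * ennreal k + ennreal e"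
      proof (intro add_mono order_refl ug_le)
        have "(\<integral>\<^sup>+x. ennreal \<bar>mollify \<rho> (t n) (\<lambda>x. u x - g x) x\<bar> \<partial>lebesgue) \<le>
          (\<integral>\<^sup>+x. ennreal \<bar>u x - g x\<bar> \<partial>lebesgue) * ennreal R"
          using mollify_L1_bound[OF ug \<rho>(1) t(1)] unfolding R(1) .
        also have "\<dots> \<le> ennreal e * ennreal R"
          by (intro mult_right_mono ug_le) simp
        finally show "(\<integral>\<^sup>+x. ennreal \<bar>mollify \<rho> (t n) (\<lambda>x. u x - g x) x\<bar> \<partial>lebesgue) \<le> ennreal e * ennreal R" .
      qed
      also have "\<dots> = ennreal (e * (R + k + 1))"
        using \<open>e > 0\<close> R(2) k(2) by (simp add: distrib_left ennreal_mult ennreal_plus)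
      finally show ?case .
    qed
    then show ?thesis
      by (rule Limsup_bounded)
  qed
  show "Limsup sequentially (\<lambda>n. \<integral>\<^sup>+x\<in>K. ennreal \<bar>mollify \<rho> (t n) u x - u x\<bar> \<partial>lebesgue) = 0"
  proof (rule antisym)
    show "Limsup sequentially (\<lambda>n. \<integral>\<^sup>+x\<in>K. ennreal \<bar>mollify \<rho> (t n) u x - u x\<bar> \<partial>lebesgue) \<le> 0"
    proof (rule ennreal_le_epsilon)
      fix \<epsilon> :: real
      assume "\<epsilon> > 0"
      have "R + k + 1 > 0"
        using R(2) k(2) by simp
      then show "Limsup sequentially (\<lambda>n. \<integral>\<^sup>+x\<in>K. ennreal \<bar>mollify \<rho> (t n) u x - u x\<bar> \<partial>lebesgue) \<le> 0 + ennreal \<epsilon>"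
        using bound[of "\<epsilon> / (R + k + 1)"] \<open>\<epsilon> > 0\<close> by simp
    qed
  qed simp
qed

subsection \<open>A pointwise Gagliardo--Nirenberg estimate\<close>

lemma integral_lebesgue_on:
  fixes F :: "'a::euclidean_space \<Rightarrow> real"
  assumes "G \<in> sets lebesgue"
  shows "(LINT y|lebesgue_on G. F y) = (LINT y|lebesgue. indicator G y * F y)"
  using assms by (subst integral_restrict_space) auto

text \<open>Test with the reflected kernel: the sign \<open>(-1)^i\<close> of the weak derivative
  cancels that of the inner derivative \<open>- 1 / t\<close>. The right-hand side mentions only
  \<open>u\<close>, so any two weak derivatives of \<open>u\<close> have the same mollification at
  \<open>x\<close>.\<close>

lemma weak_deriv_mollify:
  fixes u :: "'a::euclidean_space \<Rightarrow> real"
  assumes wd: "has_weak_derivative G i u V" and G: "G \<in> sets lebesgue" and sub: "cball x t \<subseteq> G" and "t > 0"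
    and \<kappa>: "kernel \<kappa>" and hs: "length hs = i"
  shows "mollify \<kappa> t (\<lambda>y. indicator G y * V y hs) x =
    mollify (iterated_deriv hs \<kappa>) t (\<lambda>y. indicator G y * u y) x / t ^ i"
proof -
  define \<phi> where "\<phi> y = \<kappa> ((x - y) /\<^sub>R t)" for y
  let ?D = "\<lambda>y. iterated_deriv hs \<kappa> ((x - y) /\<^sub>R t)"
  have "test_function G \<phi>"
    unfolding \<phi>_def by (rule scaled_kernel_test_function[OF \<kappa> \<open>t > 0\<close> sub])
  then have "(LINT y|lebesgue_on G. u y * iterated_deriv hs \<phi> y) = (- 1) ^ i * (LINT y|lebesgue_on G. V y hs * \<phi> y)"
    using wd hs unfolding has_weak_derivative_def by blast
  moreover have "iterated_deriv hs \<phi> = (\<lambda>y. (- inverse t) ^ i * ?D y)"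
    unfolding \<phi>_def using iterated_deriv_scaled_kernel[OF \<kappa>, where hs = hs and x = x and t = t] hs by simp
  ultimately have "(LINT y|lebesgue. indicator G y * (u y * ((- inverse t) ^ i * ?D y))) =
     (- 1) ^ i * (LINT y|lebesgue. indicator G y * (V y hs * \<phi> y))"
    by (simp add: integral_lebesgue_on[OF G])
  also have "(LINT y|lebesgue. indicator G y * (u y * ((- inverse t) ^ i * ?D y))) =
     (LINT y|lebesgue. (- inverse t) ^ i * (indicator G y * u y * ?D y))"
    by (intro Bochner_Integration.integral_cong refl) (simp only: ac_simps)
  also have "\<dots> = (- inverse t) ^ i * (LINT y|lebesgue. indicator G y * u y * ?D y)"
    by (rule integral_mult_right_zero)
  also have "(- inverse t) ^ i = (- 1) ^ i * inverse t ^ i"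
    by (metis mult_minus1 power_mult_distrib)
  finally have eq: "inverse t ^ i * (LINT y|lebesgue. indicator G y * u y * ?D y) =
     (LINT y|lebesgue. indicator G y * (V y hs * \<phi> y))"
    by simp
  have "mollify \<kappa> t (\<lambda>y. indicator G y * V y hs) x = (LINT y|lebesgue. indicator G y * (V y hs * \<phi> y)) / t ^ DIM('a)"
    unfolding mollify_def \<phi>_def by (subst integral_divide_zero[symmetric]) (simp add: ac_simps)
  also have "\<dots> = inverse t ^ i * ((LINT y|lebesgue. indicator G y * u y * ?D y) / t ^ DIM('a))"
    unfolding eq[symmetric] by simp
  also have "(LINT y|lebesgue. indicator G y * u y * ?D y) / t ^ DIM('a) =
     mollify (iterated_deriv hs \<kappa>) t (\<lambda>y. indicator G y * u y) x"
    unfolding mollify_def by (subst integral_divide_zero[symmetric]) simp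
  finally show ?thesis
    using \<open>t > 0\<close> by (simp add: divide_inverse power_inverse mult.commute)
qed

context
  fixes G :: "'a::euclidean_space set" and f F :: "'a \<Rightarrow> real" and V :: "nat \<Rightarrow> 'a \<Rightarrow> 'a list \<Rightarrow> real" and k :: nat
  assumes G: "G \<in> sets lebesgue"
    and wd: "\<And>i. i \<le> k \<Longrightarrow> has_weak_derivative G i f (V i)"
    and f_int: "integrable lebesgue (\<lambda>y. indicator G y * f y)"
    and V_int: "\<And>hs. length hs \<le> k \<Longrightarrow> integrable lebesgue (\<lambda>y. indicator G y * V (length hs) y hs)"
    and F_meas: "F \<in> borel_measurable lebesgue"
    and F: "\<And>y. y \<in> G \<Longrightarrow> (\<Sum>bs\<in>basis_lists k. \<bar>V k y bs\<bar>) \<le> F y"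
begin

text \<open>The kernel is a parameter because differentiating in the scale replaces it by its
  product with a coordinate and adds a direction to the list.\<close>

definition mollified_deriv :: "('a \<Rightarrow> real) \<Rightarrow> 'a list \<Rightarrow> real \<Rightarrow> 'a \<Rightarrow> real" where
  "mollified_deriv \<kappa> hs t x = mollify \<kappa> t (\<lambda>y. indicator G y * V (length hs) y hs) x"

text \<open>All derivatives go to the kernel, which then has integral \<open>0\<close>; so
  \<open>f x\<close> can be subtracted, and \<open>L t\<close> remains against the power
  \<open>t ^ length hs\<close>. The exponent \<open>1 - length hs\<close> is written as a quotient
  to stay within natural numbers.\<close>

lemma mollified_deriv_lipschitz_bound:
  assumes \<kappa>: "kernel \<kappa>" and hs: "1 \<le> length hs" "length hs \<le> k"
  shows "\<exists>C\<ge>0. \<forall>x t L. 0 < t \<longrightarrow> 0 \<le> L \<longrightarrow> cball x t \<subseteq> G \<longrightarrow> (\<forall>y\<in>ball x t. \<bar>f y - f x\<bar> \<le> L * dist y x) \<longrightarrow>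
    \<bar>mollified_deriv \<kappa> hs t x\<bar> \<le> C * (L * (t / t ^ length hs))"
proof -
  note K = kernel_iterated_deriv[OF \<kappa>, of hs]
  obtain C where "C > 0" and C: "\<And>x. \<bar>iterated_deriv hs \<kappa> x\<bar> \<le> C"
    using kernel_bounded[OF K] by blast
  have zero: "(\<integral>z. iterated_deriv hs \<kappa> z \<partial>lborel) = 0"
    by (rule integral_kernel_deriv[OF \<kappa>]) (use hs in auto)
  define \<omega> where "\<omega> = unit_ball_vol (real DIM('a))"
  have "\<omega> > 0"
    by (simp add: \<omega>_def)
  show ?thesis
  proof (intro exI[of _ "C * \<omega>"] conjI allI impI)
    fix x :: 'a and t L :: real
    assume t: "0 < t" and "0 \<le> L" and sub: "cball x t \<subseteq> G" and lip: "\<forall>y\<in>ball x t. \<bar>f y - f x\<bar> \<le> L * dist y x"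
    have "\<bar>mollify (iterated_deriv hs \<kappa>) t (\<lambda>y. indicator G y * f y) x - f x * (\<integral>z. iterated_deriv hs \<kappa> z \<partial>lborel)\<bar>
        \<le> C * (unit_ball_vol DIM('a) * (L * t))"
    proof (rule mollify_oscillation[OF f_int K C t])
      fix y
      assume y: "y \<in> ball x t"
      then have "y \<in> G"
        using sub by auto
      moreover have "L * dist y x \<le> L * t"
        using y \<open>0 \<le> L\<close> by (intro mult_left_mono) (auto simp: dist_commute)
      ultimately show "\<bar>indicator G y * f y - f x\<bar> \<le> L * t"
        using lip y by fastforce
    qed (use t \<open>0 \<le> L\<close> in auto)
    then have "\<bar>mollify (iterated_deriv hs \<kappa>) t (\<lambda>y. indicator G y * f y) x\<bar> \<le> C * (\<omega> * (L * t))"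
      by (simp add: zero \<omega>_def)
    then have "\<bar>mollified_deriv \<kappa> hs t x\<bar> \<le> C * (\<omega> * (L * t)) / t ^ length hs"
      unfolding mollified_deriv_def weak_deriv_mollify[OF wd[OF hs(2)] G sub t \<kappa> refl]
      using t by (simp add: divide_right_mono)
    then show "\<bar>mollified_deriv \<kappa> hs t x\<bar> \<le> C * \<omega> * (L * (t / t ^ length hs))"
      by (simp add: ac_simps)
  qed (use \<open>C > 0\<close> \<open>\<omega> > 0\<close> in auto)
qed

text \<open>The direction \<open>b\<close> in the scale derivative of the kernel is moved onto the
  function. The order rises by one, and the factor \<open>t\<close> released cancels the
  \<open>1 / t\<close> of \<open>mollify_scale_derivative\<close>; no negative power of the scale
  remains.\<close>

lemma mollified_deriv_scale_derivative:
  assumes \<kappa>: "kernel \<kappa>" and hs: "length hs < k" and t: "t > 0" and sub: "cball x t \<subseteq> G"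
  shows "((\<lambda>t. mollified_deriv \<kappa> hs t x) has_real_derivative
    - (\<Sum>b\<in>Basis. mollified_deriv (\<lambda>z. (z \<bullet> b) * \<kappa> z) (hs @ [b]) t x)) (at t)"
proof -
  have eq: "mollify (iterated_deriv [b] (\<lambda>z. (z \<bullet> b) * \<kappa> z)) t (\<lambda>y. indicator G y * V (length hs) y hs) x =
      t * mollified_deriv (\<lambda>z. (z \<bullet> b) * \<kappa> z) (hs @ [b]) t x" for b
  proof -
    define \<kappa>' where "\<kappa>' = (\<lambda>z. (z \<bullet> b) * \<kappa> z)"
    have k': "kernel \<kappa>'"
      unfolding \<kappa>'_def by (rule kernel_inner_mult[OF \<kappa>])
    have "mollify (iterated_deriv [b] \<kappa>') t (\<lambda>y. indicator G y * V (length hs) y hs) x =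
      mollify (iterated_deriv (hs @ [b]) \<kappa>') t (\<lambda>y. indicator G y * f y) x / t ^ length hs"
      using weak_deriv_mollify[OF wd[of "length hs"] G sub t kernel_iterated_deriv[OF k', of "[b]"], of hs] hs
      by (simp only: iterated_deriv_append)
    moreover have "mollified_deriv \<kappa>' (hs @ [b]) t x =
      mollify (iterated_deriv (hs @ [b]) \<kappa>') t (\<lambda>y. indicator G y * f y) x / t ^ Suc (length hs)"
      unfolding mollified_deriv_def
      using weak_deriv_mollify[OF wd[of "length (hs @ [b])"] G sub t k', of "hs @ [b]"] hs by simp
    ultimately show ?thesis
      using t unfolding \<kappa>'_def by simp
  qed
  have "integrable lebesgue (\<lambda>y. indicator G y * V (length hs) y hs)"
    using hs by (intro V_int) simp
  from mollify_scale_derivative[OF this \<kappa> t, of x] show ?thesis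
    unfolding eq mollified_deriv_def[of \<kappa> hs] sum_distrib_left[symmetric] using t by simp
qed

lemma mollified_deriv_top_bound:
  assumes \<kappa>: "kernel \<kappa>" and hs: "length hs = k"
  shows "\<exists>C\<ge>0. \<forall>x t M. 0 < t \<longrightarrow> 0 \<le> M \<longrightarrow> (\<integral>\<^sup>+y\<in>ball x t. ennreal (F y) \<partial>lebesgue) \<le> ennreal (M * t ^ DIM('a)) \<longrightarrow> cball x t \<subseteq> G \<longrightarrow>
    \<bar>mollified_deriv \<kappa> hs t x\<bar> \<le> C * M"
proof -
  obtain C where "C > 0" and C: "\<And>x. \<bar>\<kappa> x\<bar> \<le> C"
    using kernel_bounded[OF \<kappa>] by blast
  \<comment> \<open>Directions of arbitrary length are allowed, while \<open>F\<close> controls only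
    the values on basis vectors; \<open>P\<close> makes up for the difference.\<close>
  define P where "P = (\<Prod>h\<leftarrow>hs. norm h)"
  have "P \<ge> 0"
    unfolding P_def by (rule prod_list_nonneg) auto
  show ?thesis
  proof (intro exI[of _ "C * P"] conjI allI impI)
    fix x :: 'a and t M :: real
    assume t: "0 < t" and "0 \<le> M" and le: "(\<integral>\<^sup>+y\<in>ball x t. ennreal (F y) \<partial>lebesgue) \<le> ennreal (M * t ^ DIM('a))"
      and sub: "cball x t \<subseteq> G"
    have "\<bar>mollified_deriv \<kappa> hs t x\<bar> \<le> C * (P * M)"
      unfolding mollified_deriv_def
    proof (rule mollify_bound[OF _ \<kappa> C t])
      show "(\<lambda>y. indicator G y * V (length hs) y hs) \<in> borel_measurable lebesgue"
        using V_int[of hs] hs by (intro borel_measurable_integrable) simp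
      have "(\<integral>\<^sup>+y\<in>ball x t. ennreal \<bar>indicator G y * V (length hs) y hs\<bar> \<partial>lebesgue) \<le>
        (\<integral>\<^sup>+y. ennreal P * (ennreal (F y) * indicator (ball x t) y) \<partial>lebesgue)"
      proof (intro nn_integral_mono)
        fix y
        show "ennreal \<bar>indicator G y * V (length hs) y hs\<bar> * indicator (ball x t) y \<le> ennreal P * (ennreal (F y) * indicator (ball x t) y)"
        proof (cases "y \<in> ball x t")
          case True
          then have "y \<in> G"
            using sub by auto
          then have "multilinear_form k (V k y)"
            using wd[of k] unfolding has_weak_derivative_def by simp
          from multilinear_form_bound[OF this hs]
          have "\<bar>V k y hs\<bar> \<le> P * (\<Sum>bs\<in>basis_lists k. \<bar>V k y bs\<bar>)"
            by (simp add: P_def)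
          also have "\<dots> \<le> P * F y"
            using F[OF \<open>y \<in> G\<close>] \<open>P \<ge> 0\<close> by (rule mult_left_mono)
          finally have "ennreal \<bar>V k y hs\<bar> \<le> ennreal P * ennreal (F y)"
            using \<open>P \<ge> 0\<close> by (simp add: ennreal_mult'[symmetric] ennreal_leI)
          then show ?thesis
            using True \<open>y \<in> G\<close> hs by simp
        qed simp
      qed
      also have "\<dots> = ennreal P * (\<integral>\<^sup>+y\<in>ball x t. ennreal (F y) \<partial>lebesgue)"
      proof (rule nn_integral_cmult)
        have [measurable]: "F \<in> borel_measurable lebesgue" "ball x t \<in> sets lebesgue"
          using F_meas by auto
        show "(\<lambda>y. ennreal (F y) * indicator (ball x t) y) \<in> borel_measurable lebesgue"
          by measurable
      qed
      also have "\<dots> \<le> ennreal P * ennreal (M * t ^ DIM('a))"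
        by (intro mult_left_mono le) simp
      also have "\<dots> = ennreal (P * M * t ^ DIM('a))"
        using \<open>P \<ge> 0\<close> by (simp add: ennreal_mult'[symmetric] mult.assoc)
      finally show "(\<integral>\<^sup>+y\<in>ball x t. ennreal \<bar>indicator G y * V (length hs) y hs\<bar> \<partial>lebesgue) \<le> ennreal (P * M * t ^ DIM('a))" .
    qed (use \<open>P \<ge> 0\<close> \<open>0 \<le> M\<close> in auto)
    then show "\<bar>mollified_deriv \<kappa> hs t x\<bar> \<le> C * P * M"
      by (simp add: mult.assoc)
  qed (use \<open>C > 0\<close> \<open>P \<ge> 0\<close> in auto)
qed

text \<open>Descending induction on the order: from scale \<open>r\<close> down to scale \<open>t\<close> the mollified derivative
  changes by at most \<open>r\<close> times a mollified derivative of the next order, with another kernel.\<close>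

lemma mollified_deriv_interpolation:
  assumes "d + length hs = k" "1 \<le> length hs" "kernel \<kappa>"
  shows "\<exists>C\<ge>0. \<forall>x t r L M. 0 < t \<longrightarrow> t \<le> r \<longrightarrow> 0 \<le> L \<longrightarrow> 0 \<le> M \<longrightarrow> cball x r \<subseteq> G \<longrightarrow>
    (\<forall>y\<in>ball x r. \<bar>f y - f x\<bar> \<le> L * dist y x) \<longrightarrow>
    (\<forall>s. 0 < s \<longrightarrow> s \<le> r \<longrightarrow> (\<integral>\<^sup>+y\<in>ball x s. ennreal (F y) \<partial>lebesgue) \<le> ennreal (M * s ^ DIM('a))) \<longrightarrow>
    \<bar>mollified_deriv \<kappa> hs t x\<bar> \<le> C * (L * (r / r ^ length hs) + M * r ^ (k - length hs))"
  using assms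
proof (induction d arbitrary: hs \<kappa>)
  case 0
  then obtain C where C: "C \<ge> 0" "\<And>x t M. 0 < t \<Longrightarrow> 0 \<le> M \<Longrightarrow>
      (\<integral>\<^sup>+y\<in>ball x t. ennreal (F y) \<partial>lebesgue) \<le> ennreal (M * t ^ DIM('a)) \<Longrightarrow> cball x t \<subseteq> G \<Longrightarrow>
      \<bar>mollified_deriv \<kappa> hs t x\<bar> \<le> C * M"
    using mollified_deriv_top_bound[of \<kappa> hs] by auto
  show ?case
  proof (intro exI[of _ C] conjI allI impI C(1))
    fix x :: 'a and t r L M :: real
    assume H: "0 < t" "t \<le> r" "0 \<le> L" "0 \<le> M" "cball x r \<subseteq> G"
      "\<forall>s. 0 < s \<longrightarrow> s \<le> r \<longrightarrow> (\<integral>\<^sup>+y\<in>ball x s. ennreal (F y) \<partial>lebesgue) \<le> ennreal (M * s ^ DIM('a))"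
    have "\<bar>mollified_deriv \<kappa> hs t x\<bar> \<le> C * M"
      using H by (intro C(2)) (auto intro: order_trans)
    also have "\<dots> \<le> C * (L * (r / r ^ length hs) + M * r ^ (k - length hs))"
      using H C(1) 0 by (intro mult_left_mono) auto
    finally show "\<bar>mollified_deriv \<kappa> hs t x\<bar> \<le> C * (L * (r / r ^ length hs) + M * r ^ (k - length hs))" .
  qed
next
  case (Suc d)
  define j where "j = length hs"
  have j: "j < k" "1 \<le> j" "k - j = Suc (k - Suc j)"
    using Suc.prems by (auto simp: j_def)
  obtain C0 where C0: "C0 \<ge> 0" "\<And>x t L. 0 < t \<Longrightarrow> 0 \<le> L \<Longrightarrow> cball x t \<subseteq> G \<Longrightarrow>
      \<forall>y\<in>ball x t. \<bar>f y - f x\<bar> \<le> L * dist y x \<Longrightarrow> \<bar>mollified_deriv \<kappa> hs t x\<bar> \<le> C0 * (L * (t / t ^ j))"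
    using mollified_deriv_lipschitz_bound[OF Suc.prems(3,2)] j(1) unfolding j_def by (metis less_imp_le)
  define E where "E b = mollified_deriv (\<lambda>z. (z \<bullet> b) * \<kappa> z) (hs @ [b])" for b
  have "\<forall>b. \<exists>C\<ge>0. \<forall>x t r L M. 0 < t \<longrightarrow> t \<le> r \<longrightarrow> 0 \<le> L \<longrightarrow> 0 \<le> M \<longrightarrow> cball x r \<subseteq> G \<longrightarrow>
    (\<forall>y\<in>ball x r. \<bar>f y - f x\<bar> \<le> L * dist y x) \<longrightarrow>
    (\<forall>s. 0 < s \<longrightarrow> s \<le> r \<longrightarrow> (\<integral>\<^sup>+y\<in>ball x s. ennreal (F y) \<partial>lebesgue) \<le> ennreal (M * s ^ DIM('a))) \<longrightarrow>
    \<bar>E b t x\<bar> \<le> C * (L * (r / r ^ Suc j) + M * r ^ (k - Suc j))"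
  proof
    fix b
    show "\<exists>C\<ge>0. \<forall>x t r L M. 0 < t \<longrightarrow> t \<le> r \<longrightarrow> 0 \<le> L \<longrightarrow> 0 \<le> M \<longrightarrow> cball x r \<subseteq> G \<longrightarrow>
      (\<forall>y\<in>ball x r. \<bar>f y - f x\<bar> \<le> L * dist y x) \<longrightarrow>
      (\<forall>s. 0 < s \<longrightarrow> s \<le> r \<longrightarrow> (\<integral>\<^sup>+y\<in>ball x s. ennreal (F y) \<partial>lebesgue) \<le> ennreal (M * s ^ DIM('a))) \<longrightarrow>
      \<bar>E b t x\<bar> \<le> C * (L * (r / r ^ Suc j) + M * r ^ (k - Suc j))"
      using Suc.IH[of "hs @ [b]" "\<lambda>z. (z \<bullet> b) * \<kappa> z"] Suc.prems kernel_inner_mult[OF Suc.prems(3), of b]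
      unfolding E_def j_def by simp
  qed
  then obtain C where C: "\<And>b. C b \<ge> 0" and CE: "\<And>b x t r L M. 0 < t \<Longrightarrow> t \<le> r \<Longrightarrow> 0 \<le> L \<Longrightarrow> 0 \<le> M \<Longrightarrow> cball x r \<subseteq> G \<Longrightarrow>
    \<forall>y\<in>ball x r. \<bar>f y - f x\<bar> \<le> L * dist y x \<Longrightarrow>
    \<forall>s. 0 < s \<longrightarrow> s \<le> r \<longrightarrow> (\<integral>\<^sup>+y\<in>ball x s. ennreal (F y) \<partial>lebesgue) \<le> ennreal (M * s ^ DIM('a)) \<Longrightarrow>
    \<bar>E b t x\<bar> \<le> C b * (L * (r / r ^ Suc j) + M * r ^ (k - Suc j))"
    unfolding choice_iff by (elim exE) (rule that; blast)
  define S where "S = (\<Sum>b\<in>Basis. C b)"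
  have "S \<ge> 0"
    unfolding S_def using C by (intro sum_nonneg) auto
  show ?case
  proof (intro exI[of _ "C0 + S"] conjI allI impI)
    fix x :: 'a and t r L M :: real
    assume H: "0 < t" "t \<le> r" "0 \<le> L" "0 \<le> M" "cball x r \<subseteq> G"
      "\<forall>y\<in>ball x r. \<bar>f y - f x\<bar> \<le> L * dist y x"
      "\<forall>s. 0 < s \<longrightarrow> s \<le> r \<longrightarrow> (\<integral>\<^sup>+y\<in>ball x s. ennreal (F y) \<partial>lebesgue) \<le> ennreal (M * s ^ DIM('a))"
    define B where "B = L * (r / r ^ Suc j) + M * r ^ (k - Suc j)"
    \<comment> \<open>\<open>B\<close> is the bound for order \<open>j + 1\<close>. Integrated over
      an interval of length at most \<open>r\<close> it becomes the bound for order
      \<open>j\<close>, with the same two terms; this closes the induction.\<close>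
    have rB: "r * B = L * (r / r ^ j) + M * r ^ (k - j)"
      using H(1,2) j(3) by (simp add: B_def field_simps)
    have "B \<ge> 0"
      using H by (simp add: B_def)
    \<comment> \<open>Only at the upper end \<open>r\<close> is the Lipschitz bound used directly;
      at a small \<open>t\<close> it would be too large when \<open>j > 1\<close>.\<close>
    have at_r: "\<bar>mollified_deriv \<kappa> hs r x\<bar> \<le> C0 * (L * (r / r ^ j))"
      using H by (intro C0(2)) auto
    have "norm (mollified_deriv \<kappa> hs t x - mollified_deriv \<kappa> hs r x) \<le> S * B * norm (t - r)"
    proof (rule field_differentiable_bound[where S = "{t..r}" and f = "\<lambda>t. mollified_deriv \<kappa> hs t x"
          and f' = "\<lambda>s. - (\<Sum>b\<in>Basis. E b s x)"])
      fix s
      assume s: "s \<in> {t..r}"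
      then have "s > 0" "cball x s \<subseteq> G"
        using H subset_cball[of s r x] by auto
      then show "((\<lambda>t. mollified_deriv \<kappa> hs t x) has_field_derivative - (\<Sum>b\<in>Basis. E b s x)) (at s within {t..r})"
        using mollified_deriv_scale_derivative[OF Suc.prems(3), of hs s x] j(1)
        unfolding E_def j_def by (auto intro: has_field_derivative_at_within)
      have "\<bar>\<Sum>b\<in>Basis. E b s x\<bar> \<le> (\<Sum>b\<in>Basis. C b * B)"
        using H s \<open>s > 0\<close> unfolding B_def by (intro order_trans[OF sum_abs] sum_mono CE) auto
      then show "norm (- (\<Sum>b\<in>Basis. E b s x)) \<le> S * B"
        by (simp add: S_def sum_distrib_right)
    qed (use H in auto)
    also have "\<dots> \<le> S * B * r"
      using H \<open>S \<ge> 0\<close> \<open>B \<ge> 0\<close> by (intro mult_left_mono) auto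
    also have "\<dots> = S * (L * (r / r ^ j) + M * r ^ (k - j))"
      unfolding rB[symmetric] by simp
    finally have "\<bar>mollified_deriv \<kappa> hs t x\<bar> \<le> C0 * (L * (r / r ^ j)) + S * (L * (r / r ^ j) + M * r ^ (k - j))"
      using at_r by (simp add: abs_le_iff)
    also have "\<dots> \<le> C0 * (L * (r / r ^ j) + M * r ^ (k - j)) + S * (L * (r / r ^ j) + M * r ^ (k - j))"
      using C0(1) H by (intro add_right_mono mult_left_mono) auto
    finally show "\<bar>mollified_deriv \<kappa> hs t x\<bar> \<le> (C0 + S) * (L * (r / r ^ length hs) + M * r ^ (k - length hs))"
      unfolding j_def by (simp only: distrib_right)
  qed (use C0 \<open>S \<ge> 0\<close> in auto)
qed

end

subsection \<open>Level sets of the local maximal function\<close>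

text \<open>Up to the factor \<open>unit_ball_vol\<close>, the set where the uncentred maximal
  function of \<open>u\<close> over radii up to \<open>R\<close> exceeds \<open>L\<close>. As a
  union of balls it is open, hence measurable; off it, all centred means are bounded.\<close>

definition max_level :: "('a::euclidean_space \<Rightarrow> real) \<Rightarrow> real \<Rightarrow> real \<Rightarrow> 'a set" where
  "max_level u R L = (\<Union>(x, r)\<in>{(x, r). 0 < r \<and> r \<le> R \<and>
     ennreal (L * r ^ DIM('a)) < (\<integral>\<^sup>+y\<in>ball x r. ennreal (u y) \<partial>lebesgue)}. ball x r)"

lemma open_max_level: "open (max_level u R L)"
  unfolding max_level_def by (auto intro!: open_UN)

lemma not_in_max_level:
  fixes x :: "'a::euclidean_space"
  assumes "x \<notin> max_level u R L" "0 < r" "r \<le> R"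
  shows "(\<integral>\<^sup>+y\<in>ball x r. ennreal (u y) \<partial>lebesgue) \<le> ennreal (L * r ^ DIM('a))"
proof (rule ccontr)
  assume "\<not> ?thesis"
  then have "(x, r) \<in> {(x, r). 0 < r \<and> r \<le> R \<and>
     ennreal (L * r ^ DIM('a)) < (\<integral>\<^sup>+y\<in>ball x r. ennreal (u y) \<partial>lebesgue)}"
    using assms by auto
  then have "x \<in> max_level u R L"
    unfolding max_level_def using \<open>0 < r\<close> by (intro UN_I[of "(x, r)"]) auto
  then show False
    using assms by simp
qed

text \<open>Countable subadditivity for an arbitrary countable index set: the Vitali covering is a
  set of pairs of centre and radius, not a sequence.\<close>

lemma emeasure_UN_le_count_space:
  assumes "countable I" "\<And>i. i \<in> I \<Longrightarrow> X i \<in> sets M"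
  shows "emeasure M (\<Union>i\<in>I. X i) \<le> (\<integral>\<^sup>+i. emeasure M (X i) \<partial>count_space I)"
proof -
  have "(\<Union>i\<in>I. X i) \<in> sets M"
    using assms by (intro sets.countable_UN') auto
  then have "emeasure M (\<Union>i\<in>I. X i) = (\<integral>\<^sup>+x. indicator (\<Union>i\<in>I. X i) x \<partial>M)"
    by simp
  also have "\<dots> \<le> (\<integral>\<^sup>+x. \<integral>\<^sup>+i. indicator (X i) x \<partial>count_space I \<partial>M)"
  proof (intro nn_integral_mono)
    fix x
    show "indicator (\<Union>i\<in>I. X i) x \<le> (\<integral>\<^sup>+i. indicator (X i) x \<partial>count_space I)"
    proof (cases "x \<in> (\<Union>i\<in>I. X i)")
      case True
      then obtain j where "j \<in> I" "x \<in> X j"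
        by auto
      have "1 = (\<integral>\<^sup>+i. indicator {j} i \<partial>count_space I)"
        using \<open>j \<in> I\<close> by (simp add: nn_integral_count_space_indicator)
      also have "\<dots> \<le> (\<integral>\<^sup>+i. indicator (X i) x \<partial>count_space I)"
        using \<open>x \<in> X j\<close> by (intro nn_integral_mono) (auto simp: indicator_def)
      finally show ?thesis
        using True by simp
    qed auto
  qed
  also have "\<dots> = (\<integral>\<^sup>+i. \<integral>\<^sup>+x. indicator (X i) x \<partial>M \<partial>count_space I)"
    using assms by (intro nn_integral_count_space_nn_integral) auto
  also have "\<dots> = (\<integral>\<^sup>+i. emeasure M (X i) \<partial>count_space I)"
    using assms by (intro nn_integral_cong) auto
  finally show ?thesis .
qed

text \<open>Weak type \<open>(1, 1)\<close> in its truncated form. On a selected ball the part of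
  \<open>u\<close> below \<open>L / (2 \<omega>)\<close> accounts for at most half of the required
  mean, so the other half comes from the set where \<open>u\<close> is larger. Passing from disjoint
  balls to balls five times as large costs \<open>5 ^ n\<close>. The truncation is what
  \<open>ri_family_weak_type\<close> relies on.\<close>

lemma max_level_weak_type:
  fixes u :: "'a::euclidean_space \<Rightarrow> real"
  assumes u: "u \<in> borel_measurable lebesgue" "\<And>x. 0 \<le> u x" and "L > 0"
  defines "\<omega> \<equiv> unit_ball_vol (real DIM('a))"
  shows "ennreal L * emeasure lebesgue (max_level u R L) \<le>
    ennreal (2 * \<omega> * 5 ^ DIM('a)) * (\<integral>\<^sup>+x\<in>{x. L / (2 * \<omega>) < u x}. ennreal (u x) \<partial>lebesgue)"
proof -
  define n where "n = DIM('a)"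
  define E where "E = {x. L / (2 * \<omega>) < u x}"
  define K where "K = {(x, r). 0 < r \<and> r \<le> R \<and>
     ennreal (L * r ^ n) < (\<integral>\<^sup>+y\<in>ball x r. ennreal (u y) \<partial>lebesgue)}"
  have "\<omega> > 0"
    by (simp add: \<omega>_def)
  have [measurable]: "u \<in> borel_measurable lebesgue" "E \<in> sets lebesgue" "ball x r \<in> sets lebesgue" for x r
  proof -
    have "{x \<in> space lebesgue. L / (2 * \<omega>) < u x} \<in> sets lebesgue"
      using u(1) by measurable
    then show "E \<in> sets lebesgue"
      by (simp add: E_def)
  qed (use u in auto)
  define I where "I S = (\<integral>\<^sup>+x\<in>S \<inter> E. ennreal (u x) \<partial>lebesgue)" for S
  have ball_le: "ennreal (L / 2 * snd i ^ n) \<le> I (ball (fst i) (snd i))" if iK: "i \<in> K" for i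
  proof -
    obtain x r where i: "i = (x, r)" "0 < r" and
      gt: "ennreal (L * r ^ n) < (\<integral>\<^sup>+y\<in>ball x r. ennreal (u y) \<partial>lebesgue)"
      using iK by (cases i) (auto simp: K_def)
    have "(\<integral>\<^sup>+y\<in>ball x r. ennreal (u y) \<partial>lebesgue) \<le>
       (\<integral>\<^sup>+y. (ennreal (u y) * indicator (ball x r \<inter> E) y + ennreal (L / (2 * \<omega>)) * indicator (ball x r) y) \<partial>lebesgue)"
      by (intro nn_integral_mono) (auto simp: indicator_def E_def intro: ennreal_leI)
    also have "\<dots> = I (ball x r) + ennreal (L / (2 * \<omega>)) * emeasure lebesgue (ball x r)"
      unfolding I_def by (subst nn_integral_add) (auto simp: nn_integral_cmult_indicator simp del: emeasure_completion)
    also have "emeasure lebesgue (ball x r) = ennreal (\<omega> * r ^ n)"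
      using emeasure_ball[of r x] i by (simp add: \<omega>_def n_def)
    also have "ennreal (L / (2 * \<omega>)) * ennreal (\<omega> * r ^ n) = ennreal (L / (2 * \<omega>) * (\<omega> * r ^ n))"
      using \<open>\<omega> > 0\<close> \<open>L > 0\<close> i by (simp flip: ennreal_mult)
    also have "L / (2 * \<omega>) * (\<omega> * r ^ n) = L / 2 * r ^ n"
      using \<open>\<omega> > 0\<close> by simp
    finally have "ennreal (L * r ^ n) \<le> I (ball x r) + ennreal (L / 2 * r ^ n)"
      using gt by simp
    \<comment> \<open>The left side is halved so that a finite summand can be cancelled instead of
      subtracted in \<open>ennreal\<close>.\<close>
    moreover have "ennreal (L * r ^ n) = ennreal (L / 2 * r ^ n) + ennreal (L / 2 * r ^ n)"
      using \<open>L > 0\<close> i by (subst ennreal_plus[symmetric]) auto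
    ultimately have "ennreal (L / 2 * r ^ n) + ennreal (L / 2 * r ^ n) \<le> ennreal (L / 2 * r ^ n) + I (ball x r)"
      by (simp add: add.commute)
    then show ?thesis
      unfolding ennreal_add_left_cancel_le using i by simp
  qed
  have eqU: "max_level u R L = (\<Union>i\<in>K. ball (fst i) (snd i))"
    by (auto simp: max_level_def K_def n_def)
  have "max_level u R L \<subseteq> (\<Union>i\<in>K. ball (fst i) (snd i))"
    by (simp add: eqU)
  moreover have "0 < snd i \<and> snd i \<le> R" if "i \<in> K" for i
    using that by (auto simp: K_def)
  ultimately obtain C where C: "countable C" "C \<subseteq> K"
     "pairwise (\<lambda>i j. disjnt (ball (fst i) (snd i)) (ball (fst j) (snd j))) C"
     "max_level u R L \<subseteq> (\<Union>i\<in>C. ball (fst i) (5 * snd i))"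
    by (rule Vitali_covering_lemma_balls)
  have disj: "disjoint_family_on (\<lambda>i. ball (fst i) (snd i)) C"
    using C(3) by (auto simp: pairwise_def disjnt_def disjoint_family_on_def)
  have "emeasure lebesgue (max_level u R L) \<le> emeasure lebesgue (\<Union>i\<in>C. ball (fst i) (5 * snd i))"
    using C by (intro emeasure_mono sets.countable_UN') auto
  also have "\<dots> \<le> (\<integral>\<^sup>+i. emeasure lebesgue (ball (fst i) (5 * snd i)) \<partial>count_space C)"
    using C by (intro emeasure_UN_le_count_space) auto
  also have "ennreal L * \<dots> = (\<integral>\<^sup>+i. ennreal L * emeasure lebesgue (ball (fst i) (5 * snd i)) \<partial>count_space C)"
    by (subst nn_integral_cmult) auto
  also have "\<dots> \<le> (\<integral>\<^sup>+i. ennreal (2 * \<omega> * 5 ^ n) * I (ball (fst i) (snd i)) \<partial>count_space C)"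
  proof (intro nn_integral_mono)
    fix i
    assume "i \<in> space (count_space C)"
    then have i: "i \<in> K" "0 < snd i"
      using C(2) by (auto simp: K_def)
    have "ennreal L * emeasure lebesgue (ball (fst i) (5 * snd i)) = ennreal L * ennreal (\<omega> * (5 * snd i) ^ n)"
      using emeasure_ball[of "5 * snd i" "fst i"] i by (simp add: \<omega>_def n_def)
    also have "\<dots> = ennreal (2 * \<omega> * 5 ^ n) * ennreal (L / 2 * snd i ^ n)"
      using \<open>L > 0\<close> \<open>\<omega> > 0\<close> i by (simp add: power_mult_distrib ac_simps flip: ennreal_mult)
    also have "\<dots> \<le> ennreal (2 * \<omega> * 5 ^ n) * I (ball (fst i) (snd i))"
      by (intro mult_left_mono ball_le i) auto
    finally show "ennreal L * emeasure lebesgue (ball (fst i) (5 * snd i)) \<le>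
      ennreal (2 * \<omega> * 5 ^ n) * I (ball (fst i) (snd i))" .
  qed
  also have "\<dots> = ennreal (2 * \<omega> * 5 ^ n) * (\<integral>\<^sup>+i. I (ball (fst i) (snd i)) \<partial>count_space C)"
    by (subst nn_integral_cmult) auto
  also have "(\<integral>\<^sup>+i. I (ball (fst i) (snd i)) \<partial>count_space C) \<le> (\<integral>\<^sup>+x\<in>E. ennreal (u x) \<partial>lebesgue)"
  proof -
    \<comment> \<open>As a measure with this density, the truncated integral is additive over the
      countable family of disjoint balls.\<close>
    define N where "N = density lebesgue (\<lambda>x. ennreal (u x) * indicator E x)"
    have I_eq: "I S = emeasure N S" if "S \<in> sets lebesgue" for S
      unfolding N_def I_def using that
      by (subst emeasure_density) (auto intro!: nn_integral_cong simp: indicator_def)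
    have "(\<integral>\<^sup>+i. I (ball (fst i) (snd i)) \<partial>count_space C) = (\<integral>\<^sup>+i. emeasure N (ball (fst i) (snd i)) \<partial>count_space C)"
      by (intro nn_integral_cong I_eq) auto
    also have "\<dots> = emeasure N (\<Union>i\<in>C. ball (fst i) (snd i))"
      using C disj by (intro emeasure_UN_countable[symmetric]) (auto simp: N_def)
    also have "\<dots> \<le> emeasure N (space N)"
      by (rule emeasure_space)
    also have "\<dots> = (\<integral>\<^sup>+x\<in>E. ennreal (u x) \<partial>lebesgue)"
      unfolding N_def by (subst emeasure_density) auto
    finally show ?thesis .
  qed
  finally show ?thesis
    unfolding E_def n_def by (simp add: mult_left_mono)
qed

subsection \<open>Convergence on compact sets\<close>

definition conv_mean :: "'a::euclidean_space set \<Rightarrow> (nat \<Rightarrow> 'a \<Rightarrow> real) \<Rightarrow> ('a \<Rightarrow> real) \<Rightarrow> bool" where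
  "conv_mean K S s \<longleftrightarrow> (\<forall>n. integrable lebesgue (S n)) \<and> integrable lebesgue s \<and>
     (\<lambda>n. \<integral>\<^sup>+x\<in>K. ennreal \<bar>S n x - s x\<bar> \<partial>lebesgue) \<longlonglongrightarrow> 0"

definition conv_AE :: "'a::euclidean_space set \<Rightarrow> (nat \<Rightarrow> 'a \<Rightarrow> real) \<Rightarrow> ('a \<Rightarrow> real) \<Rightarrow> bool" where
  "conv_AE K S s \<longleftrightarrow> (AE x in lebesgue. x \<in> K \<longrightarrow> (\<lambda>n. S n x) \<longlonglongrightarrow> s x)"

lemma conv_mean_subseq:
  assumes "conv_mean K S s" "strict_mono r"
  shows "conv_mean K (\<lambda>n. S (r n)) s"
proof -
  have "(\<lambda>n. \<integral>\<^sup>+x\<in>K. ennreal \<bar>S n x - s x\<bar> \<partial>lebesgue) \<longlonglongrightarrow> 0"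
    using assms(1) by (simp add: conv_mean_def)
  from LIMSEQ_subseq_LIMSEQ[OF this assms(2)] show ?thesis
    using assms(1) by (simp add: conv_mean_def o_def)
qed

lemma conv_mean_imp_conv_AE:
  fixes K :: "'a::euclidean_space set"
  assumes "conv_mean K S s" and K: "K \<in> sets lebesgue"
  shows "\<exists>r::nat \<Rightarrow> nat. strict_mono r \<and> conv_AE K (\<lambda>n. S (r n)) s"
proof -
  have int: "integrable lebesgue (\<lambda>x. indicator K x * (S n x - s x))" for n
    using assms integrable_mult_indicator[of K lebesgue "\<lambda>x. S n x - s x"] by (auto simp: conv_mean_def)
  have eq: "ennreal (\<integral>x. norm (indicator K x * (S n x - s x)) \<partial>lebesgue) = (\<integral>\<^sup>+x\<in>K. ennreal \<bar>S n x - s x\<bar> \<partial>lebesgue)" for n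
  proof -
    have "ennreal (\<integral>x. norm (indicator K x * (S n x - s x)) \<partial>lebesgue) = (\<integral>\<^sup>+x. ennreal (norm (indicator K x * (S n x - s x))) \<partial>lebesgue)"
      using int[of n] by (intro nn_integral_eq_integral[symmetric]) auto
    also have "\<dots> = (\<integral>\<^sup>+x\<in>K. ennreal \<bar>S n x - s x\<bar> \<partial>lebesgue)"
      by (intro nn_integral_cong) (auto simp: indicator_def)
    finally show ?thesis .
  qed
  have "(\<lambda>n. ennreal (\<integral>x. norm (indicator K x * (S n x - s x)) \<partial>lebesgue)) \<longlonglongrightarrow> ennreal 0"
    using assms(1) unfolding eq conv_mean_def by simp
  then have "(\<lambda>n. \<integral>x. norm (indicator K x * (S n x - s x)) \<partial>lebesgue) \<longlonglongrightarrow> 0"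
    by (subst (asm) tendsto_ennreal_iff) (auto intro!: always_eventually)
  from tendsto_L1_AE_subseq[OF int this] obtain r :: "nat \<Rightarrow> nat"
    where r: "strict_mono r" "AE x in lebesgue. (\<lambda>n. indicator K x * (S (r n) x - s x)) \<longlonglongrightarrow> 0"
    by blast
  have "conv_AE K (\<lambda>n. S (r n)) s"
    unfolding conv_AE_def using r(2)
  proof eventually_elim
    case (elim x)
    then show ?case
      by (auto simp: LIM_zero_iff)
  qed
  with r(1) show ?thesis
    by blast
qed

lemma conv_AE_subseq:
  assumes "conv_AE K S s" "strict_mono r"
  shows "conv_AE K (\<lambda>n. S (r n)) s"
  unfolding conv_AE_def
proof (rule eventually_mono[OF assms(1)[unfolded conv_AE_def]], rule impI)
  fix x
  assume "x \<in> K \<longrightarrow> (\<lambda>n. S n x) \<longlonglongrightarrow> s x" "x \<in> K"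
  then have "(\<lambda>n. S n x) \<longlonglongrightarrow> s x"
    by simp
  from LIMSEQ_subseq_LIMSEQ[OF this assms(2)] show "(\<lambda>n. S (r n) x) \<longlonglongrightarrow> s x"
    by (simp add: o_def)
qed

text \<open>Subsequences are extracted one after the other, as almost everywhere convergence
  survives every later extraction. All factors of all Leibniz terms can then be handled along one
  sequence of scales.\<close>

lemma common_AE_subseq:
  fixes K :: "'a::euclidean_space set"
  assumes "finite \<S>" "K \<in> sets lebesgue" "\<And>S s. (S, s) \<in> \<S> \<Longrightarrow> conv_mean K S s"
  shows "\<exists>r::nat \<Rightarrow> nat. strict_mono r \<and> (\<forall>(S, s)\<in>\<S>. conv_AE K (\<lambda>n. S (r n)) s)"
  using assms(1,3)
proof (induction \<S>)
  case empty
  show ?case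
    by (intro exI[of _ id]) (auto simp: strict_mono_def)
next
  case (insert p \<S>)
  obtain S s where p: "p = (S, s)"
    by (cases p)
  obtain r where r: "strict_mono r" "\<forall>(S, s)\<in>\<S>. conv_AE K (\<lambda>n. S (r n)) s"
    using insert by auto
  have "conv_mean K (\<lambda>n. S (r n)) s"
    using p by (intro conv_mean_subseq[OF insert.prems r(1)]) auto
  from conv_mean_imp_conv_AE[OF this assms(2)] obtain r' :: "nat \<Rightarrow> nat"
    where r': "strict_mono r'" "conv_AE K (\<lambda>n. S (r (r' n))) s"
    by blast
  have "conv_AE K (\<lambda>n. T (r (r' n))) t" if Tt: "(T, t) \<in> insert p \<S>" for T t
  proof -
    consider "T = S" "t = s" | "(T, t) \<in> \<S>"
      using Tt p by auto
    then show "conv_AE K (\<lambda>n. T (r (r' n))) t"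
    proof cases
      case 2
      then have "conv_AE K (\<lambda>n. T (r n)) t"
        using r(2) by auto
      from conv_AE_subseq[OF this r'(1)] show ?thesis .
    qed (use r' in simp)
  qed
  moreover have "strict_mono (\<lambda>n. r (r' n))"
    using strict_mono_o[OF r(1) r'(1)] by (simp add: o_def)
  ultimately show ?case
    by (intro exI[of _ "\<lambda>n. r (r' n)"]) (simp add: case_prod_beta del: insert_iff)
qed

text \<open>Dominated convergence with a majorant for the product of the two factors. This serves
  the mixed terms, where neither factor has to be bounded.\<close>

lemma product_limit_dominated:
  fixes K :: "'a::euclidean_space set"
  assumes meas: "\<And>n. P n \<in> borel_measurable lebesgue" "p \<in> borel_measurable lebesgue"
    "\<And>n. Q n \<in> borel_measurable lebesgue" "q \<in> borel_measurable lebesgue" "\<psi> \<in> borel_measurable lebesgue"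
    and ae: "conv_AE K P p" "conv_AE K Q q"
    and \<psi>: "\<And>x. \<bar>\<psi> x\<bar> \<le> B" "\<And>x. x \<notin> K \<Longrightarrow> \<psi> x = 0"
    and h: "integrable lebesgue h" "AE x in lebesgue. x \<in> K \<longrightarrow> (\<forall>n. \<bar>P n x * Q n x\<bar> \<le> h x)"
  shows "integrable lebesgue (\<lambda>x. P n x * Q n x * \<psi> x)" "integrable lebesgue (\<lambda>x. p x * q x * \<psi> x)"
    "(\<lambda>n. \<integral>x. P n x * Q n x * \<psi> x \<partial>lebesgue) \<longlonglongrightarrow> (\<integral>x. p x * q x * \<psi> x \<partial>lebesgue)"
proof -
  have lim: "AE x in lebesgue. (\<lambda>n. P n x * Q n x * \<psi> x) \<longlonglongrightarrow> p x * q x * \<psi> x"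
    using ae unfolding conv_AE_def
  proof eventually_elim
    case (elim x)
    then show ?case
      using \<psi>(2)[of x] by (cases "x \<in> K") (auto intro!: tendsto_intros)
  qed
  have bound: "AE x in lebesgue. norm (P n x * Q n x * \<psi> x) \<le> B * \<bar>h x\<bar>" for n
    using h(2)
  proof eventually_elim
    case (elim x)
    have "B \<ge> 0"
      using \<psi>(1)[of x] by linarith
    show ?case
    proof (cases "x \<in> K")
      case True
      then have "\<bar>P n x * Q n x\<bar> \<le> \<bar>h x\<bar>"
        using elim by (meson abs_ge_self order_trans)
      then have "\<bar>P n x * Q n x\<bar> * \<bar>\<psi> x\<bar> \<le> \<bar>h x\<bar> * B"
        using \<psi>(1)[of x] by (intro mult_mono) auto
      then show ?thesis
        by (simp add: abs_mult mult.commute)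
    next
      case False
      then show ?thesis
        using \<psi>(2)[of x] \<open>B \<ge> 0\<close> by simp
    qed
  qed
  have m: "(\<lambda>x. P n x * Q n x * \<psi> x) \<in> borel_measurable lebesgue" "(\<lambda>x. p x * q x * \<psi> x) \<in> borel_measurable lebesgue" for n
    using meas by (auto intro!: borel_measurable_times)
  have w: "integrable lebesgue (\<lambda>x. B * \<bar>h x\<bar>)"
    using h(1) by simp
  show "integrable lebesgue (\<lambda>x. P n x * Q n x * \<psi> x)"
  proof (rule Bochner_Integration.integrable_bound[OF w m(1)])
    show "AE x in lebesgue. norm (P n x * Q n x * \<psi> x) \<le> norm (B * \<bar>h x\<bar>)"
    proof (rule eventually_mono[OF bound[of n]])
      fix x
      assume "norm (P n x * Q n x * \<psi> x) \<le> B * \<bar>h x\<bar>"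
      also have "B * \<bar>h x\<bar> \<le> norm (B * \<bar>h x\<bar>)"
        unfolding real_norm_def by (rule abs_ge_self)
      finally show "norm (P n x * Q n x * \<psi> x) \<le> norm (B * \<bar>h x\<bar>)" .
    qed
  qed
  show "integrable lebesgue (\<lambda>x. p x * q x * \<psi> x)"
    using integrable_dominated_convergence[OF m(2) m(1) w lim bound] .
  show "(\<lambda>n. \<integral>x. P n x * Q n x * \<psi> x \<partial>lebesgue) \<longlonglongrightarrow> (\<integral>x. p x * q x * \<psi> x \<partial>lebesgue)"
    using integral_dominated_convergence[OF m(2) m(1) w lim bound] .
qed

text \<open>If one factor is bounded, convergence in mean of the other factor replaces domination:
  \<open>P\<^sub>n Q\<^sub>n = P\<^sub>n q + P\<^sub>n (Q\<^sub>n - q)\<close>.\<close>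

lemma product_limit_bounded:
  fixes K :: "'a::euclidean_space set"
  assumes P: "conv_mean K P p" "conv_AE K P p" and Q: "conv_mean K Q q"
    and Pb: "\<And>n x. \<bar>P n x\<bar> \<le> A"
    and \<psi>: "\<psi> \<in> borel_measurable lebesgue" "\<And>x. \<bar>\<psi> x\<bar> \<le> B" "\<And>x. x \<notin> K \<Longrightarrow> \<psi> x = 0"
    and K: "K \<in> sets lebesgue"
  shows "integrable lebesgue (\<lambda>x. P n x * Q n x * \<psi> x)" "integrable lebesgue (\<lambda>x. p x * q x * \<psi> x)"
    "(\<lambda>n. \<integral>x. P n x * Q n x * \<psi> x \<partial>lebesgue) \<longlonglongrightarrow> (\<integral>x. p x * q x * \<psi> x \<partial>lebesgue)"
proof -
  have A: "A \<ge> 0" and B: "B \<ge> 0"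
    using Pb[of 0 0] \<psi>(2)[of 0] by linarith+
  have meas: "P n \<in> borel_measurable lebesgue" "p \<in> borel_measurable lebesgue" "Q n \<in> borel_measurable lebesgue"
      "q \<in> borel_measurable lebesgue" for n
    using P Q by (auto simp: conv_mean_def)
  have Qi: "integrable lebesgue (Q n)" "integrable lebesgue q" for n
    using Q by (auto simp: conv_mean_def)
  \<comment> \<open>For \<open>P n * q\<close> the dominated version applies, with the constant
    sequence \<open>q\<close> and the majorant \<open>A * \<bar>q\<bar>\<close>.\<close>
  have dom: "AE x in lebesgue. x \<in> K \<longrightarrow> (\<forall>n. \<bar>P n x * q x\<bar> \<le> A * \<bar>q x\<bar>)"
    using Pb by (intro AE_I2) (auto simp: abs_mult intro!: mult_right_mono)
  have "conv_AE K (\<lambda>n. q) q"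
    by (simp add: conv_AE_def)
  note lim = product_limit_dominated[OF meas(1,2,4,4) \<psi>(1) P(2) this \<psi>(2,3) _ dom]
  show "integrable lebesgue (\<lambda>x. p x * q x * \<psi> x)"
    by (intro lim(2) integrable_mult_right integrable_abs Qi)
  have Pq: "integrable lebesgue (\<lambda>x. P n x * q x * \<psi> x)" for n
    by (intro lim(1) integrable_mult_right integrable_abs Qi)
  have PQ: "integrable lebesgue (\<lambda>x. P n x * Q n x * \<psi> x)" for n
  proof (rule Bochner_Integration.integrable_bound)
    show "integrable lebesgue (\<lambda>x. A * B * \<bar>Q n x\<bar>)"
      using Qi by simp
    show "(\<lambda>x. P n x * Q n x * \<psi> x) \<in> borel_measurable lebesgue"
      using meas \<psi> by (auto intro!: borel_measurable_times)
    show "AE x in lebesgue. norm (P n x * Q n x * \<psi> x) \<le> norm (A * B * \<bar>Q n x\<bar>)"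
    proof (intro AE_I2)
      fix x
      have "\<bar>P n x\<bar> * \<bar>\<psi> x\<bar> * \<bar>Q n x\<bar> \<le> A * B * \<bar>Q n x\<bar>"
        using Pb[of n x] \<psi>(2)[of x] A by (intro mult_right_mono mult_mono) auto
      then show "norm (P n x * Q n x * \<psi> x) \<le> norm (A * B * \<bar>Q n x\<bar>)"
        using A B by (simp add: abs_mult ac_simps)
    qed
  qed
  then show "integrable lebesgue (\<lambda>x. P n x * Q n x * \<psi> x)" .
  have "(\<lambda>n. (\<integral>x. P n x * Q n x * \<psi> x \<partial>lebesgue) - (\<integral>x. P n x * q x * \<psi> x \<partial>lebesgue)) \<longlonglongrightarrow> 0"
  proof -
    have bnd: "ennreal \<bar>(\<integral>x. P n x * Q n x * \<psi> x \<partial>lebesgue) - (\<integral>x. P n x * q x * \<psi> x \<partial>lebesgue)\<bar> \<le>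
       ennreal (A * B) * (\<integral>\<^sup>+x\<in>K. ennreal \<bar>Q n x - q x\<bar> \<partial>lebesgue)" for n
    proof -
      have "(\<integral>x. P n x * Q n x * \<psi> x \<partial>lebesgue) - (\<integral>x. P n x * q x * \<psi> x \<partial>lebesgue) =
        (\<integral>x. P n x * Q n x * \<psi> x - P n x * q x * \<psi> x \<partial>lebesgue)"
        using PQ Pq by simp
      also have "ennreal \<bar>\<dots>\<bar> \<le> (\<integral>\<^sup>+x. ennreal (norm (P n x * Q n x * \<psi> x - P n x * q x * \<psi> x)) \<partial>lebesgue)"
        using integral_norm_bound_ennreal[of lebesgue "\<lambda>x. P n x * Q n x * \<psi> x - P n x * q x * \<psi> x"] PQ Pq by simp
      also have "\<dots> \<le> (\<integral>\<^sup>+x. ennreal (A * B) * (ennreal \<bar>Q n x - q x\<bar> * indicator K x) \<partial>lebesgue)"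
      proof (intro nn_integral_mono)
        fix x
        have "\<bar>P n x\<bar> * \<bar>\<psi> x\<bar> * \<bar>Q n x - q x\<bar> \<le> A * B * \<bar>Q n x - q x\<bar>"
          using Pb[of n x] \<psi>(2)[of x] A by (intro mult_right_mono mult_mono) auto
        moreover have "P n x * Q n x * \<psi> x - P n x * q x * \<psi> x = P n x * \<psi> x * (Q n x - q x)"
          by (simp add: algebra_simps)
        ultimately have "norm (P n x * Q n x * \<psi> x - P n x * q x * \<psi> x) \<le> A * B * \<bar>Q n x - q x\<bar>"
          by (simp only: real_norm_def abs_mult)
        then have le: "ennreal (norm (P n x * Q n x * \<psi> x - P n x * q x * \<psi> x)) \<le> ennreal (A * B) * ennreal \<bar>Q n x - q x\<bar>"
          using A B by (simp add: ennreal_mult'[symmetric] ennreal_leI)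
        show "ennreal (norm (P n x * Q n x * \<psi> x - P n x * q x * \<psi> x)) \<le>
          ennreal (A * B) * (ennreal \<bar>Q n x - q x\<bar> * indicator K x)"
        proof (cases "x \<in> K")
          case True
          then show ?thesis
            using le by simp
        next
          case False
          then show ?thesis
            using \<psi>(3)[of x] by simp
        qed
      qed
      also have "\<dots> = ennreal (A * B) * (\<integral>\<^sup>+x\<in>K. ennreal \<bar>Q n x - q x\<bar> \<partial>lebesgue)"
      proof (rule nn_integral_cmult)
        have [measurable]: "Q n \<in> borel_measurable lebesgue" "q \<in> borel_measurable lebesgue" "K \<in> sets lebesgue"
          using meas K by auto
        show "(\<lambda>x. ennreal \<bar>Q n x - q x\<bar> * indicator K x) \<in> borel_measurable lebesgue"
          by measurable
      qed
      finally show ?thesis .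
    qed
    have lim0: "(\<lambda>n. ennreal (A * B) * (\<integral>\<^sup>+x\<in>K. ennreal \<bar>Q n x - q x\<bar> \<partial>lebesgue)) \<longlonglongrightarrow> ennreal 0"
      using Q ennreal_tendsto_cmult[of "ennreal (A * B)" _ 0 sequentially] unfolding conv_mean_def by simp
    have "(\<lambda>n. ennreal \<bar>(\<integral>x. P n x * Q n x * \<psi> x \<partial>lebesgue) - (\<integral>x. P n x * q x * \<psi> x \<partial>lebesgue)\<bar>) \<longlonglongrightarrow> ennreal 0"
      by (rule tendsto_sandwich[OF always_eventually always_eventually tendsto_const lim0]) (use bnd in auto)
    then have "(\<lambda>n. \<bar>(\<integral>x. P n x * Q n x * \<psi> x \<partial>lebesgue) - (\<integral>x. P n x * q x * \<psi> x \<partial>lebesgue)\<bar>) \<longlonglongrightarrow> 0"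
      by (subst (asm) tendsto_ennreal_iff) (auto intro!: always_eventually)
    then show ?thesis
      by (simp only: tendsto_rabs_zero_iff)
  qed
  moreover have "(\<lambda>n. \<integral>x. P n x * q x * \<psi> x \<partial>lebesgue) \<longlonglongrightarrow> (\<integral>x. p x * q x * \<psi> x \<partial>lebesgue)"
    by (intro lim(3) integrable_mult_right integrable_abs Qi)
  ultimately have "(\<lambda>n. ((\<integral>x. P n x * Q n x * \<psi> x \<partial>lebesgue) - (\<integral>x. P n x * q x * \<psi> x \<partial>lebesgue)) +
      (\<integral>x. P n x * q x * \<psi> x \<partial>lebesgue)) \<longlonglongrightarrow> 0 + (\<integral>x. p x * q x * \<psi> x \<partial>lebesgue)"
    by (rule tendsto_add)
  then show "(\<lambda>n. \<integral>x. P n x * Q n x * \<psi> x \<partial>lebesgue) \<longlonglongrightarrow> (\<integral>x. p x * q x * \<psi> x \<partial>lebesgue)"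
    by simp
qed

subsection \<open>Integrability of weak derivatives\<close>

text \<open>Exhausting \<open>G\<close> by compact sets presents the function as a pointwise limit
  of integrable ones.\<close>

lemma measurable_of_locally_integrable:
  fixes u :: "'a::euclidean_space \<Rightarrow> real"
  assumes "open G" "locally_integrable_on u G"
  shows "(\<lambda>x. indicator G x * u x) \<in> borel_measurable lebesgue"
proof -
  obtain C :: "nat \<Rightarrow> 'a set" where C: "\<And>n. compact (C n)" "\<And>n. C n \<subseteq> G" "\<And>n. C n \<subseteq> interior (C (Suc n))" "\<Union> (range C) = G"
    using open_Union_compact_subsets[OF assms(1)] by metis
  have inc: "C n \<subseteq> C m" if "n \<le> m" for n m
  proof (rule lift_Suc_mono_le[OF _ that])
    show "C n \<subseteq> C (Suc n)" for n
      using C(3)[of n] interior_subset[of "C (Suc n)"] by blast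
  qed
  show ?thesis
  proof (rule borel_measurable_LIMSEQ_real)
    show "(\<lambda>n. indicator (C n) x * u x) \<longlonglongrightarrow> indicator G x * u x" for x
    proof (cases "x \<in> G")
      case True
      then obtain N where "x \<in> C N"
        using C(4) by auto
      then have "\<forall>\<^sub>F n in sequentially. indicator (C n) x * u x = indicator G x * u x"
        using True inc by (auto simp: eventually_sequentially indicator_def intro!: exI[of _ N])
      then show ?thesis
        by (rule tendsto_eventually)
    next
      case False
      then have eq: "indicator (C n) x * u x = indicator G x * u x" for n
        using C(2)[of n] by (auto simp: indicator_def)
      show ?thesis
        unfolding eq by (rule tendsto_const)
    qed
    show "(\<lambda>x. indicator (C n) x * u x) \<in> borel_measurable lebesgue" for n
    proof -
      have "set_integrable lebesgue (C n) u"
        using assms(2) C(1,2) unfolding locally_integrable_on_def by blast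
      then show ?thesis
        unfolding set_integrable_def real_scaleR_def by (rule borel_measurable_integrable)
    qed
  qed
qed

lemma measurable_on_indicator:
  fixes u :: "'a::euclidean_space \<Rightarrow> real"
  assumes "G \<in> sets lebesgue" "(\<lambda>x. indicator G x * u x) \<in> borel_measurable lebesgue"
  shows "u \<in> borel_measurable (lebesgue_on G)"
  using assms borel_measurable_restrict_space_iff[of G lebesgue u] by simp

lemma measurable_on_indicator_ennreal:
  fixes u :: "'a::euclidean_space \<Rightarrow> ennreal"
  assumes "G \<in> sets lebesgue" "u \<in> borel_measurable (lebesgue_on G)"
  shows "(\<lambda>x. u x * indicator G x) \<in> borel_measurable lebesgue"
  using assms borel_measurable_restrict_space_iff_ennreal[of G lebesgue u] by simp

text \<open>Axiom (P5) embeds the space over a set of finite measure into \<open>L^1\<close>, and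
  the basis values recover \<open>V x hs\<close> for arbitrary directions.\<close>

lemma multilinear_integrable:
  fixes V :: "'a::euclidean_space \<Rightarrow> 'a list \<Rightarrow> real"
  assumes \<rho>: "banach_function_norm (lebesgue_on G) \<rho>" and G: "G \<in> lmeasurable"
    and ml: "\<And>x. x \<in> G \<Longrightarrow> multilinear_form i (V x)"
    and meas: "\<And>hs. length hs = i \<Longrightarrow> (\<lambda>x. indicator G x * V x hs) \<in> borel_measurable lebesgue"
    and fin: "\<rho> (\<lambda>x. multilinear_norm i (V x)) < \<infinity>" and hs: "length hs = i"
  shows "integrable lebesgue (\<lambda>x. indicator G x * V x hs)"
proof -
  have Gs: "G \<in> sets lebesgue"
    using G by (rule fmeasurableD)
  have Nm: "(\<lambda>x. multilinear_norm i (V x)) \<in> borel_measurable (lebesgue_on G)"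
    by (intro borel_measurable_multilinear_norm ml measurable_on_indicator Gs meas) (auto simp: space_restrict_space)
  have "emeasure (lebesgue_on G) G < \<infinity>"
    using G Gs by (simp add: emeasure_lebesgue_on emeasure_eq_measure2 del: emeasure_completion)
  then obtain C where C: "(\<integral>\<^sup>+x\<in>G. multilinear_norm i (V x) \<partial>lebesgue_on G) \<le> ennreal C * \<rho> (\<lambda>x. multilinear_norm i (V x))"
    using norm_L1[OF \<rho>, of G] Nm Gs by (auto simp: sets_lebesgue_on_iff)
  have "(\<integral>\<^sup>+x\<in>G. multilinear_norm i (V x) \<partial>lebesgue) < \<infinity>"
  proof -
    have "(\<integral>\<^sup>+x\<in>G. multilinear_norm i (V x) \<partial>lebesgue) \<le> ennreal C * \<rho> (\<lambda>x. multilinear_norm i (V x))"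
      using C nn_integral_lebesgue_on[OF Gs order_refl] by simp
    also have "\<dots> < \<infinity>"
      using fin by (simp add: ennreal_mult_less_top)
    finally show ?thesis .
  qed
  define P where "P = (\<Prod>h\<leftarrow>hs. norm h) * real (card (basis_lists i :: 'a list set))"
  have "P \<ge> 0"
    unfolding P_def by (intro mult_nonneg_nonneg prod_list_nonneg) auto
  have le: "ennreal \<bar>V x hs\<bar> \<le> ennreal P * multilinear_norm i (V x)" if "x \<in> G" for x
  proof (cases "multilinear_norm i (V x)")
    case (real N)
    have "(\<Sum>bs\<in>basis_lists i. \<bar>V x bs\<bar>) \<le> (\<Sum>bs\<in>(basis_lists i :: 'a list set). N)"
    proof (rule sum_mono)
      fix bs :: "'a list"
      assume "bs \<in> basis_lists i"
      from basis_lists_le_multilinear_norm[OF this, of "V x"] show "\<bar>V x bs\<bar> \<le> N"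
        using real by simp
    qed
    then have "(\<Prod>h\<leftarrow>hs. norm h) * (\<Sum>bs\<in>basis_lists i. \<bar>V x bs\<bar>) \<le> (\<Prod>h\<leftarrow>hs. norm h) * (real (card (basis_lists i :: 'a list set)) * N)"
      by (intro mult_left_mono prod_list_nonneg) auto
    then have "\<bar>V x hs\<bar> \<le> P * N"
      using multilinear_form_bound[OF ml[OF that] hs] by (simp add: P_def)
    then show ?thesis
      using real \<open>P \<ge> 0\<close> by (simp add: ennreal_mult[symmetric] ennreal_leI)
  next
    \<comment> \<open>A multilinear form in finite dimension has finite norm, so this case is
      void.\<close>
    case top
    then show ?thesis
    proof -
      have "multilinear_norm i (V x) \<le> ennreal (\<Sum>bs\<in>basis_lists i. \<bar>V x bs\<bar>)"
        by (rule multilinear_norm_le[OF ml[OF that]])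
      then show ?thesis
        using top by (simp add: top_unique)
    qed
  qed
  show ?thesis
  proof (rule integrableI_bounded)
    have "(\<integral>\<^sup>+x. ennreal (norm (indicator G x * V x hs)) \<partial>lebesgue) \<le>
      (\<integral>\<^sup>+x. ennreal P * (multilinear_norm i (V x) * indicator G x) \<partial>lebesgue)"
      using le by (intro nn_integral_mono) (auto simp: indicator_def)
    also have "\<dots> = ennreal P * (\<integral>\<^sup>+x\<in>G. multilinear_norm i (V x) \<partial>lebesgue)"
      by (intro nn_integral_cmult measurable_on_indicator_ennreal Gs Nm)
    also have "\<dots> < \<infinity>"
      using \<open>(\<integral>\<^sup>+x\<in>G. multilinear_norm i (V x) \<partial>lebesgue) < \<infinity>\<close> by (simp add: ennreal_mult_less_top)
    finally show "(\<integral>\<^sup>+x. ennreal (norm (indicator G x * V x hs)) \<partial>lebesgue) < \<infinity>" .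
  qed (rule meas[OF hs])
qed

subsection \<open>Mollification of a locally Lipschitz Sobolev function\<close>

text \<open>\<open>G\<close> is the domain of interest and \<open>G'\<close> a neighbourhood of its closure.  The weak derivatives
  \<open>V\<close> on \<open>G\<close> and \<open>V'\<close> on \<open>G'\<close> are chosen independently; both control the same mollifications of \<open>f\<close>,
  which makes the uniqueness of weak derivatives unnecessary.\<close>

locale approximation_domain =
  fixes G G' :: "'a::euclidean_space set" and R L B :: real and m :: nat and \<rho> :: "'a \<Rightarrow> real"
  assumes open_G: "open G" and open_G': "open G'" and G_fin: "G \<in> lmeasurable" and G'_fin: "G' \<in> lmeasurable"
    and R_pos: "R > 0" and L_nonneg: "L \<ge> 0" and B_nonneg: "B \<ge> 0" and cball_sub: "\<And>x. x \<in> G \<Longrightarrow> cball x R \<subseteq> G'"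
    and ker: "kernel \<rho>" and ker_int: "(\<integral>z. \<rho> z \<partial>lborel) = 1"

locale sobolev_approximation = approximation_domain G G' R L B m \<rho>
  for G G' :: "'a::euclidean_space set" and R L B m \<rho> +
  fixes f :: "'a \<Rightarrow> real" and V V' :: "nat \<Rightarrow> 'a \<Rightarrow> 'a list \<Rightarrow> real"
  assumes wd: "\<And>i. i \<le> m \<Longrightarrow> has_weak_derivative G i f (V i)"
    and wd': "\<And>i. i \<le> m \<Longrightarrow> has_weak_derivative G' i f (V' i)"
    and V_int: "\<And>hs. length hs \<le> m \<Longrightarrow> integrable lebesgue (\<lambda>y. indicator G y * V (length hs) y hs)"
    and V'_int: "\<And>hs. length hs \<le> m \<Longrightarrow> integrable lebesgue (\<lambda>y. indicator G' y * V' (length hs) y hs)"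
    and f_int: "integrable lebesgue (\<lambda>y. indicator G' y * f y)"
    and f_bound: "\<And>y. y \<in> G' \<Longrightarrow> \<bar>f y\<bar> \<le> B"
    and f_lip: "\<And>x y. x \<in> G \<Longrightarrow> y \<in> ball x R \<Longrightarrow> \<bar>f y - f x\<bar> \<le> L * dist y x"
begin

lemma sets_G: "G \<in> sets lebesgue" and sets_G': "G' \<in> sets lebesgue"
  using G_fin G'_fin by (auto simp: fmeasurableD)

lemma G_subset: "G \<subseteq> G'"
  using cball_sub R_pos by fastforce

text \<open>All derivatives are placed on the kernel and only \<open>f\<close> is mollified. The
  definition thus makes sense for lists of every length, beyond \<open>m\<close> as well, and
  prepending a direction is always differentiation; the weak derivatives enter only through
  \<open>U_eq\<close> and \<open>U_eq'\<close>.\<close>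

definition U :: "real \<Rightarrow> 'a list \<Rightarrow> 'a \<Rightarrow> real" where
  "U t a x = mollify (iterated_deriv a \<rho>) t (\<lambda>y. indicator G' y * f y) x / t ^ length a"

lemma U_eq': "length a \<le> m \<Longrightarrow> t > 0 \<Longrightarrow> cball x t \<subseteq> G' \<Longrightarrow>
    U t a x = mollify \<rho> t (\<lambda>y. indicator G' y * V' (length a) y a) x"
  using weak_deriv_mollify[OF wd' sets_G' _ _ ker, of "length a" x t a] by (simp add: U_def)

text \<open>Values of \<open>f\<close> off \<open>ball x t\<close> do not enter, so mollifying over
  \<open>G\<close> or over \<open>G'\<close> is the same. This is how the derivatives chosen on
  \<open>G\<close> come into play.\<close>

lemma U_eq:
  assumes "length a \<le> m" "t > 0" "cball x t \<subseteq> G"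
  shows "U t a x = mollify \<rho> t (\<lambda>y. indicator G y * V (length a) y a) x"
proof -
  have "mollify (iterated_deriv a \<rho>) t (\<lambda>y. indicator G y * f y) x = mollify (iterated_deriv a \<rho>) t (\<lambda>y. indicator G' y * f y) x"
    unfolding mollify_def
  proof (intro Bochner_Integration.integral_cong refl)
    fix y
    show "indicator G y * f y * (iterated_deriv a \<rho> ((x - y) /\<^sub>R t) / t ^ DIM('a)) =
        indicator G' y * f y * (iterated_deriv a \<rho> ((x - y) /\<^sub>R t) / t ^ DIM('a))"
    proof (cases "y \<in> ball x t")
      case True
      then have "y \<in> G"
        using assms(3) by auto
      moreover from this have "y \<in> G'"
        using G_subset by blast
      ultimately have "y \<in> G" "y \<in> G'" .
      then show ?thesis
        by simp
    next
      case False
      then show ?thesis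
        using kernel_scaled_eq_0[OF kernel_iterated_deriv[OF ker] assms(2)] by simp
    qed
  qed
  then show ?thesis
    using weak_deriv_mollify[OF wd sets_G assms(3,2) ker, of "length a" a] assms(1) by (simp add: U_def)
qed

lemma U_dir_deriv: "t > 0 \<Longrightarrow> has_dir_deriv (U t a) h (U t (h # a))"
proof -
  assume t: "t > 0"
  have "has_dir_deriv (mollify (iterated_deriv a \<rho>) t (\<lambda>y. indicator G' y * f y)) h
      (\<lambda>x. mollify (iterated_deriv (h # a) \<rho>) t (\<lambda>y. indicator G' y * f y) x / t)"
    using mollify_has_dir_deriv[OF f_int kernel_iterated_deriv[OF ker, of a] t, of h] by simp
  then show ?thesis
    using t unfolding has_dir_deriv_def U_def by (auto intro!: derivative_eq_intros)
qed

lemma U_borel: "U t a \<in> borel_measurable borel"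
  unfolding U_def[abs_def]
  by (intro borel_measurable_divide mollify_borel kernel_iterated_deriv ker borel_measurable_integrable f_int borel_measurable_const)

lemma U_bounded: "\<exists>C. \<forall>x. \<bar>U t a x\<bar> \<le> C"
proof -
  obtain C where "\<And>x. \<bar>mollify (iterated_deriv a \<rho>) t (\<lambda>y. indicator G' y * f y) x\<bar> \<le> C"
    using mollify_bounded[OF f_int kernel_iterated_deriv[OF ker, of a], of t] by blast
  then have "\<bar>U t a x\<bar> \<le> C / \<bar>t ^ length a\<bar>" for x
    unfolding U_def abs_divide by (intro divide_right_mono) auto
  then show ?thesis
    by blast
qed

text \<open>The bound is uniform in the scale, unlike that of \<open>U_bounded\<close>; it controls
  the undifferentiated factor of the end terms.\<close>

lemma U_Nil_bounded: "\<exists>C. \<forall>t>0. \<forall>x. \<bar>U t [] x\<bar> \<le> C"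
proof -
  obtain C where C: "\<And>x. \<bar>\<rho> x\<bar> \<le> C"
    using kernel_bounded[OF ker] by blast
  have "\<bar>U t [] x\<bar> \<le> C * (unit_ball_vol DIM('a) * B)" if "t > 0" for t x
  proof -
    have "\<bar>mollify \<rho> t (\<lambda>y. indicator G' y * f y) x - 0 * (\<integral>z. \<rho> z \<partial>lborel)\<bar> \<le> C * (unit_ball_vol DIM('a) * B)"
      by (rule mollify_oscillation[OF f_int ker C that B_nonneg]) (use f_bound B_nonneg in \<open>auto simp: indicator_def\<close>)
    then show ?thesis
      by (simp add: U_def)
  qed
  then show ?thesis
    by blast
qed

lemma U_integrable: "t > 0 \<Longrightarrow> integrable lebesgue (U t a)"
proof (rule integrableI_bounded)
  assume t: "t > 0"
  note K = kernel_iterated_deriv[OF ker, of a]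
  have "(\<integral>\<^sup>+x. ennreal (norm (U t a x)) \<partial>lebesgue) =
    (\<integral>\<^sup>+x. ennreal (1 / t ^ length a) * ennreal \<bar>mollify (iterated_deriv a \<rho>) t (\<lambda>y. indicator G' y * f y) x\<bar> \<partial>lebesgue)"
    using t by (intro nn_integral_cong) (simp add: U_def abs_mult flip: ennreal_mult')
  also have "\<dots> = ennreal (1 / t ^ length a) * (\<integral>\<^sup>+x. ennreal \<bar>mollify (iterated_deriv a \<rho>) t (\<lambda>y. indicator G' y * f y) x\<bar> \<partial>lebesgue)"
    by (intro nn_integral_cmult measurable_compose[OF _ measurable_ennreal] borel_measurable_abs borel_imp_lebesgue_measurable
        mollify_borel K borel_measurable_integrable f_int)
  also have "\<dots> \<le> ennreal (1 / t ^ length a) * ((\<integral>\<^sup>+y. ennreal \<bar>indicator G' y * f y\<bar> \<partial>lebesgue) * (\<integral>\<^sup>+x. ennreal \<bar>iterated_deriv a \<rho> x\<bar> \<partial>lborel))"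
    by (intro mult_left_mono mollify_L1_bound f_int K t) simp
  also have "\<dots> < \<infinity>"
    using f_int kernel_integrable[OF K] by (auto simp: integrable_iff_bounded ennreal_mult_less_top)
  finally show "(\<integral>\<^sup>+x. ennreal (norm (U t a x)) \<partial>lebesgue) < \<infinity>" .
qed (intro borel_imp_lebesgue_measurable U_borel)

lemma conv_mean_U_Nil:
  assumes "compact K" "\<And>n. t n > 0" "t \<longlonglongrightarrow> 0"
  shows "conv_mean K (\<lambda>n. U (t n) []) (\<lambda>y. indicator G' y * f y)"
proof -
  have "U (t n) [] = mollify \<rho> (t n) (\<lambda>y. indicator G' y * f y)" for n
    by (simp add: U_def fun_eq_iff)
  then show ?thesis
    unfolding conv_mean_def using mollify_tendsto_L1[OF f_int ker ker_int assms] U_integrable[OF assms(2), of _ "[]"] f_int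
    by simp
qed

lemma conv_mean_U:
  assumes K: "compact K" and a: "length a \<le> m" and t: "\<And>n. t n > 0" "t \<longlonglongrightarrow> 0" and sub: "\<And>n x. x \<in> K \<Longrightarrow> cball x (t n) \<subseteq> G"
  shows "conv_mean K (\<lambda>n. U (t n) a) (\<lambda>y. indicator G y * V (length a) y a)"
proof -
  have "(\<integral>\<^sup>+x\<in>K. ennreal \<bar>U (t n) a x - indicator G x * V (length a) x a\<bar> \<partial>lebesgue) =
     (\<integral>\<^sup>+x\<in>K. ennreal \<bar>mollify \<rho> (t n) (\<lambda>y. indicator G y * V (length a) y a) x - indicator G x * V (length a) x a\<bar> \<partial>lebesgue)" for n
    using U_eq[OF a t(1) sub] by (intro nn_integral_cong) (auto simp: indicator_def)
  then show ?thesis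
    unfolding conv_mean_def using mollify_tendsto_L1[OF V_int[OF a] ker ker_int K t] U_integrable[OF t(1)] V_int[OF a] by simp
qed

text \<open>Suppose no mean up to radius \<open>R\<close> exceeds the height
  \<open>2^(i(k-1))\<close>. Then \<open>r = R / 2^i\<close> is the scale at which both terms of the
  interpolation are of order \<open>2^(i(j-1))\<close>. A mollification scale below \<open>r\<close>
  is compared with \<open>r\<close>; above \<open>r\<close>, the Lipschitz bound of order
  \<open>t^(1-j)\<close> is at most its value at \<open>r\<close>. Hence the bound does not depend
  on \<open>t\<close>.\<close>

lemma U_level_bound:
  assumes k: "k \<le> m" and a: "1 \<le> length a" "length a \<le> k"
    and F_meas: "F \<in> borel_measurable lebesgue" and F: "\<And>y. y \<in> G' \<Longrightarrow> (\<Sum>bs\<in>basis_lists k. \<bar>V' k y bs\<bar>) \<le> F y"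
  shows "\<exists>C\<ge>0. \<forall>x\<in>G. \<forall>t i. 0 < t \<longrightarrow> t \<le> R \<longrightarrow>
    (\<forall>s. 0 < s \<longrightarrow> s \<le> R \<longrightarrow> (\<integral>\<^sup>+y\<in>ball x s. ennreal (F y) \<partial>lebesgue) \<le> ennreal (2 ^ (i * (k - 1)) * s ^ DIM('a))) \<longrightarrow>
    \<bar>U t a x\<bar> \<le> C * 2 ^ (i * (length a - 1))"
proof -
  define j where "j = length a"
  have j: "1 \<le> j" "j \<le> k"
    using a by (auto simp: j_def)
  define A where "A t x = mollify \<rho> t (\<lambda>y. indicator G' y * V' (length a) y a) x" for t x
  note hyp = sets_G' wd'[OF order_trans[OF _ k]] f_int V'_int[OF order_trans[OF _ k]] F_meas F
  have A_eq: "mollified_deriv G' V' \<rho> a t x = A t x" for t x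
    by (simp add: A_def mollified_deriv_def[OF hyp])
  obtain C0 where C0: "C0 \<ge> 0" "\<And>x t L. 0 < t \<Longrightarrow> 0 \<le> L \<Longrightarrow> cball x t \<subseteq> G' \<Longrightarrow>
      \<forall>y\<in>ball x t. \<bar>f y - f x\<bar> \<le> L * dist y x \<Longrightarrow> \<bar>A t x\<bar> \<le> C0 * (L * (t / t ^ j))"
    using mollified_deriv_lipschitz_bound[OF hyp ker a] unfolding A_eq j_def by blast
  obtain C1 where C1: "C1 \<ge> 0" "\<And>x t r L M. 0 < t \<Longrightarrow> t \<le> r \<Longrightarrow> 0 \<le> L \<Longrightarrow> 0 \<le> M \<Longrightarrow> cball x r \<subseteq> G' \<Longrightarrow>
    \<forall>y\<in>ball x r. \<bar>f y - f x\<bar> \<le> L * dist y x \<Longrightarrow>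
    \<forall>s. 0 < s \<longrightarrow> s \<le> r \<longrightarrow> (\<integral>\<^sup>+y\<in>ball x s. ennreal (F y) \<partial>lebesgue) \<le> ennreal (M * s ^ DIM('a)) \<Longrightarrow>
    \<bar>A t x\<bar> \<le> C1 * (L * (r / r ^ j) + M * r ^ (k - j))"
    using mollified_deriv_interpolation[OF hyp, of "k - j" a \<rho>] a ker unfolding A_eq j_def by force
  \<comment> \<open>Collects the powers of \<open>R\<close> left over in the two cases: the
    Lipschitz bound alone for \<open>t > r\<close>, interpolation for
    \<open>t \<le> r\<close>.\<close>
  define C where "C = max (C0 * (L * (R / R ^ j))) (C1 * (L * (R / R ^ j) + R ^ (k - j)))"
  have "C \<ge> 0"
    using C0(1) L_nonneg R_pos by (simp add: C_def le_max_iff_disj)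
  have "\<bar>U t a x\<bar> \<le> C * 2 ^ (i * (j - 1))"
    if x: "x \<in> G" and t: "0 < t" "t \<le> R"
      and le: "\<And>s. 0 < s \<Longrightarrow> s \<le> R \<Longrightarrow> (\<integral>\<^sup>+y\<in>ball x s. ennreal (F y) \<partial>lebesgue) \<le> ennreal (2 ^ (i * (k - 1)) * s ^ DIM('a))"
    for x t i
  proof -
    have sub: "cball x R \<subseteq> G'"
      using x by (rule cball_sub)
    then have "cball x t \<subseteq> G'"
      using t subset_cball[of t R x] by blast
    then have U_A: "U t a x = A t x"
      using a k t by (simp add: U_eq' A_def)
    define r where "r = R / 2 ^ i"
    have r: "0 < r" "r \<le> R"
      using R_pos by (auto simp: r_def field_simps)
    have r_pow: "r / r ^ j = R / R ^ j * 2 ^ (i * (j - 1))"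
    proof -
      obtain j' where "j = Suc j'"
        using j(1) by (cases j) auto
      then show ?thesis
        using R_pos by (simp add: r_def field_simps power_mult)
    qed
    have M_pow: "2 ^ (i * (k - 1)) * r ^ (k - j) = R ^ (k - j) * 2 ^ (i * (j - 1))"
    proof -
      have "k - 1 = (j - 1) + (k - j)"
        using j by simp
      then have "(2::real) ^ (i * (k - 1)) = 2 ^ (i * (j - 1)) * 2 ^ (i * (k - j))"
        by (simp add: distrib_left power_add)
      then show ?thesis
        by (simp add: r_def power_divide power_mult)
    qed
    show ?thesis
    proof (cases "t \<le> r")
      case True
      have "\<bar>A t x\<bar> \<le> C1 * (L * (r / r ^ j) + 2 ^ (i * (k - 1)) * r ^ (k - j))"
      proof (rule C1(2)[OF t(1) True L_nonneg])
        show "cball x r \<subseteq> G'"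
          using sub r subset_cball[of r R x] by blast
        show "\<forall>y\<in>ball x r. \<bar>f y - f x\<bar> \<le> L * dist y x"
          using f_lip[OF x] r by auto
      qed (use le r in auto)
      also have "\<dots> = C1 * (L * (R / R ^ j) + R ^ (k - j)) * 2 ^ (i * (j - 1))"
        unfolding r_pow M_pow by (simp add: algebra_simps)
      also have "\<dots> \<le> C * 2 ^ (i * (j - 1))"
        by (intro mult_right_mono) (auto simp: C_def)
      finally show ?thesis
        by (simp add: U_A)
    next
      case False
      have "\<bar>A t x\<bar> \<le> C0 * (L * (t / t ^ j))"
        using t f_lip[OF x] L_nonneg \<open>cball x t \<subseteq> G'\<close> by (intro C0(2)) auto
      also have "\<dots> \<le> C0 * (L * (r / r ^ j))"
      proof (intro mult_left_mono C0(1) L_nonneg)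
        obtain j' where j': "j = Suc j'"
          using j(1) by (cases j) auto
        have "r ^ j' \<le> t ^ j'"
          using False r by (intro power_mono) auto
        then show "t / t ^ j \<le> r / r ^ j"
          using r t by (simp add: j' frac_le)
      qed
      also have "\<dots> = C0 * (L * (R / R ^ j)) * 2 ^ (i * (j - 1))"
        unfolding r_pow by simp
      also have "\<dots> \<le> C * 2 ^ (i * (j - 1))"
        by (intro mult_right_mono) (auto simp: C_def)
      finally show ?thesis
        by (simp add: U_A)
    qed
  qed
  then show ?thesis
    using \<open>C \<ge> 0\<close> unfolding j_def by blast
qed

end

text \<open>An open set is a countable union of compact sets, and countably many exceptional null
  sets may be united.\<close>

lemma AE_on_open:
  fixes G :: "'a::euclidean_space set"
  assumes "open G" "\<And>K. compact K \<Longrightarrow> K \<subseteq> G \<Longrightarrow> AE x in lebesgue. x \<in> K \<longrightarrow> P x"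
  shows "AE x in lebesgue. x \<in> G \<longrightarrow> P x"
proof -
  obtain C :: "nat \<Rightarrow> 'a set" where C: "\<And>n. compact (C n)" "\<And>n. C n \<subseteq> G" "\<Union> (range C) = G"
    using open_Union_compact_subsets[OF assms(1)] by metis
  have "AE x in lebesgue. \<forall>n. x \<in> C n \<longrightarrow> P x"
    unfolding AE_all_countable using assms(2) C(1,2) by blast
  then show ?thesis
    by eventually_elim (use C(3) in blast)
qed

text \<open>Scales of at most \<open>R\<close> are those covered by the level bounds; the inclusion
  of the balls in \<open>G\<close> is what \<open>U_eq\<close> asks for, and it holds uniformly on
  \<open>K\<close> by compactness.\<close>

lemma (in approximation_domain) scale_sequence:
  assumes "compact K" "K \<subseteq> G"
  obtains t :: "nat \<Rightarrow> real" where "\<And>n. t n > 0" "\<And>n. t n \<le> R" "t \<longlonglongrightarrow> 0" "\<And>n x. x \<in> K \<Longrightarrow> cball x (t n) \<subseteq> G"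
proof -
  obtain d where d: "d > 0" "(\<Union>x\<in>K. cball x d) \<subseteq> G"
    using compact_subset_open_imp_cball_epsilon_subset[OF assms(1) open_G assms(2)] by metis
  define t where "t n = min d R * inverse (real (Suc n))" for n
  have t_le: "t n \<le> min d R" for n
  proof -
    have "inverse (real (Suc n)) \<le> 1"
      by (simp add: field_simps)
    then have "min d R * inverse (real (Suc n)) \<le> min d R * 1"
      using d R_pos by (intro mult_left_mono) auto
    then show ?thesis
      by (simp add: t_def)
  qed
  show thesis
  proof (rule that[of t])
    show "t n > 0" for n
      using d R_pos by (simp add: t_def)
    show "t n \<le> R" for n
      using t_le[of n] by simp
    have "(\<lambda>n. min d R * inverse (real (Suc n))) \<longlonglongrightarrow> min d R * 0"
      by (intro tendsto_intros LIMSEQ_inverse_real_of_nat)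
    then show "t \<longlonglongrightarrow> 0"
      by (simp add: t_def[abs_def])
    show "cball x (t n) \<subseteq> G" if "x \<in> K" for n x
      using d(2) that t_le[of n] subset_cball[of "t n" d x] by fastforce
  qed
qed

section \<open>Two factors over a common pair of domains, and the majorant of their mixed
  products\<close>

locale sobolev_product =
  f: sobolev_approximation G G' R L B m \<rho> f V V' + g: sobolev_approximation G G' R L B m \<rho> g W W'
  for G G' :: "'a::euclidean_space set" and R L B m \<rho> f V V' g W W' +
  fixes X :: "'a set \<Rightarrow> ('a \<Rightarrow> ennreal) \<Rightarrow> ennreal"
  assumes fam: "ri_family X" and G_ne: "G \<noteq> {}"
    and V_fin: "\<And>i. i \<le> m \<Longrightarrow> X G (\<lambda>x. multilinear_norm i (V i x)) < \<infinity>"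
    and W_fin: "\<And>i. i \<le> m \<Longrightarrow> X G (\<lambda>x. multilinear_norm i (W i x)) < \<infinity>"
    and V'_fin: "\<And>i. i \<le> m \<Longrightarrow> X G' (\<lambda>x. multilinear_norm i (V' i x)) < \<infinity>"
    and W'_fin: "\<And>i. i \<le> m \<Longrightarrow> X G' (\<lambda>x. multilinear_norm i (W' i x)) < \<infinity>"
begin

lemma norm_G: "banach_function_norm (lebesgue_on G) (X G)" and norm_G': "banach_function_norm (lebesgue_on G') (X G')"
  using fam f.open_G f.open_G' f.G_fin f.G'_fin unfolding ri_family_def
  by (auto intro!: ri_imp_bfn simp: emeasure_eq_measure2 simp del: emeasure_completion)

lemma norm_measurable:
  assumes "has_weak_derivative D i u T" "D \<in> sets lebesgue"
    "\<And>hs. length hs = i \<Longrightarrow> integrable lebesgue (\<lambda>y. indicator D y * T y hs)"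
  shows "(\<lambda>x. multilinear_norm i (T x)) \<in> borel_measurable (lebesgue_on D)"
proof (rule borel_measurable_multilinear_norm)
  show "multilinear_form i (T x)" if "x \<in> space (lebesgue_on D)" for x
    using assms(1) that by (auto simp: has_weak_derivative_def space_restrict_space)
  show "(\<lambda>x. T x hs) \<in> borel_measurable (lebesgue_on D)" if "length hs = i" for hs
    using assms that by (intro measurable_on_indicator borel_measurable_integrable) auto
qed

lemma NV_meas: "i \<le> m \<Longrightarrow> (\<lambda>x. multilinear_norm i (V i x)) \<in> borel_measurable (lebesgue_on G)"
  using f.V_int by (intro norm_measurable[OF f.wd f.sets_G]) auto

lemma NW_meas: "i \<le> m \<Longrightarrow> (\<lambda>x. multilinear_norm i (W i x)) \<in> borel_measurable (lebesgue_on G)"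
  using g.V_int by (intro norm_measurable[OF g.wd f.sets_G]) auto

lemma NV'_meas: "i \<le> m \<Longrightarrow> (\<lambda>x. multilinear_norm i (V' i x)) \<in> borel_measurable (lebesgue_on G')"
  using f.V'_int by (intro norm_measurable[OF f.wd' f.sets_G']) auto

lemma NW'_meas: "i \<le> m \<Longrightarrow> (\<lambda>x. multilinear_norm i (W' i x)) \<in> borel_measurable (lebesgue_on G')"
  using g.V'_int by (intro norm_measurable[OF g.wd' f.sets_G']) auto

text \<open>Axiom (P5) on the whole of \<open>G\<close>, which has finite measure.\<close>

lemma integral_finite:
  assumes "H \<in> borel_measurable (lebesgue_on G)" "X G H < \<infinity>"
  shows "(\<integral>\<^sup>+x\<in>G. H x \<partial>lebesgue) < \<infinity>"
proof -
  have "emeasure (lebesgue_on G) G < \<infinity>"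
    using f.G_fin f.sets_G by (simp add: emeasure_lebesgue_on emeasure_eq_measure2 del: emeasure_completion)
  then obtain C where C: "(\<integral>\<^sup>+x\<in>G. H x \<partial>lebesgue_on G) \<le> ennreal C * X G H"
    using norm_L1[OF norm_G, of G] assms(1) f.sets_G by (auto simp: sets_lebesgue_on_iff)
  then have "(\<integral>\<^sup>+x\<in>G. H x \<partial>lebesgue) \<le> ennreal C * X G H"
    using nn_integral_lebesgue_on[OF f.sets_G order_refl] by simp
  also have "\<dots> < \<infinity>"
    using assms(2) by (simp add: ennreal_mult_less_top)
  finally show ?thesis .
qed

text \<open>A majorant of finite norm for all mixed products of total order \<open>k\<close>,
  uniform in the scale. If \<open>x\<close> is outside the level set of index \<open>i\<close>, each
  factor is bounded by \<open>U_level_bound\<close>, and the exponents add up to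
  \<open>(length a - 1) + (length b - 1) = k - 2 = l\<close>.\<close>

lemma product_level_bound:
  assumes k: "k = l + 2" "k \<le> m"
  obtains H where "H \<in> borel_measurable lebesgue" "X G H < \<infinity>"
    "\<And>a b. length a + length b = k \<Longrightarrow> a \<noteq> [] \<Longrightarrow> b \<noteq> [] \<Longrightarrow>
      \<exists>C\<ge>0. AE x in lebesgue. x \<in> G \<longrightarrow> (\<forall>t. 0 < t \<longrightarrow> t \<le> R \<longrightarrow> ennreal \<bar>f.U t a x * g.U t b x\<bar> \<le> ennreal C * H x)"
proof -
  \<comment> \<open>One function for both factors, so that the same level sets govern
    \<open>f\<close> and \<open>g\<close>; it vanishes off \<open>G'\<close>, which confines its
    superlevel sets of positive height to \<open>G'\<close>.\<close>
  define u where "u y = (\<Sum>bs\<in>basis_lists k. \<bar>indicator G' y * V' k y bs\<bar> + \<bar>indicator G' y * W' k y bs\<bar>)" for y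
  have u0: "u y \<ge> 0" for y
    unfolding u_def by (intro sum_nonneg) auto
  have lens: "length bs = k" if "bs \<in> basis_lists k" for bs :: "'a list"
    using that by (simp add: basis_lists_def)
  have u_meas: "u \<in> borel_measurable lebesgue"
    unfolding u_def
  proof (intro borel_measurable_sum borel_measurable_add borel_measurable_abs)
    fix bs :: "'a list"
    assume "bs \<in> basis_lists k"
    then show "(\<lambda>y. indicator G' y * V' k y bs) \<in> borel_measurable lebesgue"
        "(\<lambda>y. indicator G' y * W' k y bs) \<in> borel_measurable lebesgue"
      using f.V'_int[of bs] g.V'_int[of bs] lens k(2) by auto
  qed
  have u_out: "u y = 0" if "y \<notin> G'" for y
    using that by (simp add: u_def)
  have u_V: "(\<Sum>bs\<in>basis_lists k. \<bar>V' k y bs\<bar>) \<le> u y" and u_W: "(\<Sum>bs\<in>basis_lists k. \<bar>W' k y bs\<bar>) \<le> u y"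
    if "y \<in> G'" for y
    using that unfolding u_def by (auto intro!: sum_mono)
  have u_fin: "X G' (\<lambda>x. ennreal (u x)) < \<infinity>"
  proof -
    let ?N = "\<lambda>x. multilinear_norm k (V' k x) + multilinear_norm k (W' k x)"
    have Nm: "?N \<in> borel_measurable (lebesgue_on G')"
      using NV'_meas[OF k(2)] NW'_meas[OF k(2)] by simp
    have "X G' (\<lambda>x. ennreal (u x)) \<le> X G' (\<lambda>x. \<Sum>bs\<in>(basis_lists k :: 'a list set). ?N x)"
    proof (rule norm_mono[OF norm_G'])
      show "AE x in lebesgue_on G'. ennreal (u x) \<le> (\<Sum>bs\<in>(basis_lists k :: 'a list set). ?N x)"
      proof (rule AE_I2)
        fix x
        assume "x \<in> space (lebesgue_on G')"
        have "ennreal (u x) = (\<Sum>bs\<in>basis_lists k. ennreal (\<bar>indicator G' x * V' k x bs\<bar> + \<bar>indicator G' x * W' k x bs\<bar>))"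
          unfolding u_def by (intro sum_ennreal[symmetric]) auto
        also have "\<dots> \<le> (\<Sum>bs\<in>(basis_lists k :: 'a list set). ?N x)"
        proof (rule sum_mono)
          fix bs :: "'a list"
          assume bs: "bs \<in> basis_lists k"
          have "ennreal (\<bar>indicator G' x * V' k x bs\<bar> + \<bar>indicator G' x * W' k x bs\<bar>) \<le> ennreal (\<bar>V' k x bs\<bar> + \<bar>W' k x bs\<bar>)"
            by (intro ennreal_leI add_mono) (auto simp: indicator_def)
          also have "\<dots> = ennreal \<bar>V' k x bs\<bar> + ennreal \<bar>W' k x bs\<bar>"
            by (rule ennreal_plus) auto
          also have "\<dots> \<le> ?N x"
            by (intro add_mono basis_lists_le_multilinear_norm bs)
          finally show "ennreal (\<bar>indicator G' x * V' k x bs\<bar> + \<bar>indicator G' x * W' k x bs\<bar>) \<le> ?N x" .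
        qed
        finally show "ennreal (u x) \<le> (\<Sum>bs\<in>(basis_lists k :: 'a list set). ?N x)" .
      qed
      show "(\<lambda>x. ennreal (u x)) \<in> borel_measurable (lebesgue_on G')"
        using u_meas by (intro measurable_lebesgue_on) auto
      show "(\<lambda>x. \<Sum>bs\<in>(basis_lists k :: 'a list set). ?N x) \<in> borel_measurable (lebesgue_on G')"
        using Nm by (intro borel_measurable_sum)
    qed
    also have "\<dots> \<le> (\<Sum>bs\<in>(basis_lists k :: 'a list set). X G' ?N)"
      by (rule norm_sum[OF norm_G' finite_basis_lists Nm])
    also have "\<dots> < \<infinity>"
    proof -
      have "X G' ?N \<le> X G' (\<lambda>x. multilinear_norm k (V' k x)) + X G' (\<lambda>x. multilinear_norm k (W' k x))"
        by (rule norm_add[OF norm_G' NV'_meas[OF k(2)] NW'_meas[OF k(2)]])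
      also have "\<dots> < \<infinity>"
        using V'_fin[OF k(2)] W'_fin[OF k(2)] by simp
      finally show ?thesis
        by (simp add: ennreal_mult_less_top of_nat_less_top)
    qed
    finally show ?thesis .
  qed
  define \<omega> where "\<omega> = unit_ball_vol (real DIM('a))"
  have "\<omega> > 0"
    by (simp add: \<omega>_def)
  have G'_ne: "G' \<noteq> {}"
    using f.G_subset G_ne by auto
  \<comment> \<open>The constants \<open>2 \<omega> 5^n\<close> and \<open>1 / (2 \<omega>)\<close>
    are those of \<open>max_level_weak_type\<close>.\<close>
  obtain C where C: "C \<ge> 0" "\<And>A L. A \<in> lmeasurable \<Longrightarrow> A \<subseteq> G \<Longrightarrow> L > 0 \<Longrightarrow>
    ennreal (L * measure lebesgue A) \<le> ennreal (2 * \<omega> * 5 ^ DIM('a)) * (\<integral>\<^sup>+x\<in>{x\<in>G'. 1 / (2 * \<omega>) * L < u x}. ennreal (u x) \<partial>lebesgue) \<Longrightarrow>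
    X G (indicator A) \<le> ennreal (C / L)"
    using ri_family_weak_type[OF fam f.open_G G_ne f.G_fin f.open_G' G'_ne f.G'_fin u_meas u0 u_fin, of "2 * \<omega> * 5 ^ DIM('a)" "1 / (2 * \<omega>)"]
      \<open>\<omega> > 0\<close> by auto
  \<comment> \<open>The heights are \<open>2^(i(k-1))\<close>, as
    \<open>l + 1 = k - 1\<close>.\<close>
  define E where "E i = max_level u R (2 ^ (i * (l + 1))) \<inter> G" for i
  have level_sets: "max_level u R L' \<in> sets lebesgue" for L'
    by (intro sets_completionI_sets) (simp add: open_max_level)
  have E_sets: "E i \<in> sets lebesgue" for i
    unfolding E_def by (intro sets.Int level_sets f.sets_G)
  have E_lm: "E i \<in> lmeasurable" for i
    using E_sets f.G_fin by (rule fmeasurableI2[rotated 2]) (auto simp: E_def)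
  have E_norm: "X G (indicator (E i)) \<le> ennreal (C / 2 ^ (i * (l + 1)))" for i
  proof (rule C(2)[OF E_lm])
    let ?L = "2 ^ (i * (l + 1)) :: real"
    have "ennreal (?L * measure lebesgue (E i)) = ennreal ?L * emeasure lebesgue (E i)"
      using E_lm by (simp add: ennreal_mult emeasure_eq_measure2 del: emeasure_completion)
    also have "\<dots> \<le> ennreal ?L * emeasure lebesgue (max_level u R ?L)"
      by (intro mult_left_mono emeasure_mono level_sets) (auto simp: E_def)
    also have "\<dots> \<le> ennreal (2 * \<omega> * 5 ^ DIM('a)) * (\<integral>\<^sup>+x\<in>{x. ?L / (2 * \<omega>) < u x}. ennreal (u x) \<partial>lebesgue)"
      unfolding \<omega>_def by (rule max_level_weak_type[OF u_meas u0]) simp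
    also have "{x. ?L / (2 * \<omega>) < u x} = {x\<in>G'. 1 / (2 * \<omega>) * ?L < u x}"
    proof -
      have "0 < ?L / (2 * \<omega>)"
        using \<open>\<omega> > 0\<close> by simp
      then have "y \<in> G'" if "?L / (2 * \<omega>) < u y" for y
        using u_out[of y] that by force
      then show ?thesis
        by auto
    qed
    finally show "ennreal (?L * measure lebesgue (E i)) \<le>
      ennreal (2 * \<omega> * 5 ^ DIM('a)) * (\<integral>\<^sup>+x\<in>{x\<in>G'. 1 / (2 * \<omega>) * ?L < u x}. ennreal (u x) \<partial>lebesgue)" .
  qed (auto simp: E_def)
  \<comment> \<open>At a point of \<open>E i\<close> outside \<open>E (i + 1)\<close> the product
    has size at most a multiple of \<open>2^((i+1)l)\<close>, hence the shift in the weight; the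
    summand \<open>1\<close> serves points outside \<open>E 0\<close>.\<close>
  define H where "H x = 1 + (\<Sum>i. ennreal (2 ^ ((i + 1) * l)) * indicator (E i) x)" for x
  have H_meas: "H \<in> borel_measurable lebesgue"
    unfolding H_def[abs_def] using E_sets by measurable
  have H_fin: "X G H < \<infinity>"
    unfolding H_def[abs_def]
  proof (rule norm_level_sum_finite[OF norm_G _ _ C(1) E_norm])
    show "emeasure (lebesgue_on G) (space (lebesgue_on G)) < \<infinity>"
      using f.G_fin f.sets_G by (simp add: space_restrict_space emeasure_lebesgue_on emeasure_eq_measure2 del: emeasure_completion)
    show "E i \<in> sets (lebesgue_on G)" for i
      using E_sets f.sets_G by (auto simp: sets_lebesgue_on_iff E_def)
  qed
  have H_AE: "AE x in lebesgue. x \<in> G \<longrightarrow> H x \<noteq> \<infinity>"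
  proof -
    have "(\<integral>\<^sup>+x\<in>G. H x \<partial>lebesgue) \<noteq> \<infinity>"
      using integral_finite[OF measurable_lebesgue_on[OF H_meas] H_fin] by simp
    then have "AE x in lebesgue. H x * indicator G x \<noteq> \<infinity>"
      using H_meas f.sets_G by (intro nn_integral_noteq_infinite) auto
    then show ?thesis
      by eventually_elim auto
  qed
  \<comment> \<open>All weights are at least \<open>1\<close>, so \<open>H\<close> is infinite on
    the intersection of the level sets; since the norm of \<open>H\<close>, and with it the
    integral, is finite, such points form a null set.\<close>
  have exits: "\<exists>i. x \<notin> E i" if Hx: "H x \<noteq> \<infinity>" for x
  proof (rule ccontr)
    assume "\<not> ?thesis"
    then have in_E: "x \<in> E i" for i
      by auto
    obtain N :: nat where N: "H x < of_nat N"
      using Hx ennreal_Ex_less_of_nat[of "H x"] by (auto simp: less_top)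
    have "of_nat N = (\<Sum>i<N. (1::ennreal))"
      by simp
    also have "\<dots> \<le> (\<Sum>i<N. ennreal (2 ^ ((i + 1) * l)) * indicator (E i) x)"
      using in_E by (intro sum_mono) (simp add: ennreal_ge_1)
    also have "\<dots> \<le> (\<Sum>i. ennreal (2 ^ ((i + 1) * l)) * indicator (E i) x)"
      by (intro sum_le_suminf) auto
    also have "\<dots> \<le> H x"
      by (simp add: H_def)
    finally show False
      using N by simp
  qed
  show thesis
  proof (rule that[OF H_meas H_fin])
    fix a b :: "'a list"
    assume ab: "length a + length b = k" "a \<noteq> []" "b \<noteq> []"
    then have la: "1 \<le> length a" "length a \<le> k" and lb: "1 \<le> length b" "length b \<le> k"
      by (auto simp: Suc_le_eq)
    obtain C1 where C1: "C1 \<ge> 0" "\<And>x t i. x \<in> G \<Longrightarrow> 0 < t \<Longrightarrow> t \<le> R \<Longrightarrow>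
      (\<forall>s. 0 < s \<longrightarrow> s \<le> R \<longrightarrow> (\<integral>\<^sup>+y\<in>ball x s. ennreal (u y) \<partial>lebesgue) \<le> ennreal (2 ^ (i * (k - 1)) * s ^ DIM('a))) \<Longrightarrow>
      \<bar>f.U t a x\<bar> \<le> C1 * 2 ^ (i * (length a - 1))"
      using f.U_level_bound[OF k(2) la u_meas u_V] by blast
    obtain C2 where C2: "C2 \<ge> 0" "\<And>x t i. x \<in> G \<Longrightarrow> 0 < t \<Longrightarrow> t \<le> R \<Longrightarrow>
      (\<forall>s. 0 < s \<longrightarrow> s \<le> R \<longrightarrow> (\<integral>\<^sup>+y\<in>ball x s. ennreal (u y) \<partial>lebesgue) \<le> ennreal (2 ^ (i * (k - 1)) * s ^ DIM('a))) \<Longrightarrow>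
      \<bar>g.U t b x\<bar> \<le> C2 * 2 ^ (i * (length b - 1))"
      using g.U_level_bound[OF k(2) lb u_meas u_W] by blast
    have "AE x in lebesgue. x \<in> G \<longrightarrow> (\<forall>t. 0 < t \<longrightarrow> t \<le> R \<longrightarrow> ennreal \<bar>f.U t a x * g.U t b x\<bar> \<le> ennreal (C1 * C2) * H x)"
      using H_AE
    proof (eventually_elim, intro impI allI)
      fix x t
      assume "x \<in> G \<longrightarrow> H x \<noteq> \<infinity>" and x: "x \<in> G" and t: "0 < t" "t \<le> R"
      then have ex: "\<exists>i. x \<notin> E i"
        using exits by blast
      define i where "i = (LEAST i. x \<notin> E i)"
      have "x \<notin> E i"
        unfolding i_def using ex by (rule LeastI_ex)
      then have notin: "x \<notin> max_level u R (2 ^ (i * (l + 1)))"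
        using x by (simp add: E_def)
      have le: "\<forall>s. 0 < s \<longrightarrow> s \<le> R \<longrightarrow> (\<integral>\<^sup>+y\<in>ball x s. ennreal (u y) \<partial>lebesgue) \<le> ennreal (2 ^ (i * (k - 1)) * s ^ DIM('a))"
        using not_in_max_level[OF notin] k(1) by simp
      have "\<bar>f.U t a x * g.U t b x\<bar> \<le> (C1 * 2 ^ (i * (length a - 1))) * (C2 * 2 ^ (i * (length b - 1)))"
        unfolding abs_mult using C1(2)[OF x t le] C2(2)[OF x t le] C1(1) by (intro mult_mono) auto
      also have "\<dots> = C1 * C2 * 2 ^ (i * l)"
      proof -
        have "l = (length a - 1) + (length b - 1)"
          using ab k(1) la lb by simp
        then show ?thesis
          by (simp add: distrib_left power_add)
      qed
      finally have "ennreal \<bar>f.U t a x * g.U t b x\<bar> \<le> ennreal (C1 * C2) * ennreal (2 ^ (i * l))"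
        using C1(1) C2(1) by (simp add: ennreal_mult'[symmetric] ennreal_leI)
      also have "\<dots> \<le> ennreal (C1 * C2) * H x"
      proof (rule mult_left_mono)
        show "ennreal (2 ^ (i * l)) \<le> H x"
        proof (cases i)
          case 0
          then show ?thesis
            by (simp add: H_def)
        next
          \<comment> \<open>The predecessor of the first index left still contains \<open>x\<close>,
            and its weight is exactly \<open>2^(i l)\<close>.\<close>
          case (Suc i')
          then have "x \<in> E i'"
            using not_less_Least[of i' "\<lambda>i. x \<notin> E i"] by (simp add: i_def)
          then have "ennreal (2 ^ (i * l)) = (\<Sum>j\<in>{i'}. ennreal (2 ^ ((j + 1) * l)) * indicator (E j) x)"
            by (simp add: Suc)
          also have "\<dots> \<le> (\<Sum>j. ennreal (2 ^ ((j + 1) * l)) * indicator (E j) x)"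
            by (intro sum_le_suminf) auto
          also have "\<dots> \<le> H x"
            by (simp add: H_def)
          finally show ?thesis .
        qed
      qed simp
      finally show "ennreal \<bar>f.U t a x * g.U t b x\<bar> \<le> ennreal (C1 * C2) * H x" .
    qed
    then show "\<exists>C\<ge>0. AE x in lebesgue. x \<in> G \<longrightarrow> (\<forall>t. 0 < t \<longrightarrow> t \<le> R \<longrightarrow> ennreal \<bar>f.U t a x * g.U t b x\<bar> \<le> ennreal C * H x)"
      using C1(1) C2(1) by (intro exI[of _ "C1 * C2"]) auto
  qed
qed

end

context sobolev_approximation
begin

text \<open>\<open>V 0\<close> is an arbitrary weak derivative of order \<open>0\<close>. Its
  boundedness is inherited from the mollifications \<open>U t []\<close>, which are uniformly
  bounded and converge to it almost everywhere on each compact set along a subsequence.\<close>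

lemma V_zeroth_bounded: "\<exists>C. AE x in lebesgue. x \<in> G \<longrightarrow> \<bar>V 0 x []\<bar> \<le> C"
proof -
  obtain C where C: "\<And>t x. t > 0 \<Longrightarrow> \<bar>U t [] x\<bar> \<le> C"
    using U_Nil_bounded by blast
  have "AE x in lebesgue. x \<in> G \<longrightarrow> \<bar>V 0 x []\<bar> \<le> C"
  proof (rule AE_on_open[OF open_G])
    fix K
    assume K: "compact K" "K \<subseteq> G"
    obtain t where t: "\<And>n. t n > 0" "\<And>n. t n \<le> R" "t \<longlonglongrightarrow> 0" "\<And>n x. x \<in> K \<Longrightarrow> cball x (t n) \<subseteq> G"
      using scale_sequence[OF K] by blast
    have "conv_mean K (\<lambda>n. U (t n) []) (\<lambda>y. indicator G y * V 0 y [])"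
      using conv_mean_U[OF K(1) _ t(1,3,4), of "[]"] by simp
    from conv_mean_imp_conv_AE[OF this fmeasurableD[OF lmeasurable_compact[OF K(1)]]]
    obtain r :: "nat \<Rightarrow> nat" where "conv_AE K (\<lambda>n. U (t (r n)) []) (\<lambda>y. indicator G y * V 0 y [])"
      by blast
    then show "AE x in lebesgue. x \<in> K \<longrightarrow> \<bar>V 0 x []\<bar> \<le> C"
      unfolding conv_AE_def
    proof (eventually_elim, intro impI)
      fix x
      assume lim: "x \<in> K \<longrightarrow> (\<lambda>n. U (t (r n)) [] x) \<longlonglongrightarrow> indicator G x * V 0 x []" and "x \<in> K"
      then have "(\<lambda>n. \<bar>U (t (r n)) [] x\<bar>) \<longlonglongrightarrow> \<bar>V 0 x []\<bar>"
        using K(2) tendsto_rabs[of "\<lambda>n. U (t (r n)) [] x" "V 0 x []" sequentially] by auto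
      then show "\<bar>V 0 x []\<bar> \<le> C"
        by (rule LIMSEQ_le_const2) (use C t(1) in auto)
    qed
  qed
  then show ?thesis
    by blast
qed

end

section \<open>The Leibniz sum of the weak derivatives and its norm\<close>

context sobolev_product
begin

text \<open>The candidate for the weak derivatives of the product, with the directions in the order
  in which integration by parts delivers them.\<close>

definition Z :: "nat \<Rightarrow> 'a \<Rightarrow> 'a list \<Rightarrow> real" where
  "Z i x hs = leibniz (\<lambda>a. V (length a) x a) (\<lambda>b. W (length b) x b) (rev hs)"

lemma Z_multilinear:
  assumes "x \<in> G" "i \<le> m"
  shows "multilinear_form i (Z i x)"
proof -
  have fam: "multilinear_family m (\<lambda>a. T (length a) x a)" if "\<And>i. i \<le> m \<Longrightarrow> multilinear_form i (T i x)"
    for T :: "nat \<Rightarrow> 'a \<Rightarrow> 'a list \<Rightarrow> real"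
    using that unfolding multilinear_family_def multilinear_form_def by simp
  have "multilinear_form i (V i x)" "multilinear_form i (W i x)" if "i \<le> m" for i
    using f.wd[OF that] g.wd[OF that] assms(1) by (auto simp: has_weak_derivative_def)
  then have "multilinear_form i (\<lambda>hs. leibniz (\<lambda>a. V (length a) x a) (\<lambda>b. W (length b) x b) (rev hs))"
    by (intro multilinear_form_leibniz_rev[OF fam fam assms(2)])
  then show ?thesis
    by (simp add: Z_def[abs_def])
qed

lemma Z_measurable:
  assumes "length hs \<le> m"
  shows "(\<lambda>x. indicator G x * Z i x hs) \<in> borel_measurable lebesgue"
proof -
  have "(\<lambda>x. leibniz (\<lambda>a. indicator G x * V (length a) x a) (\<lambda>b. indicator G x * W (length b) x b) (rev hs)) \<in> borel_measurable lebesgue"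
  proof (rule leibniz_measurable)
    fix a b :: "'a list"
    assume "splitting (rev hs) a b"
    then have "length a \<le> m" "length b \<le> m"
      using assms by (auto simp: splitting_def)
    then show "(\<lambda>x. indicator G x * V (length a) x a * (indicator G x * W (length b) x b)) \<in> borel_measurable lebesgue"
      using f.V_int g.V_int by (intro borel_measurable_times borel_measurable_integrable)
  qed
  moreover have "leibniz (\<lambda>a. indicator G x * V (length a) x a) (\<lambda>b. indicator G x * W (length b) x b) (rev hs) =
     indicator G x * Z i x hs" for x
    unfolding leibniz_cmult_left leibniz_cmult_right Z_def by (simp add: indicator_def)
  ultimately show ?thesis
    by simp
qed

text \<open>A majorant for the mollified products also dominates the product of the weak
  derivatives: the factors converge almost everywhere on compact sets along a common subsequence,
  and the bound is uniform in the scale.\<close>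

lemma higher_product_bound_aux:
  assumes "i \<le> m" "length a \<le> i" "length b \<le> i"
    and H0: "H0 \<in> borel_measurable lebesgue" "X G H0 < \<infinity>" and C: "C \<ge> 0"
    and bound: "AE x in lebesgue. x \<in> G \<longrightarrow> (\<forall>t. 0 < t \<longrightarrow> t \<le> R \<longrightarrow> ennreal \<bar>f.U t a x * g.U t b x\<bar> \<le> ennreal C * H0 x)"
  obtains H where "H \<in> borel_measurable lebesgue" "X G H < \<infinity>"
    "AE x in lebesgue. x \<in> G \<longrightarrow> (\<forall>t. 0 < t \<longrightarrow> t \<le> R \<longrightarrow> ennreal \<bar>f.U t a x * g.U t b x\<bar> \<le> H x)"
    "AE x in lebesgue. x \<in> G \<longrightarrow> ennreal \<bar>V (length a) x a * W (length b) x b\<bar> \<le> H x"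
proof -
  have la: "length a \<le> m" "length b \<le> m"
    using assms by auto
  show thesis
  proof (rule that[of "\<lambda>x. ennreal C * H0 x"])
    show "(\<lambda>x. ennreal C * H0 x) \<in> borel_measurable lebesgue"
      using H0(1) by simp
    show "X G (\<lambda>x. ennreal C * H0 x) < \<infinity>"
      using norm_cmult[OF norm_G measurable_lebesgue_on[OF H0(1)] C] H0(2) by (simp add: ennreal_mult_less_top)
    show "AE x in lebesgue. x \<in> G \<longrightarrow> (\<forall>t. 0 < t \<longrightarrow> t \<le> R \<longrightarrow> ennreal \<bar>f.U t a x * g.U t b x\<bar> \<le> ennreal C * H0 x)"
      by (rule bound)
    show "AE x in lebesgue. x \<in> G \<longrightarrow> ennreal \<bar>V (length a) x a * W (length b) x b\<bar> \<le> ennreal C * H0 x"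
    proof (rule AE_on_open[OF f.open_G])
      fix K
      assume K: "compact K" "K \<subseteq> G"
      obtain t where t: "\<And>n. t n > 0" "\<And>n. t n \<le> R" "t \<longlonglongrightarrow> 0" "\<And>n x. x \<in> K \<Longrightarrow> cball x (t n) \<subseteq> G"
        using f.scale_sequence[OF K] by blast
      have Ks: "K \<in> sets lebesgue"
        using K(1) by (simp add: fmeasurableD lmeasurable_compact)
      define \<S> where "\<S> = {((\<lambda>n. f.U (t n) a), (\<lambda>y. indicator G y * V (length a) y a)),
        ((\<lambda>n. g.U (t n) b), (\<lambda>y. indicator G y * W (length b) y b))}"
      have "\<exists>r::nat \<Rightarrow> nat. strict_mono r \<and> (\<forall>(S, s)\<in>\<S>. conv_AE K (\<lambda>n. S (r n)) s)"
        by (rule common_AE_subseq[OF _ Ks])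
          (use f.conv_mean_U[OF K(1) la(1) t(1,3,4)] g.conv_mean_U[OF K(1) la(2) t(1,3,4)] in \<open>auto simp: \<S>_def\<close>)
      then obtain r :: "nat \<Rightarrow> nat" where
        "conv_AE K (\<lambda>n. f.U (t (r n)) a) (\<lambda>y. indicator G y * V (length a) y a)"
        "conv_AE K (\<lambda>n. g.U (t (r n)) b) (\<lambda>y. indicator G y * W (length b) y b)"
        by (auto simp: \<S>_def)
      then show "AE x in lebesgue. x \<in> K \<longrightarrow> ennreal \<bar>V (length a) x a * W (length b) x b\<bar> \<le> ennreal C * H0 x"
        using bound unfolding conv_AE_def
      proof (eventually_elim, intro impI)
        fix x
        assume lim: "x \<in> K \<longrightarrow> (\<lambda>n. f.U (t (r n)) a x) \<longlonglongrightarrow> indicator G x * V (length a) x a"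
            "x \<in> K \<longrightarrow> (\<lambda>n. g.U (t (r n)) b x) \<longlonglongrightarrow> indicator G x * W (length b) x b"
          and le: "x \<in> G \<longrightarrow> (\<forall>t. 0 < t \<longrightarrow> t \<le> R \<longrightarrow> ennreal \<bar>f.U t a x * g.U t b x\<bar> \<le> ennreal C * H0 x)"
          and x: "x \<in> K"
        have "x \<in> G"
          using x K(2) by auto
        then have "(\<lambda>n. \<bar>f.U (t (r n)) a x * g.U (t (r n)) b x\<bar>) \<longlonglongrightarrow> \<bar>V (length a) x a * W (length b) x b\<bar>"
          using lim x by (auto intro!: tendsto_rabs tendsto_mult)
        then have "(\<lambda>n. ennreal \<bar>f.U (t (r n)) a x * g.U (t (r n)) b x\<bar>) \<longlonglongrightarrow> ennreal \<bar>V (length a) x a * W (length b) x b\<bar>"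
          by (rule tendsto_ennrealI)
        then show "ennreal \<bar>V (length a) x a * W (length b) x b\<bar> \<le> ennreal C * H0 x"
          by (rule LIMSEQ_le_const2) (use le \<open>x \<in> G\<close> t(1,2) in auto)
      qed
    qed
  qed
qed

lemma higher_product_bound:
  assumes "length a + length b = i" "i \<le> m" "a \<noteq> []" "b \<noteq> []"
  obtains H where "H \<in> borel_measurable lebesgue" "X G H < \<infinity>"
    "AE x in lebesgue. x \<in> G \<longrightarrow> (\<forall>t. 0 < t \<longrightarrow> t \<le> R \<longrightarrow> ennreal \<bar>f.U t a x * g.U t b x\<bar> \<le> H x)"
    "AE x in lebesgue. x \<in> G \<longrightarrow> ennreal \<bar>V (length a) x a * W (length b) x b\<bar> \<le> H x"
proof -
  have "length a \<ge> 1" "length b \<ge> 1"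
    using assms(3,4) by (auto simp: Suc_le_eq)
  then have i: "i = (i - 2) + 2"
    using assms(1) by simp
  show thesis
  proof (rule product_level_bound[OF i assms(2)])
    fix H0 :: "'a \<Rightarrow> ennreal"
    assume H0: "H0 \<in> borel_measurable lebesgue" "X G H0 < \<infinity>"
      and "\<And>a b. length a + length b = i \<Longrightarrow> a \<noteq> [] \<Longrightarrow> b \<noteq> [] \<Longrightarrow>
        \<exists>C\<ge>0. AE x in lebesgue. x \<in> G \<longrightarrow> (\<forall>t. 0 < t \<longrightarrow> t \<le> R \<longrightarrow> ennreal \<bar>f.U t a x * g.U t b x\<bar> \<le> ennreal C * H0 x)"
    from this(3)[OF assms(1,3,4)] obtain C where C: "C \<ge> 0"
      and bound: "AE x in lebesgue. x \<in> G \<longrightarrow> (\<forall>t. 0 < t \<longrightarrow> t \<le> R \<longrightarrow> ennreal \<bar>f.U t a x * g.U t b x\<bar> \<le> ennreal C * H0 x)"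
      by blast
    show thesis
      by (rule higher_product_bound_aux[OF assms(2) _ _ H0 C bound that]) (use assms in auto)
  qed
qed

text \<open>For a mixed pair the majorant is that of the mollified products. If one list is empty,
  the factor of order \<open>0\<close> is bounded almost everywhere and the other has order
  \<open>i\<close>, so a multiple of the pointwise norm of that derivative serves.\<close>

lemma pair_bound:
  assumes bs: "bs \<in> basis_lists i" and "i \<le> m" and "splitting bs a b"
  shows "\<exists>H\<in>borel_measurable (lebesgue_on G). X G H < \<infinity> \<and>
    (AE x in lebesgue. x \<in> G \<longrightarrow> ennreal \<bar>V (length a) x a * W (length b) x b\<bar> \<le> H x)"
proof -
  have len: "length a + length b = i" and sets: "set a \<subseteq> Basis" "set b \<subseteq> Basis"
    using assms by (auto simp: splitting_def basis_lists_def)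
  \<comment> \<open>Stated for \<open>T\<close> and \<open>T'\<close> so that it applies with the
    roles of \<open>f\<close> and \<open>g\<close> exchanged.\<close>
  have zero: "\<exists>H\<in>borel_measurable (lebesgue_on G). X G H < \<infinity> \<and>
    (AE x in lebesgue. x \<in> G \<longrightarrow> ennreal \<bar>T 0 x [] * T' i x c\<bar> \<le> H x)"
    if T: "\<exists>C. AE x in lebesgue. x \<in> G \<longrightarrow> \<bar>T 0 x []\<bar> \<le> C" and c: "c \<in> basis_lists i"
      and NT: "(\<lambda>x. multilinear_norm i (T' i x)) \<in> borel_measurable (lebesgue_on G)" "X G (\<lambda>x. multilinear_norm i (T' i x)) < \<infinity>"
    for T T' :: "nat \<Rightarrow> 'a \<Rightarrow> 'a list \<Rightarrow> real" and c
  proof -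
    obtain C where C: "AE x in lebesgue. x \<in> G \<longrightarrow> \<bar>T 0 x []\<bar> \<le> C"
      using T by blast
    show ?thesis
    proof (intro bexI[of _ "\<lambda>x. ennreal (max C 0) * multilinear_norm i (T' i x)"] conjI)
      show "X G (\<lambda>x. ennreal (max C 0) * multilinear_norm i (T' i x)) < \<infinity>"
        using norm_cmult[OF norm_G NT(1), of "max C 0"] NT(2) by (simp add: ennreal_mult_less_top)
      show "(\<lambda>x. ennreal (max C 0) * multilinear_norm i (T' i x)) \<in> borel_measurable (lebesgue_on G)"
        using NT(1) by simp
      show "AE x in lebesgue. x \<in> G \<longrightarrow> ennreal \<bar>T 0 x [] * T' i x c\<bar> \<le> ennreal (max C 0) * multilinear_norm i (T' i x)"
        using C
      proof (eventually_elim, intro impI)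
        fix x
        assume "x \<in> G \<longrightarrow> \<bar>T 0 x []\<bar> \<le> C" "x \<in> G"
        then have "\<bar>T 0 x []\<bar> \<le> max C 0"
          by simp
        then have "ennreal \<bar>T 0 x []\<bar> * ennreal \<bar>T' i x c\<bar> \<le> ennreal (max C 0) * multilinear_norm i (T' i x)"
          by (intro mult_mono ennreal_leI basis_lists_le_multilinear_norm c) auto
        then show "ennreal \<bar>T 0 x [] * T' i x c\<bar> \<le> ennreal (max C 0) * multilinear_norm i (T' i x)"
          by (simp add: abs_mult ennreal_mult)
      qed
    qed
  qed
  consider "a = []" | "b = []" | "a \<noteq> []" "b \<noteq> []"
    by blast
  then show ?thesis
  proof cases
    case 1
    then have "b \<in> basis_lists i"
      using len sets by (simp add: basis_lists_def)
    from zero[where T = V and T' = W, OF f.V_zeroth_bounded this NW_meas[OF assms(2)] W_fin[OF assms(2)]] show ?thesis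
      using 1 len by simp
  next
    case 2
    then have "a \<in> basis_lists i"
      using len sets by (simp add: basis_lists_def)
    from zero[where T = W and T' = V, OF g.V_zeroth_bounded this NV_meas[OF assms(2)] V_fin[OF assms(2)]] show ?thesis
      using 2 len by (simp add: mult.commute)
  next
    case 3
    show ?thesis
    proof (rule higher_product_bound[OF len assms(2) 3])
      fix H :: "'a \<Rightarrow> ennreal"
      assume "H \<in> borel_measurable lebesgue" "X G H < \<infinity>"
        "AE x in lebesgue. x \<in> G \<longrightarrow> ennreal \<bar>V (length a) x a * W (length b) x b\<bar> \<le> H x"
      then show ?thesis
        by (intro bexI[of _ H] conjI measurable_lebesgue_on)
    qed
  qed
qed

lemma finite_splittings: "finite {(a, b). splitting hs a b}"
proof (rule finite_subset)
  show "{(a, b). splitting hs a b} \<subseteq> {a. set a \<subseteq> set hs \<and> length a \<le> length hs} \<times> {a. set a \<subseteq> set hs \<and> length a \<le> length hs}"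
    by (auto simp: splitting_def)
qed (intro finite_cartesian_product finite_lists_length_le; simp)

text \<open>The values on finitely many basis lists control the form, and each value of
  \<open>Z\<close> is at most \<open>2^i\<close> times the sum of the majorants of its finitely many
  splittings.\<close>

lemma Z_norm_finite:
  assumes "i \<le> m"
  shows "X G (\<lambda>x. multilinear_norm i (Z i x)) < \<infinity>"
proof -
  have one: "\<exists>H. H \<in> borel_measurable (lebesgue_on G) \<and> X G H < \<infinity> \<and> (AE x in lebesgue. x \<in> G \<longrightarrow> ennreal \<bar>Z i x bs\<bar> \<le> H x)"
    if bs: "bs \<in> basis_lists i" for bs
  proof -
    define S where "S = {(a, b). splitting bs a b}"
    have "\<forall>p\<in>S. \<exists>H. H \<in> borel_measurable (lebesgue_on G) \<and> X G H < \<infinity> \<and>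
      (AE x in lebesgue. x \<in> G \<longrightarrow> ennreal \<bar>V (length (fst p)) x (fst p) * W (length (snd p)) x (snd p)\<bar> \<le> H x)"
    proof
      fix p
      assume "p \<in> S"
      then have "splitting bs (fst p) (snd p)"
        by (auto simp: S_def)
      from pair_bound[OF bs assms this] show "\<exists>H. H \<in> borel_measurable (lebesgue_on G) \<and> X G H < \<infinity> \<and>
          (AE x in lebesgue. x \<in> G \<longrightarrow> ennreal \<bar>V (length (fst p)) x (fst p) * W (length (snd p)) x (snd p)\<bar> \<le> H x)"
        by (simp only: Bex_def)
    qed
    from bchoice[OF this] obtain H where Hp: "\<forall>p\<in>S. H p \<in> borel_measurable (lebesgue_on G) \<and> X G (H p) < \<infinity> \<and>
      (AE x in lebesgue. x \<in> G \<longrightarrow> ennreal \<bar>V (length (fst p)) x (fst p) * W (length (snd p)) x (snd p)\<bar> \<le> H p x)" ..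
    have H: "\<And>p. p \<in> S \<Longrightarrow> H p \<in> borel_measurable (lebesgue_on G)" "\<And>p. p \<in> S \<Longrightarrow> X G (H p) < \<infinity>"
      and le: "\<And>p. p \<in> S \<Longrightarrow> AE x in lebesgue. x \<in> G \<longrightarrow> ennreal \<bar>V (length (fst p)) x (fst p) * W (length (snd p)) x (snd p)\<bar> \<le> H p x"
      using Hp by simp_all
    have fin: "finite S"
      unfolding S_def by (rule finite_splittings)
    have sum_meas: "(\<lambda>x. \<Sum>p\<in>S. H p x) \<in> borel_measurable (lebesgue_on G)"
      using H(1) by (intro borel_measurable_sum)
    show ?thesis
    proof (intro exI[of _ "\<lambda>x. ennreal (2 ^ i) * (\<Sum>p\<in>S. H p x)"] conjI)
      show "(\<lambda>x. ennreal (2 ^ i) * (\<Sum>p\<in>S. H p x)) \<in> borel_measurable (lebesgue_on G)"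
        using sum_meas by simp
      have "X G (\<lambda>x. \<Sum>p\<in>S. H p x) \<le> (\<Sum>p\<in>S. X G (H p))"
        by (rule norm_sum[OF norm_G fin H(1)])
      also have "\<dots> < \<infinity>"
        using fin H(2) by simp
      finally show "X G (\<lambda>x. ennreal (2 ^ i) * (\<Sum>p\<in>S. H p x)) < \<infinity>"
        using norm_cmult[OF norm_G sum_meas, of "2 ^ i"] by (simp add: ennreal_mult_less_top)
      have "AE x in lebesgue. \<forall>p\<in>S. x \<in> G \<longrightarrow> ennreal \<bar>V (length (fst p)) x (fst p) * W (length (snd p)) x (snd p)\<bar> \<le> H p x"
        using fin le by (intro AE_finite_allI)
      then show "AE x in lebesgue. x \<in> G \<longrightarrow> ennreal \<bar>Z i x bs\<bar> \<le> ennreal (2 ^ i) * (\<Sum>p\<in>S. H p x)"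
      proof (eventually_elim, intro impI)
        fix x
        assume all: "\<forall>p\<in>S. x \<in> G \<longrightarrow> ennreal \<bar>V (length (fst p)) x (fst p) * W (length (snd p)) x (snd p)\<bar> \<le> H p x" and x: "x \<in> G"
        define Q where "Q = (\<Sum>p\<in>S. H p x)"
        show "ennreal \<bar>Z i x bs\<bar> \<le> ennreal (2 ^ i) * (\<Sum>p\<in>S. H p x)"
        proof (cases Q)
          case (real q)
          have "\<bar>V (length a) x a * W (length b) x b\<bar> \<le> q" if "splitting (rev bs) a b" for a b
          proof -
            have p: "(a, b) \<in> S"
              using that by (simp add: S_def splitting_rev)
            have "ennreal \<bar>V (length a) x a * W (length b) x b\<bar> \<le> H (a, b) x"
              using all p x by force
            also have "\<dots> \<le> Q"
              unfolding Q_def using fin p by (intro member_le_sum) auto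
            finally show ?thesis
              using real by simp
          qed
          then have "\<bar>Z i x bs\<bar> \<le> 2 ^ length (rev bs) * q"
            unfolding Z_def by (rule leibniz_bound)
          then have "ennreal \<bar>Z i x bs\<bar> \<le> ennreal (2 ^ i) * ennreal q"
            using bs real by (simp add: basis_lists_def ennreal_mult[symmetric] ennreal_leI)
          then show ?thesis
            using real Q_def by simp
        next
          case top
          then show ?thesis
            unfolding Q_def[symmetric] by (simp add: ennreal_mult_top)
        qed
      qed
    qed
  qed
  have "\<forall>bs\<in>basis_lists i. \<exists>H. H \<in> borel_measurable (lebesgue_on G) \<and> X G H < \<infinity> \<and>
      (AE x in lebesgue. x \<in> G \<longrightarrow> ennreal \<bar>Z i x bs\<bar> \<le> H x)"
    by (intro ballI one)
  from bchoice[OF this] obtain H where Hbs: "\<forall>bs\<in>basis_lists i. H bs \<in> borel_measurable (lebesgue_on G) \<and> X G (H bs) < \<infinity> \<and>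
      (AE x in lebesgue. x \<in> G \<longrightarrow> ennreal \<bar>Z i x bs\<bar> \<le> H bs x)" ..
  have H: "\<And>bs. bs \<in> basis_lists i \<Longrightarrow> H bs \<in> borel_measurable (lebesgue_on G)"
    "\<And>bs. bs \<in> basis_lists i \<Longrightarrow> X G (H bs) < \<infinity>"
    and le: "\<And>bs. bs \<in> basis_lists i \<Longrightarrow> AE x in lebesgue. x \<in> G \<longrightarrow> ennreal \<bar>Z i x bs\<bar> \<le> H bs x"
    using Hbs by simp_all
  have "X G (\<lambda>x. multilinear_norm i (Z i x)) \<le> X G (\<lambda>x. \<Sum>bs\<in>basis_lists i. H bs x)"
  proof (rule norm_mono[OF norm_G])
    show "(\<lambda>x. \<Sum>bs\<in>basis_lists i. H bs x) \<in> borel_measurable (lebesgue_on G)"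
      using H(1) by (intro borel_measurable_sum)
    show "(\<lambda>x. multilinear_norm i (Z i x)) \<in> borel_measurable (lebesgue_on G)"
      using Z_multilinear assms Z_measurable
      by (intro borel_measurable_multilinear_norm measurable_on_indicator f.sets_G) (auto simp: space_restrict_space)
    have "AE x in lebesgue. \<forall>bs\<in>basis_lists i. x \<in> G \<longrightarrow> ennreal \<bar>Z i x bs\<bar> \<le> H bs x"
      using finite_basis_lists le by (intro AE_finite_allI)
    then have "AE x in lebesgue. x \<in> G \<longrightarrow> multilinear_norm i (Z i x) \<le> (\<Sum>bs\<in>basis_lists i. H bs x)"
    proof (eventually_elim, intro impI)
      fix x
      assume all: "\<forall>bs\<in>basis_lists i. x \<in> G \<longrightarrow> ennreal \<bar>Z i x bs\<bar> \<le> H bs x" and x: "x \<in> G"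
      have "multilinear_norm i (Z i x) \<le> ennreal (\<Sum>bs\<in>basis_lists i. \<bar>Z i x bs\<bar>)"
        by (intro multilinear_norm_le Z_multilinear x assms)
      also have "\<dots> = (\<Sum>bs\<in>basis_lists i. ennreal \<bar>Z i x bs\<bar>)"
        by (intro sum_ennreal[symmetric]) auto
      also have "\<dots> \<le> (\<Sum>bs\<in>basis_lists i. H bs x)"
        using all x by (intro sum_mono) auto
      finally show "multilinear_norm i (Z i x) \<le> (\<Sum>bs\<in>basis_lists i. H bs x)" .
    qed
    then show "AE x in lebesgue_on G. multilinear_norm i (Z i x) \<le> (\<Sum>bs\<in>basis_lists i. H bs x)"
      using f.sets_G by (simp add: AE_restrict_space_iff)
  qed
  also have "\<dots> \<le> (\<Sum>bs\<in>basis_lists i. X G (H bs))"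
    by (rule norm_sum[OF norm_G finite_basis_lists H(1)])
  also have "\<dots> < \<infinity>"
    using H(2) by (simp add: finite_basis_lists)
  finally show ?thesis .
qed

lemma Z_integrable:
  assumes "length hs = i" "i \<le> m"
  shows "integrable lebesgue (\<lambda>x. indicator G x * Z i x hs)"
  using assms Z_measurable
  by (intro multilinear_integrable[OF norm_G f.G_fin Z_multilinear _ Z_norm_finite]) auto

end

section \<open>Weak differentiability of the product\<close>

lemma absolutely_integrable_on_compact:
  fixes u :: "'a::euclidean_space \<Rightarrow> real"
  assumes "integrable lebesgue (\<lambda>x. indicator G x * u x)" "compact K" "K \<subseteq> G"
  shows "u absolutely_integrable_on K"
proof -
  have "K \<in> sets lebesgue"
    using assms(2) by (simp add: fmeasurableD lmeasurable_compact)
  from integrable_mult_indicator[OF this assms(1)]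
  have "integrable lebesgue (\<lambda>x. indicator K x *\<^sub>R (indicator G x * u x))" .
  moreover have "(\<lambda>x. indicator K x *\<^sub>R (indicator G x * u x)) = (\<lambda>x. indicator K x *\<^sub>R u x)"
    using assms(3) by (auto simp: indicator_def fun_eq_iff)
  ultimately show ?thesis
    by (simp only: set_integrable_def)
qed

context sobolev_product
begin

text \<open>For the mollified functions the identity is integration by parts with the classical
  Leibniz rule. Both sides converge along a common sequence of scales: every Leibniz term has either
  a bounded factor or an integrable majorant.\<close>

lemma product_weak_derivative:
  assumes "i \<le> m"
  shows "has_weak_derivative G i (\<lambda>x. f x * g x) (Z i)"
  unfolding has_weak_derivative_def
proof (intro conjI allI ballI impI)
  let ?F = "\<lambda>y. indicator G' y * f y" and ?E = "\<lambda>y. indicator G' y * g y"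
  show "locally_integrable_on (\<lambda>x. f x * g x) G"
    unfolding locally_integrable_on_def
  proof (intro allI impI)
    fix K
    assume K: "compact K \<and> K \<subseteq> G"
    have "integrable lebesgue (\<lambda>x. indicator G' x * (f x * g x))"
    proof (rule Bochner_Integration.integrable_bound)
      show "integrable lebesgue (\<lambda>x. B * \<bar>?E x\<bar>)"
        by (intro integrable_mult_right integrable_abs g.f_int)
      have "(\<lambda>x. ?F x * ?E x) \<in> borel_measurable lebesgue"
        by (intro borel_measurable_times borel_measurable_integrable f.f_int g.f_int)
      moreover have "(\<lambda>x. ?F x * ?E x) = (\<lambda>x. indicator G' x * (f x * g x))"
        by (auto simp: indicator_def)
      ultimately show "(\<lambda>x. indicator G' x * (f x * g x)) \<in> borel_measurable lebesgue"
        by simp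
      show "AE x in lebesgue. norm (indicator G' x * (f x * g x)) \<le> norm (B * \<bar>?E x\<bar>)"
        using f.f_bound f.B_nonneg by (intro AE_I2) (auto simp: indicator_def abs_mult intro: mult_right_mono)
    qed
    then show "(\<lambda>x. f x * g x) absolutely_integrable_on K"
      using K f.G_subset by (intro absolutely_integrable_on_compact) auto
  qed
  show "multilinear_form i (Z i x)" if "x \<in> G" for x
    by (rule Z_multilinear[OF that assms])
  fix hs :: "'a list"
  assume hs: "length hs = i"
  show "locally_integrable_on (\<lambda>x. Z i x hs) G"
    unfolding locally_integrable_on_def using absolutely_integrable_on_compact[OF Z_integrable[OF hs assms]] by blast
  fix \<phi>
  assume test: "test_function G \<phi>"
  define K where "K = closure {x. \<phi> x \<noteq> 0}"
  have K: "compact K" "K \<subseteq> G" and sm: "smooth \<phi>"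
    using test unfolding test_function_def K_def smooth_def by auto
  have Ks: "K \<in> sets lebesgue"
    using K(1) by (simp add: fmeasurableD lmeasurable_compact)
  have \<phi>0: "\<phi> x = 0" if "x \<notin> K" for x
    using that closure_subset[of "{x. \<phi> x \<noteq> 0}"] by (auto simp: K_def)
  have D0: "iterated_deriv ks \<phi> x = 0" if "x \<notin> K" for ks x
    by (rule iterated_deriv_eq_0_on_open[of "- K"]) (use that K(1) \<phi>0 in \<open>auto simp: compact_imp_closed\<close>)
  obtain r0 where r0: "K \<subseteq> cball 0 r0"
  proof -
    obtain c where "\<forall>x\<in>K. norm x \<le> c"
      using compact_imp_bounded[OF K(1)] unfolding bounded_iff by blast
    then show thesis
      by (intro that[of c]) auto
  qed
  have Dm: "iterated_deriv ks \<phi> \<in> borel_measurable lebesgue" for ks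
    by (intro borel_imp_lebesgue_measurable smooth_borel_measurable smooth_iterated_deriv sm)
  have Db: "\<exists>C. \<forall>x. \<bar>iterated_deriv ks \<phi> x\<bar> \<le> C" for ks
  proof -
    have "bounded (iterated_deriv ks \<phi> ` K)"
      by (intro compact_imp_bounded compact_continuous_image smooth_continuous_on smooth_iterated_deriv sm K)
    then obtain C where C: "C > 0" "\<And>x. x \<in> K \<Longrightarrow> \<bar>iterated_deriv ks \<phi> x\<bar> \<le> C"
      by (auto simp: bounded_pos)
    then have "\<bar>iterated_deriv ks \<phi> x\<bar> \<le> C" for x
      using D0[of x ks] by (cases "x \<in> K") auto
    then show ?thesis
      by blast
  qed
  obtain C\<phi> where C\<phi>: "\<And>x. \<bar>\<phi> x\<bar> \<le> C\<phi>"
    using Db[of "[]"] by auto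
  obtain CD where CD: "\<And>x. \<bar>iterated_deriv hs \<phi> x\<bar> \<le> CD"
    using Db[of hs] by auto
  obtain t where t: "\<And>n. t n > 0" "\<And>n. t n \<le> R" "t \<longlonglongrightarrow> 0" "\<And>n x. x \<in> K \<Longrightarrow> cball x (t n) \<subseteq> G"
    using f.scale_sequence[OF K] by blast
  let ?V = "\<lambda>a y. indicator G y * V (length a) y a" and ?W = "\<lambda>a y. indicator G y * W (length a) y a"
  \<comment> \<open>All lists that can occur in a splitting of \<open>hs\<close> or of its reversal;
    finiteness permits one common subsequence.\<close>
  define Q where "Q = {a. set a \<subseteq> set hs \<and> length a \<le> length hs}"
  have "finite Q"
    unfolding Q_def by (rule finite_lists_length_le) simp
  have Qm: "length a \<le> m" if "a \<in> Q" for a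
    using that hs assms by (simp add: Q_def)
  \<comment> \<open>\<open>U t []\<close> occurs with two limits: \<open>f\<close> itself, for the
    left side of the identity, and \<open>V 0\<close>, for the Leibniz terms with an
    undifferentiated factor. The same holds for \<open>g\<close> and \<open>W 0\<close>.\<close>
  define \<S> where "\<S> = insert ((\<lambda>n. f.U (t n) []), ?F) (insert ((\<lambda>n. g.U (t n) []), ?E)
    ((\<lambda>a. ((\<lambda>n. f.U (t n) a), ?V a)) ` Q \<union> (\<lambda>a. ((\<lambda>n. g.U (t n) a), ?W a)) ` Q))"
  have conv: "conv_mean K S s" if Ss: "(S, s) \<in> \<S>" for S s
    using Ss f.conv_mean_U_Nil[OF K(1) t(1,3)] g.conv_mean_U_Nil[OF K(1) t(1,3)]
      f.conv_mean_U[OF K(1) Qm t(1,3,4)] g.conv_mean_U[OF K(1) Qm t(1,3,4)] unfolding \<S>_def by blast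
  have "finite \<S>"
    using \<open>finite Q\<close> by (simp add: \<S>_def)
  from common_AE_subseq[OF this Ks conv] obtain r :: "nat \<Rightarrow> nat"
    where r: "strict_mono r" "\<forall>(S, s)\<in>\<S>. conv_AE K (\<lambda>n. S (r n)) s"
    by blast
  define s where "s n = t (r n)" for n
  have s: "s n > 0" "s n \<le> R" for n
    using t by (auto simp: s_def)
  have AE_F: "conv_AE K (\<lambda>n. f.U (s n) []) ?F" and AE_E: "conv_AE K (\<lambda>n. g.U (s n) []) ?E"
    and AE_V: "\<And>a. a \<in> Q \<Longrightarrow> conv_AE K (\<lambda>n. f.U (s n) a) (?V a)"
    and AE_W: "\<And>a. a \<in> Q \<Longrightarrow> conv_AE K (\<lambda>n. g.U (s n) a) (?W a)"
    using r(2) unfolding \<S>_def s_def by auto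
  have M_F: "conv_mean K (\<lambda>n. f.U (s n) []) ?F" and M_E: "conv_mean K (\<lambda>n. g.U (s n) []) ?E"
    and M_V: "\<And>a. a \<in> Q \<Longrightarrow> conv_mean K (\<lambda>n. f.U (s n) a) (?V a)"
    and M_W: "\<And>a. a \<in> Q \<Longrightarrow> conv_mean K (\<lambda>n. g.U (s n) a) (?W a)"
    unfolding s_def using conv_mean_subseq[OF conv r(1)] unfolding \<S>_def by blast+
  obtain Cf where Cf: "\<And>t x. t > 0 \<Longrightarrow> \<bar>f.U t [] x\<bar> \<le> Cf"
    using f.U_Nil_bounded by blast
  obtain Cg where Cg: "\<And>t x. t > 0 \<Longrightarrow> \<bar>g.U t [] x\<bar> \<le> Cg"
    using g.U_Nil_bounded by blast
  have lhs: "(\<lambda>n. \<integral>x. f.U (s n) [] x * g.U (s n) [] x * iterated_deriv hs \<phi> x \<partial>lebesgue) \<longlonglongrightarrow>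
      (\<integral>x. ?F x * ?E x * iterated_deriv hs \<phi> x \<partial>lebesgue)"
    by (rule product_limit_bounded(3)[OF M_F AE_F M_E Cf[OF s(1)] Dm CD D0 Ks])
  \<comment> \<open>If one list is empty, the bounded factor plays the role of \<open>P\<close> in
    \<open>product_limit_bounded\<close>, with \<open>f\<close> and \<open>g\<close> exchanged in
    the second case; otherwise the majorant takes over.\<close>
  have pair: "(\<forall>n. integrable lebesgue (\<lambda>x. f.U (s n) a x * g.U (s n) b x * \<phi> x)) \<and>
      integrable lebesgue (\<lambda>x. ?V a x * ?W b x * \<phi> x) \<and>
      (\<lambda>n. \<integral>x. f.U (s n) a x * g.U (s n) b x * \<phi> x \<partial>lebesgue) \<longlonglongrightarrow> (\<integral>x. ?V a x * ?W b x * \<phi> x \<partial>lebesgue)"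
    if ab: "splitting (rev hs) a b" for a b
  proof -
    have Qa: "a \<in> Q" "b \<in> Q" and len: "length a + length b = i"
      using ab hs by (auto simp: splitting_def Q_def)
    have \<phi>m: "\<phi> \<in> borel_measurable lebesgue"
      using Dm[of "[]"] by simp
    consider "a = []" | "b = []" | "a \<noteq> []" "b \<noteq> []"
      by blast
    then show ?thesis
    proof cases
      case 1
      have "\<bar>f.U (s n) a x\<bar> \<le> Cf" for n x
        using Cf[OF s(1)] 1 by simp
      from product_limit_bounded[OF M_V[OF Qa(1)] AE_V[OF Qa(1)] M_W[OF Qa(2)] this \<phi>m C\<phi> \<phi>0 Ks]
      show ?thesis
        by blast
    next
      case 2
      have "\<bar>g.U (s n) b x\<bar> \<le> Cg" for n x
        using Cg[OF s(1)] 2 by simp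
      from product_limit_bounded[OF M_W[OF Qa(2)] AE_W[OF Qa(2)] M_V[OF Qa(1)] this \<phi>m C\<phi> \<phi>0 Ks]
      show ?thesis
        unfolding mult.commute[of "g.U _ b _"] mult.commute[of "?W b _"] by blast
    next
      case 3
      show ?thesis
      proof (rule higher_product_bound[OF len assms 3])
        fix H :: "'a \<Rightarrow> ennreal"
        assume H: "H \<in> borel_measurable lebesgue" "X G H < \<infinity>"
          and le: "AE x in lebesgue. x \<in> G \<longrightarrow> (\<forall>t. 0 < t \<longrightarrow> t \<le> R \<longrightarrow> ennreal \<bar>f.U t a x * g.U t b x\<bar> \<le> H x)"
        \<comment> \<open>A real-valued version of the majorant, which is finite almost everywhere
          in \<open>G\<close>; it is cut off outside \<open>G\<close>, where the integral of
          \<open>H\<close> is not controlled.\<close>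
        define h where "h x = enn2real (H x * indicator G x)" for x
        have HG: "(\<lambda>x. H x * indicator G x) \<in> borel_measurable lebesgue"
          using H(1) f.sets_G by simp
        have int_fin: "(\<integral>\<^sup>+x. H x * indicator G x \<partial>lebesgue) < \<infinity>"
          using integral_finite[OF measurable_lebesgue_on[OF H(1)] H(2)] .
        have fin: "AE x in lebesgue. H x * indicator G x \<noteq> \<infinity>"
          using HG int_fin by (intro nn_integral_noteq_infinite) auto
        have h_int: "integrable lebesgue h"
        proof (rule integrableI_bounded)
          show "h \<in> borel_measurable lebesgue"
            unfolding h_def[abs_def] using HG by measurable
          have "(\<integral>\<^sup>+x. ennreal (norm (h x)) \<partial>lebesgue) \<le> (\<integral>\<^sup>+x. H x * indicator G x \<partial>lebesgue)"
            by (intro nn_integral_mono) (simp add: h_def ennreal_enn2real_if)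
          then show "(\<integral>\<^sup>+x. ennreal (norm (h x)) \<partial>lebesgue) < \<infinity>"
            using int_fin by (rule le_less_trans)
        qed
        have dom: "AE x in lebesgue. x \<in> K \<longrightarrow> (\<forall>n. \<bar>f.U (s n) a x * g.U (s n) b x\<bar> \<le> h x)"
          using le fin
        proof (eventually_elim, intro impI allI)
          fix x n
          assume "x \<in> G \<longrightarrow> (\<forall>t. 0 < t \<longrightarrow> t \<le> R \<longrightarrow> ennreal \<bar>f.U t a x * g.U t b x\<bar> \<le> H x)"
            and Hf: "H x * indicator G x \<noteq> \<infinity>" and "x \<in> K"
          then have "ennreal \<bar>f.U (s n) a x * g.U (s n) b x\<bar> \<le> H x" "x \<in> G"
            using s K(2) by auto
          then have "ennreal \<bar>f.U (s n) a x * g.U (s n) b x\<bar> \<le> ennreal (h x)"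
            using Hf by (simp add: h_def ennreal_enn2real_if)
          then show "\<bar>f.U (s n) a x * g.U (s n) b x\<bar> \<le> h x"
            by (subst (asm) ennreal_le_iff) (auto simp: h_def)
        qed
        have meas: "f.U (s n) a \<in> borel_measurable lebesgue" "?V a \<in> borel_measurable lebesgue"
          "g.U (s n) b \<in> borel_measurable lebesgue" "?W b \<in> borel_measurable lebesgue" for n
          using M_V[OF Qa(1)] M_W[OF Qa(2)] by (auto simp: conv_mean_def)
        from product_limit_dominated[OF meas \<phi>m AE_V[OF Qa(1)] AE_W[OF Qa(2)] C\<phi> \<phi>0 h_int dom]
        show ?thesis
          by blast
      qed
    qed
  qed
  have rhs: "(\<lambda>n. \<integral>x. leibniz (\<lambda>a. f.U (s n) a x) (\<lambda>b. g.U (s n) b x) (rev hs) * \<phi> x \<partial>lebesgue) \<longlonglongrightarrow>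
      (\<integral>x. leibniz (\<lambda>a. ?V a x) (\<lambda>b. ?W b x) (rev hs) * \<phi> x \<partial>lebesgue)"
    by (rule leibniz_integral_tendsto) (use pair in blast)+
  have parts: "(\<integral>x. f.U (s n) [] x * g.U (s n) [] x * iterated_deriv hs \<phi> x \<partial>lebesgue) =
      (- 1) ^ i * (\<integral>x. leibniz (\<lambda>a. f.U (s n) a x) (\<lambda>b. g.U (s n) b x) (rev hs) * \<phi> x \<partial>lebesgue)" for n
  proof -
    \<comment> \<open>The iterated derivatives of the product of the mollifications: the empty list
      gives the product itself, and prepending a direction is the product rule.\<close>
    define T where "T js x = leibniz (\<lambda>a. f.U (s n) a x) (\<lambda>b. g.U (s n) b x) js" for js x
    have T_deriv: "has_dir_deriv (T js) h (T (h # js))" for js h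
      unfolding T_def[abs_def] leibniz.simps
      by (rule leibniz_has_dir_deriv) (intro f.U_dir_deriv g.U_dir_deriv s)+
    have T_meas: "T js \<in> borel_measurable borel" for js
      unfolding T_def[abs_def] by (intro leibniz_measurable borel_measurable_times f.U_borel g.U_borel)
    have T_bnd: "\<exists>C. \<forall>x. \<bar>T js x\<bar> \<le> C" for js
    proof -
      \<comment> \<open>Generalised to arbitrary families, as the recursion of
        \<open>leibniz\<close> alters both of them.\<close>
      have gen: "\<exists>C. \<forall>x. \<bar>leibniz (\<lambda>a. P a x) (\<lambda>b. S b x) js\<bar> \<le> C"
        if "\<And>a. \<exists>C. \<forall>x. \<bar>P a x\<bar> \<le> C" "\<And>a. \<exists>C. \<forall>x. \<bar>S a x\<bar> \<le> C" for P S :: "'a list \<Rightarrow> 'a \<Rightarrow> real" and js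
        using that
      proof (induction js arbitrary: P S)
        case Nil
        obtain C1 C2 where C: "\<And>x. \<bar>P [] x\<bar> \<le> C1" "\<And>x. \<bar>S [] x\<bar> \<le> C2"
          using Nil by meson
        have "\<bar>P [] x * S [] x\<bar> \<le> C1 * C2" for x
          unfolding abs_mult using C(1)[of x] C(2)[of x] by (intro mult_mono) auto
        then show ?case
          by auto
      next
        case (Cons h js)
        obtain C1 where C1: "\<And>x. \<bar>leibniz (\<lambda>a. P (h # a) x) (\<lambda>b. S b x) js\<bar> \<le> C1"
          using Cons.IH[of "\<lambda>a. P (h # a)" S] Cons.prems by blast
        obtain C2 where C2: "\<And>x. \<bar>leibniz (\<lambda>a. P a x) (\<lambda>b. S (h # b) x) js\<bar> \<le> C2"
          using Cons.IH[of P "\<lambda>b. S (h # b)"] Cons.prems by blast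
        have "\<bar>leibniz (\<lambda>a. P a x) (\<lambda>b. S b x) (h # js)\<bar> \<le> C1 + C2" for x
          using C1[of x] C2[of x] by simp
        then show ?case
          by blast
      qed
      show ?thesis
        unfolding T_def by (rule gen[OF f.U_bounded g.U_bounded])
    qed
    have "(\<integral>x. T [] x * iterated_deriv hs \<phi> x \<partial>lborel) = (- 1) ^ length hs * (\<integral>x. T (rev hs @ []) x * \<phi> x \<partial>lborel)"
      by (rule integration_by_parts[OF T_deriv T_meas T_bnd sm, of r0]) (use \<phi>0 r0 in blast)
    moreover have "(\<integral>x. T [] x * iterated_deriv hs \<phi> x \<partial>lebesgue) = (\<integral>x. T [] x * iterated_deriv hs \<phi> x \<partial>lborel)"
      by (rule integral_completion) (use T_meas smooth_borel_measurable[OF smooth_iterated_deriv[OF sm]] in auto)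
    moreover have "(\<integral>x. T (rev hs) x * \<phi> x \<partial>lebesgue) = (\<integral>x. T (rev hs) x * \<phi> x \<partial>lborel)"
      by (rule integral_completion) (use T_meas smooth_borel_measurable[OF sm] in auto)
    ultimately show ?thesis
      using hs by (simp add: T_def)
  qed
  have "(\<integral>x. ?F x * ?E x * iterated_deriv hs \<phi> x \<partial>lebesgue) =
      (- 1) ^ i * (\<integral>x. leibniz (\<lambda>a. ?V a x) (\<lambda>b. ?W b x) (rev hs) * \<phi> x \<partial>lebesgue)"
    using lhs tendsto_mult_left[OF rhs, of "(- 1) ^ i"] unfolding parts by (rule LIMSEQ_unique)
  moreover have "(LINT x|lebesgue_on G. f x * g x * iterated_deriv hs \<phi> x) = (\<integral>x. ?F x * ?E x * iterated_deriv hs \<phi> x \<partial>lebesgue)"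
    unfolding integral_lebesgue_on[OF f.sets_G]
  proof (intro Bochner_Integration.integral_cong refl)
    fix x
    show "indicator G x * (f x * g x * iterated_deriv hs \<phi> x) = ?F x * ?E x * iterated_deriv hs \<phi> x"
    proof (cases "x \<in> K")
      case True
      then have "x \<in> G" "x \<in> G'"
        using K(2) f.G_subset by auto
      then show ?thesis
        by simp
    qed (simp add: D0)
  qed
  moreover have "(LINT x|lebesgue_on G. Z i x hs * \<phi> x) = (\<integral>x. leibniz (\<lambda>a. ?V a x) (\<lambda>b. ?W b x) (rev hs) * \<phi> x \<partial>lebesgue)"
    unfolding integral_lebesgue_on[OF f.sets_G] Z_def leibniz_cmult_left leibniz_cmult_right
    by (intro Bochner_Integration.integral_cong refl) (simp add: indicator_def)
  ultimately show "(LINT x|lebesgue_on G. f x * g x * iterated_deriv hs \<phi> x) = (- 1) ^ i * (LINT x|lebesgue_on G. Z i x hs * \<phi> x)"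
    by simp
qed

end

subsection \<open>Local Lipschitz continuity\<close>

text \<open>A Lebesgue number of a finite subcover gives one radius for all points of
  \<open>K\<close>. Only \<open>x\<close> has to lie in \<open>K\<close>; \<open>y\<close> may lie
  outside, in the neighbourhood from which a mollification at \<open>x\<close> takes its
  values.\<close>

lemma locally_lipschitz_uniform:
  fixes f :: "'a::euclidean_space \<Rightarrow> real"
  assumes "open \<Omega>" and lip: "locally_lipschitz_on \<Omega> f" and K: "compact K" "K \<subseteq> \<Omega>"
  obtains e L where "e > 0" "L \<ge> 0" "\<And>x. x \<in> K \<Longrightarrow> ball x e \<subseteq> \<Omega>"
    "\<And>x y. x \<in> K \<Longrightarrow> y \<in> ball x e \<Longrightarrow> \<bar>f y - f x\<bar> \<le> L * dist y x"
proof -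
  have "\<forall>x\<in>K. \<exists>p. fst p > 0 \<and> (snd p)-lipschitz_on (ball x (fst p) \<inter> \<Omega>) f"
  proof
    fix x
    assume "x \<in> K"
    then obtain r L where "r > 0" "L-lipschitz_on (ball x r \<inter> \<Omega>) f"
      using lip K(2) unfolding locally_lipschitz_on_def by blast
    then show "\<exists>p. fst p > 0 \<and> (snd p)-lipschitz_on (ball x (fst p) \<inter> \<Omega>) f"
      by (intro exI[of _ "(r, L)"]) simp
  qed
  from bchoice[OF this] obtain p where p: "\<forall>x\<in>K. fst (p x) > 0 \<and> (snd (p x))-lipschitz_on (ball x (fst (p x)) \<inter> \<Omega>) f" ..
  define N where "N x = ball x (fst (p x)) \<inter> \<Omega>" for x
  have N: "open (N x)" for x
    unfolding N_def by (intro open_Int open_ball assms(1))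
  have "K \<subseteq> (\<Union>x\<in>K. N x)"
  proof
    fix x
    assume "x \<in> K"
    then have "x \<in> N x"
      using p K(2) unfolding N_def by auto
    then show "x \<in> (\<Union>x\<in>K. N x)"
      using \<open>x \<in> K\<close> by blast
  qed
  then obtain D where D: "D \<subseteq> K" "finite D" "K \<subseteq> (\<Union>x\<in>D. N x)"
    using compactE_image[OF K(1), of K N] N by blast
  obtain e where e: "e > 0" "\<And>x. x \<in> K \<Longrightarrow> \<exists>G\<in>N ` D. ball x e \<subseteq> G"
    using Heine_Borel_lemma[OF K(1), of "N ` D"] D(3) N by blast
  \<comment> \<open>A sum instead of a maximum of the local constants: it dominates each of them and
    makes sense for an empty cover.\<close>
  define L where "L = (\<Sum>x\<in>D. snd (p x))"
  have nonneg: "snd (p x) \<ge> 0" if "x \<in> D" for x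
    using p that D(1) lipschitz_on_nonneg by blast
  show thesis
  proof (rule that[OF e(1)])
    show "L \<ge> 0"
      unfolding L_def using nonneg by (rule sum_nonneg)
    show "ball x e \<subseteq> \<Omega>" if "x \<in> K" for x
      using e(2)[OF that] by (auto simp: N_def)
    fix x y
    assume x: "x \<in> K" and y: "y \<in> ball x e"
    obtain z where z: "z \<in> D" "ball x e \<subseteq> N z"
      using e(2)[OF x] by auto
    have "x \<in> N z" "y \<in> N z"
      using z(2) y e(1) by auto
    then have "dist (f y) (f x) \<le> snd (p z) * dist y x"
      using p z(1) D(1) lipschitz_onD[of "snd (p z)" "N z" f y x] by (auto simp: N_def)
    also have "\<dots> \<le> L * dist y x"
      unfolding L_def using z(1) D(2) nonneg by (intro mult_right_mono member_le_sum) auto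
    finally show "\<bar>f y - f x\<bar> \<le> L * dist y x"
      by (simp add: dist_real_def)
  qed
qed

lemma locally_lipschitz_continuous:
  fixes f :: "'a::euclidean_space \<Rightarrow> real"
  assumes "open \<Omega>" "locally_lipschitz_on \<Omega> f"
  shows "continuous_on \<Omega> f"
proof (rule continuous_at_imp_continuous_on, rule ballI)
  fix x
  assume x: "x \<in> \<Omega>"
  then obtain r L where r: "r > 0" "L-lipschitz_on (ball x r \<inter> \<Omega>) f"
    using assms(2) unfolding locally_lipschitz_on_def by blast
  have "open (ball x r \<inter> \<Omega>)" "x \<in> ball x r \<inter> \<Omega>"
    using assms(1) r(1) x by auto
  then show "isCont f x"
    using lipschitz_on_continuous_on[OF r(2)] by (simp add: continuous_on_eq_continuous_at)
qed

lemma locally_lipschitz_mult: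
  fixes f g :: "'a::metric_space \<Rightarrow> real"
  assumes "locally_lipschitz_on \<Omega> f" "locally_lipschitz_on \<Omega> g"
  shows "locally_lipschitz_on \<Omega> (\<lambda>x. f x * g x)"
  unfolding locally_lipschitz_on_def
proof
  fix x
  assume x: "x \<in> \<Omega>"
  obtain r1 L1 where f: "r1 > 0" "L1-lipschitz_on (ball x r1 \<inter> \<Omega>) f"
    using assms(1) x unfolding locally_lipschitz_on_def by blast
  obtain r2 L2 where g: "r2 > 0" "L2-lipschitz_on (ball x r2 \<inter> \<Omega>) g"
    using assms(2) x unfolding locally_lipschitz_on_def by blast
  define r where "r = min r1 r2"
  have r: "r > 0"
    using f g by (simp add: r_def)
  have f': "L1-lipschitz_on (ball x r \<inter> \<Omega>) f" and g': "L2-lipschitz_on (ball x r \<inter> \<Omega>) g"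
    by (rule lipschitz_on_subset[OF f(2)], auto simp: r_def) (rule lipschitz_on_subset[OF g(2)], auto simp: r_def)
  have L: "L1 \<ge> 0" "L2 \<ge> 0"
    using f' g' lipschitz_on_nonneg by blast+
  \<comment> \<open>\<open>A\<close> and \<open>B\<close> bound the factors on the small ball, from
    the value at its centre and the Lipschitz constant.\<close>
  define A where "A = \<bar>f x\<bar> + L1 * r"
  define B where "B = \<bar>g x\<bar> + L2 * r"
  have fb: "\<bar>f y\<bar> \<le> A" and gb: "\<bar>g y\<bar> \<le> B" if y: "y \<in> ball x r \<inter> \<Omega>" for y
  proof -
    have "dist (f y) (f x) \<le> L1 * dist y x" "dist (g y) (g x) \<le> L2 * dist y x"
      using lipschitz_onD[OF f' y, of x] lipschitz_onD[OF g' y, of x] r x by auto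
    moreover have "L1 * dist y x \<le> L1 * r" "L2 * dist y x \<le> L2 * r"
      using y L by (auto intro!: mult_left_mono simp: dist_commute)
    ultimately show "\<bar>f y\<bar> \<le> A" "\<bar>g y\<bar> \<le> B"
      by (auto simp: A_def B_def dist_real_def)
  qed
  have "(A * L2 + B * L1)-lipschitz_on (ball x r \<inter> \<Omega>) (\<lambda>x. f x * g x)"
  proof (rule lipschitz_onI)
    fix y z
    assume y: "y \<in> ball x r \<inter> \<Omega>" and z: "z \<in> ball x r \<inter> \<Omega>"
    have "f y * g y - f z * g z = f y * (g y - g z) + g z * (f y - f z)"
      by (simp add: algebra_simps)
    then have "\<bar>f y * g y - f z * g z\<bar> \<le> \<bar>f y\<bar> * \<bar>g y - g z\<bar> + \<bar>g z\<bar> * \<bar>f y - f z\<bar>"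
      by (metis abs_mult abs_triangle_ineq)
    also have "\<dots> \<le> A * (L2 * dist y z) + B * (L1 * dist y z)"
      using fb[OF y] gb[OF z] lipschitz_onD[OF f' y z] lipschitz_onD[OF g' y z]
      by (intro add_mono mult_mono) (auto simp: dist_real_def A_def B_def L r less_imp_le)
    finally show "dist (f y * g y) (f z * g z) \<le> (A * L2 + B * L1) * dist y z"
      by (simp add: dist_real_def algebra_simps)
  qed (use L r in \<open>simp add: A_def B_def\<close>)
  then show "\<exists>r>0. \<exists>L. L-lipschitz_on (ball x r \<inter> \<Omega>) (\<lambda>x. f x * g x)"
    using r by blast
qed

subsection \<open>The product of Sobolev functions\<close>

lemma sobolev_integrable:
  assumes X: "ri_family X" and G: "open G" "G \<in> lmeasurable"
    and V: "\<And>i. i \<le> m \<Longrightarrow> has_weak_derivative G i u (V i)" and fin: "(\<Sum>i\<le>m. X G (\<lambda>x. multilinear_norm i (V i x))) < \<infinity>"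
  shows "i \<le> m \<Longrightarrow> X G (\<lambda>x. multilinear_norm i (V i x)) < \<infinity>"
    and "length hs \<le> m \<Longrightarrow> integrable lebesgue (\<lambda>y. indicator G y * V (length hs) y hs)"
proof -
  have \<rho>: "banach_function_norm (lebesgue_on G) (X G)"
    using X G unfolding ri_family_def
    by (auto intro!: ri_imp_bfn simp: emeasure_eq_measure2 simp del: emeasure_completion)
  show Vf: "X G (\<lambda>x. multilinear_norm i (V i x)) < \<infinity>" if "i \<le> m" for i
    using fin that by simp
  show "integrable lebesgue (\<lambda>y. indicator G y * V (length hs) y hs)" if "length hs \<le> m"
  proof (rule multilinear_integrable[OF \<rho> G(2) _ _ Vf[OF that] refl])
    show "multilinear_form (length hs) (V (length hs) x)" if "x \<in> G" for x
      using V[OF \<open>length hs \<le> m\<close>] that unfolding has_weak_derivative_def by blast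
    show "(\<lambda>x. indicator G x * V (length hs) x ks) \<in> borel_measurable lebesgue" if "length ks = length hs" for ks
      using V[OF \<open>length hs \<le> m\<close>] that unfolding has_weak_derivative_def
      by (intro measurable_of_locally_integrable G(1)) blast
  qed
qed

text \<open>Supplies the data of the locales: a radius at which both functions are Lipschitz around
  \<open>closure G\<close>, a neighbourhood \<open>G'\<close> still relatively compact in
  \<open>\<Omega>\<close>, so that the hypothesis yields weak derivatives there too, and common
  constants \<open>L\<close> and \<open>B\<close>.\<close>

lemma sobolev_mult:
  fixes f g :: "'a::euclidean_space \<Rightarrow> real"
  assumes \<Omega>: "open \<Omega>" and X: "ri_family X" and f: "locally_lipschitz_on \<Omega> f" "f \<in> sobolev_loc m X \<Omega>"
    and g: "locally_lipschitz_on \<Omega> g" "g \<in> sobolev_loc m X \<Omega>"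
    and G: "open G" "compact (closure G)" "closure G \<subseteq> \<Omega>" "G \<noteq> {}"
  shows "(\<lambda>x. f x * g x) \<in> sobolev m X G"
proof -
  obtain e1 L1 where e1: "e1 > 0" "L1 \<ge> 0" "\<And>x. x \<in> closure G \<Longrightarrow> ball x e1 \<subseteq> \<Omega>"
    "\<And>x y. x \<in> closure G \<Longrightarrow> y \<in> ball x e1 \<Longrightarrow> \<bar>f y - f x\<bar> \<le> L1 * dist y x"
    using locally_lipschitz_uniform[OF \<Omega> f(1) G(2,3)] by metis
  obtain e2 L2 where e2: "e2 > 0" "L2 \<ge> 0" "\<And>x. x \<in> closure G \<Longrightarrow> ball x e2 \<subseteq> \<Omega>"
    "\<And>x y. x \<in> closure G \<Longrightarrow> y \<in> ball x e2 \<Longrightarrow> \<bar>g y - g x\<bar> \<le> L2 * dist y x"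
    using locally_lipschitz_uniform[OF \<Omega> g(1) G(2,3)] by metis
  \<comment> \<open>A third leaves room for balls of radius \<open>2 * R\<close> inside the
    Lipschitz radius; the closed balls of radius \<open>R\<close> then lie in the open set
    \<open>G'\<close>.\<close>
  define R where "R = min e1 e2 / 3"
  define L where "L = max L1 L2"
  have R: "R > 0" "R < e1" "R < e2" "2 * R < e1"
    using e1 e2 by (auto simp: R_def)
  define G' where "G' = (\<Union>x\<in>closure G. ball x (2 * R))"
  \<comment> \<open>A compact set between \<open>G'\<close> and \<open>\<Omega>\<close>; it yields
    compactness of \<open>closure G'\<close> and the bound \<open>B\<close>.\<close>
  define K where "K = {x + y | x y. x \<in> closure G \<and> y \<in> cball (0::'a) (2 * R)}"
  have "compact K"
    unfolding K_def by (intro compact_sums G(2) compact_cball)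
  have G'_K: "G' \<subseteq> K"
  proof
    fix y
    assume "y \<in> G'"
    then obtain x where "x \<in> closure G" "dist x y < 2 * R"
      by (auto simp: G'_def)
    then have "y = x + (y - x)" "x \<in> closure G" "y - x \<in> cball 0 (2 * R)"
      by (auto simp: dist_norm norm_minus_commute)
    then show "y \<in> K"
      unfolding K_def by blast
  qed
  have K_\<Omega>: "K \<subseteq> \<Omega>"
  proof
    fix z
    assume "z \<in> K"
    then obtain x y where "z = x + y" "x \<in> closure G" "norm y \<le> 2 * R"
      by (auto simp: K_def)
    then have "z \<in> ball x e1"
      using R by (simp add: dist_norm)
    then show "z \<in> \<Omega>"
      using e1(3) \<open>x \<in> closure G\<close> by blast
  qed
  have G': "open G'" "compact (closure G')" "closure G' \<subseteq> \<Omega>"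
  proof -
    show "open G'"
      by (auto simp: G'_def)
    have "closure G' \<subseteq> K"
      using G'_K \<open>compact K\<close> by (simp add: closure_minimal compact_imp_closed)
    then show "closure G' \<subseteq> \<Omega>"
      using K_\<Omega> by blast
    show "compact (closure G')"
      using G'_K \<open>compact K\<close> by (meson bounded_subset compact_closure compact_imp_bounded)
  qed
  have lm: "D \<in> lmeasurable" if "open D" "compact (closure D)" for D :: "'a set"
    using that by (meson bounded_subset closure_subset compact_imp_bounded lmeasurable_open)
  note Gl = lm[OF G(1,2)] and G'l = lm[OF G'(1,2)]
  have "f \<in> sobolev m X G" "f \<in> sobolev m X G'" "g \<in> sobolev m X G" "g \<in> sobolev m X G'"
    using f(2) g(2) G G' unfolding sobolev_loc_def by blast+
  then obtain V V' W W' where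
      V: "\<And>i. i \<le> m \<Longrightarrow> has_weak_derivative G i f (V i)" "(\<Sum>i\<le>m. X G (\<lambda>x. multilinear_norm i (V i x))) < \<infinity>"
    and V': "\<And>i. i \<le> m \<Longrightarrow> has_weak_derivative G' i f (V' i)" "(\<Sum>i\<le>m. X G' (\<lambda>x. multilinear_norm i (V' i x))) < \<infinity>"
    and W: "\<And>i. i \<le> m \<Longrightarrow> has_weak_derivative G i g (W i)" "(\<Sum>i\<le>m. X G (\<lambda>x. multilinear_norm i (W i x))) < \<infinity>"
    and W': "\<And>i. i \<le> m \<Longrightarrow> has_weak_derivative G' i g (W' i)" "(\<Sum>i\<le>m. X G' (\<lambda>x. multilinear_norm i (W' i x))) < \<infinity>"
    unfolding sobolev_def by auto
  obtain \<rho> :: "'a \<Rightarrow> real" where \<rho>: "kernel \<rho>" "(\<integral>z. \<rho> z \<partial>lborel) = 1"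
    by (rule normalized_kernel)
  have "bounded (f ` K)" "bounded (g ` K)"
    using locally_lipschitz_continuous[OF \<Omega> f(1)] locally_lipschitz_continuous[OF \<Omega> g(1)] K_\<Omega> \<open>compact K\<close>
    by (meson compact_continuous_image compact_imp_bounded continuous_on_subset)+
  then obtain B1 B2 where B12: "\<And>x. x \<in> K \<Longrightarrow> \<bar>f x\<bar> \<le> B1" "\<And>x. x \<in> K \<Longrightarrow> \<bar>g x\<bar> \<le> B2"
    by (auto simp: bounded_iff)
  define B where "B = max 0 (max B1 B2)"
  have bnd: "\<bar>f y\<bar> \<le> B" "\<bar>g y\<bar> \<le> B" if "y \<in> G'" for y
    using B12[of y] that G'_K by (auto simp: B_def)
  have int: "integrable lebesgue (\<lambda>y. indicator G' y * h y)"
    if "has_weak_derivative G' 0 h T" "\<And>y. y \<in> G' \<Longrightarrow> \<bar>h y\<bar> \<le> B" for h :: "'a \<Rightarrow> real" and T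
  proof (rule Bochner_Integration.integrable_bound)
    show "integrable lebesgue (\<lambda>y. B * indicator G' y)"
      using G'l by (intro integrable_mult_right) (simp add: lmeasurable_iff_integrable)
    show "(\<lambda>y. indicator G' y * h y) \<in> borel_measurable lebesgue"
      using that(1) unfolding has_weak_derivative_def by (intro measurable_of_locally_integrable G'(1)) blast
    show "AE y in lebesgue. norm (indicator G' y * h y) \<le> norm (B * indicator G' y :: real)"
      using that(2) by (intro AE_I2) (auto simp: indicator_def intro: order_trans[OF _ abs_ge_self])
  qed
  interpret D: approximation_domain G G' R L B m \<rho>
  proof
    show "cball x R \<subseteq> G'" if "x \<in> G" for x
    proof -
      have "x \<in> closure G"
        using that closure_subset by auto
      moreover have "cball x R \<subseteq> ball x (2 * R)"
        using R by auto
      ultimately show ?thesis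
        by (auto simp: G'_def)
    qed
  qed (use G G' Gl G'l R \<rho> e1 in \<open>auto simp: L_def B_def\<close>)
  interpret F: sobolev_approximation G G' R L B m \<rho> f V V'
  proof
    fix x y
    assume "x \<in> G" "y \<in> ball x R"
    then have "\<bar>f y - f x\<bar> \<le> L1 * dist y x"
      using closure_subset[of G] R by (intro e1(4)) auto
    also have "\<dots> \<le> L * dist y x"
      by (intro mult_right_mono) (auto simp: L_def)
    finally show "\<bar>f y - f x\<bar> \<le> L * dist y x" .
  qed (use V V' bnd int[OF V'(1)[of 0]] sobolev_integrable(2)[OF X G(1) Gl V] sobolev_integrable(2)[OF X G'(1) G'l V'] in auto)
  interpret E: sobolev_approximation G G' R L B m \<rho> g W W'
  proof
    fix x y
    assume "x \<in> G" "y \<in> ball x R"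
    then have "\<bar>g y - g x\<bar> \<le> L2 * dist y x"
      using closure_subset[of G] R by (intro e2(4)) auto
    also have "\<dots> \<le> L * dist y x"
      by (intro mult_right_mono) (auto simp: L_def)
    finally show "\<bar>g y - g x\<bar> \<le> L * dist y x" .
  qed (use W W' bnd int[OF W'(1)[of 0]] sobolev_integrable(2)[OF X G(1) Gl W] sobolev_integrable(2)[OF X G'(1) G'l W'] in auto)
  interpret P: sobolev_product G G' R L B m \<rho> f V V' g W W' X
    by (unfold_locales, rule X, rule G(4))
      (use sobolev_integrable(1)[OF X G(1) Gl V] sobolev_integrable(1)[OF X G'(1) G'l V']
        sobolev_integrable(1)[OF X G(1) Gl W] sobolev_integrable(1)[OF X G'(1) G'l W'] in auto)
  have "(\<Sum>i\<le>m. X G (\<lambda>x. multilinear_norm i (P.Z i x))) < \<infinity>"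
    using P.Z_norm_finite by simp
  then show ?thesis
    unfolding sobolev_def using P.product_weak_derivative by blast
qed

text \<open>Over the empty set (P1) makes every norm vanish. The case is treated apart because
  similarity compares spaces over nonempty sets.\<close>

lemma sobolev_empty:
  assumes "ri_family X"
  shows "u \<in> sobolev m X {}"
proof -
  have \<rho>: "banach_function_norm (lebesgue_on {}) (X {})"
    using assms unfolding ri_family_def by (auto intro!: ri_imp_bfn)
  have "X {} h = 0" for h
    by (subst norm_eq_0_iff[OF \<rho>]) (auto simp: measurable_def space_restrict_space AE_restrict_space_iff sets_restrict_space)
  moreover have "has_weak_derivative {} i u (\<lambda>x hs. 0)" for i
    by (auto simp: has_weak_derivative_def locally_integrable_on_def integral_lebesgue_on)
  ultimately show ?thesis
    unfolding sobolev_def by (auto intro!: exI[of _ "\<lambda>i x hs. 0"])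
qed

theorem theorem1p3:
  fixes m :: nat
    and \<Omega> :: "(real ^ 'n) set"
    and X :: "(real ^ 'n) set \<Rightarrow> (real ^ 'n \<Rightarrow> ennreal) \<Rightarrow> ennreal"
    and G\<^sub>0 :: "(real ^ 'n) set"
    and Xbar :: "(real \<Rightarrow> ennreal) \<Rightarrow> ennreal"
    and f g :: "real ^ 'n \<Rightarrow> real"
  assumes "open \<Omega>"
    and "ri_family X"
    and "open G\<^sub>0" and "G\<^sub>0 \<noteq> {}" and "emeasure lebesgue G\<^sub>0 < \<infinity>"
    and "representation_norm G\<^sub>0 (X G\<^sub>0) Xbar"
    and "upper_boyd_index (measure lebesgue G\<^sub>0) Xbar < 1"
    and "locally_lipschitz_on \<Omega> f" and "locally_lipschitz_on \<Omega> g"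
    and "f \<in> sobolev_loc m X \<Omega>" and "g \<in> sobolev_loc m X \<Omega>"
  shows "(\<lambda>x. f x * g x) \<in> sobolev_loc m X \<Omega> \<and> locally_lipschitz_on \<Omega> (\<lambda>x. f x * g x)"
proof
  show "(\<lambda>x. f x * g x) \<in> sobolev_loc m X \<Omega>"
    unfolding sobolev_loc_def
  proof (intro CollectI allI impI)
    fix G :: "(real ^ 'n) set"
    assume G: "open G \<and> compact (closure G) \<and> closure G \<subseteq> \<Omega>"
    show "(\<lambda>x. f x * g x) \<in> sobolev m X G"
    proof (cases "G = {}")
      case True
      then show ?thesis
        using sobolev_empty[OF assms(2)] by simp
    next
      case False
      then show ?thesis
        using G by (intro sobolev_mult[OF assms(1,2,8,10,9,11)]) auto
    qed
  qed
  show "locally_lipschitz_on \<Omega> (\<lambda>x. f x * g x)"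
    by (rule locally_lipschitz_mult[OF assms(8,9)])
qed

end
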